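(* Let $H$ be a Hilbert space, let $p\ge 2$, and let $K(t,s,x)$ be a measurable function defined on $\mathbb{R}^{d+2}$ ($t,s\in\mathbb{R}$, $x\in\mathbb{R}^d$). Suppose the following two assumptions hold. **(A)** There is a constant $C_0$, independent of $(s,\xi)$, such that $$\int_s^\infty |\mathcal{F}\{K(t,s,\cdot)\}(\xi)|^2\,dt\le C_0 .$$ **(B)** Take a constant $c_2>\tfrac12$ and put $c_3:=\frac{2(d+1)(c_2+1)+3}{2(d+2)}$. (i) For almost all $t$ and each $s<t$, $K(t,s,\cdot)$, $D_xK(t,s,\cdot)$ and $\frac{\partial}{\partial t}K(t,s,\cdot)$ are locally integrable functions of $x$. (ii) There exist functions $F_i(t,s,x)$ and positive constants $\sigma_i,\kappa_i$ ($i=1,2,3$) and $C$ such that for almost all $t$ and each $s<t$ and $x\in\mathbb{R}^d\setminus\{0\}$, $$|D_xK(t,s,x)|\le C\,\big|(t-s)^{-\sigma_1}F_1(t,s,(t-s)^{-\kappa_1}x)\big|,$$ $$|D_x^2K(t,s,x)|\le C\Big((t-s)^{-\sigma_2}\big|F_2(t,s,(t-s)^{-\kappa_2}x)\big|\wedge (t-s)^{-c_2}\Big),$$ $$\Big|\tfrac{\partial}{\partial t}D_xK(t,s,x)\Big|\le C\Big((t-s)^{-\sigma_3}\big|F_3(t,s,(t-s)^{-\kappa_3}x)\big|\wedge (t-s)^{-c_3}\Big).$$ (iii) For these $F_i$, $$\sup_{s<t}\int_{\mathbb{R}^d}|x|^{\mu_1}|F_1(t,s,x)|^2dx<\infty,$$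 $$\sup_{s<t}\int_{|x|\ge (t-s)^{c_2-c_3+1-\kappa_2}}|x|^{\mu_2}|F_2(t,s,x)|^2dx<\infty,$$ $$\sup_{s<t}\int_{|x|\ge (t-s)^{c_2-c_3+1-\kappa_3}}|x|^{\mu_3}|F_3(t,s,x)|^2dx<\infty,$$ where $\mu_i>d+2$ ($i=1,2,3$) satisfy the system $$(c_2-c_3+1-\kappa_1)\mu_1=d(\kappa_1+c_2-c_3+1)+2(c_2-c_3-\sigma_1)+3,$$ $$(c_2-c_3+1-\kappa_2)\mu_2=d(\kappa_2-c_2+c_3-1)+2(c_2-\sigma_2),$$ $$(c_2-c_3+1-\kappa_3)\mu_3=d(\kappa_3-c_2+c_3-1)+2(c_3-\sigma_3).$$ Then for any $f\in C_0^\infty(\mathbb{R}^{d+1},H)$, $$\left\|\Big(\int_{-\infty}^t\big|K(t,s,\cdot)*f(s,\cdot)(x)\big|_H^2\,ds\Big)^{1/2}\right\|_{L_p(\mathbb{R}^{d+1})}\le N\,\big\||f|_H\big\|_{L_p(\mathbb{R}^{d+1})},$$ where $N$ is independent of $f$.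
   Context: Points of $\mathbb{R}^{d+1}$ are written $(t,x)$ with $t\in\mathbb{R}$, $x\in\mathbb{R}^d$. $C_0^\infty(\mathbb{R}^{d+1},H)$ is the set of infinitely differentiable compactly supported $H$-valued functions. $a\wedge b=\min\{a,b\}$. $\mathcal{F}(g)(\xi)=\int_{\mathbb{R}^d}e^{-ix\cdot\xi}g(x)\,dx$ is the Fourier transform in $x$. The convolution $*$ is in the $x$ variable. $D_x$ and $D_x^2$ denote partial derivatives of order 1 and 2 with respect to $x$.
   Formalization: Added: for x≠0, K and D_xK are locally absolutely continuous in t on (s,∞), i.e. integrals of their time derivatives (with only a.e. derivatives the claim fails for p>2); K(t,s,·) is integrable in x for each s and a.e. t>s, so that (A) is defined; the F_i are measurable in x. *)

theory Defs
  imports "HOL-Analysis.Analysis"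
begin

section \<open>Scalars, test functions and integrals\<close>

text \<open>
  The scalar field \<open>S\<close> is the set of reals or all of the complex numbers, and \<open>m\<close> is scalar
  multiplication by elements of \<open>S\<close>. Applied to a complete \<^class>\<open>real_inner\<close> space this
  describes exactly the real (\<open>S = \<real>\<close>) and the complex (\<open>S = UNIV\<close>) Hilbert spaces: a real
  inner product whose norm is homogeneous for the complex scalars is the real part of a unique
  complex one with the same norm.
\<close>

definition scalar_mult_on :: "complex set \<Rightarrow> (complex \<Rightarrow> 'h::real_normed_vector \<Rightarrow> 'h) \<Rightarrow> bool" where
  "scalar_mult_on S m \<longleftrightarrow>
     (S = \<real> \<or> S = UNIV) \<and>
     (\<forall>r v. m (of_real r) v = r *\<^sub>R v) \<and>
     (\<forall>a\<in>S. \<forall>b\<in>S. \<forall>v. m (a + b) v = m a v + m b v) \<and>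
     (\<forall>a\<in>S. \<forall>v w. m a (v + w) = m a v + m a w) \<and>
     (\<forall>a\<in>S. \<forall>b\<in>S. \<forall>v. m (a * b) v = m a (m b v)) \<and>
     (\<forall>a\<in>S. \<forall>v. norm (m a v) = norm a * norm v)"

primrec times_cont_diff :: "nat \<Rightarrow> ('a::euclidean_space \<Rightarrow> 'h::real_normed_vector) \<Rightarrow> bool" where
  "times_cont_diff 0 f \<longleftrightarrow> continuous_on UNIV f"
| "times_cont_diff (Suc k) f \<longleftrightarrow>
     (\<forall>x. f differentiable (at x)) \<and> (\<forall>v. times_cont_diff k (\<lambda>x. frechet_derivative f (at x) v))"

definition smooth_compact_support :: "('a::euclidean_space \<Rightarrow> 'h::real_normed_vector) \<Rightarrow> bool" where
  "smooth_compact_support f \<longleftrightarrow>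
     (\<forall>k. times_cont_diff k f) \<and> compact (closure {x. f x \<noteq> 0})"

definition fourier :: "('a::euclidean_space \<Rightarrow> complex) \<Rightarrow> 'a \<Rightarrow> complex" where
  "fourier g \<xi> = (LINT x|lebesgue. exp (- (\<i> * of_real (x \<bullet> \<xi>))) * g x)"

text \<open>
  The Henstock-Kurzweil integral is used because the Bochner integral of the library is restricted
  to second countable (hence separable) target spaces. If \<open>g\<close> is locally integrable and
  \<open>u\<close> is continuous with compact support, the integrand is Bochner integrable and both integrals
  agree.
\<close>

definition convol ::
  "(complex \<Rightarrow> 'h::real_normed_vector \<Rightarrow> 'h) \<Rightarrow> ('a::euclidean_space \<Rightarrow> complex) \<Rightarrow> ('a \<Rightarrow> 'h) \<Rightarrow> 'a \<Rightarrow> 'h" where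
  "convol m g u x = integral UNIV (\<lambda>y. m (g (x - y)) (u y))"

definition locally_integrable :: "('a::euclidean_space \<Rightarrow> complex) \<Rightarrow> bool" where
  "locally_integrable g \<longleftrightarrow> (\<forall>S. compact S \<longrightarrow> g absolutely_integrable_on S)"

definition epowr :: "ennreal \<Rightarrow> real \<Rightarrow> ennreal" where
  "epowr x a = (if x = \<infinity> then \<infinity> else ennreal (enn2real x powr a))"  \<comment> \<open>only used for \<open>a > 0\<close>\<close>

definition Lp_norm :: "real \<Rightarrow> ('a::euclidean_space \<Rightarrow> ennreal) \<Rightarrow> ennreal" where
  "Lp_norm p g = epowr (\<integral>\<^sup>+ z. epowr (g z) p \<partial>lebesgue) (1 / p)"

section \<open>Derivatives of a kernel\<close>

text \<open>
  Kernels are curried as \<open>G t s x\<close>. \<open>space_deriv b G\<close> for \<open>b \<in> Basis\<close> ranges over the partial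
  derivatives \<open>D\<^sub>x G\<close> of order one; \<open>space_deriv b' (space_deriv b G)\<close> over those of order two.
  Both operators return an arbitrary value where the derivative does not exist.
\<close>

definition space_deriv ::
  "'a::euclidean_space \<Rightarrow> (real \<Rightarrow> real \<Rightarrow> 'a \<Rightarrow> complex) \<Rightarrow> real \<Rightarrow> real \<Rightarrow> 'a \<Rightarrow> complex" where
  "space_deriv b G t s x = vector_derivative (\<lambda>h. G t s (x + h *\<^sub>R b)) (at 0)"

definition has_space_deriv ::
  "'a::euclidean_space \<Rightarrow> (real \<Rightarrow> real \<Rightarrow> 'a \<Rightarrow> complex) \<Rightarrow> real \<Rightarrow> real \<Rightarrow> 'a \<Rightarrow> bool" where
  "has_space_deriv b G t s x \<longleftrightarrow> (\<lambda>h. G t s (x + h *\<^sub>R b)) differentiable (at 0)"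

definition time_deriv ::
  "(real \<Rightarrow> real \<Rightarrow> 'a::euclidean_space \<Rightarrow> complex) \<Rightarrow> real \<Rightarrow> real \<Rightarrow> 'a \<Rightarrow> complex" where
  "time_deriv G t s x = vector_derivative (\<lambda>r. G r s x) (at t)"

definition has_time_deriv ::
  "(real \<Rightarrow> real \<Rightarrow> 'a::euclidean_space \<Rightarrow> complex) \<Rightarrow> real \<Rightarrow> real \<Rightarrow> 'a \<Rightarrow> bool" where
  "has_time_deriv G t s x \<longleftrightarrow> (\<lambda>r. G r s x) differentiable (at t)"

text \<open>
  Local absolute continuity of \<open>t \<mapsto> G t s x\<close> on \<open>(s, \<infinity>)\<close>, in the form of the fundamental theorem
  of calculus. A time derivative that exists only for almost all \<open>t\<close> has to be understood together
  with this property: otherwise a kernel that is piecewise constant in \<open>t\<close> would have time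
  derivative zero, and bounds on that derivative would say nothing about the kernel.
\<close>

definition time_abs_continuous ::
  "(real \<Rightarrow> real \<Rightarrow> 'a::euclidean_space \<Rightarrow> complex) \<Rightarrow> real \<Rightarrow> 'a \<Rightarrow> bool" where
  "time_abs_continuous G s x \<longleftrightarrow>
     (\<forall>u v. s < u \<and> u \<le> v \<longrightarrow>
        (\<lambda>t. time_deriv G t s x) absolutely_integrable_on {u..v} \<and>
        G v s x - G u s x = integral {u..v} (\<lambda>t. time_deriv G t s x))"

end

theory Submission
  imports Defs "HOL-Probability.Probability" "HOL-Real_Asymp.Real_Asymp"
begin

text \<open>
  Put \<open>\<gamma> = c\<^sub>2 - c\<^sub>3 + 1\<close>, which is positive. In these terms \<open>c\<^sub>2 = 1/2 + (d + 2) \<gamma>\<close> and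
  \<open>c\<^sub>3 = 3/2 + (d + 1) \<gamma>\<close>, and the equations for \<open>\<mu>\<^sub>1\<close> and \<open>\<mu>\<^sub>3\<close> say that the weighted
  \<open>L\<^sub>2\<close> bounds of (B) scale like \<open>x \<sim> (t - s)\<^sup>\<gamma>\<close>. Splitting space at \<open>\<bar>x\<bar> = (t - s)\<^sup>\<gamma>\<close> and using the
  Cauchy-Schwarz inequality outside and the pointwise bounds inside yields
  \<open>\<parallel>D\<^sub>x K(t,s)\<parallel>\<^sub>1 \<le> N (t - s) powr (- 1/2 - \<gamma>)\<close>, a power decay of the tail of \<open>K(t,s)\<close>, and
  \<open>\<parallel>\<bar>x\<bar> D\<^sub>t D\<^sub>x K(t,s)\<parallel>\<^sub>1 \<le> N (t - s) powr (- 3/2)\<close>, which Hardy's inequality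
  turns into a bound for \<open>\<parallel>K(t,s) - K(t',s)\<parallel>\<^sub>1\<close>.

  For \<open>p = 2\<close> the theorem is Plancherel's theorem together with (A). For \<open>p > 2\<close> the square function
  of a function bounded by \<open>A\<close> has mean oscillation at most \<open>N A\<close> on cells of length \<open>R powr (1/\<gamma>)\<close> in time
  and side \<open>R\<close> in space: the recent past is controlled by the \<open>L\<^sub>2\<close> bound near the cell and by the
  tail of \<open>K\<close> away from it, and for the distant past the square function varies little over the cell. A
  dyadic good-\<open>\<lambda>\<close> inequality, applied after truncating the values of \<open>f\<close> at each height,
  gives the \<open>L\<^sub>p\<close> bound.
\<close>

section \<open>Hilbert space valued convolutions\<close>

text \<open>\<open>H\<close> may be nonseparable, so measurability of \<open>H\<close>-valued maps
  is avoided: vectors are tested against vectors, and norms of convolutions become double integrals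
  of the scalars \<open>cip\<close>, through which Plancherel's theorem and joint measurability
  pass. The kernel is differentiable only off the origin. Its size is therefore recovered from its
  derivative by integrating in from infinity along rays that avoid 0. Hence the weight
  \<open>\<bar>x\<bar>\<close>, and hence \<open>\<mu> > d + 2\<close>: it makes
  \<open>\<bar>x\<bar> powr (2 - \<mu>)\<close>, the other factor in Cauchy-Schwarz, integrable at
  infinity. The bounds in (B) hold at every \<open>x \<noteq> 0\<close> and would be lost by
  changing \<open>K\<close> on a null set. They are first turned into integral estimates, and only
  then is \<open>K\<close> replaced by a Borel version. In the last step every height
  \<open>l\<close> is treated separately: the part of \<open>f\<close> below \<open>l\<close> has
  controlled oscillation, the rest is paid for in \<open>L\<^sub>2\<close>. Over geometric heights
  these payments sum to the integral of \<open>\<bar>f\<bar> powr p\<close>, because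
  \<open>p > 2\<close>.\<close>

lemma integrable_on_cbox_approx:
  fixes f :: "'a::euclidean_space \<Rightarrow> 'h::{real_normed_vector,complete_space}"
  assumes w: "w integrable_on cbox a b"
    and approx: "\<And>e. e > 0 \<Longrightarrow>
      \<exists>v. v integrable_on cbox a b \<and> (\<forall>x\<in>cbox a b. norm (f x - v x) \<le> e * w x)"
  shows "f integrable_on cbox a b"
  unfolding integrable_Cauchy
proof (intro allI impI)
  fix e :: real assume e: "e > 0"
  define W where "W = \<bar>integral (cbox a b) w\<bar>"
  \<comment> \<open>A fine enough Riemann sum of \<open>w\<close> is at most \<open>W + 1\<close>,
    so replacing \<open>f\<close> by \<open>v\<close> costs at most e/8 in each of the two sums, and
    the Cauchy gap of \<open>v\<close> may use e/2. Adding 1 to \<open>W\<close> covers the case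
    \<open>W = 0\<close>.\<close>
  define e' where "e' = e / (8 * (W + 1))"
  have W: "W \<ge> 0" by (simp add: W_def)
  have e': "e' > 0" using e W by (simp add: e'_def)
  obtain v where v: "v integrable_on cbox a b" "\<And>x. x \<in> cbox a b \<Longrightarrow> norm (f x - v x) \<le> e' * w x"
    using approx[OF e'] by blast
  have "e / 2 > 0" using e by simp
  with v(1)[unfolded integrable_Cauchy] obtain g1 where g1: "gauge g1"
    "\<And>D1 D2. D1 tagged_division_of (cbox a b) \<Longrightarrow> g1 fine D1 \<Longrightarrow>
       D2 tagged_division_of (cbox a b) \<Longrightarrow> g1 fine D2 \<Longrightarrow>
       norm ((\<Sum>(x,K)\<in>D1. measure lborel K *\<^sub>R v x) - (\<Sum>(x,K)\<in>D2. measure lborel K *\<^sub>R v x)) < e / 2"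
    by meson
  obtain g2 where g2: "gauge g2"
    "\<And>D. D tagged_division_of (cbox a b) \<Longrightarrow> g2 fine D \<Longrightarrow>
       norm ((\<Sum>(x,K)\<in>D. measure lborel K *\<^sub>R w x) - integral (cbox a b) w) < 1"
    using integrable_integral[OF w, unfolded has_integral] zero_less_one by meson
  have close: "norm ((\<Sum>(x,K)\<in>D. measure lborel K *\<^sub>R f x) - (\<Sum>(x,K)\<in>D. measure lborel K *\<^sub>R v x)) \<le> e' * (W + 1)"
    if D: "D tagged_division_of (cbox a b)" "g2 fine D" for D
  proof -
    have "(\<Sum>(x,K)\<in>D. measure lborel K *\<^sub>R f x) - (\<Sum>(x,K)\<in>D. measure lborel K *\<^sub>R v x)
        = (\<Sum>(x,K)\<in>D. measure lborel K *\<^sub>R (f x - v x))"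
      by (simp add: sum_subtractf[symmetric] scaleR_diff_right split_beta)
    also have "norm \<dots> \<le> (\<Sum>(x,K)\<in>D. measure lborel K * (e' * w x))"
    proof (rule order_trans[OF norm_sum], rule sum_mono, clarify)
      fix x K assume xK: "(x, K) \<in> D"
      have "x \<in> cbox a b" using tagged_division_ofD(2,3)[OF D(1) xK] by auto
      then show "norm (measure lborel K *\<^sub>R (f x - v x)) \<le> measure lborel K * (e' * w x)"
        using v(2) by (simp add: mult_left_mono)
    qed
    also have "\<dots> = e' * (\<Sum>(x,K)\<in>D. measure lborel K *\<^sub>R w x)"
      by (simp add: sum_distrib_left split_beta mult.left_commute)
    also have "\<dots> \<le> e' * (W + 1)"
    proof (rule mult_left_mono)
      show "(\<Sum>(x,K)\<in>D. measure lborel K *\<^sub>R w x) \<le> W + 1"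
        using g2(2)[OF D] by (auto simp: W_def)
    qed (use e' in simp)
    finally show ?thesis .
  qed
  have e'W: "e' * (W + 1) = e / 8" using W by (simp add: e'_def field_simps)
  show "\<exists>\<gamma>. gauge \<gamma> \<and>
       (\<forall>D1 D2. D1 tagged_division_of (cbox a b) \<and> \<gamma> fine D1 \<and>
          D2 tagged_division_of (cbox a b) \<and> \<gamma> fine D2 \<longrightarrow>
          norm ((\<Sum>(x,K)\<in>D1. measure lborel K *\<^sub>R f x) - (\<Sum>(x,K)\<in>D2. measure lborel K *\<^sub>R f x)) < e)"
  proof (intro exI[of _ "\<lambda>x. g1 x \<inter> g2 x"] conjI allI impI)
    show "gauge (\<lambda>x. g1 x \<inter> g2 x)" using g1(1) g2(1) by auto
  next
    fix D1 D2
    assume *: "D1 tagged_division_of (cbox a b) \<and> (\<lambda>x. g1 x \<inter> g2 x) fine D1 \<and>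
          D2 tagged_division_of (cbox a b) \<and> (\<lambda>x. g1 x \<inter> g2 x) fine D2"
    define A B A' B' where "A = (\<Sum>(x,K)\<in>D1. measure lborel K *\<^sub>R f x)" "B = (\<Sum>(x,K)\<in>D2. measure lborel K *\<^sub>R f x)"
      "A' = (\<Sum>(x,K)\<in>D1. measure lborel K *\<^sub>R v x)" "B' = (\<Sum>(x,K)\<in>D2. measure lborel K *\<^sub>R v x)"
    note defs = this
    have "norm (A - A') \<le> e / 8" "norm (B - B') \<le> e / 8" "norm (A' - B') < e / 2"
      using * close[of D1] close[of D2] g1(2)[of D1 D2] by (auto simp: fine_Int defs e'W)
    moreover have "A - B = (A - A') - (B - B') + (A' - B')" by simp
    then have "norm (A - B) \<le> norm (A - A') + norm (B - B') + norm (A' - B')"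
      using norm_triangle_ineq[of "(A - A') - (B - B')" "A' - B'"] norm_triangle_ineq4[of "A - A'" "B - B'"]
      by simp
    ultimately show "norm (A - B) < e" using e by linarith
  qed
qed

text \<open>On a box the range of \<open>u\<close> is compact, hence totally bounded. Snapping
  \<open>u x\<close> to one of finitely many centres within \<open>e\<close> leaves a finite sum of
  scalar integrable functions times fixed vectors, at the pointwise cost
  \<open>e * \<bar>k x\<bar>\<close>. This works in nonseparable spaces as well.\<close>

lemma scaleR_continuous_integrable_on_cbox:
  fixes k :: "'a::euclidean_space \<Rightarrow> real" and u :: "'a \<Rightarrow> 'h::{real_normed_vector,complete_space}"
  assumes k: "integrable lborel k" and u: "continuous_on UNIV u"
  shows "(\<lambda>x. k x *\<^sub>R u x) integrable_on cbox a b"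
proof (rule integrable_on_cbox_approx[where w = "\<lambda>x. \<bar>k x\<bar>"])
  show "(\<lambda>x. \<bar>k x\<bar>) integrable_on cbox a b"
    using k by (intro integrable_on_subcbox[OF integrable_on_lborel]) auto
next
  fix e :: real assume e: "e > 0"
  have "compact (u ` cbox a b)"
    using u continuous_on_subset by (intro compact_continuous_image) auto
  then obtain F where F: "finite F" "u ` cbox a b \<subseteq> (\<Union>x\<in>F. ball x e)"
    using e unfolding compact_eq_totally_bounded by meson
  obtain n :: nat and c where c: "F = c ` {i. i < n}"
    using finite_imp_nat_seg_image_inj_on[OF F(1)] by blast
  \<comment> \<open>The first suitable centre is taken: a least index over Borel conditions is a
    Borel function of \<open>x\<close>.\<close>
  define idx where "idx x = (LEAST i. dist (c i) (u x) < e)" for x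
  have [measurable]: "k \<in> borel_measurable borel" using k by auto
  have op: "{x. dist (c i) (u x) < e} \<in> sets borel" for i
    by (intro borel_open open_Collect_less continuous_intros continuous_on_subset[OF u]) auto
  have [measurable]: "Measurable.pred borel (\<lambda>x. dist (c i) (u x) < e)" for i
    using op by (simp add: pred_def)
  have idx_m[measurable]: "idx \<in> measurable borel (count_space UNIV)"
    unfolding idx_def by measurable
  have idx: "idx x < n \<and> dist (c (idx x)) (u x) < e" if "x \<in> cbox a b" for x
  proof -
    have "u x \<in> (\<Union>y\<in>F. ball y e)" using that F(2) by blast
    then obtain i where i: "i < n" "dist (c i) (u x) < e" unfolding c by auto
    have "idx x \<le> i" unfolding idx_def by (rule Least_le) (rule i)
    moreover have "dist (c (idx x)) (u x) < e" unfolding idx_def by (rule LeastI) (rule i)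
    ultimately show ?thesis using i by simp
  qed
  define v where "v x = (\<Sum>i<n. (if idx x = i then k x else 0) *\<^sub>R c i)" for x
  have "(\<lambda>x. (if idx x = i then k x else 0) *\<^sub>R c i) integrable_on cbox a b" for i
  proof (rule integrable_on_scaleR_left, rule integrable_on_subcbox[OF integrable_on_lborel])
    show "integrable lborel (\<lambda>x. if idx x = i then k x else 0)"
      by (rule Bochner_Integration.integrable_bound[OF k]) auto
  qed auto
  then have "v integrable_on cbox a b"
    unfolding v_def by (intro integrable_sum) auto
  moreover have "norm (k x *\<^sub>R u x - v x) \<le> e * \<bar>k x\<bar>" if "x \<in> cbox a b" for x
  proof -
    have "v x = (\<Sum>i<n. if i = idx x then k x *\<^sub>R c i else 0)"
      unfolding v_def by (intro sum.cong) auto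
    also have "\<dots> = k x *\<^sub>R c (idx x)" using idx[OF that] by simp
    finally have "k x *\<^sub>R u x - v x = k x *\<^sub>R (u x - c (idx x))"
      by (simp add: scaleR_diff_right)
    then have "norm (k x *\<^sub>R u x - v x) = \<bar>k x\<bar> * dist (c (idx x)) (u x)"
      by (simp add: dist_norm norm_minus_commute)
    also have "\<dots> \<le> \<bar>k x\<bar> * e" using idx[OF that] by (intro mult_left_mono) auto
    finally show ?thesis by (simp add: mult.commute)
  qed
  ultimately show "\<exists>v. v integrable_on cbox a b \<and> (\<forall>x\<in>cbox a b. norm (k x *\<^sub>R u x - v x) \<le> e * \<bar>k x\<bar>)"
    by blast
qed

text \<open>All boxes containing the support give the same integral, so the limit over growing boxes
  is already attained.\<close>

lemma scaleR_continuous_integrable: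
  fixes k :: "'a::euclidean_space \<Rightarrow> real" and u :: "'a \<Rightarrow> 'h::{real_inner,complete_space}"
  assumes k: "integrable lborel k" and u: "continuous_on UNIV u"
    and supp: "\<And>x. x \<notin> cbox a b \<Longrightarrow> u x = 0"
  shows "(\<lambda>x. k x *\<^sub>R u x) integrable_on UNIV"
proof -
  let ?f = "\<lambda>x. k x *\<^sub>R u x"
  define z where "z = integral (cbox a b) ?f"
  have int: "?f integrable_on cbox c d" for c d
    by (rule scaleR_continuous_integrable_on_cbox[OF k u])
  have eq: "integral (cbox c d) ?f = z" if sub: "cbox a b \<subseteq> cbox c d" for c d
  proof -
    have *: "integral (cbox p q) ?f \<bullet> v = integral (cbox p q) (\<lambda>x. ?f x \<bullet> v)" for p q v
      using integral_linear[OF int bounded_linear_inner_left[of v], of p q] by (simp add: o_def)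
    \<comment> \<open>Independence of the box is tested against every vector \<open>v\<close>, where
      it is a fact about real integrals.\<close>
    have "integral (cbox c d) (\<lambda>x. ?f x \<bullet> v) = integral (cbox a b) (\<lambda>x. ?f x \<bullet> v)" for v
    proof (rule integral_unique, rule has_integral_on_superset[OF integrable_integral _ sub])
      show "(\<lambda>x. ?f x \<bullet> v) integrable_on cbox a b"
        using integrable_linear[OF int bounded_linear_inner_left[of v]] by (simp add: o_def)
    qed (simp add: supp)
    then have "(integral (cbox c d) ?f - z) \<bullet> v = 0" for v
      by (simp only: inner_diff_left z_def *)
    from this[of "integral (cbox c d) ?f - z"] show ?thesis by simp
  qed
  have "(?f has_integral z) UNIV"
  \<comment> \<open>The integral over a set is defined by cases according to whether the set is
    itself a box; both cases are answered, although the whole space never is one.\<close>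
  proof (cases "\<exists>c d. UNIV = cbox c (d::'a)")
    case False
    have "\<exists>B>0. \<forall>c d. ball 0 B \<subseteq> cbox c d \<longrightarrow>
        (\<exists>y. ((\<lambda>x. if x \<in> UNIV then ?f x else 0) has_integral y) (cbox c d) \<and> norm (y - z) < e)"
      if "e > 0" for e
    proof -
    obtain B where B: "B > 0" "cbox a b \<subseteq> ball 0 B"
      using bounded_subset_ballD[OF bounded_cbox] by blast
    show ?thesis
    proof (intro exI[of _ B] conjI allI impI)
      fix c d :: 'a assume "ball 0 B \<subseteq> cbox c d"
      then have "integral (cbox c d) ?f = z" using B eq by blast
      then show "\<exists>y. ((\<lambda>x. if x \<in> UNIV then ?f x else 0) has_integral y) (cbox c d) \<and> norm (y - z) < e"
        using int[of c d] \<open>e > 0\<close> by (intro exI[of _ z]) (auto simp: has_integral_iff)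
    qed (use B in simp)
    qed
    then show ?thesis by (subst has_integral_alt) (simp only: False if_False, blast)
  next
    case True
    then obtain c d :: 'a where "UNIV = cbox c d" by auto
    then have "integral (cbox c d) ?f = z" using eq by blast
    then show ?thesis using int[of c d] \<open>UNIV = cbox c d\<close> by (simp add: has_integral_iff)
  qed
  then show ?thesis by blast
qed

text \<open>The class of functions on which the estimates are proved. Unlike the smooth functions it
  is closed under truncation of the values and under multiplication by the merely continuous
  \<open>cutoff\<close>; both operations are applied to \<open>f\<close> below.\<close>

definition cc_fun :: "('a::euclidean_space \<Rightarrow> 'h::real_normed_vector) \<Rightarrow> bool" where
  "cc_fun u \<longleftrightarrow> continuous_on UNIV u \<and> (\<exists>a b. \<forall>x. x \<notin> cbox a b \<longrightarrow> u x = 0)"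

lemma cc_fun_bounded:
  assumes "cc_fun u" shows "\<exists>B\<ge>0. \<forall>x. norm (u x) \<le> B"
proof -
  obtain a b where ab: "\<And>x. x \<notin> cbox a b \<Longrightarrow> u x = 0" using assms unfolding cc_fun_def by blast
  have "compact (u ` cbox a b)"
    using assms continuous_on_subset unfolding cc_fun_def by (intro compact_continuous_image) auto
  then have "bounded (u ` cbox a b)" by (rule compact_imp_bounded)
  then obtain B where "\<And>y. y \<in> u ` cbox a b \<Longrightarrow> norm y \<le> B"
    by (auto simp: bounded_iff)
  then have "norm (u x) \<le> max B 0" for x using ab[of x] by (cases "x \<in> cbox a b") fastforce+
  then show ?thesis by (intro exI[of _ "max B 0"]) auto
qed

lemma cc_fun_norm_integrable:
  assumes "cc_fun u" shows "integrable lborel (\<lambda>x. norm (u x))"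
proof -
  obtain a b where ab: "\<And>x. x \<notin> cbox a b \<Longrightarrow> u x = 0" using assms unfolding cc_fun_def by blast
  have "continuous_on (cbox a b) (\<lambda>x. norm (u x))"
    using assms continuous_on_subset unfolding cc_fun_def by (intro continuous_intros) blast
  then have "integrable lborel (\<lambda>x. indicator (cbox a b) x *\<^sub>R norm (u x))"
    by (intro borel_integrable_compact) auto
  moreover have "(\<lambda>x. indicator (cbox a b) x *\<^sub>R norm (u x)) = (\<lambda>x. norm (u x))"
    by (auto simp: fun_eq_iff indicator_def ab)
  ultimately show ?thesis by simp
qed

section \<open>Hilbert spaces over the real or the complex numbers\<close>

locale scalar_hilbert =
  fixes S :: "complex set" and m :: "complex \<Rightarrow> 'h::{real_inner,complete_space} \<Rightarrow> 'h"
  assumes scalar: "scalar_mult_on S m"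
begin

text \<open>
  Multiplication by \<open>\<i>\<close> turns the real inner product into the complex one. For real scalars \<open>J = 0\<close>,
  so that \<open>cip\<close> is real valued and both cases are treated at once.
\<close>

definition J :: "'h \<Rightarrow> 'h" where "J v = (if \<i> \<in> S then m \<i> v else 0)"

definition cip :: "'h \<Rightarrow> 'h \<Rightarrow> complex" where "cip u v = Complex (u \<bullet> v) (u \<bullet> J v)"

lemma S_cases: "S = \<real> \<or> S = UNIV"
  and m_real: "m (of_real r) v = r *\<^sub>R v"
  and m_add_left: "a \<in> S \<Longrightarrow> b \<in> S \<Longrightarrow> m (a + b) v = m a v + m b v"
  and m_add_right: "a \<in> S \<Longrightarrow> m a (v + w) = m a v + m a w"
  and m_mult: "a \<in> S \<Longrightarrow> b \<in> S \<Longrightarrow> m (a * b) v = m a (m b v)"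
  and norm_m: "a \<in> S \<Longrightarrow> norm (m a v) = norm a * norm v"
  using scalar unfolding scalar_mult_on_def by blast+

lemma of_real_in_S [simp]: "of_real r \<in> S" using S_cases by auto

lemma in_S: "\<i> \<in> S \<Longrightarrow> a \<in> S" using S_cases by (auto simp: complex_is_Real_iff)

lemma in_S_real: "\<i> \<notin> S \<Longrightarrow> a \<in> S \<Longrightarrow> Im a = 0" using S_cases by (auto simp: complex_is_Real_iff)

text \<open>Either \<open>\<i>\<close> is a scalar and the real and imaginary parts of
  \<open>a\<close> act separately, or every element of \<open>S\<close> is real, and then
  \<open>Im a = 0\<close> and \<open>J = 0\<close>.\<close>

lemma m_eq: assumes "a \<in> S" shows "m a v = Re a *\<^sub>R v + Im a *\<^sub>R J v"
proof (cases "\<i> \<in> S")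
  case True
  have "m a v = m (of_real (Re a) + of_real (Im a) * \<i>) v"
    by (rule arg_cong[of _ _ "\<lambda>z. m z v"]) (simp add: complex_eq_iff)
  also have "\<dots> = m (of_real (Re a)) v + m (of_real (Im a) * \<i>) v" using True in_S by (intro m_add_left) blast+
  also have "m (of_real (Im a) * \<i>) v = m (of_real (Im a)) (m \<i> v)" using True in_S by (intro m_mult) blast+
  finally show ?thesis using True by (simp add: m_real J_def)
next
  case False
  then have "a = of_real (Re a)" using assms in_S_real by (simp add: complex_eq_iff)
  then have "m a v = Re a *\<^sub>R v" by (metis m_real)
  then show ?thesis using False by (simp add: J_def)
qed

lemma J_linear: "linear J"
proof (cases "\<i> \<in> S")
  case True
  show ?thesis
  proof
    show "J (x + y) = J x + J y" for x y using True by (simp add: J_def m_add_right)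
    have "m \<i> (m (of_real r) x) = m (of_real r) (m \<i> x)" for r x
      using True in_S m_mult[of \<i> "of_real r" x] m_mult[of "of_real r" \<i> x] by (simp add: mult.commute)
    then show "J (r *\<^sub>R x) = r *\<^sub>R J x" for r x using True by (simp add: J_def m_real)
  qed
next
  case False then show ?thesis by (auto simp: J_def intro: linearI)
qed

lemma norm_J_le: "norm (J v) \<le> norm v"
  using norm_m[of \<i> v] by (auto simp: J_def)

lemma J_bounded: "bounded_linear J"
  using J_linear norm_J_le
  by (intro bounded_linear_intro[where K = 1]) (auto simp: linear_add linear_scale)

text \<open>Polarisation: \<open>J\<close> is linear and preserves norms.\<close>

lemma J_inner: assumes "\<i> \<in> S" shows "J v \<bullet> J w = v \<bullet> w"
proof -
  have n: "norm (J v) = norm v" for v using norm_m[of \<i> v] assms by (simp add: J_def)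
  have sq: "J v \<bullet> J v = v \<bullet> v" for v using n[of v] by (simp add: dot_square_norm)
  show ?thesis
    using sq[of "v + w"] sq[of v] sq[of w]
    by (simp add: linear_add[OF J_linear] inner_add_left inner_add_right inner_commute)
qed

lemma J_J: assumes "\<i> \<in> S" shows "J (J v) = - v"
proof -
  have "J (J v) = m (\<i> * \<i>) v" using assms m_mult[of \<i> \<i> v] by (simp add: J_def)
  also have "\<dots> = m (of_real (- 1)) v" by simp
  finally show ?thesis by (simp only: m_real) simp
qed

lemma J_skew: "J u \<bullet> v = - (u \<bullet> J v)"
proof (cases "\<i> \<in> S")
  case True
  have "J u \<bullet> v = J (J u) \<bullet> J v" using J_inner[OF True] by simp
  then show ?thesis using J_J[OF True] by simp
qed (simp add: J_def)

text \<open>Skewness of \<open>J\<close> and \<open>J (J v) = - v\<close> let both scalars be pulled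
  out as complex numbers. In \<open>fourier_form_nonneg\<close> this reads a double integral with
  exponential weights as a squared norm.\<close>

lemma inner_m_m: assumes "a \<in> S" "b \<in> S"
  shows "m a u \<bullet> m b v = Re (a * cnj b * cip u v)"
proof (cases "\<i> \<in> S")
  case True
  then show ?thesis
    by (simp add: m_eq[OF assms(1)] m_eq[OF assms(2)] cip_def inner_add_left inner_add_right J_skew J_J algebra_simps)
next
  case False
  then have "Im a = 0" "Im b = 0" using assms in_S_real by auto
  then show ?thesis by (simp add: m_eq[OF assms(1)] m_eq[OF assms(2)] cip_def)
qed

lemma cip_m_left: assumes "a \<in> S" shows "cip (m a u) v = a * cip u v"
proof (cases "\<i> \<in> S")
  case True
  then show ?thesis
    by (simp add: m_eq[OF assms(1)] cip_def inner_add_left inner_add_right J_skew J_J algebra_simps complex_eq_iff)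
next
  case False
  then have "Im a = 0" using assms in_S_real by auto
  then show ?thesis by (simp add: m_eq[OF assms(1)] cip_def complex_eq_iff)
qed

lemma cip_cnj: "cip v u = cnj (cip u v)"
  using J_skew[of u v] by (simp add: cip_def complex_eq_iff inner_commute)

lemma cip_self: "cip v v = of_real ((norm v)\<^sup>2)"
  using J_skew[of v v] by (simp add: cip_def complex_eq_iff power2_norm_eq_inner inner_commute)

lemma cip_add_left: "cip (u + w) v = cip u v + cip w v"
  and cip_diff_left: "cip (u - w) v = cip u v - cip w v"
  and cip_zero_left [simp]: "cip 0 v = 0"
  and cip_zero_right [simp]: "cip v 0 = 0"
  by (simp_all add: cip_def inner_add_left inner_diff_left complex_eq_iff linear_0[OF J_linear])

lemma norm_cip_le: "norm (cip u v) \<le> norm u * norm v"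
proof (cases "cip u v = 0")
  case False
  show ?thesis
  proof (cases "\<i> \<in> S")
    case True
    \<comment> \<open>Multiplying \<open>u\<close> by the conjugate of \<open>cip u v\<close> makes
      the form real, where the real Cauchy-Schwarz inequality applies; one factor
      \<open>norm (cip u v)\<close> is cancelled at the end.\<close>
    define a where "a = cnj (cip u v)"
    have "(norm (cip u v))\<^sup>2 = Re (a * cip u v)"
      unfolding a_def cmod_power2 by (simp add: power2_eq_square)
    also have "\<dots> = m a u \<bullet> v"
      using True in_S inner_m_m[of a 1 u v] m_real[of 1 v] by simp
    also have "\<dots> \<le> norm (m a u) * norm v" by (rule norm_cauchy_schwarz)
    also have "\<dots> = norm (cip u v) * (norm u * norm v)" using norm_m[OF in_S[OF True], of a u] by (simp add: a_def)
    finally show ?thesis using False by (simp add: power2_eq_square)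
  next
    case False
    then have "cip u v = of_real (u \<bullet> v)" by (simp add: cip_def J_def complex_eq_iff)
    then show ?thesis using Cauchy_Schwarz_ineq2[of u v] by simp
  qed
qed simp

lemma cip_bounded_linear: "bounded_linear (\<lambda>u. cip u v)"
  by (rule bounded_linear_intro[where K = "norm v"])
     (auto simp: cip_add_left norm_cip_le, simp add: cip_def complex_eq_iff)

lemma cip_continuous [continuous_intros]:
  assumes "continuous_on A f" "continuous_on A g"
  shows "continuous_on A (\<lambda>x. cip (f x) (g x))"
proof -
  have "continuous_on A (\<lambda>x. J (g x))"
    using assms(2) bounded_linear.continuous_on[OF J_bounded] by blast
  then have "continuous_on A (\<lambda>x. of_real (f x \<bullet> g x) + \<i> * of_real (f x \<bullet> J (g x)))"
    using assms by (intro continuous_intros)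
  moreover have "(\<lambda>x. cip (f x) (g x)) = (\<lambda>x. of_real (f x \<bullet> g x) + \<i> * of_real (f x \<bullet> J (g x)))"
    by (simp add: cip_def complex_eq_iff fun_eq_iff)
  ultimately show ?thesis by (simp only:)
qed

lemma m_integrable:
  assumes k: "integrable lborel k" "\<And>x. k x \<in> S" and u: "cc_fun u"
  shows "(\<lambda>x. m (k x) (u x)) integrable_on UNIV"
proof -
  obtain a b where ab: "\<And>x. x \<notin> cbox a b \<Longrightarrow> u x = 0" and c: "continuous_on UNIV u"
    using u unfolding cc_fun_def by blast
  have "(\<lambda>x. Re (k x) *\<^sub>R u x + Im (k x) *\<^sub>R J (u x)) integrable_on UNIV"
    by (intro integrable_add scaleR_continuous_integrable[where a = a and b = b])
       (auto simp: k ab c linear_0[OF J_linear] intro!: bounded_linear.continuous_on[OF J_bounded])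
  then show ?thesis using k(2) by (simp add: m_eq)
qed

text \<open>A bounded linear map into a Euclidean space carries the gauge integral to a Lebesgue
  integral. Estimates of \<open>H\<close>-valued integrals pass through such an \<open>L\<close>, an
  inner product or \<open>cip\<close> with a fixed vector.\<close>

lemma linear_integral_m:
  fixes L :: "'h \<Rightarrow> 'b::euclidean_space"
  assumes k: "integrable lborel k" "\<And>x. k x \<in> S" and u: "cc_fun u" and L: "bounded_linear L"
  shows "integrable lborel (\<lambda>x. L (m (k x) (u x)))"
    and "L (integral UNIV (\<lambda>x. m (k x) (u x))) = (LINT x|lborel. L (m (k x) (u x)))"
proof -
  obtain B where B: "B \<ge> 0" "\<And>x. norm (u x) \<le> B" using cc_fun_bounded[OF u] by blast
  obtain C where C: "\<And>v. norm (L v) \<le> norm v * C" "C \<ge> 0"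
    using bounded_linear.nonneg_bounded[OF L] by blast
  have cu: "continuous_on UNIV u" using u unfolding cc_fun_def by blast
  have [measurable]: "k \<in> borel_measurable borel" using k by auto
  have [measurable]: "(\<lambda>x. L (u x)) \<in> borel_measurable borel" "(\<lambda>x. L (J (u x))) \<in> borel_measurable borel"
    by (intro borel_measurable_continuous_onI bounded_linear.continuous_on[OF L]
          bounded_linear.continuous_on[OF J_bounded] cu)+
  have eq: "L (m (k x) (u x)) = Re (k x) *\<^sub>R L (u x) + Im (k x) *\<^sub>R L (J (u x))" for x
    using L by (simp add: m_eq[OF k(2)] linear_simps)
  have meas: "(\<lambda>x. L (m (k x) (u x))) \<in> borel_measurable lborel" unfolding eq by measurable
  show int: "integrable lborel (\<lambda>x. L (m (k x) (u x)))"
  proof (rule Bochner_Integration.integrable_bound[OF _ meas])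
    show "integrable lborel (\<lambda>x. norm (k x) * (B * C))" using k by auto
    have "norm (L (m (k x) (u x))) \<le> norm (k x) * (B * C)" for x
    proof -
      have "norm (L (m (k x) (u x))) \<le> norm (k x) * norm (u x) * C" using C(1)[of "m (k x) (u x)"] norm_m[OF k(2)] by simp
      also have "\<dots> \<le> norm (k x) * B * C" using B C by (intro mult_mono) auto
      finally show ?thesis by simp
    qed
    then show "AE x in lborel. norm (L (m (k x) (u x))) \<le> norm (norm (k x) * (B * C))"
      using B C by auto
  qed
  show "L (integral UNIV (\<lambda>x. m (k x) (u x))) = (LINT x|lborel. L (m (k x) (u x)))"
    using integral_linear[OF m_integrable[OF k u] L] integral_lborel[OF int] by (simp add: o_def)
qed

text \<open>Pairing the integral \<open>V\<close> with itself bounds \<open>norm V * norm V\<close>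
  by the scalar integral times \<open>norm V\<close>, and one factor cancels.\<close>

lemma norm_integral_m_le:
  assumes k: "integrable lborel k" "\<And>x. k x \<in> S" and u: "cc_fun u"
  shows "norm (integral UNIV (\<lambda>x. m (k x) (u x))) \<le> (LINT x|lborel. norm (k x) * norm (u x))"
proof -
  define V where "V = integral UNIV (\<lambda>x. m (k x) (u x))"
  obtain B where B: "B \<ge> 0" "\<And>x. norm (u x) \<le> B" using cc_fun_bounded[OF u] by blast
  have [measurable]: "k \<in> borel_measurable borel" using k by auto
  have [measurable]: "(\<lambda>x. norm (u x)) \<in> borel_measurable borel"
    using u unfolding cc_fun_def by (intro borel_measurable_continuous_onI continuous_intros) auto
  have int: "integrable lborel (\<lambda>x. norm (k x) * norm (u x))"
  proof (rule Bochner_Integration.integrable_bound)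
    show "integrable lborel (\<lambda>x. norm (k x) * B)" using k by auto
    show "AE x in lborel. norm (norm (k x) * norm (u x)) \<le> norm (norm (k x) * B)"
      using B by (auto intro!: mult_left_mono)
  qed auto
  note L = linear_integral_m[OF k u bounded_linear_inner_left[of V], folded V_def]
  have "norm V * norm V = V \<bullet> V" by (simp add: norm_eq_sqrt_inner)
  also have "\<dots> = (LINT x|lborel. m (k x) (u x) \<bullet> V)" by (rule L(2))
  also have "\<dots> \<le> (LINT x|lborel. norm (k x) * norm (u x) * norm V)"
  proof (rule integral_mono[OF L(1)])
    show "integrable lborel (\<lambda>x. norm (k x) * norm (u x) * norm V)" using int by auto
    show "m (k x) (u x) \<bullet> V \<le> norm (k x) * norm (u x) * norm V" for x
      using norm_cauchy_schwarz[of "m (k x) (u x)" V] norm_m[OF k(2)] by simp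
  qed
  also have "\<dots> = (LINT x|lborel. norm (k x) * norm (u x)) * norm V" by simp
  finally have "norm V * norm V \<le> (LINT x|lborel. norm (k x) * norm (u x)) * norm V" .
  then show ?thesis unfolding V_def[symmetric]
    by (cases "norm V = 0") (auto simp: mult_le_cancel_right intro: integral_nonneg_AE)
qed

end

section \<open>A Gaussian proof of the Plancherel bound\<close>

lemma lborel_reflect:
  fixes x :: "'a::euclidean_space" shows "distr lborel borel (\<lambda>y. x - y) = lborel"
  using lborel_affine[of "-1" x] by (simp add: density_1)

lemma integrable_reflect:
  fixes f :: "'a::euclidean_space \<Rightarrow> 'b::{banach, second_countable_topology}"
  assumes "integrable lborel f" shows "integrable lborel (\<lambda>y. f (x - y))"
proof -
  have [measurable]: "f \<in> borel_measurable borel" using assms by auto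
  have "integrable (distr lborel borel (\<lambda>y. x - y)) f" by (simp add: lborel_reflect assms)
  then show ?thesis by (subst (asm) integrable_distr_eq) auto
qed

lemma integral_reflect:
  fixes f :: "'a::euclidean_space \<Rightarrow> 'b::{banach, second_countable_topology}"
  assumes [measurable]: "f \<in> borel_measurable borel"
  shows "(LINT y|lborel. f (x - y)) = (LINT y|lborel. f y)"
proof -
  have "(LINT y|lborel. f y) = (LINT y|distr lborel borel (\<lambda>y. x - y). f y)"
    by (simp add: lborel_reflect)
  also have "\<dots> = (LINT y|lborel. f (x - y))" by (rule integral_distr) auto
  finally show ?thesis by simp
qed

lemma nn_integral_reflect:
  fixes f :: "'a::euclidean_space \<Rightarrow> ennreal"
  assumes [measurable]: "f \<in> borel_measurable borel"
  shows "(\<integral>\<^sup>+ y. f (x - y) \<partial>lborel) = (\<integral>\<^sup>+ y. f y \<partial>lborel)"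
proof -
  have "(\<integral>\<^sup>+ y. f y \<partial>lborel) = (\<integral>\<^sup>+ y. f y \<partial>distr lborel borel (\<lambda>y. x - y))"
    by (simp add: lborel_reflect)
  also have "\<dots> = (\<integral>\<^sup>+ y. f (x - y) \<partial>lborel)" by (rule nn_integral_distr) auto
  finally show ?thesis by simp
qed

lemma lborel_shift:
  fixes x :: "'a::euclidean_space" shows "distr lborel borel (\<lambda>y. x + y) = lborel"
  using lborel_affine[of 1 x] by (simp add: density_1)

lemma integral_shift:
  fixes f :: "'a::euclidean_space \<Rightarrow> 'b::{banach, second_countable_topology}"
  assumes [measurable]: "f \<in> borel_measurable borel"
  shows "(LINT y|lborel. f (x + y)) = (LINT y|lborel. f y)"
proof -
  have "(LINT y|lborel. f y) = (LINT y|distr lborel borel (\<lambda>y. x + y). f y)"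
    by (simp add: lborel_shift)
  also have "\<dots> = (LINT y|lborel. f (x + y))" by (rule integral_distr) auto
  finally show ?thesis by simp
qed

lemma nn_integral_shift:
  fixes f :: "'a::euclidean_space \<Rightarrow> ennreal"
  assumes [measurable]: "f \<in> borel_measurable borel"
  shows "(\<integral>\<^sup>+ y. f (x + y) \<partial>lborel) = (\<integral>\<^sup>+ y. f y \<partial>lborel)"
proof -
  have "(\<integral>\<^sup>+ y. f y \<partial>lborel) = (\<integral>\<^sup>+ y. f y \<partial>distr lborel borel (\<lambda>y. x + y))"
    by (simp add: lborel_shift)
  also have "\<dots> = (\<integral>\<^sup>+ y. f (x + y) \<partial>lborel)" by (rule nn_integral_distr) auto
  finally show ?thesis by simp
qed

lemma integral_affine:
  fixes f :: "'a::euclidean_space \<Rightarrow> 'b::{banach, second_countable_topology}"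
  assumes [measurable]: "f \<in> borel_measurable borel" and c: "c > 0"
  shows "(LINT y|lborel. f y) = c ^ DIM('a) *\<^sub>R (LINT y|lborel. f (x + c *\<^sub>R y))"
proof -
  have "(LINT y|lborel. f y)
      = (LINT y|density (distr lborel borel (\<lambda>y. x + c *\<^sub>R y)) (\<lambda>_. ennreal (c ^ DIM('a))). f y)"
    using lborel_affine[of c x] c by simp
  also have "\<dots> = c ^ DIM('a) *\<^sub>R (LINT y|lborel. f (x + c *\<^sub>R y))"
    using c by (subst integral_density) (auto simp: integral_distr)
  finally show ?thesis .
qed

definition ew :: "'a::euclidean_space \<Rightarrow> 'a \<Rightarrow> complex" where
  "ew \<xi> x = exp (- (\<i> * of_real (x \<bullet> \<xi>)))"

definition gauss :: "'a::euclidean_space \<Rightarrow> real" where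
  "gauss x = exp (- (norm x)\<^sup>2 / 2)"

lemma norm_ew [simp]: "norm (ew \<xi> x) = 1"
  by (simp add: ew_def)

lemma ew_measurable_pair [measurable (raw)]:
  assumes "f \<in> borel_measurable M" "g \<in> borel_measurable M"
  shows "(\<lambda>x. ew (f x) (g x)) \<in> borel_measurable M"
  using assms unfolding ew_def by measurable

lemma ew_diff: "ew \<xi> x * cnj (ew \<xi> y) = ew \<xi> (x - y)"
  unfolding ew_def exp_cnj exp_add[symmetric] by (simp add: inner_diff_left algebra_simps)

lemma gauss_pos: "gauss x > 0" and gauss_le_1: "gauss x \<le> 1"
  by (auto simp: gauss_def)

lemma gauss_measurable [measurable]: "gauss \<in> borel_measurable borel"
  unfolding gauss_def by measurable

text \<open>Up to the factor \<open>sqrt (2 * pi)\<close> this is the characteristic function of the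
  standard normal distribution.\<close>

lemma gauss_ew_real:
  "integrable lborel (\<lambda>x::real. complex_of_real (exp (- x\<^sup>2 / 2)) * exp (- (\<i> * of_real (x * z))))"
  "(LINT x|lborel. complex_of_real (exp (- x\<^sup>2 / 2)) * exp (- (\<i> * of_real (x * z))))
     = of_real (sqrt (2 * pi) * exp (- z\<^sup>2 / 2))"
proof -
  have d: "exp (- x\<^sup>2 / 2) = sqrt (2 * pi) * std_normal_density x" for x :: real
    by (simp add: std_normal_density_def real_sqrt_mult)
  have i: "integrable lborel (\<lambda>x. sqrt (2 * pi) * std_normal_density x)"
    using integrable_normal_density[of 1 0] by simp
  show "integrable lborel (\<lambda>x::real. complex_of_real (exp (- x\<^sup>2 / 2)) * exp (- (\<i> * of_real (x * z))))"
    unfolding d by (rule Bochner_Integration.integrable_bound[OF i]) (auto simp: norm_mult)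
  have "(LINT x|lborel. complex_of_real (exp (- x\<^sup>2 / 2)) * exp (- (\<i> * of_real (x * z))))
      = (LINT x|lborel. of_real (sqrt (2 * pi)) * (std_normal_density x *\<^sub>R iexp ((- z) * x)))"
    unfolding d by (intro Bochner_Integration.integral_cong) (auto simp: scaleR_conv_of_real mult_ac)
  also have "\<dots> = of_real (sqrt (2 * pi)) * (LINT x|lborel. std_normal_density x *\<^sub>R iexp ((- z) * x))"
    by (rule integral_mult_right_zero)
  also have "(LINT x|lborel. std_normal_density x *\<^sub>R iexp ((- z) * x)) = char std_normal_distribution (- z)"
    unfolding char_def by (subst integral_density) auto
  finally show "(LINT x|lborel. complex_of_real (exp (- x\<^sup>2 / 2)) * exp (- (\<i> * of_real (x * z))))
     = of_real (sqrt (2 * pi) * exp (- z\<^sup>2 / 2))"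
    by (simp add: char_std_normal_distribution)
qed

text \<open>Gaussian and exponential both factor over the coordinates, and \<open>lborel\<close> is
  the image of a product of one-dimensional measures, so the one-dimensional formula is applied in
  each coordinate.\<close>

lemma gauss_ew:
  fixes z :: "'a::euclidean_space"
  shows "integrable lborel (\<lambda>\<xi>::'a. of_real (gauss \<xi>) * ew \<xi> z)"
    and "(LINT \<xi>|lborel. of_real (gauss \<xi>) * ew \<xi> z) = of_real (sqrt (2 * pi) ^ DIM('a) * gauss z)"
proof -
  interpret product_sigma_finite "\<lambda>_::'a. lborel :: real measure" ..
  let ?f = "\<lambda>b x. complex_of_real (exp (- x\<^sup>2 / 2)) * exp (- (\<i> * of_real (x * (z \<bullet> b))))"
  let ?T = "\<lambda>f::'a \<Rightarrow> real. \<Sum>b\<in>Basis. f b *\<^sub>R b"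
  have Tb: "?T f \<bullet> b = f b" if "b \<in> Basis" for f b using that by simp
  have nsq: "(norm (x::'a))\<^sup>2 = (\<Sum>b\<in>Basis. (x \<bullet> b)\<^sup>2)" for x
  proof -
    have "(norm x)\<^sup>2 = x \<bullet> x" by (rule power2_norm_eq_inner)
    also have "\<dots> = (\<Sum>b\<in>Basis. (x \<bullet> b) * (x \<bullet> b))" by (rule euclidean_inner)
    finally show ?thesis by (simp only: power2_eq_square)
  qed
  have eq: "of_real (gauss (?T f)) * ew (?T f) z = (\<Prod>b\<in>Basis. ?f b (f b))" for f
  proof -
    have 1: "gauss (?T f) = (\<Prod>b\<in>Basis. exp (- (f b)\<^sup>2 / 2))"
      by (simp add: gauss_def nsq Tb exp_sum[symmetric] sum_negf sum_divide_distrib)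
    have "z \<bullet> ?T f = (\<Sum>b\<in>Basis. f b * (z \<bullet> b))" by (simp add: inner_sum_right)
    then have 2: "ew (?T f) z = (\<Prod>b\<in>Basis. exp (- (\<i> * of_real (f b * (z \<bullet> b)))))"
      by (simp add: ew_def exp_sum[symmetric] sum_negf sum_distrib_left)
    show ?thesis unfolding 1 2 by (simp add: prod.distrib)
  qed
  have [measurable]: "?T \<in> borel_measurable (\<Pi>\<^sub>M b\<in>Basis. lborel)" by measurable
  have [measurable]: "(\<lambda>\<xi>. of_real (gauss \<xi>) * ew \<xi> z) \<in> borel_measurable borel" by measurable
  have "integrable (\<Pi>\<^sub>M b\<in>Basis. lborel) (\<lambda>f. \<Prod>b\<in>Basis. ?f b (f b))"
    by (rule product_integrable_prod) (simp, rule gauss_ew_real(1))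
  then have "integrable (\<Pi>\<^sub>M b\<in>Basis. lborel) (\<lambda>f. of_real (gauss (?T f)) * ew (?T f) z)"
    by (simp only: eq)
  then show "integrable lborel (\<lambda>\<xi>::'a. of_real (gauss \<xi>) * ew \<xi> z)"
    by (subst lborel_eq, subst integrable_distr_eq) simp_all
  have "(LINT \<xi>|lborel. of_real (gauss \<xi>) * ew \<xi> z)
      = (LINT f|(\<Pi>\<^sub>M b\<in>Basis. lborel). of_real (gauss (?T f)) * ew (?T f) z)"
    by (subst lborel_eq, subst integral_distr) simp_all
  also have "\<dots> = (\<Prod>b\<in>Basis. of_real (sqrt (2 * pi) * exp (- (z \<bullet> b)\<^sup>2 / 2)))"
  proof -
    have "(LINT f|(\<Pi>\<^sub>M b\<in>Basis. lborel). (\<Prod>b\<in>Basis. ?f b (f b))) = (\<Prod>b\<in>Basis. (LINT x|lborel. ?f b x))"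
      by (rule product_integral_prod) (simp, rule gauss_ew_real(1))
    then show ?thesis unfolding eq gauss_ew_real(2) .
  qed
  also have "\<dots> = of_real (sqrt (2 * pi) ^ DIM('a) * gauss z)"
    by (simp add: prod.distrib gauss_def nsq exp_sum[symmetric] sum_negf sum_divide_distrib
        flip: of_real_prod)
  finally show "(LINT \<xi>|lborel. of_real (gauss \<xi>) * ew \<xi> z) = of_real (sqrt (2 * pi) ^ DIM('a) * gauss z)" .
qed

lemma gauss_integrable: "integrable lborel (gauss :: 'a::euclidean_space \<Rightarrow> real)"
proof -
  have "integrable lborel (\<lambda>\<xi>::'a. norm (of_real (gauss \<xi>) * ew \<xi> 0))"
    using gauss_ew(1) by (rule integrable_norm)
  then show ?thesis by (simp add: norm_mult abs_of_pos[OF gauss_pos])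
qed

lemma fourier_borel:
  assumes [measurable]: "g \<in> borel_measurable borel"
  shows "fourier g \<xi> = (LINT x|lborel. ew \<xi> x * g x)"
proof -
  have "(\<lambda>x. ew \<xi> x * g x) \<in> borel_measurable lborel" by measurable
  then show ?thesis unfolding fourier_def ew_def[symmetric] by (rule integral_completion)
qed

text \<open>Made for convolutions of an integrable kernel with a function in \<open>cc_fun\<close>:
  compact support is lost, but these three properties remain (\<open>convol_nice\<close>), and
  together they make the square of the norm integrable (\<open>norm_sq_integrable\<close>).\<close>

definition nice_fun :: "('a::euclidean_space \<Rightarrow> 'h::real_normed_vector) \<Rightarrow> bool" where
  "nice_fun W \<longleftrightarrow> continuous_on UNIV W \<and> integrable lborel (\<lambda>x. norm (W x)) \<and> (\<exists>B\<ge>0. \<forall>x. norm (W x) \<le> B)"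

lemma cc_fun_nice: assumes "cc_fun u" shows "nice_fun u"
  using cc_fun_norm_integrable[OF assms] cc_fun_bounded[OF assms] assms
  by (simp add: nice_fun_def cc_fun_def)

section \<open>Scalar formulas for vector-valued convolutions\<close>

context scalar_hilbert
begin

lemma cip_measurable_nice:
  assumes "nice_fun W" "nice_fun U"
  shows "(\<lambda>z. cip (W (fst z)) (U (snd z))) \<in> borel_measurable borel"
proof -
  have "continuous_on UNIV W" "continuous_on UNIV U" using assms by (auto simp: nice_fun_def)
  then have "continuous_on UNIV (\<lambda>z. W (fst z))" "continuous_on UNIV (\<lambda>z. U (snd z))"
    using continuous_on_compose2[OF _ continuous_on_fst[OF continuous_on_id] subset_UNIV]
      continuous_on_compose2[OF _ continuous_on_snd[OF continuous_on_id] subset_UNIV] by simp_all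
  then show ?thesis by (intro borel_measurable_continuous_onI continuous_intros)
qed

lemma cip_measurable_nice' [measurable (raw)]:
  assumes "nice_fun W" "nice_fun U" "f \<in> borel_measurable M" "g \<in> borel_measurable M"
  shows "(\<lambda>x. cip (W (f x)) (U (g x))) \<in> borel_measurable M"
proof -
  have "(\<lambda>x. (f x, g x)) \<in> M \<rightarrow>\<^sub>M borel" using assms(3,4) by simp
  from measurable_compose[OF this cip_measurable_nice[OF assms(1,2)]] show ?thesis by simp
qed

lemma cip_measurable_left:
  assumes "nice_fun W" shows "(\<lambda>x. cip (W x) v) \<in> borel_measurable borel"
  using assms unfolding nice_fun_def by (intro borel_measurable_continuous_onI continuous_intros) auto

lemma norm_measurable_nice:
  assumes "nice_fun W" shows "(\<lambda>x. norm (W x)) \<in> borel_measurable borel"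
  using assms unfolding nice_fun_def by auto

lemma cip_integrable_left:
  assumes "nice_fun W" shows "integrable lborel (\<lambda>x. cip (W x) v)"
proof (rule Bochner_Integration.integrable_bound)
  show "integrable lborel (\<lambda>x. norm (W x) * norm v)" using assms by (auto simp: nice_fun_def)
qed (use cip_measurable_left[OF assms] norm_cip_le in auto)

lemma cip_integrable_pair:
  assumes W: "nice_fun W" and U: "nice_fun U"
  shows "integrable (lborel \<Otimes>\<^sub>M lborel) (\<lambda>(x, y). cip (W x) (U y))"
proof -
  have [measurable]: "(\<lambda>x. norm (W x)) \<in> borel_measurable borel" "(\<lambda>x. norm (U x)) \<in> borel_measurable borel"
    using W U by (auto intro: norm_measurable_nice)
  have i: "integrable lborel (\<lambda>x. norm (W x))" "integrable lborel (\<lambda>x. norm (U x))"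
    using W U by (auto simp: nice_fun_def)
  have "integrable (lborel \<Otimes>\<^sub>M lborel) (\<lambda>(x, y). norm (W x) * norm (U y))"
    by (rule lborel_pair.Fubini_integrable) (use i in \<open>auto simp: norm_mult\<close>)
  then show ?thesis
    by (rule Bochner_Integration.integrable_bound)
      (use W U norm_cip_le cip_measurable_nice[OF W U] in
        \<open>auto simp: split_beta' borel_prod intro: order_trans\<close>)
qed

text \<open>Testing against \<open>v\<close> turns the convolution into a scalar one. The second
  form moves the translation onto \<open>u\<close>, whose continuity then passes to the
  convolution.\<close>

lemma convol_cip:
  assumes k: "integrable lborel k" "\<And>x. k x \<in> S" and u: "cc_fun u"
  shows "cip (convol m k u x) v = (LINT y|lborel. k (x - y) * cip (u y) v)"
    and "cip (convol m k u x) v = (LINT z|lborel. k z * cip (u (x - z)) v)"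
proof -
  have [measurable]: "k \<in> borel_measurable borel" using k by auto
  have [measurable]: "(\<lambda>x. cip (u x) v) \<in> borel_measurable borel"
    by (rule cip_measurable_left[OF cc_fun_nice[OF u]])
  show 1: "cip (convol m k u x) v = (LINT y|lborel. k (x - y) * cip (u y) v)"
    unfolding convol_def
    using linear_integral_m(2)[OF integrable_reflect[OF k(1)] k(2) u cip_bounded_linear]
    by (simp add: cip_m_left[OF k(2)])
  have "(LINT y|lborel. k (x - y) * cip (u y) v) = (LINT y|lborel. (\<lambda>z. k z * cip (u (x - z)) v) (x - y))"
    by simp
  also have "\<dots> = (LINT z|lborel. k z * cip (u (x - z)) v)"
    by (rule integral_reflect) measurable
  finally show "cip (convol m k u x) v = (LINT z|lborel. k z * cip (u (x - z)) v)" using 1 by simp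
qed

lemma convol_norm_le:
  assumes k: "integrable lborel k" "\<And>x. k x \<in> S" and u: "cc_fun u"
  shows "norm (convol m k u x) \<le> (LINT y|lborel. norm (k (x - y)) * norm (u y))"
  unfolding convol_def by (rule norm_integral_m_le[OF integrable_reflect[OF k(1)] k(2) u])

text \<open>Expanding \<open>cip V V\<close> in both arguments leaves scalar integrals only. This
  formula is the source of joint measurability in \<open>convol_norm_measurable\<close>, where norms
  are measured and not \<open>H\<close>-valued maps.\<close>

lemma convol_norm_sq:
  assumes k: "integrable lborel k" "\<And>x. k x \<in> S" and u: "cc_fun u"
  shows "(norm (convol m k u x))\<^sup>2 =
    Re (LINT y|lborel. k (x - y) * cnj (LINT y'|lborel. k (x - y') * cip (u y') (u y)))"
proof -
  define V where "V = convol m k u x"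
  have "of_real ((norm V)\<^sup>2) = cip V V" by (simp add: cip_self)
  also have "\<dots> = (LINT y|lborel. k (x - y) * cip (u y) V)" unfolding V_def by (rule convol_cip(1)[OF k u])
  also have "\<dots> = (LINT y|lborel. k (x - y) * cnj (LINT y'|lborel. k (x - y') * cip (u y') (u y)))"
  proof -
    have "cip (u y) V = cnj (LINT y'|lborel. k (x - y') * cip (u y') (u y))" for y
      by (subst cip_cnj) (simp add: V_def convol_cip(1)[OF k u])
    then show ?thesis by simp
  qed
  finally show ?thesis unfolding V_def[symmetric] by (metis Re_complex_of_real)
qed

lemma convol_norm_measurable:
  fixes k :: "'p \<Rightarrow> 'a::euclidean_space \<Rightarrow> complex" and u :: "'p \<Rightarrow> 'a \<Rightarrow> 'h"
  assumes k: "\<And>p. integrable lborel (k p)" "\<And>p x. k p x \<in> S" and u: "\<And>p. cc_fun (u p)"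
    and km: "(\<lambda>z. k (fst z) (snd z)) \<in> borel_measurable (M \<Otimes>\<^sub>M borel)"
    and um: "(\<lambda>z. cip (u (fst z) (fst (snd z))) (u (fst z) (snd (snd z)))) \<in> borel_measurable (M \<Otimes>\<^sub>M (borel \<Otimes>\<^sub>M borel))"
  shows "(\<lambda>z. norm (convol m (k (fst z)) (u (fst z)) (snd z))) \<in> borel_measurable (M \<Otimes>\<^sub>M borel)"
proof -
  have [measurable]: "cnj \<in> borel_measurable borel"
    by (intro borel_measurable_continuous_onI continuous_intros)
  have km'[measurable (raw)]: "(\<lambda>w. k (f w) (g w)) \<in> borel_measurable N"
    if "f \<in> N \<rightarrow>\<^sub>M M" "g \<in> borel_measurable N" for f g and N :: "'q measure"
  proof -
    have "(\<lambda>w. (f w, g w)) \<in> N \<rightarrow>\<^sub>M (M \<Otimes>\<^sub>M borel)" using that by simp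
    from measurable_compose[OF this km] show ?thesis by simp
  qed
  have um'[measurable (raw)]: "(\<lambda>w. cip (u (f w) (g w)) (u (f w) (h w))) \<in> borel_measurable N"
    if "f \<in> N \<rightarrow>\<^sub>M M" "g \<in> borel_measurable N" "h \<in> borel_measurable N" for f g h and N :: "'q measure"
  proof -
    have "(\<lambda>w. (f w, (g w, h w))) \<in> N \<rightarrow>\<^sub>M (M \<Otimes>\<^sub>M (borel \<Otimes>\<^sub>M borel))" using that by simp
    from measurable_compose[OF this um] show ?thesis by simp
  qed
  have "norm (convol m (k p) (u p) x) = sqrt (Re (LINT y|lborel. k p (x - y) * cnj (LINT y'|lborel. k p (x - y') * cip (u p y') (u p y))))"
    for p x
    unfolding convol_norm_sq[OF k(1) k(2) u, symmetric] by simp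
  then show ?thesis by simp measurable
qed

text \<open>Continuity is inherited from \<open>u\<close>, not from the kernel: dominated
  convergence applies to the translates of \<open>u\<close> integrated against
  \<open>norm (k z)\<close>.\<close>

lemma convol_continuous:
  assumes k: "integrable lborel k" "\<And>x. k x \<in> S" and u: "cc_fun u"
  shows "continuous_on UNIV (convol m k u)"
  unfolding continuous_on_sequentially
proof (intro ballI allI impI, elim conjE)
  fix X :: "nat \<Rightarrow> 'a" and x assume X: "X \<longlonglongrightarrow> x"
  obtain B where B: "B \<ge> 0" "\<And>x. norm (u x) \<le> B" using cc_fun_bounded[OF u] by blast
  have cu: "continuous_on UNIV u" using u by (simp add: cc_fun_def)
  have [measurable]: "k \<in> borel_measurable borel" using k by auto
  define E where "E n = (LINT z|lborel. norm (k z) * norm (u (X n - z) - u (x - z)))" for n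
  have um: "(\<lambda>z. norm (u (y - z) - u (x - z))) \<in> borel_measurable borel" for y
    by (intro borel_measurable_continuous_onI continuous_intros continuous_on_compose2[OF cu]) auto
  have ub: "norm (u (y - z) - u (x - z)) \<le> 2 * B" for y z
    using norm_triangle_ineq4[of "u (y - z)" "u (x - z)"] B(2)[of "y - z"] B(2)[of "x - z"] by simp
  have ki: "integrable lborel (\<lambda>z. norm (k z) * (2 * B))" using k by auto
  have int: "integrable lborel (\<lambda>z. norm (k z) * norm (u (X n - z) - u (x - z)))" for n
    by (rule Bochner_Integration.integrable_bound[OF ki]) (use um ub B in \<open>auto simp: abs_mult intro!: mult_left_mono\<close>)
  have "E \<longlonglongrightarrow> (LINT z|(lborel :: 'a measure). 0)" unfolding E_def
  proof (rule integral_dominated_convergence[where w = "\<lambda>z. norm (k z) * (2 * B)"])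
    have "(\<lambda>n. norm (u (X n - z) - u (x - z))) \<longlonglongrightarrow> norm (u (x - z) - u (x - z))" for z
      using cu X by (intro tendsto_intros isCont_tendsto_compose[of _ u])
        (auto simp: continuous_on_eq_continuous_at)
    then show "AE z in lborel. (\<lambda>n. norm (k z) * norm (u (X n - z) - u (x - z))) \<longlonglongrightarrow> 0"
      by (auto intro!: tendsto_mult_right_zero)
  qed (use ki um ub B in \<open>auto simp: abs_mult intro!: mult_left_mono\<close>)
  then have E0: "E \<longlonglongrightarrow> 0" by simp
  \<comment> \<open>The difference \<open>w\<close> is paired with itself, as in
    \<open>norm_integral_m_le\<close>, so that only scalar integrals are estimated.\<close>
  have le: "norm (convol m k u (X n) - convol m k u x) \<le> E n" for n
  proof -
    define w where "w = convol m k u (X n) - convol m k u x"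
    have I: "integrable lborel (\<lambda>z. k z * cip (u (y - z)) w)" for y
    proof (rule Bochner_Integration.integrable_bound)
      show "integrable lborel (\<lambda>z. norm (k z) * (B * norm w))" using k by auto
      have [measurable]: "(\<lambda>z. cip (u z) w) \<in> borel_measurable borel"
        by (rule cip_measurable_left[OF cc_fun_nice[OF u]])
      show "(\<lambda>z. k z * cip (u (y - z)) w) \<in> borel_measurable lborel" by measurable
      show "AE z in lborel. norm (k z * cip (u (y - z)) w) \<le> norm (norm (k z) * (B * norm w))"
        using B by (auto simp: norm_mult intro!: mult_left_mono order_trans[OF norm_cip_le] mult_right_mono)
    qed
    have "of_real ((norm w)\<^sup>2) = cip w w" by (simp add: cip_self)
    also have "\<dots> = (LINT z|lborel. k z * cip (u (X n - z)) w) - (LINT z|lborel. k z * cip (u (x - z)) w)"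
      by (subst (1) w_def) (simp add: cip_diff_left convol_cip(2)[OF k u])
    also have "\<dots> = (LINT z|lborel. k z * cip (u (X n - z) - u (x - z)) w)"
      by (subst Bochner_Integration.integral_diff[OF I I, symmetric]) (simp add: cip_diff_left right_diff_distrib)
    finally have "(norm w)\<^sup>2 = norm (LINT z|lborel. k z * cip (u (X n - z) - u (x - z)) w)"
      by (metis abs_power2 norm_of_real)
    also have "\<dots> \<le> (LINT z|lborel. norm (k z * cip (u (X n - z) - u (x - z)) w))"
      by (rule integral_norm_bound)
    also have "\<dots> \<le> (LINT z|lborel. norm (k z) * norm (u (X n - z) - u (x - z)) * norm w)"
    proof (rule integral_mono)
      show "integrable lborel (\<lambda>z. norm (k z * cip (u (X n - z) - u (x - z)) w))"
        using Bochner_Integration.integrable_diff[OF I[of "X n"] I[of x]]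
        by (simp add: cip_diff_left right_diff_distrib)
      show "integrable lborel (\<lambda>z. norm (k z) * norm (u (X n - z) - u (x - z)) * norm w)"
        using int by auto
      show "norm (k z * cip (u (X n - z) - u (x - z)) w) \<le> norm (k z) * norm (u (X n - z) - u (x - z)) * norm w" for z
        using mult_left_mono[OF norm_cip_le[of "u (X n - z) - u (x - z)" w], of "norm (k z)"]
        by (simp add: norm_mult mult.assoc)
    qed
    also have "\<dots> = E n * norm w" by (simp add: E_def)
    finally have "norm w * norm w \<le> E n * norm w" by (simp add: power2_eq_square)
    moreover have "E n \<ge> 0" unfolding E_def by (intro integral_nonneg_AE) auto
    ultimately show ?thesis unfolding w_def[symmetric]
      by (cases "norm w = 0") (auto simp: mult_le_cancel_right)
  qed
  have "(\<lambda>n. convol m k u (X n) - convol m k u x) \<longlonglongrightarrow> 0"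
    by (rule Lim_null_comparison[OF _ E0]) (use le in auto)
  then show "(convol m k u \<circ> X) \<longlonglongrightarrow> convol m k u x"
    by (simp add: o_def LIM_zero_iff)
qed

lemma convol_bound:
  assumes k: "integrable lborel k" "\<And>x. k x \<in> S" and u: "cc_fun u" and B: "\<And>x. norm (u x) \<le> B"
  shows "norm (convol m k u x) \<le> B * (LINT z|lborel. norm (k z))"
proof -
  have [measurable]: "k \<in> borel_measurable borel" using k by auto
  have [measurable]: "(\<lambda>x. norm (u x)) \<in> borel_measurable borel"
    by (rule norm_measurable_nice[OF cc_fun_nice[OF u]])
  have ki: "integrable lborel (\<lambda>y. norm (k (x - y)))" using integrable_reflect[OF k(1)] by auto
  have "B \<ge> 0" using B[of 0] norm_ge_zero order_trans by blast
  have kB: "integrable lborel (\<lambda>y. norm (k (x - y)) * B)" using ki by auto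
  have "norm (convol m k u x) \<le> (LINT y|lborel. norm (k (x - y)) * norm (u y))"
    by (rule convol_norm_le[OF k u])
  also have "\<dots> \<le> (LINT y|lborel. norm (k (x - y)) * B)"
  proof (rule integral_mono[OF _ kB])
    show "integrable lborel (\<lambda>y. norm (k (x - y)) * norm (u y))"
      by (rule Bochner_Integration.integrable_bound[OF kB]) (use B \<open>B \<ge> 0\<close> in \<open>auto intro!: mult_left_mono\<close>)
  qed (use B in \<open>auto intro!: mult_left_mono\<close>)
  also have "\<dots> = B * (LINT y|lborel. norm (k (x - y)))" by simp
  also have "(LINT y|lborel. norm (k (x - y))) = (LINT z|lborel. norm (k z))"
    by (rule integral_reflect) measurable
  finally show ?thesis .
qed

text \<open>Boundedness is \<open>convol_bound\<close>; integrability of the norm is Young's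
  inequality for two functions in \<open>L\<^sub>1\<close>, by Fubini.\<close>

lemma convol_nice:
  assumes k: "integrable lborel k" "\<And>x. k x \<in> S" and u: "cc_fun u"
  shows "nice_fun (convol m k u)"
proof -
  obtain B where B: "B \<ge> 0" "\<And>x. norm (u x) \<le> B" using cc_fun_bounded[OF u] by blast
  have c: "continuous_on UNIV (convol m k u)" by (rule convol_continuous[OF k u])
  have [measurable]: "k \<in> borel_measurable borel" using k by auto
  have [measurable]: "(\<lambda>x. norm (u x)) \<in> borel_measurable borel"
    by (rule norm_measurable_nice[OF cc_fun_nice[OF u]])
  have kn: "integrable lborel (\<lambda>x. norm (k x))" using k by auto
  have e: "(LINT x|lborel. norm (k (x - y))) = (LINT x|lborel. norm (k x))" for y
    using integral_shift[of "\<lambda>x. norm (k x)" "- y"] by simp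
  have "integrable (lborel \<Otimes>\<^sub>M lborel) (\<lambda>(y, x). norm (k (x - y)) * norm (u y))"
  proof (rule lborel_pair.Fubini_integrable)
    show "integrable lborel (\<lambda>y. LINT x|lborel. norm (case (y, x) of (y, x) \<Rightarrow> norm (k (x - y)) * norm (u y)))"
      using cc_fun_norm_integrable[OF u] by (simp add: e)
    have "integrable lborel (\<lambda>x. norm (k (x - y)))" for y
      using kn integrable_distr_eq[of "\<lambda>x. x - y" lborel borel "\<lambda>x. norm (k x)"] lborel_shift[of "- y"] by simp
    then show "AE y in lborel. integrable lborel (\<lambda>x. case (y, x) of (y, x) \<Rightarrow> norm (k (x - y)) * norm (u y))"
      by simp
  qed (simp add: split_beta', measurable)
  then have i: "integrable lborel (\<lambda>x. LINT y|lborel. norm (k (x - y)) * norm (u y))"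
    by (rule lborel_pair.integrable_snd)
  have "integrable lborel (\<lambda>x. norm (convol m k u x))"
  proof (rule Bochner_Integration.integrable_bound[OF i])
    show "(\<lambda>x. norm (convol m k u x)) \<in> borel_measurable lborel"
      using c by (simp add: borel_measurable_continuous_onI continuous_on_norm)
    show "AE x in lborel. norm (norm (convol m k u x)) \<le> norm (LINT y|lborel. norm (k (x - y)) * norm (u y))"
      using convol_norm_le[OF k u] by (auto intro: order_trans[OF _ abs_ge_self])
  qed
  moreover have "\<forall>x. norm (convol m k u x) \<le> B * (LINT z|lborel. norm (k z))"
    using convol_bound[OF k u] B by blast
  moreover have "B * (LINT z|lborel. norm (k z)) \<ge> 0" using B by (auto intro!: mult_nonneg_nonneg integral_nonneg_AE)
  ultimately show ?thesis using c unfolding nice_fun_def by blast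
qed

end

lemma measurable_fst_borel [measurable]: "fst \<in> borel_measurable (borel :: ('a::euclidean_space \<times> 'b::euclidean_space) measure)"
  and measurable_snd_borel [measurable]: "snd \<in> borel_measurable (borel :: ('a::euclidean_space \<times> 'b::euclidean_space) measure)"
  by (intro borel_measurable_continuous_onI continuous_intros)+

section \<open>The Fourier side of Plancherel's theorem\<close>

context scalar_hilbert
begin

text \<open>Formally the \<open>cip\<close> product of the Fourier transforms of \<open>W\<close>
  and \<open>U\<close> at \<open>\<xi>\<close>. The double integral avoids forming a vector-valued
  transform, which over real scalars would leave \<open>H\<close> for its complexification.\<close>

definition fourier_form :: "('a::euclidean_space \<Rightarrow> 'h) \<Rightarrow> ('a \<Rightarrow> 'h) \<Rightarrow> 'a \<Rightarrow> complex" where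
  "fourier_form W U \<xi> = (LINT y|lborel. LINT x|lborel. ew \<xi> x * cnj (ew \<xi> y) * cip (W x) (U y))"

lemma cnj_measurable [measurable]: "cnj \<in> borel_measurable borel"
  by (intro borel_measurable_continuous_onI continuous_intros)

lemma fourier_form_integrable:
  assumes W: "nice_fun W" and U: "nice_fun U"
  shows "integrable (lborel \<Otimes>\<^sub>M lborel) (\<lambda>(y, x). ew \<xi> x * cnj (ew \<xi> y) * cip (W x) (U y))"
proof (rule Bochner_Integration.integrable_bound)
  show "integrable (lborel \<Otimes>\<^sub>M lborel) (\<lambda>(y, x). cip (W x) (U y))"
    using lborel_pair.integrable_product_swap[OF cip_integrable_pair[OF W U]] by (simp add: split_beta')
  show "(\<lambda>(y, x). ew \<xi> x * cnj (ew \<xi> y) * cip (W x) (U y)) \<in> borel_measurable (lborel \<Otimes>\<^sub>M lborel)"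
    using W U by (simp add: split_beta') measurable
qed (auto simp: norm_mult)

lemma fourier_form_swap:
  assumes W: "nice_fun W" and U: "nice_fun U"
  shows "fourier_form U W \<xi> = cnj (fourier_form W U \<xi>)"
proof -
  have "cnj (fourier_form W U \<xi>)
      = (LINT y|lborel. LINT x|lborel. cnj (ew \<xi> x * cnj (ew \<xi> y) * cip (W x) (U y)))"
    by (simp only: fourier_form_def Bochner_Integration.integral_cnj)
  also have "\<dots> = (LINT y|lborel. LINT x|lborel. ew \<xi> y * cnj (ew \<xi> x) * cip (U y) (W x))"
    by (subst (2) cip_cnj) (simp add: mult_ac)
  also have "\<dots> = (LINT x|lborel. LINT y|lborel. ew \<xi> y * cnj (ew \<xi> x) * cip (U y) (W x))"
    by (rule lborel_pair.Fubini_integral[OF fourier_form_integrable[OF U W]])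
  finally show ?thesis unfolding fourier_form_def by simp
qed

text \<open>For a fixed second vector \<open>v\<close> this is the scalar convolution theorem:
  exchange the integrals, then shift \<open>x\<close> by \<open>y\<close> so that the exponential
  splits.\<close>

lemma fourier_form_convol:
  assumes k: "integrable lborel k" "\<And>x. k x \<in> S" and u: "cc_fun u"
  shows "fourier_form (convol m k u) U \<xi> = fourier k \<xi> * fourier_form u U \<xi>"
proof -
  have [measurable]: "k \<in> borel_measurable borel" using k by auto
  have e_add: "ew \<xi> (y + z) = ew \<xi> y * ew \<xi> z" for y z :: 'a
    by (simp add: ew_def inner_add_left distrib_left exp_add[symmetric] exp_diff exp_minus field_simps)
  have inner: "(LINT x|lborel. ew \<xi> x * cip (convol m k u x) v) = fourier k \<xi> * (LINT y|lborel. ew \<xi> y * cip (u y) v)" for v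
  proof -
    have [measurable]: "(\<lambda>x. cip (u x) v) \<in> borel_measurable borel"
      by (rule cip_measurable_left[OF cc_fun_nice[OF u]])
    have e: "(LINT x|lborel. norm (k (x - y))) = (LINT x|lborel. norm (k x))" for y
      using integral_shift[of "\<lambda>x. norm (k x)" "- y"] by simp
    have ki: "integrable lborel (\<lambda>x. k (x - y))" for y
      using k(1) integrable_distr_eq[of "\<lambda>x. x - y" lborel borel k] lborel_shift[of "- y"] by simp
    have I: "integrable (lborel \<Otimes>\<^sub>M lborel) (\<lambda>(y, x). ew \<xi> x * (k (x - y) * cip (u y) v))"
    proof (rule lborel_pair.Fubini_integrable)
      have "integrable lborel (\<lambda>y. norm (cip (u y) v))"
        using cip_integrable_left[OF cc_fun_nice[OF u]] by (rule integrable_norm)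
      then show "integrable lborel (\<lambda>y. LINT x|lborel. norm (case (y, x) of (y, x) \<Rightarrow> ew \<xi> x * (k (x - y) * cip (u y) v)))"
        by (simp add: norm_mult e)
      have "integrable lborel (\<lambda>x. ew \<xi> x * (k (x - y) * cip (u y) v))" for y
        by (rule Bochner_Integration.integrable_bound[where f = "\<lambda>x. k (x - y) * cip (u y) v"])
           (use ki in \<open>auto simp: norm_mult\<close>)
      then show "AE y in lborel. integrable lborel (\<lambda>x. case (y, x) of (y, x) \<Rightarrow> ew \<xi> x * (k (x - y) * cip (u y) v))"
        by simp
    qed (simp add: split_beta', measurable)
    have "(LINT x|lborel. ew \<xi> x * cip (convol m k u x) v)
        = (LINT x|lborel. LINT y|lborel. ew \<xi> x * (k (x - y) * cip (u y) v))"
      unfolding convol_cip(1)[OF k u] by (intro Bochner_Integration.integral_cong refl integral_mult_right_zero[symmetric])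
    also have "\<dots> = (LINT y|lborel. LINT x|lborel. ew \<xi> x * (k (x - y) * cip (u y) v))"
      by (rule lborel_pair.Fubini_integral[OF I])
    also have "(\<lambda>y. LINT x|lborel. ew \<xi> x * (k (x - y) * cip (u y) v)) = (\<lambda>y. fourier k \<xi> * (ew \<xi> y * cip (u y) v))"
    proof
      fix y
      have "(LINT x|lborel. ew \<xi> x * (k (x - y) * cip (u y) v))
          = (LINT x|lborel. ew \<xi> (y + x) * (k (y + x - y) * cip (u y) v))"
        by (rule integral_shift[symmetric]) measurable
      also have "\<dots> = (LINT x|lborel. (ew \<xi> y * cip (u y) v) * (ew \<xi> x * k x))"
        by (simp add: e_add mult_ac)
      also have "\<dots> = (ew \<xi> y * cip (u y) v) * fourier k \<xi>"
        by (subst integral_mult_right_zero) (simp add: fourier_borel)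
      finally show "(LINT x|lborel. ew \<xi> x * (k (x - y) * cip (u y) v)) = fourier k \<xi> * (ew \<xi> y * cip (u y) v)"
        by (simp add: mult_ac)
    qed
    finally show ?thesis by simp
  qed
  have pull: "(LINT x|lborel. ew \<xi> x * cnj (ew \<xi> y) * g x) = cnj (ew \<xi> y) * (LINT x|lborel. ew \<xi> x * g x)"
    for y and g :: "'a \<Rightarrow> complex"
    by (subst integral_mult_right_zero[symmetric]) (simp add: mult_ac)
  have "fourier_form (convol m k u) U \<xi>
      = (LINT y|lborel. fourier k \<xi> * (cnj (ew \<xi> y) * (LINT x|lborel. ew \<xi> x * cip (u x) (U y))))"
    unfolding fourier_form_def pull inner by (simp add: mult_ac)
  also have "\<dots> = fourier k \<xi> * fourier_form u U \<xi>"
    unfolding fourier_form_def pull by (rule integral_mult_right_zero)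
  finally show ?thesis .
qed

text \<open>The second argument is reached by \<open>fourier_form_swap\<close>, which conjugates.
  The two factors \<open>fourier k \<xi>\<close> combine to a squared modulus, and the conjugate
  left on the form of \<open>u\<close> is invisible in the real part.\<close>

lemma fourier_form_convol_convol:
  assumes k: "integrable lborel k" "\<And>x. k x \<in> S" and u: "cc_fun u"
  shows "Re (fourier_form (convol m k u) (convol m k u) \<xi>) = (norm (fourier k \<xi>))\<^sup>2 * Re (fourier_form u u \<xi>)"
proof -
  note n = convol_nice[OF k u] cc_fun_nice[OF u]
  have "fourier_form (convol m k u) (convol m k u) \<xi> = fourier k \<xi> * fourier_form u (convol m k u) \<xi>"
    by (rule fourier_form_convol[OF k u])
  also have "fourier_form u (convol m k u) \<xi> = cnj (fourier_form (convol m k u) u \<xi>)"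
    by (rule fourier_form_swap[OF n(1) n(2)])
  also have "fourier_form (convol m k u) u \<xi> = fourier k \<xi> * fourier_form u u \<xi>"
    by (rule fourier_form_convol[OF k u])
  finally have "fourier_form (convol m k u) (convol m k u) \<xi> = of_real ((norm (fourier k \<xi>))\<^sup>2) * cnj (fourier_form u u \<xi>)"
    unfolding complex_norm_square by (simp add: mult_ac)
  then show ?thesis by simp
qed

text \<open>The double integral is the squared norm of the single integral \<open>I\<close>.\<close>

lemma inner_form_nonneg:
  assumes k: "integrable lborel k" "\<And>x. k x \<in> S" and u: "cc_fun u"
  shows "integrable lborel (\<lambda>y. LINT x|lborel. m (k x) (u x) \<bullet> m (k y) (u y))"
    and "(LINT y|lborel. LINT x|lborel. m (k x) (u x) \<bullet> m (k y) (u y)) \<ge> 0"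
proof -
  define I where "I = integral UNIV (\<lambda>x. m (k x) (u x))"
  note L = linear_integral_m[OF k u bounded_linear_inner_left, folded I_def]
  have eq: "(LINT x|lborel. m (k x) (u x) \<bullet> m (k y) (u y)) = m (k y) (u y) \<bullet> I" for y
    using L(2)[of "m (k y) (u y)"] by (simp add: inner_commute)
  show "integrable lborel (\<lambda>y. LINT x|lborel. m (k x) (u x) \<bullet> m (k y) (u y))"
    unfolding eq by (rule L(1))
  show "(LINT y|lborel. LINT x|lborel. m (k x) (u x) \<bullet> m (k y) (u y)) \<ge> 0"
    unfolding eq L(2)[symmetric] by simp
qed

text \<open>Formally the value is the squared norm of the Fourier transform of \<open>u\<close>;
  \<open>inner_form_nonneg\<close> makes this precise once the exponential is expressed through
  admissible scalars.\<close>

lemma fourier_form_nonneg: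
  assumes u: "cc_fun u"
  shows "Re (fourier_form u u \<xi>) \<ge> 0"
proof -
  note n = cc_fun_nice[OF u]
  obtain a b where ab: "\<And>x. x \<notin> cbox a b \<Longrightarrow> u x = 0" using u unfolding cc_fun_def by blast
  have ibox: "integrable lborel (\<lambda>x. indicator (cbox a b) x *\<^sub>R g x)"
    if "continuous_on UNIV g" for g :: "'a \<Rightarrow> complex"
    using that by (intro borel_integrable_compact) (auto intro: continuous_on_subset)
  have in1: "integrable lborel (\<lambda>x. ew \<xi> x * cnj (ew \<xi> y) * cip (u x) (u y))" for y
  proof (rule Bochner_Integration.integrable_bound[OF cip_integrable_left[OF n, of "u y"]])
    have [measurable]: "(\<lambda>x. cip (u x) (u y)) \<in> borel_measurable borel" by (rule cip_measurable_left[OF n])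
    show "(\<lambda>x. ew \<xi> x * cnj (ew \<xi> y) * cip (u x) (u y)) \<in> borel_measurable lborel" by measurable
  qed (auto simp: norm_mult)
  have in2: "integrable lborel (\<lambda>y. LINT x|lborel. ew \<xi> x * cnj (ew \<xi> y) * cip (u x) (u y))"
    by (rule lborel_pair.integrable_fst[OF fourier_form_integrable[OF n n]])
  have Re_eq: "Re (fourier_form u u \<xi>) = (LINT y|lborel. LINT x|lborel. Re (ew \<xi> x * cnj (ew \<xi> y) * cip (u x) (u y)))"
    unfolding fourier_form_def by (subst integral_Re[OF in2, symmetric]) (simp only: integral_Re[OF in1])
  show ?thesis
  proof (cases "\<i> \<in> S")
    case True
    \<comment> \<open>Cutting off to a box around the support makes the exponential integrable
      without changing its products with \<open>u\<close>.\<close>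
    define k where "k x = indicator (cbox a b) x *\<^sub>R ew \<xi> x" for x
    have "continuous_on UNIV (ew \<xi>)" unfolding ew_def by (intro continuous_intros)
    then have k: "integrable lborel k" "k x \<in> S" for x
      unfolding k_def using ibox in_S[OF True] by auto
    have "m (k x) (u x) \<bullet> m (k y) (u y) = Re (ew \<xi> x * cnj (ew \<xi> y) * cip (u x) (u y))" for x y
      unfolding inner_m_m[OF k(2) k(2)] by (auto simp: k_def indicator_def ab)
    then show ?thesis using inner_form_nonneg(2)[OF k u] by (simp add: Re_eq)
  next
    case False
    \<comment> \<open>Over real scalars the exponential is not admissible. As \<open>cip\<close> is
      real here, only the cosine of \<open>(x - y) \<bullet> \<xi>\<close> matters, and the addition
      formula splits the form into a cosine part and a sine part, each a squared norm.\<close>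
    define kc ks where "kc x = indicator (cbox a b) x *\<^sub>R complex_of_real (cos (x \<bullet> \<xi>))"
      and "ks x = indicator (cbox a b) x *\<^sub>R complex_of_real (sin (x \<bullet> \<xi>))" for x
    have kc: "integrable lborel kc" unfolding kc_def by (rule ibox) (intro continuous_intros)
    have ks: "integrable lborel ks" unfolding ks_def by (rule ibox) (intro continuous_intros)
    have S: "kc x \<in> S" "ks x \<in> S" for x
      using of_real_in_S[of "indicator (cbox a b) x *\<^sub>R cos (x \<bullet> \<xi>)"] of_real_in_S[of "indicator (cbox a b) x *\<^sub>R sin (x \<bullet> \<xi>)"]
      by (simp_all add: kc_def ks_def scaleR_conv_of_real)
    note C = linear_integral_m(1)[OF kc S(1) u bounded_linear_inner_left]
    note D = linear_integral_m(1)[OF ks S(2) u bounded_linear_inner_left]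
    have cipr: "cip v w = of_real (v \<bullet> w)" for v w using False by (simp add: cip_def J_def complex_eq_iff)
    have "Re (ew \<xi> x * cnj (ew \<xi> y) * cip (u x) (u y))
        = m (kc x) (u x) \<bullet> m (kc y) (u y) + m (ks x) (u x) \<bullet> m (ks y) (u y)" for x y
    proof -
      have "Re (ew \<xi> x * cnj (ew \<xi> y)) = cos (x \<bullet> \<xi>) * cos (y \<bullet> \<xi>) + sin (x \<bullet> \<xi>) * sin (y \<bullet> \<xi>)"
        by (simp add: ew_diff) (simp add: ew_def Re_exp inner_diff_left cos_diff)
      then show ?thesis
        unfolding inner_m_m[OF S(1) S(1)] inner_m_m[OF S(2) S(2)]
        by (auto simp: cipr kc_def ks_def indicator_def ab distrib_right)
    qed
    then have "Re (fourier_form u u \<xi>)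
        = (LINT y|lborel. (LINT x|lborel. m (kc x) (u x) \<bullet> m (kc y) (u y)) + (LINT x|lborel. m (ks x) (u x) \<bullet> m (ks y) (u y)))"
      unfolding Re_eq by (simp add: Bochner_Integration.integral_add[OF C D])
    also have "\<dots> \<ge> 0"
      using inner_form_nonneg[OF kc S(1) u] inner_form_nonneg[OF ks S(2) u]
      by (subst Bochner_Integration.integral_add) auto
    finally show ?thesis .
  qed
qed

lemma fourier_form_measurable:
  assumes "nice_fun W" "nice_fun U"
  shows "fourier_form W U \<in> borel_measurable borel"
  unfolding fourier_form_def[abs_def] using assms by measurable

lemma fourier_form_bounded:
  assumes "nice_fun W" "nice_fun U"
  shows "\<exists>B. \<forall>\<xi>. norm (fourier_form W U \<xi>) \<le> B"
proof (intro exI allI)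
  fix \<xi>
  let ?f = "\<lambda>z. ew \<xi> (snd z) * cnj (ew \<xi> (fst z)) * cip (W (snd z)) (U (fst z))"
  have "integral\<^sup>L (lborel \<Otimes>\<^sub>M lborel) (\<lambda>(y, x). ew \<xi> x * cnj (ew \<xi> y) * cip (W x) (U y)) = fourier_form W U \<xi>"
    unfolding fourier_form_def
    by (rule lborel_pair.integral_fst[OF fourier_form_integrable[OF assms], symmetric])
  then have "norm (fourier_form W U \<xi>) = norm (integral\<^sup>L (lborel \<Otimes>\<^sub>M lborel) ?f)" by (simp add: split_beta')
  also have "\<dots> \<le> (LINT z|(lborel \<Otimes>\<^sub>M lborel). norm (?f z))" by (rule integral_norm_bound)
  also have "\<dots> = (LINT z|(lborel \<Otimes>\<^sub>M lborel). norm (cip (W (snd z)) (U (fst z))))"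
    by (simp add: norm_mult)
  finally show "norm (fourier_form W U \<xi>) \<le> (LINT z|(lborel \<Otimes>\<^sub>M lborel). norm (cip (W (snd z)) (U (fst z))))" .
qed

section \<open>Gaussian regularisation\<close>

lemma gauss_fourier_form_integrable:
  assumes "nice_fun W" "nice_fun U" and e: "e > 0"
  shows "integrable lborel (\<lambda>\<xi>. of_real (gauss (e *\<^sub>R \<xi>)) * fourier_form W U \<xi>)"
proof -
  obtain B where B: "\<And>\<xi>. norm (fourier_form W U \<xi>) \<le> B" using fourier_form_bounded[OF assms(1,2)] by blast
  note [measurable] = fourier_form_measurable[OF assms(1,2)]
  have "integrable (density (distr lborel borel (\<lambda>x::'a. 0 + e *\<^sub>R x)) (\<lambda>_. ennreal (\<bar>e\<bar> ^ DIM('a)))) gauss"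
    using gauss_integrable lborel_affine[of e "0::'a"] e by simp
  then have "integrable lborel (\<lambda>\<xi>::'a. gauss (e *\<^sub>R \<xi>))"
    using e by (subst (asm) integrable_density) (auto simp: integrable_distr_eq)
  then have "integrable lborel (\<lambda>\<xi>::'a. gauss (e *\<^sub>R \<xi>) * B)" by auto
  then show ?thesis
  proof (rule Bochner_Integration.integrable_bound)
    show "AE \<xi> in lborel. norm (of_real (gauss (e *\<^sub>R \<xi>)) * fourier_form W U \<xi>) \<le> norm (gauss (e *\<^sub>R \<xi>) * B)"
      using B by (auto simp: norm_mult abs_mult intro!: mult_left_mono order_trans[OF B abs_ge_self])
  qed measurable
qed

text \<open>The Gaussian factor makes everything absolutely convergent, so \<open>\<xi>\<close> can
  be integrated first. That leaves a Gaussian in \<open>x - y\<close> of width \<open>e\<close>, and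
  the substitution \<open>x = y + e w\<close> absorbs its normalisation.\<close>

lemma gauss_fourier_form:
  fixes W :: "'a::euclidean_space \<Rightarrow> 'h"
  assumes W: "nice_fun W" and e: "e > 0"
  shows "(LINT \<xi>|lborel. of_real (gauss (e *\<^sub>R \<xi>)) * fourier_form W W \<xi>)
     = of_real (sqrt (2 * pi) ^ DIM('a)) * (LINT y|lborel. LINT w|lborel. of_real (gauss w) * cip (W (y + e *\<^sub>R w)) (W y))"
proof -
  let ?Q = "\<lambda>z. cip (W (snd z)) (W (fst z))"
  have [measurable]: "?Q \<in> borel_measurable borel" using W by measurable
  have ge: "integrable lborel (\<lambda>\<xi>::'a. gauss (e *\<^sub>R \<xi>))"
  proof -
    have "integrable (density (distr lborel borel (\<lambda>x::'a. 0 + e *\<^sub>R x)) (\<lambda>_. ennreal (\<bar>e\<bar> ^ DIM('a)))) gauss"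
      using gauss_integrable lborel_affine[of e "0::'a"] e by simp
    then show ?thesis
      using e by (subst (asm) integrable_density) (auto simp: integrable_distr_eq)
  qed
  have Qi: "integrable lborel ?Q"
    using lborel_pair.integrable_product_swap[OF cip_integrable_pair[OF W W]] by (simp add: split_beta' lborel_prod)
  let ?F = "\<lambda>\<xi> z. of_real (gauss (e *\<^sub>R \<xi>)) * (ew \<xi> (snd z) * cnj (ew \<xi> (fst z)) * ?Q z)"
  have FI: "integrable (lborel \<Otimes>\<^sub>M lborel) (\<lambda>(\<xi>, z). ?F \<xi> z)"
  proof (rule lborel_pair.Fubini_integrable)
    show "(\<lambda>(\<xi>, z). ?F \<xi> z) \<in> borel_measurable (lborel \<Otimes>\<^sub>M lborel)"
      using W by (simp add: split_beta') measurable
    show "integrable lborel (\<lambda>\<xi>. LINT z|lborel. norm (case (\<xi>, z) of (\<xi>, z) \<Rightarrow> ?F \<xi> z))"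
      using ge by (simp add: norm_mult abs_of_pos[OF gauss_pos])
    have "integrable lborel (?F \<xi>)" for \<xi>
      by (rule Bochner_Integration.integrable_bound[OF Qi])
         (use W gauss_le_1[of "e *\<^sub>R \<xi>"] gauss_pos[of "e *\<^sub>R \<xi>"] in
          \<open>auto simp: norm_mult intro!: mult_left_le_one_le\<close>)
    then show "AE \<xi> in lborel. integrable lborel (\<lambda>z. case (\<xi>, z) of (\<xi>, z) \<Rightarrow> ?F \<xi> z)" by simp
  qed
  have ff: "fourier_form W W \<xi> = (LINT z|lborel. ew \<xi> (snd z) * cnj (ew \<xi> (fst z)) * ?Q z)" for \<xi>
    unfolding fourier_form_def
    by (subst lborel_pair.integral_fst[OF fourier_form_integrable[OF W W]]) (simp add: lborel_prod split_beta')
  have GI: "(LINT \<xi>|lborel. of_real (gauss (e *\<^sub>R \<xi>)) * ew \<xi> z)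
      = of_real (inverse e ^ DIM('a) * sqrt (2 * pi) ^ DIM('a) * gauss (z /\<^sub>R e))" for z :: 'a
  proof -
    have "(LINT \<xi>|lborel. of_real (gauss \<xi>) * ew \<xi> (z /\<^sub>R e))
        = e ^ DIM('a) *\<^sub>R (LINT \<xi>|lborel. of_real (gauss (0 + e *\<^sub>R \<xi>)) * ew (0 + e *\<^sub>R \<xi>) (z /\<^sub>R e))"
      by (rule integral_affine) (use e in auto)
    also have "\<dots> = e ^ DIM('a) *\<^sub>R (LINT \<xi>|lborel. of_real (gauss (e *\<^sub>R \<xi>)) * ew \<xi> z)"
    proof -
      have "(z /\<^sub>R e) \<bullet> (0 + e *\<^sub>R \<xi>) = z \<bullet> \<xi>" for \<xi> using e by simp
      then show ?thesis by (simp only: ew_def add_0)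
    qed
    finally show ?thesis
      using e by (simp add: gauss_ew(2) scaleR_conv_of_real field_simps power_inverse)
  qed
  have "(LINT \<xi>|lborel. of_real (gauss (e *\<^sub>R \<xi>)) * fourier_form W W \<xi>) = (LINT \<xi>|lborel. LINT z|lborel. ?F \<xi> z)"
    unfolding ff by (simp only: integral_mult_right_zero)
  also have "\<dots> = (LINT z|lborel. LINT \<xi>|lborel. ?F \<xi> z)"
    by (rule lborel_pair.Fubini_integral[OF FI, symmetric])
  also have "\<dots> = (LINT z|lborel. ?Q z * of_real (inverse e ^ DIM('a) * sqrt (2 * pi) ^ DIM('a) * gauss ((snd z - fst z) /\<^sub>R e)))"
  proof (rule Bochner_Integration.integral_cong[OF refl])
    fix z :: "'a \<times> 'a"
    have "(LINT \<xi>|lborel. ?F \<xi> z) = (LINT \<xi>|lborel. ?Q z * (of_real (gauss (e *\<^sub>R \<xi>)) * ew \<xi> (snd z - fst z)))"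
      by (simp add: ew_diff mult_ac)
    then show "(LINT \<xi>|lborel. ?F \<xi> z) = ?Q z * of_real (inverse e ^ DIM('a) * sqrt (2 * pi) ^ DIM('a) * gauss ((snd z - fst z) /\<^sub>R e))"
      by (simp only: integral_mult_right_zero GI)
  qed
  also have "\<dots> = (LINT y|lborel. LINT x|lborel. cip (W x) (W y) * of_real (inverse e ^ DIM('a) * sqrt (2 * pi) ^ DIM('a) * gauss ((x - y) /\<^sub>R e)))"
    (is "_ = (LINT y|lborel. LINT x|lborel. ?G y x)")
  proof -
    have [measurable]: "(\<lambda>z. gauss ((snd z - fst z) /\<^sub>R e)) \<in> borel_measurable borel" by measurable
    have "integrable lborel (\<lambda>z::'a\<times>'a. norm (?Q z) * (inverse e ^ DIM('a) * sqrt (2 * pi) ^ DIM('a)))"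
      using Qi by auto
    then have "integrable lborel (\<lambda>z::'a\<times>'a. ?G (fst z) (snd z))"
    proof (rule Bochner_Integration.integrable_bound)
      show "AE z in lborel. norm (?G (fst z) (snd z)) \<le> norm (norm (?Q z) * (inverse e ^ DIM('a) * sqrt (2 * pi) ^ DIM('a)))"
      proof (rule AE_I2)
        fix z :: "'a \<times> 'a"
        define q where "q = inverse e ^ DIM('a) * sqrt (2 * pi) ^ DIM('a)"
        have q: "q \<ge> 0" using e by (simp add: q_def)
        have "norm (?G (fst z) (snd z)) = norm (?Q z) * \<bar>q * gauss ((snd z - fst z) /\<^sub>R e)\<bar>"
          unfolding q_def by (simp only: norm_mult norm_of_real)
        also have "\<dots> \<le> norm (?Q z) * q"
          using q gauss_pos[of "(snd z - fst z) /\<^sub>R e"] gauss_le_1[of "(snd z - fst z) /\<^sub>R e"]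
          by (intro mult_left_mono) (auto simp: abs_mult intro: mult_left_le)
        finally show "norm (?G (fst z) (snd z)) \<le> norm (norm (?Q z) * (inverse e ^ DIM('a) * sqrt (2 * pi) ^ DIM('a)))"
          using q unfolding q_def by simp
      qed
    qed measurable
    then have "integrable (lborel \<Otimes>\<^sub>M lborel) (\<lambda>(y, x). ?G y x)" by (simp add: lborel_prod split_beta')
    from lborel_pair.integral_fst[OF this] show ?thesis by (simp add: lborel_prod split_beta')
  qed
  also have "\<dots> = (LINT y|lborel. of_real (sqrt (2 * pi) ^ DIM('a)) * (LINT w|lborel. of_real (gauss w) * cip (W (y + e *\<^sub>R w)) (W y)))"
  proof (rule Bochner_Integration.integral_cong[OF refl])
    fix y :: 'a
    have [measurable]: "(\<lambda>x. cip (W x) (W y)) \<in> borel_measurable borel" by (rule cip_measurable_left[OF W])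
    have "(LINT x|lborel. ?G y x) = e ^ DIM('a) *\<^sub>R (LINT w|lborel. ?G y (y + e *\<^sub>R w))"
      by (rule integral_affine[OF _ e]) measurable
    also have "\<dots> = e ^ DIM('a) *\<^sub>R (LINT w|lborel. of_real (inverse e ^ DIM('a) * sqrt (2 * pi) ^ DIM('a)) * (of_real (gauss w) * cip (W (y + e *\<^sub>R w)) (W y)))"
      using e by (simp add: mult_ac)
    also have "\<dots> = of_real (sqrt (2 * pi) ^ DIM('a)) * (LINT w|lborel. of_real (gauss w) * cip (W (y + e *\<^sub>R w)) (W y))"
      using e by (simp only: integral_mult_right_zero) (simp add: scaleR_conv_of_real field_simps power_inverse)
    finally show "(LINT x|lborel. ?G y x) = of_real (sqrt (2 * pi) ^ DIM('a)) * (LINT w|lborel. of_real (gauss w) * cip (W (y + e *\<^sub>R w)) (W y))" .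
  qed
  also have "\<dots> = of_real (sqrt (2 * pi) ^ DIM('a)) * (LINT y|lborel. LINT w|lborel. of_real (gauss w) * cip (W (y + e *\<^sub>R w)) (W y))"
    by (rule integral_mult_right_zero)
  finally show ?thesis .
qed

lemma norm_sq_integrable:
  assumes W: "nice_fun W" shows "integrable lborel (\<lambda>x. (norm (W x))\<^sup>2)"
proof -
  obtain B where B: "B \<ge> 0" "\<And>x. norm (W x) \<le> B" and i: "integrable lborel (\<lambda>x. norm (W x))"
    using W unfolding nice_fun_def by auto
  have [measurable]: "(\<lambda>x. norm (W x)) \<in> borel_measurable borel" by (rule norm_measurable_nice[OF W])
  show ?thesis
    by (rule Bochner_Integration.integrable_bound[where f = "\<lambda>x. norm (W x) * B"])
       (use i B in \<open>auto simp: power2_eq_square abs_mult intro!: mult_left_mono\<close>)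
qed

text \<open>The Gaussian is an approximate identity. Dominated convergence is used twice: in
  \<open>w\<close> for fixed \<open>y\<close>, by continuity and boundedness of \<open>W\<close>,
  and then in \<open>y\<close>, by integrability of its norm.\<close>

lemma gauss_form_tendsto:
  fixes W :: "'a::euclidean_space \<Rightarrow> 'h"
  assumes W: "nice_fun W"
  shows "(\<lambda>n. LINT y|lborel. LINT w|lborel. of_real (gauss w) * cip (W (y + inverse (real (Suc n)) *\<^sub>R w)) (W y))
    \<longlonglongrightarrow> of_real ((LINT w|lborel. gauss (w::'a)) * (LINT y|lborel. (norm (W y))\<^sup>2))"
proof -
  obtain B where B: "B \<ge> 0" "\<And>x. norm (W x) \<le> B" and i: "integrable lborel (\<lambda>x. norm (W x))"
    and c: "continuous_on UNIV W"
    using W unfolding nice_fun_def by auto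
  have [measurable]: "(\<lambda>x. norm (W x)) \<in> borel_measurable borel" by (rule norm_measurable_nice[OF W])
  define M where "M = (LINT w|lborel. gauss (w::'a))"
  let ?f = "\<lambda>n y w. of_real (gauss w) * cip (W (y + inverse (real (Suc n)) *\<^sub>R w)) (W y)"
  have bd: "norm (?f n y w) \<le> gauss w * (B * norm (W y))" for n y w
  proof -
    have "norm (cip (W (y + inverse (real (Suc n)) *\<^sub>R w)) (W y)) \<le> B * norm (W y)"
      by (rule order_trans[OF norm_cip_le mult_right_mono[OF B(2)]]) simp
    then show ?thesis using gauss_pos[of w] by (simp add: norm_mult)
  qed
  have gi: "integrable lborel (\<lambda>w. gauss w * (B * norm (W y)))" for y
    using gauss_integrable by auto
  have lim1: "(\<lambda>n. LINT w|lborel. ?f n y w) \<longlonglongrightarrow> of_real (M * (norm (W y))\<^sup>2)" for y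
  proof -
    have "(\<lambda>n. LINT w|lborel. ?f n y w) \<longlonglongrightarrow> (LINT w|lborel. of_real (gauss (w::'a)) * cip (W y) (W y))"
    proof (rule integral_dominated_convergence[where w = "\<lambda>w. gauss w * (B * norm (W y))"])
      have "(\<lambda>n. cip (W (y + inverse (real (Suc n)) *\<^sub>R w)) (W y)) \<longlonglongrightarrow> cip (W (y + 0 *\<^sub>R w)) (W y)" for w
        using c by (intro bounded_linear.tendsto[OF cip_bounded_linear] isCont_tendsto_compose[of _ W] tendsto_intros LIMSEQ_inverse_real_of_nat)
          (auto simp: continuous_on_eq_continuous_at)
      then show "AE w in lborel. (\<lambda>n. ?f n y w) \<longlonglongrightarrow> of_real (gauss w) * cip (W y) (W y)"
        by (auto intro!: tendsto_intros)
      show "?f n y \<in> borel_measurable lborel" for n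
        using W by measurable
    qed (use bd gi in auto)
    also have "(LINT w|lborel. of_real (gauss (w::'a)) * cip (W y) (W y)) = of_real (M * (norm (W y))\<^sup>2)"
      by (simp add: cip_self M_def)
    finally show ?thesis .
  qed
  have "(\<lambda>n. LINT y|lborel. LINT w|lborel. ?f n y w) \<longlonglongrightarrow> (LINT y|lborel. of_real (M * (norm (W y))\<^sup>2))"
  proof (rule integral_dominated_convergence[where w = "\<lambda>y. norm (W y) * (B * M)"])
    show "integrable lborel (\<lambda>y. norm (W y) * (B * M))" using i by auto
    show "AE y in lborel. (\<lambda>n. LINT w|lborel. ?f n y w) \<longlonglongrightarrow> of_real (M * (norm (W y))\<^sup>2)"
      using lim1 by auto
    show "(\<lambda>y. LINT w|lborel. ?f n y w) \<in> borel_measurable lborel" for n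
      using W by measurable
    show "AE y in lborel. norm (LINT w|lborel. ?f n y w) \<le> norm (W y) * (B * M)" for n
    proof (rule AE_I2)
      fix y
      have "norm (LINT w|lborel. ?f n y w) \<le> (LINT w|lborel. norm (?f n y w))" by (rule integral_norm_bound)
      also have "\<dots> \<le> (LINT w|lborel. gauss (w::'a) * (B * norm (W y)))"
        by (rule Bochner_Integration.integral_mono'[OF gi]) (use bd B in \<open>simp_all add: less_imp_le[OF gauss_pos]\<close>)
      finally show "norm (LINT w|lborel. ?f n y w) \<le> norm (W y) * (B * M)" by (simp add: M_def mult_ac)
    qed
  qed auto
  then show ?thesis unfolding M_def by (simp only: integral_complex_of_real integral_mult_right_zero)
qed

lemma gauss_mono: "0 < e \<Longrightarrow> e \<le> e' \<Longrightarrow> gauss (e' *\<^sub>R x) \<le> gauss (e *\<^sub>R x)"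
  by (auto simp: gauss_def intro!: mult_right_mono power_mono)

text \<open>With the Gaussian weight in place the integrals over \<open>t\<close> and
  \<open>\<xi>\<close> are exchanged, and the hypothesis on the Fourier transforms bounds the
  \<open>t\<close> integral for each \<open>\<xi>\<close>, the density \<open>P \<xi>\<close> being
  nonnegative. The weight is then removed, by monotonicity for \<open>u\<close> and by Fatou's lemma
  for the convolution. The positive constant \<open>c\<close> appears on both sides and
  cancels.\<close>

theorem Plancherel_bound:
  fixes k :: "real \<Rightarrow> 'a::euclidean_space \<Rightarrow> complex"
  assumes k: "\<And>t. integrable lborel (k t)" "\<And>t x. k t x \<in> S"
    and km: "(\<lambda>z. k (fst z) (snd z)) \<in> borel_measurable borel"
    and C: "\<And>\<xi>. (\<integral>\<^sup>+ t. ennreal ((norm (fourier (k t) \<xi>))\<^sup>2) \<partial>lborel) \<le> ennreal C\<^sub>0"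
    and u: "cc_fun u"
  shows "(\<integral>\<^sup>+ t. \<integral>\<^sup>+ x. ennreal ((norm (convol m (k t) u x))\<^sup>2) \<partial>lborel \<partial>lborel)
    \<le> ennreal C\<^sub>0 * (\<integral>\<^sup>+ x. ennreal ((norm (u x))\<^sup>2) \<partial>lborel)"
proof -
  define c where "c = sqrt (2 * pi) ^ DIM('a) * (LINT w|lborel. gauss (w::'a))"
  define G where "G n \<xi> = gauss (inverse (real (Suc n)) *\<^sub>R \<xi>)" for n and \<xi> :: 'a
  define V where "V t = convol m (k t) u" for t
  define P where "P \<xi> = Re (fourier_form u u \<xi>)" for \<xi>
  define T where "T n t = (LINT \<xi>|lborel. G n \<xi> * ((norm (fourier (k t) \<xi>))\<^sup>2 * P \<xi>))" for n t
  have nu: "nice_fun u" by (rule cc_fun_nice[OF u])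
  have nV: "nice_fun (V t)" for t unfolding V_def by (rule convol_nice[OF k u])
  have M: "(LINT w|lborel. gauss (w::'a)) > 0"
  proof (rule ccontr)
    assume "\<not> ?thesis"
    moreover have "(LINT w|lborel. gauss (w::'a)) \<ge> 0" by (intro integral_nonneg_AE) (simp add: gauss_pos less_imp_le)
    ultimately have "(LINT w|lborel. gauss (w::'a)) = 0" by simp
    then have "AE w::'a in lborel. gauss w = 0"
      by (subst (asm) integral_nonneg_eq_0_iff_AE) (auto simp: gauss_integrable gauss_pos less_imp_le)
    then have "AE w::'a in lborel. False" by eventually_elim (metis gauss_pos less_irrefl)
    then show False by (simp add: AE_iff_null null_sets_def)
  qed
  then have c: "c > 0" by (simp add: c_def)
  have P0: "P \<xi> \<ge> 0" for \<xi> unfolding P_def by (rule fourier_form_nonneg[OF u])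
  have G0: "G n \<xi> > 0" for n \<xi> by (simp add: G_def gauss_pos)
  have lim: "(\<lambda>n. LINT \<xi>|lborel. G n \<xi> * Re (fourier_form W W \<xi>)) \<longlonglongrightarrow> c * (LINT y|lborel. (norm (W y))\<^sup>2)"
    and intW: "\<And>n. integrable lborel (\<lambda>\<xi>. G n \<xi> * Re (fourier_form W W \<xi>))" if W: "nice_fun W" for W :: "'a \<Rightarrow> 'h"
  proof -
    have i: "integrable lborel (\<lambda>\<xi>. of_real (G n \<xi>) * fourier_form W W \<xi>)" for n
      unfolding G_def by (rule gauss_fourier_form_integrable[OF W W]) simp
    show "integrable lborel (\<lambda>\<xi>. G n \<xi> * Re (fourier_form W W \<xi>))" for n
      using integrable_Re[OF i[of n]] by simp
    have "(LINT \<xi>|lborel. G n \<xi> * Re (fourier_form W W \<xi>)) = Re (LINT \<xi>|lborel. of_real (G n \<xi>) * fourier_form W W \<xi>)" for n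
      by (subst integral_Re[OF i[of n], symmetric]) simp
    also have "\<And>n. Re (LINT \<xi>|lborel. of_real (G n \<xi>) * fourier_form W W \<xi>)
       = Re (of_real (sqrt (2 * pi) ^ DIM('a)) * (LINT y|lborel. LINT w|lborel. of_real (gauss w) * cip (W (y + inverse (real (Suc n)) *\<^sub>R w)) (W y)))"
      unfolding G_def by (subst gauss_fourier_form[OF W]) auto
    finally have e: "(\<lambda>n. LINT \<xi>|lborel. G n \<xi> * Re (fourier_form W W \<xi>)) = (\<lambda>n. Re (of_real (sqrt (2 * pi) ^ DIM('a)) * (LINT y|lborel. LINT w|lborel. of_real (gauss w) * cip (W (y + inverse (real (Suc n)) *\<^sub>R w)) (W y))))"
      by (rule ext)
    have "(\<lambda>n. LINT \<xi>|lborel. G n \<xi> * Re (fourier_form W W \<xi>)) \<longlonglongrightarrow>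
        Re (of_real (sqrt (2 * pi) ^ DIM('a)) * of_real ((LINT w|lborel. gauss (w::'a)) * (LINT y|lborel. (norm (W y))\<^sup>2)))"
      unfolding e by (intro tendsto_Re tendsto_mult tendsto_const gauss_form_tendsto[OF W])
    also have "Re (of_real (sqrt (2 * pi) ^ DIM('a)) * of_real ((LINT w|lborel. gauss (w::'a)) * (LINT y|lborel. (norm (W y))\<^sup>2)))
        = c * (LINT y|lborel. (norm (W y))\<^sup>2)"
      by (simp only: of_real_mult[symmetric] Re_complex_of_real c_def mult.assoc)
    finally show "(\<lambda>n. LINT \<xi>|lborel. G n \<xi> * Re (fourier_form W W \<xi>)) \<longlonglongrightarrow> c * (LINT y|lborel. (norm (W y))\<^sup>2)" .
  qed
  have ffV: "Re (fourier_form (V t) (V t) \<xi>) = (norm (fourier (k t) \<xi>))\<^sup>2 * P \<xi>" for t \<xi>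
    unfolding V_def P_def by (rule fourier_form_convol_convol[OF k u])
  have limT: "(\<lambda>n. T n t) \<longlonglongrightarrow> c * (LINT y|lborel. (norm (V t y))\<^sup>2)" for t
    using lim[OF nV] by (simp add: T_def ffV)
  have intT: "integrable lborel (\<lambda>\<xi>. G n \<xi> * ((norm (fourier (k t) \<xi>))\<^sup>2 * P \<xi>))" for n t
    using intW[OF nV] by (simp add: ffV)
  \<comment> \<open>The weights \<open>G n\<close> increase with \<open>n\<close>, so the limit
    bounds every term; this makes \<open>Tb\<close> uniform in \<open>n\<close>.\<close>
  have U: "(LINT \<xi>|lborel. G n \<xi> * P \<xi>) \<le> c * (LINT y|lborel. (norm (u y))\<^sup>2)" for n
  proof (rule incseq_le)
    show "(\<lambda>n. LINT \<xi>|lborel. G n \<xi> * P \<xi>) \<longlonglongrightarrow> c * (LINT y|lborel. (norm (u y))\<^sup>2)"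
      using lim[OF nu] by (simp add: P_def)
    show "incseq (\<lambda>n. LINT \<xi>|lborel. G n \<xi> * P \<xi>)"
    proof (rule incseq_SucI, rule integral_mono)
      show "integrable lborel (\<lambda>\<xi>. G n \<xi> * P \<xi>)" "integrable lborel (\<lambda>\<xi>. G (Suc n) \<xi> * P \<xi>)" for n
        using intW[OF nu] by (simp_all add: P_def)
      show "G n \<xi> * P \<xi> \<le> G (Suc n) \<xi> * P \<xi>" for n \<xi>
        using P0 unfolding G_def by (intro mult_right_mono gauss_mono) (auto simp: field_simps)
    qed
  qed
  have [measurable]: "P \<in> borel_measurable borel" unfolding P_def using fourier_form_measurable[OF nu nu] by simp
  have [measurable]: "G n \<in> borel_measurable borel" for n unfolding G_def by measurable
  have kmr[measurable (raw)]: "(\<lambda>w. k (f w) (g w)) \<in> borel_measurable N"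
    if "f \<in> borel_measurable N" "g \<in> borel_measurable N" for f g and N :: "'q measure"
  proof -
    have "(\<lambda>w. (f w, g w)) \<in> borel_measurable N" using that by simp
    from measurable_compose[OF this km] show ?thesis by simp
  qed
  have kb: "k t \<in> borel_measurable borel" for t using k(1) by auto
  have Fm[measurable (raw)]: "(\<lambda>w. fourier (k (f w)) (g w)) \<in> borel_measurable N"
    if [measurable]: "f \<in> borel_measurable N" "g \<in> borel_measurable N" for f g and N :: "'q measure"
    unfolding fourier_borel[OF kb] by measurable
  have [measurable]: "T n \<in> borel_measurable lborel" for n unfolding T_def by measurable
  have T0: "T n t \<ge> 0" for n t
    unfolding T_def by (intro integral_nonneg_AE) (simp add: less_imp_le[OF G0] P0)
  have Tb: "(\<integral>\<^sup>+ t. ennreal (T n t) \<partial>lborel) \<le> ennreal C\<^sub>0 * ennreal (c * (LINT y|lborel. (norm (u y))\<^sup>2))" for n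
  proof -
    have "(\<integral>\<^sup>+ t. ennreal (T n t) \<partial>lborel)
        = (\<integral>\<^sup>+ t. \<integral>\<^sup>+ \<xi>. ennreal (G n \<xi> * ((norm (fourier (k t) \<xi>))\<^sup>2 * P \<xi>)) \<partial>lborel \<partial>lborel)"
      unfolding T_def
      by (intro nn_integral_cong nn_integral_eq_integral[symmetric] intT) (simp add: less_imp_le[OF G0] P0)
    also have "\<dots> = (\<integral>\<^sup>+ \<xi>. \<integral>\<^sup>+ t. ennreal (G n \<xi> * ((norm (fourier (k t) \<xi>))\<^sup>2 * P \<xi>)) \<partial>lborel \<partial>lborel)"
      by (rule lborel_pair.Fubini'[symmetric]) measurable
    also have "\<dots> = (\<integral>\<^sup>+ \<xi>. ennreal (G n \<xi> * P \<xi>) * (\<integral>\<^sup>+ t. ennreal ((norm (fourier (k t) \<xi>))\<^sup>2) \<partial>lborel) \<partial>lborel)"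
    proof (rule nn_integral_cong)
      fix \<xi>
      have "(\<integral>\<^sup>+ t. ennreal (G n \<xi> * ((norm (fourier (k t) \<xi>))\<^sup>2 * P \<xi>)) \<partial>lborel)
         = (\<integral>\<^sup>+ t. ennreal (G n \<xi> * P \<xi>) * ennreal ((norm (fourier (k t) \<xi>))\<^sup>2) \<partial>lborel)"
        using P0 G0 by (intro nn_integral_cong) (simp add: ennreal_mult''[symmetric] mult_ac)
      also have "\<dots> = ennreal (G n \<xi> * P \<xi>) * (\<integral>\<^sup>+ t. ennreal ((norm (fourier (k t) \<xi>))\<^sup>2) \<partial>lborel)"
        by (rule nn_integral_cmult) measurable
      finally show "(\<integral>\<^sup>+ t. ennreal (G n \<xi> * ((norm (fourier (k t) \<xi>))\<^sup>2 * P \<xi>)) \<partial>lborel)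
        = ennreal (G n \<xi> * P \<xi>) * (\<integral>\<^sup>+ t. ennreal ((norm (fourier (k t) \<xi>))\<^sup>2) \<partial>lborel)" .
    qed
    also have "\<dots> \<le> (\<integral>\<^sup>+ \<xi>. ennreal C\<^sub>0 * ennreal (G n \<xi> * P \<xi>) \<partial>lborel)"
      using C by (intro nn_integral_mono) (simp add: mult.commute[of "ennreal C\<^sub>0"] mult_left_mono)
    also have "\<dots> = ennreal C\<^sub>0 * (\<integral>\<^sup>+ \<xi>. ennreal (G n \<xi> * P \<xi>) \<partial>lborel)"
      by (rule nn_integral_cmult) measurable
    also have "(\<integral>\<^sup>+ \<xi>. ennreal (G n \<xi> * P \<xi>) \<partial>lborel) = ennreal (LINT \<xi>|lborel. G n \<xi> * P \<xi>)"
      using intW[OF nu, folded P_def] by (intro nn_integral_eq_integral) (simp_all add: less_imp_le[OF G0] P0)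
    also have "ennreal C\<^sub>0 * \<dots> \<le> ennreal C\<^sub>0 * ennreal (c * (LINT y|lborel. (norm (u y))\<^sup>2))"
      by (intro mult_left_mono ennreal_leI U) simp
    finally show ?thesis .
  qed
  have nn: "ennreal (LINT y|lborel. (norm (W y))\<^sup>2) = (\<integral>\<^sup>+ y. ennreal ((norm (W y))\<^sup>2) \<partial>lborel)"
    if "nice_fun W" for W :: "'a \<Rightarrow> 'h"
    by (intro nn_integral_eq_integral[symmetric] norm_sq_integrable that) auto
  have "ennreal c * (\<integral>\<^sup>+ t. \<integral>\<^sup>+ x. ennreal ((norm (V t x))\<^sup>2) \<partial>lborel \<partial>lborel)
     = ennreal c * (\<integral>\<^sup>+ t. ennreal (LINT y|lborel. (norm (V t y))\<^sup>2) \<partial>lborel)"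
    by (simp only: nn[OF nV])
  also have "\<dots> = (\<integral>\<^sup>+ t. ennreal (c * (LINT y|lborel. (norm (V t y))\<^sup>2)) \<partial>lborel)"
  proof (subst nn_integral_cmult[symmetric])
    \<comment> \<open>Measurability in \<open>t\<close> comes from the limit \<open>limT\<close>, up
      to the factor \<open>c\<close>.\<close>
    have "(\<lambda>t. inverse c * (c * (LINT y|lborel. (norm (V t y))\<^sup>2))) \<in> borel_measurable lborel"
      by (intro borel_measurable_times borel_measurable_const borel_measurable_LIMSEQ_real[OF limT]) measurable
    moreover have "inverse c * (c * r) = r" for r using c by simp
    ultimately show "(\<lambda>t. ennreal (LINT y|lborel. (norm (V t y))\<^sup>2)) \<in> borel_measurable lborel"
      by (simp only: measurable_compose[OF _ measurable_ennreal])
  qed (use c in \<open>simp add: ennreal_mult'\<close>)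
  also have "\<dots> = (\<integral>\<^sup>+ t. liminf (\<lambda>n. ennreal (T n t)) \<partial>lborel)"
    by (intro nn_integral_cong lim_imp_Liminf[symmetric] tendsto_ennrealI limT) simp
  also have "\<dots> \<le> liminf (\<lambda>n. \<integral>\<^sup>+ t. ennreal (T n t) \<partial>lborel)"
    by (rule nn_integral_liminf) measurable
  also have "\<dots> \<le> liminf (\<lambda>n::nat. ennreal C\<^sub>0 * ennreal (c * (LINT y|lborel. (norm (u y))\<^sup>2)))"
    by (intro Liminf_mono always_eventually allI Tb)
  also have "\<dots> = ennreal c * (ennreal C\<^sub>0 * (\<integral>\<^sup>+ x. ennreal ((norm (u x))\<^sup>2) \<partial>lborel))"
    using c by (simp add: Liminf_const ennreal_mult' nn[OF nu] mult_ac)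
  finally show ?thesis
    using c unfolding V_def by (simp add: ennreal_mult_le_mult_iff)
qed

end

section \<open>A dyadic good-lambda inequality\<close>

lemma emeasure_Union_mono:
  assumes "countable \<A>" "disjoint \<A>" "\<A> \<subseteq> sets M1" and sets: "sets M2 = sets M1"
    and le: "\<And>Q. Q \<in> \<A> \<Longrightarrow> emeasure M1 Q \<le> emeasure M2 Q"
  shows "emeasure M1 (\<Union>\<A>) \<le> emeasure M2 (\<Union>\<A>)"
proof -
  have d: "disjoint_family_on (\<lambda>Q. Q) \<A>"
    using assms(2) by (auto simp: disjoint_family_on_def disjoint_def)
  have "emeasure M1 (\<Union>((\<lambda>Q. Q) ` \<A>)) = (\<integral>\<^sup>+Q. emeasure M1 Q \<partial>count_space \<A>)"
    by (rule emeasure_UN_countable) (use assms d in auto)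
  also have "\<dots> \<le> (\<integral>\<^sup>+Q. emeasure M2 Q \<partial>count_space \<A>)"
    by (intro nn_integral_mono) (simp add: le)
  also have "\<dots> = emeasure M2 (\<Union>((\<lambda>Q. Q) ` \<A>))"
    by (rule emeasure_UN_countable[symmetric]) (use assms d in auto)
  finally show ?thesis by simp
qed

lemma nn_set_integral_Union_mono:
  assumes "countable \<A>" "disjoint \<A>" "\<A> \<subseteq> sets M"
    and [measurable]: "f \<in> borel_measurable M" "g \<in> borel_measurable M"
    and le: "\<And>Q. Q \<in> \<A> \<Longrightarrow> (\<integral>\<^sup>+z\<in>Q. f z \<partial>M) \<le> (\<integral>\<^sup>+z\<in>Q. g z \<partial>M)"
  shows "(\<integral>\<^sup>+z\<in>\<Union>\<A>. f z \<partial>M) \<le> (\<integral>\<^sup>+z\<in>\<Union>\<A>. g z \<partial>M)"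
proof -
  have U: "\<Union>\<A> \<in> sets M" using assms(1,3) by (auto intro: sets.countable_Union)
  have "emeasure (density M f) (\<Union>\<A>) \<le> emeasure (density M g) (\<Union>\<A>)"
    by (rule emeasure_Union_mono) (use assms in \<open>auto simp: emeasure_density subset_iff\<close>)
  then show ?thesis using U by (simp add: emeasure_density)
qed

lemma ennreal_add3:
  assumes "a \<ge> 0" "b \<ge> 0" "c \<ge> 0"
  shows "3 * (ennreal a + ennreal b + ennreal c) = ennreal (3 * (a + b + c))"
proof -
  have "ennreal (3 * (a + b + c)) = ennreal 3 * ennreal (a + b + c)" by (rule ennreal_mult) (use assms in auto)
  also have "ennreal 3 = 3" by simp
  also have "ennreal (a + b + c) = ennreal a + ennreal b + ennreal c" using assms by (simp add: ennreal_plus)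
  finally show ?thesis by (rule sym)
qed

text \<open>Generations run over all integers, and a larger index means smaller cells.
  \<open>vol_unbounded\<close> makes the stopping conditions used below fail at coarse generations,
  \<open>doubling\<close> compares a cell with its parent, and \<open>small_cells\<close> lets cells
  exhaust open sets.\<close>

locale dyadic_grid =
  fixes cell :: "int \<Rightarrow> 'z::euclidean_space \<Rightarrow> 'z set" and vol :: "int \<Rightarrow> real" and D :: real
  assumes mem: "z \<in> cell n z"
    and cell_eq: "w \<in> cell n z \<Longrightarrow> cell n w = cell n z"
    and nest: "cell (n + 1) z \<subseteq> cell n z"
    and cell_sets: "cell n z \<in> sets borel"
    and emeasure_cell: "emeasure lborel (cell n z) = ennreal (vol n)"
    and vol_pos: "vol n > 0"
    and doubling: "vol n \<le> D * vol (n + 1)"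
    and vol_unbounded: "\<exists>n0. \<forall>n\<le>n0. vol n > M"
    and countable_cells: "countable (range (cell n))"
    and small_cells: "open U \<Longrightarrow> z \<in> U \<Longrightarrow> \<exists>n. cell n z \<subseteq> U"
begin

lemma nest_le: "n \<le> m \<Longrightarrow> cell m z \<subseteq> cell n z"
  by (induction m rule: int_ge_induct) (use nest in auto)

lemma cell_eq_le: assumes "w \<in> cell m z" "n \<le> m" shows "cell n w = cell n z"
  using assms nest_le[OF assms(2), of z] by (intro cell_eq) auto

text \<open>Calderon-Zygmund stopping cells. Distinct ones are disjoint because each point
  determines the first generation at which \<open>P\<close> holds for the cell around it.\<close>

definition maxcells :: "(int \<Rightarrow> 'z set \<Rightarrow> bool) \<Rightarrow> 'z set set" where
  "maxcells P = {Q. \<exists>n z. Q = cell n z \<and> P n (cell n z) \<and> (\<forall>m<n. \<not> P m (cell m z))}"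

lemma countable_maxcells: "countable (maxcells P)"
proof (rule countable_subset)
  show "maxcells P \<subseteq> (\<Union>n. range (cell n))" by (auto simp: maxcells_def)
qed (auto intro: countable_cells)

lemma maxcells_sets: "maxcells P \<subseteq> sets borel"
  by (auto simp: maxcells_def cell_sets)

lemma maxcellsD:
  assumes "Q \<in> maxcells P" "w \<in> Q"
  obtains n where "Q = cell n w" "P n (cell n w)" "\<And>m. m < n \<Longrightarrow> \<not> P m (cell m w)"
proof -
  obtain n z where *: "Q = cell n z" "P n (cell n z)" "\<forall>m<n. \<not> P m (cell m z)"
    using assms(1) unfolding maxcells_def by auto
  have "cell m w = cell m z" if "m \<le> n" for m
    using cell_eq_le[OF _ that] assms(2) * by simp
  then show ?thesis using * by (intro that[of n]) auto
qed

lemma disjoint_maxcells: "disjoint (maxcells P)"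
proof (rule disjointI)
  fix Q R assume QR: "Q \<in> maxcells P" "R \<in> maxcells P" "Q \<noteq> R"
  show "Q \<inter> R = {}"
  proof (rule ccontr)
    assume "Q \<inter> R \<noteq> {}"
    then obtain w where w: "w \<in> Q" "w \<in> R" by auto
    obtain n where n: "Q = cell n w" "P n (cell n w)" "\<And>m. m < n \<Longrightarrow> \<not> P m (cell m w)"
      by (rule maxcellsD[OF QR(1) w(1)]) (rule that, assumption+)
    obtain k where k: "R = cell k w" "P k (cell k w)" "\<And>m. m < k \<Longrightarrow> \<not> P m (cell m w)"
      by (rule maxcellsD[OF QR(2) w(2)]) (rule that, assumption+)
    have "n = k" using n(2,3) k(2,3) by (meson linorder_neqE)
    then show False using n(1) k(1) QR(3) by simp
  qed
qed

text \<open>\<open>bd\<close> gives the search over the integers a starting point: the first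
  successful generation is \<open>n0\<close> plus a least natural number.\<close>

lemma Union_maxcells:
  assumes bd: "\<And>n z. n \<le> n0 \<Longrightarrow> \<not> P n (cell n z)"
  shows "\<Union>(maxcells P) = {z. \<exists>n. P n (cell n z)}"
proof (intro equalityI subsetI)
  fix w assume "w \<in> \<Union>(maxcells P)"
  then obtain Q where Q: "Q \<in> maxcells P" "w \<in> Q" by auto
  from maxcellsD[OF this] show "w \<in> {z. \<exists>n. P n (cell n z)}" by auto
next
  fix w assume "w \<in> {z. \<exists>n. P n (cell n z)}"
  then obtain n where n: "P n (cell n w)" by auto
  have "n > n0" using bd[of n w] n by (rule_tac ccontr) auto
  then have ex: "P (n0 + int (nat (n - n0))) (cell (n0 + int (nat (n - n0))) w)" using n by simp
  define k where "k = (LEAST k. P (n0 + int k) (cell (n0 + int k) w))"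
  have k: "P (n0 + int k) (cell (n0 + int k) w)" unfolding k_def by (rule LeastI) (rule ex)
  have "\<not> P m (cell m w)" if m: "m < n0 + int k" for m
  proof (cases "m \<le> n0")
    case False
    then have "nat (m - n0) < k" using m by simp
    then have "\<not> P (n0 + int (nat (m - n0))) (cell (n0 + int (nat (m - n0))) w)"
      unfolding k_def by (rule not_less_Least)
    then show ?thesis using False by simp
  qed (rule bd)
  then have "cell (n0 + int k) w \<in> maxcells P" using k unfolding maxcells_def by auto
  then show "w \<in> \<Union>(maxcells P)" using mem by auto
qed

section \<open>Level sets of the dyadic maximal function\<close>

definition heavy :: "('z \<Rightarrow> ennreal) \<Rightarrow> real \<Rightarrow> int \<Rightarrow> 'z set \<Rightarrow> bool" where
  "heavy G s n Q \<longleftrightarrow> (\<integral>\<^sup>+z\<in>Q. G z \<partial>lborel) > ennreal (s * vol n)"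

text \<open>By \<open>\<Omega>_eq\<close> this is the set where the dyadic maximal function of
  \<open>G\<close> exceeds \<open>s\<close>; the definition keeps its decomposition into disjoint
  stopping cells.\<close>

definition \<Omega> :: "('z \<Rightarrow> ennreal) \<Rightarrow> real \<Rightarrow> 'z set" where
  "\<Omega> G s = \<Union>(maxcells (heavy G s))"

context
  fixes G :: "'z \<Rightarrow> ennreal"
  assumes Gm [measurable]: "G \<in> borel_measurable borel" and Gfin: "(\<integral>\<^sup>+z. G z \<partial>lborel) < \<infinity>"
begin

lemma heavy_bounded:
  assumes "s > 0" shows "\<exists>n0. \<forall>n z. n \<le> n0 \<longrightarrow> \<not> heavy G s n (cell n z)"
proof -
  obtain r where r: "r \<ge> 0" "(\<integral>\<^sup>+z. G z \<partial>lborel) = ennreal r"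
    using Gfin by (cases "\<integral>\<^sup>+z. G z \<partial>lborel") auto
  obtain n0 where n0: "\<And>n. n \<le> n0 \<Longrightarrow> vol n > r / s" using vol_unbounded by blast
  show ?thesis
  proof (intro exI[of _ n0] allI impI)
    fix n z assume "n \<le> n0"
    then have "r \<le> s * vol n" using n0[of n] assms by (simp add: field_simps)
    have "(\<integral>\<^sup>+z\<in>cell n z. G z \<partial>lborel) \<le> ennreal r"
      unfolding r(2)[symmetric] by (intro nn_integral_mono) (simp add: indicator_def)
    also have "\<dots> \<le> ennreal (s * vol n)" using \<open>r \<le> s * vol n\<close> by (rule ennreal_leI)
    finally show "\<not> heavy G s n (cell n z)" by (simp add: heavy_def)
  qed
qed

lemma \<Omega>_eq: assumes "s > 0" shows "\<Omega> G s = {z. \<exists>n. heavy G s n (cell n z)}"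
proof -
  obtain n0 where "\<And>n z. n \<le> n0 \<Longrightarrow> \<not> heavy G s n (cell n z)" using heavy_bounded[OF assms] by auto
  from Union_maxcells[of n0 "heavy G s", OF this] show ?thesis by (simp add: \<Omega>_def)
qed

lemma \<Omega>_sets [measurable]: "\<Omega> G s \<in> sets borel"
  unfolding \<Omega>_def using countable_maxcells maxcells_sets by (intro sets.countable_Union) auto

text \<open>The mean of \<open>G\<close> exceeds \<open>s\<close> on each stopping cell, and these
  cells are disjoint and countable in number.\<close>

lemma \<Omega>_weak: assumes "s > 0" shows "ennreal s * emeasure lborel (\<Omega> G s) \<le> (\<integral>\<^sup>+z\<in>\<Omega> G s. G z \<partial>lborel)"
proof -
  have "(\<integral>\<^sup>+z\<in>\<Omega> G s. ennreal s \<partial>lborel) \<le> (\<integral>\<^sup>+z\<in>\<Omega> G s. G z \<partial>lborel)"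
    unfolding \<Omega>_def
  proof (rule nn_set_integral_Union_mono[OF countable_maxcells disjoint_maxcells])
    fix Q assume "Q \<in> maxcells (heavy G s)"
    then obtain n z where Q: "Q = cell n z" "heavy G s n (cell n z)" unfolding maxcells_def by auto
    then show "(\<integral>\<^sup>+z\<in>Q. ennreal s \<partial>lborel) \<le> (\<integral>\<^sup>+z\<in>Q. G z \<partial>lborel)"
      using cell_sets[of n z] assms
      by (simp add: heavy_def nn_integral_cmult_indicator emeasure_cell ennreal_mult'[symmetric] less_imp_le)
  qed (use maxcells_sets in auto)
  then show ?thesis by (simp add: nn_integral_cmult_indicator)
qed

text \<open>Suppose \<open>G\<close> exceeds some \<open>t > s\<close> on a set \<open>E\<close>
  outside \<open>\<Omega> G s\<close>. Cover \<open>E\<close> by cells inside an open set exceeding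
  \<open>E\<close> in measure by less than \<open>\<delta>\<close>. Each of them that meets
  \<open>E\<close> has mean at most \<open>s\<close>, so \<open>t |E|\<close> is at most
  \<open>s (|E| + \<delta>)\<close>, and \<open>E\<close> is null.\<close>

lemma \<Omega>_differentiation:
  assumes s: "s > 0"
  shows "AE z in lborel. G z > ennreal s \<longrightarrow> z \<in> \<Omega> G s"
proof -
  have null: "emeasure lborel {z. G z > ennreal t \<and> z \<notin> \<Omega> G s} = 0" if t: "t > s" for t
  proof -
    define E where "E = {z. G z > ennreal t \<and> z \<notin> \<Omega> G s}"
    have Es[measurable]: "E \<in> sets borel" unfolding E_def by measurable
    have tE: "ennreal t * emeasure lborel E \<le> (\<integral>\<^sup>+z\<in>E. G z \<partial>lborel)"
    proof -
      have "ennreal t * emeasure lborel E = (\<integral>\<^sup>+z. ennreal t * indicator E z \<partial>lborel)"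
        by (simp add: nn_integral_cmult_indicator)
      also have "\<dots> \<le> (\<integral>\<^sup>+z\<in>E. G z \<partial>lborel)"
        by (intro nn_integral_mono) (auto simp: indicator_def E_def less_imp_le)
      finally show ?thesis .
    qed
    have GE: "(\<integral>\<^sup>+z\<in>E. G z \<partial>lborel) \<le> ennreal s * (emeasure lborel E + ennreal \<delta>)" if \<delta>: "\<delta> > 0" for \<delta>
    proof -
      have finE: "emeasure lborel E < \<infinity>"
      proof -
        have "(\<integral>\<^sup>+z\<in>E. G z \<partial>lborel) \<le> (\<integral>\<^sup>+z. G z \<partial>lborel)"
          by (intro nn_integral_mono) (simp add: indicator_def)
        then have "ennreal t * emeasure lborel E < \<infinity>" using tE Gfin by simp
        then show ?thesis using s t by (auto simp: ennreal_mult_less_top)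
      qed
      obtain U where U: "open U" "E \<subseteq> U" "emeasure lborel (U - E) < ennreal \<delta>"
        using outer_regular_lborel[OF Es \<delta>] by auto
      have UE: "emeasure lborel U \<le> emeasure lborel E + ennreal \<delta>"
      proof -
        have "emeasure lborel U = emeasure lborel E + emeasure lborel (U - E)"
          using U by (subst plus_emeasure) (auto simp: Un_absorb1)
        then show ?thesis using U(3) by (simp add: add_left_mono less_imp_le)
      qed
      then have finU: "emeasure lborel U < \<infinity>" using finE by (simp add: order.strict_trans1)
      define P where "P n Q \<longleftrightarrow> Q \<subseteq> U" for n :: int and Q :: "'z set"
      obtain r where r: "r \<ge> 0" "emeasure lborel U = ennreal r"
        using finU by (cases "emeasure lborel U") auto
      obtain n0 where n0: "\<And>n. n \<le> n0 \<Longrightarrow> vol n > r" using vol_unbounded by blast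
      have "\<not> P n (cell n z)" if "n \<le> n0" for n z
      proof
        assume "P n (cell n z)"
        then have "emeasure lborel (cell n z) \<le> emeasure lborel U"
          using U(1) by (intro emeasure_mono) (auto simp: P_def)
        then show False using n0[OF that] vol_pos[of n] r by (simp add: emeasure_cell)
      qed
      from Union_maxcells[of n0 P, OF this] have UU: "U \<subseteq> \<Union>(maxcells P)"
        using small_cells[OF U(1)] by (auto simp: P_def)
      \<comment> \<open>Only cells meeting \<open>E\<close> are kept: a point of \<open>E\<close>
        lies outside \<open>\<Omega> G s\<close>, so no cell containing it is heavy.\<close>
      define \<W> where "\<W> = {Q \<in> maxcells P. Q \<inter> E \<noteq> {}}"
      have W: "countable \<W>" "disjoint \<W>" "\<W> \<subseteq> sets borel"
        using countable_maxcells[of P] disjoint_maxcells[of P] maxcells_sets[of P]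
        by (auto simp: \<W>_def disjoint_def intro: countable_subset)
      have EW: "E \<subseteq> \<Union>\<W>" using UU U(2) by (fastforce simp: \<W>_def)
      have WU: "\<Union>\<W> \<subseteq> U" by (auto simp: \<W>_def maxcells_def P_def)
      have Wm: "\<Union>\<W> \<in> sets borel" using W by (intro sets.countable_Union) auto
      have "(\<integral>\<^sup>+z\<in>E. G z \<partial>lborel) \<le> (\<integral>\<^sup>+z\<in>\<Union>\<W>. G z \<partial>lborel)"
        using EW by (intro nn_integral_mono) (auto simp: indicator_def)
      also have "\<dots> \<le> (\<integral>\<^sup>+z\<in>\<Union>\<W>. ennreal s \<partial>lborel)"
      proof (rule nn_set_integral_Union_mono[OF W(1,2)])
        fix Q assume "Q \<in> \<W>"
        then obtain w where w: "Q \<in> maxcells P" "w \<in> Q" "w \<in> E" by (auto simp: \<W>_def)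
        obtain n where n: "Q = cell n w" using maxcellsD[OF w(1,2)] by blast
        have "\<not> heavy G s n (cell n w)" using w(3) by (auto simp: E_def \<Omega>_eq[OF s])
        then show "(\<integral>\<^sup>+z\<in>Q. G z \<partial>lborel) \<le> (\<integral>\<^sup>+z\<in>Q. ennreal s \<partial>lborel)"
          using cell_sets[of n w] s
          by (simp add: n heavy_def nn_integral_cmult_indicator emeasure_cell ennreal_mult'[symmetric] not_less)
      qed (use W in auto)
      also have "\<dots> = ennreal s * emeasure lborel (\<Union>\<W>)" using Wm by (simp add: nn_integral_cmult_indicator)
      also have "\<dots> \<le> ennreal s * emeasure lborel U"
        using WU U(1) by (intro mult_left_mono emeasure_mono) auto
      also have "\<dots> \<le> ennreal s * (emeasure lborel E + ennreal \<delta>)" by (intro mult_left_mono UE) simp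
      finally show ?thesis .
    qed
    have finE: "emeasure lborel E < \<infinity>"
    proof -
      have "(\<integral>\<^sup>+z\<in>E. G z \<partial>lborel) \<le> (\<integral>\<^sup>+z. G z \<partial>lborel)"
        by (intro nn_integral_mono) (simp add: indicator_def)
      then have "ennreal t * emeasure lborel E < \<infinity>" using tE Gfin by simp
      then show ?thesis using s t by (auto simp: ennreal_mult_less_top)
    qed
    obtain r where r: "r \<ge> 0" "emeasure lborel E = ennreal r" using finE by (cases "emeasure lborel E") auto
    have "t * r \<le> s * (r + \<delta>)" if \<delta>: "\<delta> > 0" for \<delta>
    proof -
      have "ennreal (t * r) \<le> ennreal (s * (r + \<delta>))"
        using order_trans[OF tE GE[OF \<delta>]] r s t \<delta> by (simp add: ennreal_mult' ennreal_plus)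
      moreover have "0 \<le> s * (r + \<delta>)" using r s \<delta> by simp
      ultimately show ?thesis by (simp add: ennreal_le_iff)
    qed
    then have "t * r \<le> s * r + e" if "e > 0" for e
    proof -
      have "t * r \<le> s * (r + e / s)" using that s by (intro \<open>\<And>\<delta>. \<delta> > 0 \<Longrightarrow> t * r \<le> s * (r + \<delta>)\<close>) simp
      also have "\<dots> = s * r + e" using s by (simp add: distrib_left)
      finally show ?thesis .
    qed
    then have "t * r \<le> s * r" by (rule field_le_epsilon)
    then have "r \<le> 0" using t by (simp add: mult_le_cancel_right)
    then show ?thesis using r unfolding E_def by simp
  qed
  \<comment> \<open>Countably many heights decreasing to \<open>s\<close> exhaust the points with
    \<open>G z > s\<close>.\<close>
  have "AE z in lborel. \<not> (G z > ennreal (s + inverse (real (Suc n))) \<and> z \<notin> \<Omega> G s)" for n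
    by (rule AE_I'[of "{z. G z > ennreal (s + inverse (real (Suc n))) \<and> z \<notin> \<Omega> G s}"])
       (auto simp: null_sets_def intro!: null)
  then have "AE z in lborel. \<forall>n. \<not> (G z > ennreal (s + inverse (real (Suc n))) \<and> z \<notin> \<Omega> G s)"
    by (subst AE_all_countable) (rule allI)
  then show ?thesis
  proof eventually_elim
    case (elim z)
    show ?case
    proof (intro impI, rule ccontr)
      assume G: "G z > ennreal s" and z: "z \<notin> \<Omega> G s"
      have "G z \<le> ennreal (s + inverse (real (Suc n)))" for n using elim[rule_format, of n] z by (simp add: not_less)
      moreover have "(\<lambda>n. ennreal (s + inverse (real (Suc n)))) \<longlonglongrightarrow> ennreal (s + 0)"
        by (intro tendsto_ennrealI tendsto_add tendsto_const LIMSEQ_inverse_real_of_nat)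
      ultimately have "G z \<le> ennreal (s + 0)" by (intro LIMSEQ_le_const) auto
      then show False using G by simp
    qed
  qed
qed

text \<open>The comparison is made in each stopping cell \<open>Q\<close> of height
  \<open>s\<close>. With \<open>E\<close> the part of \<open>Q\<close> inside
  \<open>\<Omega> G (\<Lambda> * s)\<close>, \<open>E_low\<close> and \<open>up\<close> bound
  \<open>\<Lambda> s |E|\<close> by \<open>3 (c |E| + \<eta> |Q| + H)\<close>, and \<open>cQ\<close>
  bounds \<open>c |Q|\<close> by \<open>3 ((D s + \<eta>) |Q| + H)\<close>. As \<open>|E|\<close> is
  at most \<open>|Q|\<close>, the terms with \<open>|E|\<close> total
  \<open>9 (D s + \<eta>) |E|\<close>, which by \<open>L\<close> is at most half of the left side
  and is absorbed; \<open>H\<close> is collected 3 + 9 = 12 times. The cells are then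
  summed.\<close>

lemma good_lambda:
  assumes s: "s > 0" and L: "18 * (\<eta> + D * s) \<le> \<Lambda> * s" and \<eta>: "\<eta> \<ge> 0" and \<Lambda>: "\<Lambda> \<ge> 1"
    and [measurable]: "h \<in> borel_measurable borel"
    and osc: "\<And>n z. \<exists>c g. g \<in> borel_measurable borel \<and>
       (\<forall>w\<in>cell n z. G w \<le> 3 * (c + g w + h w) \<and> c \<le> 3 * (G w + g w + h w)) \<and>
       (\<integral>\<^sup>+w\<in>cell n z. g w \<partial>lborel) \<le> ennreal (\<eta> * vol n)"
  shows "ennreal (\<Lambda> * s / 2) * emeasure lborel (\<Omega> G (\<Lambda> * s))
    \<le> ennreal (3 * \<eta>) * emeasure lborel (\<Omega> G s) + 12 * (\<integral>\<^sup>+z. h z \<partial>lborel)"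
proof -
  have \<Lambda>s: "\<Lambda> * s > 0" "s \<le> \<Lambda> * s" using s \<Lambda> by auto
  have D0: "D \<ge> 0" using doubling[of 0] vol_pos[of 0] vol_pos[of 1]
    by (metis add_0 less_eq_real_def linorder_not_le mult_neg_pos order_less_le_trans)
  have heavy_mono: "heavy G (\<Lambda> * s) n Q \<Longrightarrow> heavy G s n Q" for n Q
    using \<Lambda>s vol_pos[of n] unfolding heavy_def
    by (elim le_less_trans[rotated]) (intro ennreal_leI mult_right_mono, auto)
  have sub: "\<Omega> G (\<Lambda> * s) \<subseteq> \<Omega> G s"
    unfolding \<Omega>_eq[OF s] \<Omega>_eq[OF \<Lambda>s(1)] using heavy_mono by auto
  have local: "(\<integral>\<^sup>+z\<in>Q. ennreal (\<Lambda> * s / 2) * indicator (\<Omega> G (\<Lambda> * s)) z \<partial>lborel)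
      \<le> (\<integral>\<^sup>+z\<in>Q. ennreal (3 * \<eta>) + 12 * h z \<partial>lborel)"
    if Q: "Q \<in> maxcells (heavy G s)" for Q
  proof -
    obtain n z where Qn: "Q = cell n z" "heavy G s n (cell n z)" "\<And>m. m < n \<Longrightarrow> \<not> heavy G s m (cell m z)"
      using Q unfolding maxcells_def by auto
    have Qs[measurable]: "Q \<in> sets borel" by (simp add: Qn cell_sets)
    have Qe: "emeasure lborel Q = ennreal (vol n)" by (simp add: Qn emeasure_cell)
    define E where "E = \<Omega> G (\<Lambda> * s) \<inter> Q"
    have [measurable]: "E \<in> sets borel" unfolding E_def by measurable
    obtain c g where [measurable]: "g \<in> borel_measurable borel"
      and cg: "\<And>w. w \<in> Q \<Longrightarrow> G w \<le> 3 * (c + g w + h w)" "\<And>w. w \<in> Q \<Longrightarrow> c \<le> 3 * (G w + g w + h w)"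
      and gi: "(\<integral>\<^sup>+w\<in>Q. g w \<partial>lborel) \<le> ennreal (\<eta> * vol n)"
      using osc[of n z] unfolding Qn(1)[symmetric] by auto
    define H where "H = (\<integral>\<^sup>+w\<in>Q. h w \<partial>lborel)"
    have rhs: "(\<integral>\<^sup>+z\<in>Q. ennreal (3 * \<eta>) + 12 * h z \<partial>lborel) = ennreal (3 * \<eta> * vol n) + 12 * H"
    proof -
      have "(\<integral>\<^sup>+z\<in>Q. ennreal (3 * \<eta>) + 12 * h z \<partial>lborel)
        = (\<integral>\<^sup>+z. ennreal (3 * \<eta>) * indicator Q z + 12 * (h z * indicator Q z) \<partial>lborel)"
        by (intro nn_integral_cong) (simp add: distrib_right mult.assoc)
      also have "\<dots> = ennreal (3 * \<eta>) * emeasure lborel Q + 12 * H"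
        unfolding H_def by (subst nn_integral_add) (auto simp: nn_integral_cmult nn_integral_cmult_indicator)
      finally show ?thesis using \<eta> vol_pos[of n] by (simp add: Qe ennreal_mult')
    qed
    have lhs: "(\<integral>\<^sup>+z\<in>Q. ennreal (\<Lambda> * s / 2) * indicator (\<Omega> G (\<Lambda> * s)) z \<partial>lborel) = ennreal (\<Lambda> * s / 2) * emeasure lborel E"
    proof -
      have "(\<integral>\<^sup>+z\<in>Q. ennreal (\<Lambda> * s / 2) * indicator (\<Omega> G (\<Lambda> * s)) z \<partial>lborel) = (\<integral>\<^sup>+z. ennreal (\<Lambda> * s / 2) * indicator E z \<partial>lborel)"
        by (intro nn_integral_cong) (simp add: E_def indicator_def)
      then show ?thesis by (simp add: nn_integral_cmult_indicator)
    qed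
    have EQ: "emeasure lborel E \<le> emeasure lborel Q" unfolding E_def by (intro emeasure_mono) auto
    have E_low: "ennreal (\<Lambda> * s) * emeasure lborel E \<le> (\<integral>\<^sup>+w\<in>E. G w \<partial>lborel)"
    proof -
      define \<A> where "\<A> = {R \<in> maxcells (heavy G (\<Lambda> * s)). R \<inter> Q \<noteq> {}}"
      have A: "countable \<A>" "disjoint \<A>" "\<A> \<subseteq> sets borel"
        using countable_maxcells[of "heavy G (\<Lambda> * s)"] disjoint_maxcells[of "heavy G (\<Lambda> * s)"]
          maxcells_sets[of "heavy G (\<Lambda> * s)"]
        by (auto simp: \<A>_def disjoint_def intro: countable_subset)
      \<comment> \<open>A cell heavy at height \<open>\<Lambda> * s\<close> is heavy at height
        \<open>s\<close>, hence not coarser than the stopping cell around the same point.\<close>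
      have "R \<subseteq> Q" if R: "R \<in> \<A>" for R
      proof -
        obtain w where w: "w \<in> R" "w \<in> Q" "R \<in> maxcells (heavy G (\<Lambda> * s))" using R by (auto simp: \<A>_def)
        obtain k where k: "R = cell k w" "heavy G (\<Lambda> * s) k (cell k w)"
          by (rule maxcellsD[OF w(3,1)]) (rule that, assumption+)
        obtain n' where n': "Q = cell n' w" "\<And>m. m < n' \<Longrightarrow> \<not> heavy G s m (cell m w)"
          by (rule maxcellsD[OF Q w(2)]) (rule that, assumption+)
        have "n' \<le> k" using n'(2)[of k] heavy_mono[OF k(2)] by (rule_tac ccontr) auto
        then show ?thesis using nest_le[of n' k w] k n' by simp
      qed
      then have EA: "E = \<Union>\<A>" unfolding E_def \<Omega>_def by (auto simp: \<A>_def)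
      have "(\<integral>\<^sup>+w\<in>\<Union>\<A>. ennreal (\<Lambda> * s) \<partial>lborel) \<le> (\<integral>\<^sup>+w\<in>\<Union>\<A>. G w \<partial>lborel)"
      proof (rule nn_set_integral_Union_mono[OF A(1,2)])
        fix R assume "R \<in> \<A>"
        then obtain k w where R: "R = cell k w" "heavy G (\<Lambda> * s) k (cell k w)" unfolding \<A>_def maxcells_def by auto
        then show "(\<integral>\<^sup>+z\<in>R. ennreal (\<Lambda> * s) \<partial>lborel) \<le> (\<integral>\<^sup>+z\<in>R. G z \<partial>lborel)"
          using cell_sets[of k w] \<Lambda>s vol_pos[of k]
          by (simp add: heavy_def nn_integral_cmult_indicator emeasure_cell ennreal_mult''[symmetric] less_imp_le)
      qed (use A in auto)
      then show ?thesis unfolding EA[symmetric] by (simp add: nn_integral_cmult_indicator)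
    qed
    have up: "(\<integral>\<^sup>+w\<in>E. G w \<partial>lborel) \<le> 3 * (c * emeasure lborel E + ennreal (\<eta> * vol n) + H)"
    proof -
      have "(\<integral>\<^sup>+w\<in>E. G w \<partial>lborel)
        \<le> (\<integral>\<^sup>+w. 3 * (c * indicator E w + g w * indicator Q w + h w * indicator Q w) \<partial>lborel)"
      proof (intro nn_integral_mono)
        fix w
        have "G w \<le> 3 * (c + g w + h w)" if "w \<in> Q"
          using cg(1)[OF that] .
        then show "G w * indicator E w \<le> 3 * (c * indicator E w + g w * indicator Q w + h w * indicator Q w)"
          by (auto simp: indicator_def E_def)
      qed
      also have "\<dots> = 3 * (c * emeasure lborel E + (\<integral>\<^sup>+w\<in>Q. g w \<partial>lborel) + H)"
        unfolding H_def by (simp add: nn_integral_cmult nn_integral_add nn_integral_cmult_indicator)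
      also have "\<dots> \<le> 3 * (c * emeasure lborel E + ennreal (\<eta> * vol n) + H)"
        by (intro mult_left_mono add_mono gi order_refl) simp
      finally show ?thesis .
    qed
    \<comment> \<open>The parent of \<open>Q\<close> is not heavy, and \<open>doubling\<close>
      passes its bound on to \<open>Q\<close> at the price of \<open>D\<close>.\<close>
    have FQ: "(\<integral>\<^sup>+w\<in>Q. G w \<partial>lborel) \<le> ennreal (D * s * vol n)"
    proof -
      have "(\<integral>\<^sup>+w\<in>Q. G w \<partial>lborel) \<le> (\<integral>\<^sup>+w\<in>cell (n - 1) z. G w \<partial>lborel)"
        using nest[of "n - 1" z] by (intro nn_integral_mono) (auto simp: indicator_def Qn)
      also have "\<dots> \<le> ennreal (s * vol (n - 1))" using Qn(3)[of "n - 1"] by (simp add: heavy_def not_less)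
      also have "\<dots> \<le> ennreal (s * (D * vol n))" using s doubling[of "n - 1"] by (intro ennreal_leI mult_left_mono) auto
      finally show ?thesis by (simp add: mult_ac)
    qed
    have cQ: "c * emeasure lborel Q \<le> 3 * (ennreal (D * s * vol n) + ennreal (\<eta> * vol n) + H)"
    proof -
      have "c * emeasure lborel Q = (\<integral>\<^sup>+w. c * indicator Q w \<partial>lborel)" by (simp add: nn_integral_cmult_indicator)
      also have "\<dots> \<le> (\<integral>\<^sup>+w. 3 * (G w * indicator Q w + g w * indicator Q w + h w * indicator Q w) \<partial>lborel)"
      proof (intro nn_integral_mono)
        fix w
        have "c \<le> 3 * (G w + g w + h w)" if "w \<in> Q"
          using cg(2)[OF that] .
        then show "c * indicator Q w \<le> 3 * (G w * indicator Q w + g w * indicator Q w + h w * indicator Q w)"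
          by (auto simp: indicator_def)
      qed
      also have "\<dots> = 3 * ((\<integral>\<^sup>+w\<in>Q. G w \<partial>lborel) + (\<integral>\<^sup>+w\<in>Q. g w \<partial>lborel) + H)"
        unfolding H_def by (simp add: nn_integral_cmult nn_integral_add)
      also have "\<dots> \<le> 3 * (ennreal (D * s * vol n) + ennreal (\<eta> * vol n) + H)"
        by (intro mult_left_mono add_mono gi FQ order_refl) simp
      finally show ?thesis .
    qed
    show ?thesis unfolding lhs rhs
    proof (cases "H = \<infinity>")
      case True then show "ennreal (\<Lambda> * s / 2) * emeasure lborel E \<le> ennreal (3 * \<eta> * vol n) + 12 * H" by (simp add: ennreal_mult_top)
    next
      case False
      then obtain H' where H': "H = ennreal H'" "H' \<ge> 0" by (cases H) auto
      note v = vol_pos[of n]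
      obtain e where e: "emeasure lborel E = ennreal e" "e \<ge> 0"
        using EQ unfolding Qe by (cases "emeasure lborel E") (auto simp: top_unique)
      have ev: "e \<le> vol n" using EQ v e by (simp add: Qe)
      have R: "3 * (ennreal (D * s * vol n) + ennreal (\<eta> * vol n) + H) = ennreal (3 * (D * s * vol n + \<eta> * vol n + H'))"
        unfolding H'(1) using D0 s \<eta> v H' by (intro ennreal_add3) auto
      \<comment> \<open>\<open>c\<close> is an extended number; \<open>cQ\<close> with finite
        \<open>H\<close> and the positive volume of \<open>Q\<close> force it to be finite.\<close>
      have "c \<noteq> \<infinity>" using cQ v unfolding Qe R by (auto simp: ennreal_top_mult top_unique)
      then obtain b where b: "c = ennreal b" "b \<ge> 0" by (cases "c") auto
      have bv: "b * vol n \<le> 3 * (D * s * vol n + \<eta> * vol n + H')"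
      proof -
        have "ennreal (b * vol n) \<le> ennreal (3 * (D * s * vol n + \<eta> * vol n + H'))"
          using cQ unfolding Qe R b(1) using b v by (simp add: ennreal_mult')
        moreover have "0 \<le> 3 * (D * s * vol n + \<eta> * vol n + H')" using D0 s \<eta> v H' by simp
        ultimately show ?thesis by (simp add: ennreal_le_iff del: ennreal_plus)
      qed
      have be: "b * e \<le> 3 * ((D * s + \<eta>) * e + H')"
      proof -
        have "(b * vol n) * (e / vol n) \<le> 3 * (D * s * vol n + \<eta> * vol n + H') * (e / vol n)"
          using bv v e by (intro mult_right_mono) auto
        then have "b * e \<le> 3 * ((D * s + \<eta>) * e + H' * (e / vol n))" using v by (simp add: field_simps)
        moreover have "H' * (e / vol n) \<le> H' * 1" using H' ev v by (intro mult_left_mono) auto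
        ultimately show ?thesis by simp
      qed
      have "ennreal (\<Lambda> * s) * emeasure lborel E \<le> 3 * (c * emeasure lborel E + ennreal (\<eta> * vol n) + H)"
        using order_trans[OF E_low up] .
      also have "\<dots> = ennreal (3 * (b * e + \<eta> * vol n + H'))"
        unfolding H'(1) b(1) e(1) ennreal_mult'[OF b(2), symmetric] using b e \<eta> v H' by (intro ennreal_add3) auto
      finally have "ennreal (\<Lambda> * s * e) \<le> ennreal (3 * (b * e + \<eta> * vol n + H'))"
        using \<Lambda>s e by (simp add: ennreal_mult')
      moreover have "0 \<le> 3 * (b * e + \<eta> * vol n + H')" using b e \<eta> v H' by simp
      ultimately have "\<Lambda> * s * e \<le> 3 * (b * e + \<eta> * vol n + H')" by (simp add: ennreal_le_iff del: ennreal_plus)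
      also have "\<dots> \<le> 9 * ((\<eta> + D * s) * e) + 3 * \<eta> * vol n + 12 * H'" using be by (simp add: algebra_simps)
      also have "9 * ((\<eta> + D * s) * e) \<le> \<Lambda> * s / 2 * e" using mult_right_mono[OF L e(2)] by (simp add: algebra_simps)
      finally have "\<Lambda> * s / 2 * e \<le> 3 * \<eta> * vol n + 12 * H'" by simp
      then have "ennreal (\<Lambda> * s / 2 * e) \<le> ennreal (3 * \<eta> * vol n + 12 * H')" by (rule ennreal_leI)
      also have "ennreal (\<Lambda> * s / 2 * e) = ennreal (\<Lambda> * s / 2) * emeasure lborel E"
        unfolding e(1) using \<Lambda>s e by (intro ennreal_mult) auto
      finally show "ennreal (\<Lambda> * s / 2) * emeasure lborel E \<le> ennreal (3 * \<eta> * vol n) + 12 * H"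
        using H' \<eta> v by (simp add: ennreal_mult' ennreal_plus)
    qed
  qed
  have "(\<integral>\<^sup>+z\<in>\<Omega> G s. ennreal (\<Lambda> * s / 2) * indicator (\<Omega> G (\<Lambda> * s)) z \<partial>lborel)
      \<le> (\<integral>\<^sup>+z\<in>\<Omega> G s. ennreal (3 * \<eta>) + 12 * h z \<partial>lborel)"
    unfolding \<Omega>_def[of G s]
    by (rule nn_set_integral_Union_mono[OF countable_maxcells disjoint_maxcells])
       (use maxcells_sets local in auto)
  moreover have "(\<integral>\<^sup>+z\<in>\<Omega> G s. ennreal (\<Lambda> * s / 2) * indicator (\<Omega> G (\<Lambda> * s)) z \<partial>lborel)
      = ennreal (\<Lambda> * s / 2) * emeasure lborel (\<Omega> G (\<Lambda> * s))"
  proof -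
    have "(\<integral>\<^sup>+z\<in>\<Omega> G s. ennreal (\<Lambda> * s / 2) * indicator (\<Omega> G (\<Lambda> * s)) z \<partial>lborel)
      = (\<integral>\<^sup>+z. ennreal (\<Lambda> * s / 2) * indicator (\<Omega> G (\<Lambda> * s)) z \<partial>lborel)"
      using sub by (intro nn_integral_cong) (auto simp: indicator_def)
    then show ?thesis by (simp add: nn_integral_cmult_indicator)
  qed
  moreover have "(\<integral>\<^sup>+z\<in>\<Omega> G s. ennreal (3 * \<eta>) + 12 * h z \<partial>lborel)
      \<le> (\<integral>\<^sup>+z. ennreal (3 * \<eta>) * indicator (\<Omega> G s) z + 12 * h z \<partial>lborel)"
    by (intro nn_integral_mono) (auto simp: indicator_def)
  moreover have "\<dots> = ennreal (3 * \<eta>) * emeasure lborel (\<Omega> G s) + 12 * (\<integral>\<^sup>+z. h z \<partial>lborel)"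
    by (subst nn_integral_add) (auto simp: nn_integral_cmult nn_integral_cmult_indicator)
  ultimately show ?thesis by simp
qed

end

end

section \<open>From level sets to \<open>L\<^sub>p\<close> norms\<close>

lemma epowr_ennreal: "r \<ge> 0 \<Longrightarrow> epowr (ennreal r) a = ennreal (r powr a)"
  by (simp add: epowr_def)

lemma epowr_measurable [measurable]:
  assumes [measurable]: "f \<in> borel_measurable M" shows "(\<lambda>x. epowr (f x) a) \<in> borel_measurable M"
  unfolding epowr_def by measurable

text \<open>Half of the sum is absorbed on the left. The induction needs the stronger claim with one
  more copy of the last term.\<close>

lemma sum_halving_le:
  fixes a b :: "nat \<Rightarrow> real"
  assumes "\<And>j. a (Suc j) \<le> a j / 2 + b j" "\<And>j. a j \<ge> 0"
  shows "(\<Sum>j\<le>m. a j) \<le> 2 * a 0 + 2 * (\<Sum>j<m. b j)"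
proof -
  have "(\<Sum>j\<le>m. a j) + a m \<le> 2 * a 0 + 2 * (\<Sum>j<m. b j)"
  proof (induction m)
    case (Suc m) then show ?case using assms(1)[of m] by simp
  qed simp
  then show ?thesis using assms(2)[of m] by simp
qed

text \<open>A finite geometric sum with ratio \<open>r\<close> is at most \<open>r / (r - 1)\<close>
  times its largest term, and the largest term kept is below \<open>x\<close>.\<close>

lemma sum_geometric_below:
  fixes l r x :: real
  assumes l: "l > 0" and r: "r > 1" and x: "x \<ge> 0"
  shows "(\<Sum>j<m. if l * r ^ j < x then l * r ^ j else 0) \<le> x * (r / (r - 1))"
proof (induction m)
  case 0 then show ?case using r x by simp
next
  case (Suc m)
  show ?case
  proof (cases "l * r ^ m < x")
    case False then show ?thesis using Suc by simp
  next
    case True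
    have "(\<Sum>j<Suc m. if l * r ^ j < x then l * r ^ j else 0) \<le> (\<Sum>j<Suc m. l * r ^ j)"
      using l r by (intro sum_mono) auto
    also have "\<dots> = l * ((r ^ Suc m - 1) / (r - 1))"
      using r by (subst sum_distrib_left[symmetric], subst geometric_sum) auto
    also have "\<dots> \<le> l * (r ^ Suc m / (r - 1))" using l r by (intro mult_left_mono divide_right_mono) auto
    also have "\<dots> = l * r ^ m * (r / (r - 1))" by simp
    also have "\<dots> \<le> x * (r / (r - 1))" using True r by (intro mult_right_mono) auto
    finally show ?thesis .
  qed
qed

context dyadic_grid
begin

text \<open>\<open>F\<close> stands for the square function and \<open>\<phi>\<close> for the norm
  of \<open>f\<close>. At each height \<open>l\<close> a single error \<open>h\<close> serves all
  cells and is paid for by the part of \<open>\<phi>\<close> above \<open>l\<close>, with the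
  \<open>L\<^sub>2\<close> constant \<open>B\<close>. The centre \<open>c\<close> and the error
  \<open>g\<close> depend on the cell and come from the part of \<open>f\<close> bounded by
  \<open>l\<close>. The factors 3 are those of squaring a sum of three terms.\<close>

definition oscillation_bound :: "real \<Rightarrow> real \<Rightarrow> ('z \<Rightarrow> ennreal) \<Rightarrow> ('z \<Rightarrow> real) \<Rightarrow> bool" where
  "oscillation_bound B N F \<phi> \<longleftrightarrow> (\<forall>l>0. \<exists>h. h \<in> borel_measurable borel \<and>
      (\<integral>\<^sup>+z. h z \<partial>lborel) \<le> ennreal B * (\<integral>\<^sup>+z\<in>{z. \<phi> z > l}. ennreal ((\<phi> z)\<^sup>2) \<partial>lborel) \<and>
      (\<forall>n z. \<exists>c g. g \<in> borel_measurable borel \<and>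
         (\<forall>w\<in>cell n z. (F w)\<^sup>2 \<le> 3 * (c + g w + h w) \<and> c \<le> 3 * ((F w)\<^sup>2 + g w + h w)) \<and>
         (\<integral>\<^sup>+w\<in>cell n z. g w \<partial>lborel) \<le> ennreal (N * l\<^sup>2 * vol n)))"

text \<open>\<open>good_lambda\<close> is applied to \<open>F\<^sup>2\<close> at the heights
  \<open>(l j)\<^sup>2\<close>, with the oscillation taken at the lower height
  \<open>\<epsilon> * l j\<close>. With \<open>a j\<close> denoting \<open>l j powr p\<close> times
  the measure of the level set, it bounds \<open>a (Suc j)\<close> by half of \<open>a j\<close>
  plus an error. The errors sum to a multiple of the integral of \<open>\<phi> powr p\<close>,
  because the heights are geometric and \<open>q = p - 2\<close> is positive.\<close>

lemma dyadic_Lp_bound: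
  assumes p: "p > 2" and B: "B \<ge> 0" and N: "N \<ge> 0"
  shows "\<exists>K\<ge>0. \<forall>F \<phi>. F \<in> borel_measurable borel \<longrightarrow> \<phi> \<in> borel_measurable borel \<longrightarrow> (\<forall>z. \<phi> z \<ge> 0) \<longrightarrow>
     (\<integral>\<^sup>+z. (F z)\<^sup>2 \<partial>lborel) < \<infinity> \<longrightarrow> oscillation_bound B N F \<phi> \<longrightarrow>
     (\<integral>\<^sup>+z. epowr (F z) p \<partial>lborel) \<le> ennreal K * (\<integral>\<^sup>+z. ennreal (\<phi> z powr p) \<partial>lborel)"
proof -
  define q where "q = p - 2"
  have q: "q > 0" using p by (simp add: q_def)
  have D0: "D \<ge> 0" using doubling[of 0] vol_pos[of 0] vol_pos[of 1]
    by (metis add_0 less_eq_real_def linorder_not_le mult_neg_pos order_less_le_trans)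
  \<comment> \<open>18 (N + D) is what \<open>good_lambda\<close> asks for when
    \<open>\<epsilon> \<le> 1\<close>; the added 4 makes the ratio \<open>L\<close> of consecutive
    heights at least 2.\<close>
  define \<Lambda> where "\<Lambda> = 18 * (N + D) + 4"
  have \<Lambda>: "\<Lambda> \<ge> 4" using N D0 by (simp add: \<Lambda>_def)
  define L where "L = sqrt \<Lambda>"
  have L: "L \<ge> 2" using real_sqrt_le_mono[OF \<Lambda>] by (simp add: L_def)
  have L2: "L\<^sup>2 = \<Lambda>" using \<Lambda> by (simp add: L_def)
  \<comment> \<open>Chosen so that \<open>6 * N * e2 * L powr q\<close>, which becomes the
    coefficient of \<open>a j\<close> in \<open>step\<close>, is at most 1/2.\<close>
  define e2 where "e2 = 1 / (12 * N * L powr q + 1)"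
  have e2: "e2 > 0" "e2 \<le> 1" "6 * N * e2 * L powr q \<le> 1 / 2"
  proof -
    have "12 * N * L powr q \<ge> 0" using N by simp
    then show "e2 > 0" "e2 \<le> 1" "6 * N * e2 * L powr q \<le> 1 / 2" by (auto simp: e2_def field_simps)
  qed
  define \<epsilon> where "\<epsilon> = sqrt e2"
  have \<epsilon>: "\<epsilon> > 0" "\<epsilon>\<^sup>2 = e2" using e2 by (auto simp: \<epsilon>_def)
  define r where "r = L powr q"
  have r: "r > 1" using L q by (simp add: r_def)
  define C1 where "C1 = 24 * B * L powr q"
  define C2 where "C2 = 2 * C1 * (r / (r - 1)) * \<epsilon> powr (- q)"
  have C: "C1 \<ge> 0" "C2 \<ge> 0" using B r by (auto simp: C1_def C2_def)
  define K where "K = L powr p * C2 + 1"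
  have K: "K > 0" using C by (simp add: K_def add_nonneg_pos)
  have main: "(\<integral>\<^sup>+z. epowr (F z) p \<partial>lborel) \<le> ennreal K * (\<integral>\<^sup>+z. ennreal (\<phi> z powr p) \<partial>lborel)"
    if [measurable]: "F \<in> borel_measurable borel" "\<phi> \<in> borel_measurable borel" and \<phi>0: "\<And>z. \<phi> z \<ge> 0"
      and F2: "(\<integral>\<^sup>+z. (F z)\<^sup>2 \<partial>lborel) < \<infinity>" and osc: "oscillation_bound B N F \<phi>" for F \<phi>
  proof (cases "(\<integral>\<^sup>+z. ennreal (\<phi> z powr p) \<partial>lborel) = \<infinity>")
    case True then show ?thesis using K by (simp add: ennreal_mult_top)
  next
    case False
    then obtain \<Phi> where \<Phi>: "(\<integral>\<^sup>+z. ennreal (\<phi> z powr p) \<partial>lborel) = ennreal \<Phi>" "\<Phi> \<ge> 0"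
      by (cases "\<integral>\<^sup>+z. ennreal (\<phi> z powr p) \<partial>lborel") auto
    obtain J where J: "(\<integral>\<^sup>+z. (F z)\<^sup>2 \<partial>lborel) = ennreal J" "J \<ge> 0"
      using F2 by (cases "\<integral>\<^sup>+z. (F z)\<^sup>2 \<partial>lborel") auto
    define G where "G z = (F z)\<^sup>2" for z
    have [measurable]: "G \<in> borel_measurable borel" unfolding G_def by measurable
    have Gfin: "(\<integral>\<^sup>+z. G z \<partial>lborel) < \<infinity>" using F2 by (simp add: G_def)
    \<comment> \<open>A positive lowest height \<open>l0\<close> gives the recursion a finite start:
      by the weak type bound \<open>a 0\<close> is at most \<open>l0 powr q * J\<close>. It is sent
      to 0 afterwards.\<close>
    have tail: "(\<integral>\<^sup>+z\<in>{z. F z > ennreal l0}. epowr (F z) p \<partial>lborel) \<le> ennreal (L powr p * (2 * (l0 powr q * J) + C2 * \<Phi>))"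
      if l0: "l0 > 0" for l0
    proof -
      define l where "l j = l0 * L ^ j" for j
      have l: "l j > 0" for j using l0 L by (simp add: l_def)
      have lS: "l (Suc j) = L * l j" for j by (simp add: l_def)
      have lS2: "(l (Suc j))\<^sup>2 = \<Lambda> * (l j)\<^sup>2" for j by (simp add: lS power_mult_distrib L2)
      have weak: "ennreal ((l j)\<^sup>2) * emeasure lborel (\<Omega> G ((l j)\<^sup>2)) \<le> ennreal J" for j
      proof -
        have "(\<integral>\<^sup>+z\<in>\<Omega> G ((l j)\<^sup>2). G z \<partial>lborel) \<le> (\<integral>\<^sup>+z. G z \<partial>lborel)"
          by (intro nn_integral_mono) (simp add: indicator_def)
        then show ?thesis using order_trans[OF \<Omega>_weak[of G "(l j)\<^sup>2"]] Gfin l[of j] J by (simp add: G_def)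
      qed
      have fin: "emeasure lborel (\<Omega> G ((l j)\<^sup>2)) \<noteq> \<infinity>" for j
        using weak[of j] l[of j] by (auto simp: ennreal_mult_top top_unique)
      define w where "w j = measure lborel (\<Omega> G ((l j)\<^sup>2))" for j
      have w: "emeasure lborel (\<Omega> G ((l j)\<^sup>2)) = ennreal (w j)" "w j \<ge> 0" for j
        using fin[of j] by (auto simp: w_def emeasure_eq_ennreal_measure)
      define I where "I j = (\<integral>\<^sup>+z\<in>{z. \<phi> z > \<epsilon> * l j}. ennreal ((\<phi> z)\<^sup>2) \<partial>lborel)" for j
      have lq: "(l j) powr q = l0 powr q * r ^ j" for j
        using l0 L by (simp add: l_def r_def powr_mult powr_power powr_realpow[symmetric] powr_powr mult.commute)
      \<comment> \<open>At a fixed \<open>z\<close> only the heights below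
        \<open>\<phi> z / \<epsilon>\<close> contribute, and the powers \<open>l j powr q\<close>
        form a geometric sum dominated by its last term, of order
        \<open>\<phi> z powr q\<close>.\<close>
      have sumI: "(\<Sum>j<m. ennreal ((l j) powr q) * I j) \<le> ennreal ((r / (r - 1)) * \<epsilon> powr (- q) * \<Phi>)" for m
      proof -
        have "(\<Sum>j<m. ennreal ((l j) powr q) * I j)
            = (\<integral>\<^sup>+z. (\<Sum>j<m. ennreal ((l j) powr q) * (ennreal ((\<phi> z)\<^sup>2) * indicator {z. \<phi> z > \<epsilon> * l j} z)) \<partial>lborel)"
          unfolding I_def by (subst nn_integral_sum) (auto simp: nn_integral_cmult)
        also have "\<dots> \<le> (\<integral>\<^sup>+z. ennreal ((r / (r - 1)) * \<epsilon> powr (- q)) * ennreal (\<phi> z powr p) \<partial>lborel)"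
        proof (rule nn_integral_mono)
          fix z
          define x where "x = (\<phi> z / \<epsilon>) powr q"
          have iff: "\<phi> z > \<epsilon> * l j \<longleftrightarrow> l0 powr q * r ^ j < x" for j
          proof -
            have "\<phi> z > \<epsilon> * l j \<longleftrightarrow> l j < \<phi> z / \<epsilon>" using \<epsilon> by (simp add: field_simps)
            also have "\<dots> \<longleftrightarrow> (l j) powr q < (\<phi> z / \<epsilon>) powr q"
              using q l[of j] \<phi>0[of z] \<epsilon> powr_less_mono2[of q "l j" "\<phi> z / \<epsilon>"] powr_mono2[of q "\<phi> z / \<epsilon>" "l j"]
              by (cases "l j < \<phi> z / \<epsilon>") auto
            finally show ?thesis by (simp add: lq x_def)
          qed
          have "(\<Sum>j<m. ennreal ((l j) powr q) * (ennreal ((\<phi> z)\<^sup>2) * indicator {z. \<phi> z > \<epsilon> * l j} z))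
             = (\<Sum>j<m. ennreal ((if l0 powr q * r ^ j < x then l0 powr q * r ^ j else 0) * (\<phi> z)\<^sup>2))"
            by (intro sum.cong refl) (use r in \<open>auto simp: iff lq indicator_def ennreal_mult'\<close>)
          also have "\<dots> = ennreal ((\<Sum>j<m. if l0 powr q * r ^ j < x then l0 powr q * r ^ j else 0) * (\<phi> z)\<^sup>2)"
            using r by (subst sum_ennreal) (auto simp: sum_distrib_right)
          also have "\<dots> \<le> ennreal (x * (r / (r - 1)) * (\<phi> z)\<^sup>2)"
            using l0 r by (intro ennreal_leI mult_right_mono sum_geometric_below) (auto simp: x_def)
          also have "x * (r / (r - 1)) * (\<phi> z)\<^sup>2 = (r / (r - 1)) * \<epsilon> powr (- q) * (\<phi> z powr p)"
          proof (cases "\<phi> z = 0")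
            case False
            then have "\<phi> z > 0" using \<phi>0[of z] by simp
            then have "\<phi> z powr p = \<phi> z powr q * (\<phi> z)\<^sup>2"
              by (simp add: q_def powr_diff powr_numeral)
            then show ?thesis using \<epsilon> \<phi>0[of z] by (simp add: x_def powr_divide powr_minus field_simps)
          qed (use p in auto)
          also have "ennreal \<dots> = ennreal ((r / (r - 1)) * \<epsilon> powr (- q)) * ennreal (\<phi> z powr p)"
            using r by (intro ennreal_mult) auto
          finally show "(\<Sum>j<m. ennreal ((l j) powr q) * (ennreal ((\<phi> z)\<^sup>2) * indicator {z. \<phi> z > \<epsilon> * l j} z))
            \<le> ennreal ((r / (r - 1)) * \<epsilon> powr (- q)) * ennreal (\<phi> z powr p)" .
        qed
        also have "\<dots> = ennreal ((r / (r - 1)) * \<epsilon> powr (- q) * \<Phi>)"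
        proof (subst nn_integral_cmult)
          show "ennreal ((r / (r - 1)) * \<epsilon> powr (- q)) * (\<integral>\<^sup>+z. ennreal (\<phi> z powr p) \<partial>lborel)
            = ennreal ((r / (r - 1)) * \<epsilon> powr (- q) * \<Phi>)"
            unfolding \<Phi>(1) using r \<Phi>(2) by (intro ennreal_mult[symmetric]) auto
        qed simp
        finally show ?thesis .
      qed
      have Ifin: "I j \<noteq> \<infinity>" for j
      proof
        assume "I j = \<infinity>"
        then have eq: "(\<Sum>i<Suc j. ennreal ((l i) powr q) * I i) = \<infinity>" using l[of j] by (simp add: ennreal_mult_top)
        have "\<infinity> \<le> ennreal ((r / (r - 1)) * \<epsilon> powr (- q) * \<Phi>)" using sumI[of "Suc j"] unfolding eq .
        then show False by (simp add: top_unique)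
      qed
      define I' where "I' j = enn2real (I j)" for j
      have I': "I j = ennreal (I' j)" "I' j \<ge> 0" for j using Ifin[of j] by (auto simp: I'_def ennreal_enn2real_if)
      define a where "a j = (l j) powr p * w j" for j
      have a0: "a j \<ge> 0" for j using w by (simp add: a_def)
      have step: "a (Suc j) \<le> a j / 2 + C1 * ((l j) powr q * I' j)" for j
      proof -
        have "\<epsilon> * l j > 0" using \<epsilon> l by simp
        then obtain h where h: "h \<in> borel_measurable borel"
          "(\<integral>\<^sup>+z. h z \<partial>lborel) \<le> ennreal B * I j"
          "\<And>n z. \<exists>c g. g \<in> borel_measurable borel \<and>
            (\<forall>v\<in>cell n z. G v \<le> 3 * (c + g v + h v) \<and> c \<le> 3 * (G v + g v + h v)) \<and>
            (\<integral>\<^sup>+v\<in>cell n z. g v \<partial>lborel) \<le> ennreal (N * (\<epsilon> * l j)\<^sup>2 * vol n)"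
          using osc unfolding oscillation_bound_def I_def G_def by meson
        define s where "s = (l j)\<^sup>2"
        have s: "s > 0" using l[of j] by (simp add: s_def)
        have hi: "18 * (N * (\<epsilon> * l j)\<^sup>2 + D * s) \<le> \<Lambda> * s"
        proof -
          have "N * (\<epsilon> * l j)\<^sup>2 = N * e2 * s" by (simp add: power_mult_distrib \<epsilon> s_def)
          also have "\<dots> \<le> N * 1 * s" using N e2 s by (intro mult_right_mono mult_left_mono) auto
          finally show ?thesis using s by (simp add: \<Lambda>_def algebra_simps)
        qed
        have "ennreal (\<Lambda> * s / 2) * emeasure lborel (\<Omega> G (\<Lambda> * s))
           \<le> ennreal (3 * (N * (\<epsilon> * l j)\<^sup>2)) * emeasure lborel (\<Omega> G s) + 12 * (\<integral>\<^sup>+z. h z \<partial>lborel)"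
          by (rule good_lambda[OF _ Gfin s hi _ _ h(1,3)]) (use N \<Lambda> in auto)
        also have "\<dots> \<le> ennreal (3 * (N * (\<epsilon> * l j)\<^sup>2)) * emeasure lborel (\<Omega> G s) + 12 * (ennreal B * I j)"
          by (intro add_left_mono mult_left_mono h(2)) simp
        also have "12 * (ennreal B * I j) = ennreal (12 * (B * I' j))"
        proof -
          have "ennreal (12 * (B * I' j)) = ennreal 12 * ennreal (B * I' j)" using B I' by (intro ennreal_mult) auto
          then show ?thesis using B by (simp add: I' ennreal_mult')
        qed
        finally have fin: "ennreal (\<Lambda> * s / 2) * emeasure lborel (\<Omega> G (\<Lambda> * s))
           \<le> ennreal (3 * (N * (\<epsilon> * l j)\<^sup>2)) * emeasure lborel (\<Omega> G s) + ennreal (12 * (B * I' j))" .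
        have "ennreal (\<Lambda> * s / 2 * w (Suc j)) = ennreal (\<Lambda> * s / 2) * emeasure lborel (\<Omega> G (\<Lambda> * s))"
          unfolding s_def lS2[symmetric] w(1) using w(2) by (intro ennreal_mult) auto
        also note fin
        also have "ennreal (3 * (N * (\<epsilon> * l j)\<^sup>2)) * emeasure lborel (\<Omega> G s) + ennreal (12 * (B * I' j))
            = ennreal (3 * (N * (\<epsilon> * l j)\<^sup>2) * w j + 12 * (B * I' j))"
          unfolding s_def w(1) using N B I'(2)[of j] w(2)[of j]
          by (subst ennreal_plus) (auto intro!: arg_cong2[where f = "(+)"] ennreal_mult[symmetric])
        finally have "ennreal (\<Lambda> * s / 2 * w (Suc j)) \<le> ennreal (3 * (N * (\<epsilon> * l j)\<^sup>2) * w j + 12 * (B * I' j))" .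
        moreover have "0 \<le> 3 * (N * (\<epsilon> * l j)\<^sup>2) * w j + 12 * (B * I' j)" using N B I'(2)[of j] w(2)[of j] by simp
        ultimately have le: "\<Lambda> * s / 2 * w (Suc j) \<le> 3 * (N * (\<epsilon> * l j)\<^sup>2) * w j + 12 * (B * I' j)"
          by (simp add: ennreal_le_iff del: ennreal_plus)
        \<comment> \<open>This factor turns \<open>\<Lambda> * s / 2 * w (Suc j)\<close> into
          \<open>a (Suc j)\<close>, since \<open>l (Suc j) = L * l j\<close> and
          \<open>L\<^sup>2 = \<Lambda>\<close>.\<close>
        define c where "c = 2 * L powr q * (l j) powr q"
        have c: "c \<ge> 0" by (simp add: c_def)
        have Lp: "L powr p = L powr q * \<Lambda>" "(l j) powr p = (l j) powr q * s"
          using L l[of j] \<Lambda> by (auto simp: q_def powr_diff powr_numeral L2[symmetric] s_def)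
        have "a (Suc j) = c * (\<Lambda> * s / 2 * w (Suc j))"
          using L l[of j] by (simp add: a_def lS powr_mult Lp c_def)
        also have "\<dots> \<le> c * (3 * (N * (\<epsilon> * l j)\<^sup>2) * w j + 12 * (B * I' j))" by (rule mult_left_mono[OF le c])
        also have "\<dots> = (6 * N * e2 * L powr q) * a j + C1 * ((l j) powr q * I' j)"
          by (simp add: c_def a_def Lp C1_def power_mult_distrib \<epsilon> s_def algebra_simps)
        also have "\<dots> \<le> (1 / 2) * a j + C1 * ((l j) powr q * I' j)"
          by (intro add_right_mono mult_right_mono e2 a0)
        finally show ?thesis by simp
      qed
      have suma: "(\<Sum>j\<le>m. a j) \<le> 2 * (l0 powr q * J) + C2 * \<Phi>" for m
      proof -
        have "(\<Sum>j\<le>m. a j) \<le> 2 * a 0 + 2 * (\<Sum>j<m. C1 * ((l j) powr q * I' j))"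
          by (rule sum_halving_le[of a "\<lambda>j. C1 * ((l j) powr q * I' j)", OF step a0])
        also have "(\<Sum>j<m. C1 * ((l j) powr q * I' j)) = C1 * (\<Sum>j<m. (l j) powr q * I' j)" by (simp add: sum_distrib_left)
        finally have S1: "(\<Sum>j\<le>m. a j) \<le> 2 * a 0 + 2 * (C1 * (\<Sum>j<m. (l j) powr q * I' j))" .
        have S2: "(\<Sum>j<m. (l j) powr q * I' j) \<le> (r / (r - 1)) * \<epsilon> powr (- q) * \<Phi>"
        proof -
          have "ennreal (\<Sum>j<m. (l j) powr q * I' j) \<le> ennreal ((r / (r - 1)) * \<epsilon> powr (- q) * \<Phi>)"
            using sumI[of m] I'(2) by (simp add: I'(1) ennreal_mult'[symmetric] sum_ennreal)
          then show ?thesis using r \<Phi> by (subst (asm) ennreal_le_iff) auto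
        qed
        have S3: "a 0 \<le> l0 powr q * J"
        proof -
          have "ennreal (l0\<^sup>2 * w 0) \<le> ennreal J" using weak[of 0] w[of 0] by (simp add: l_def ennreal_mult')
          then have "l0\<^sup>2 * w 0 \<le> J" using J by simp
          then have "l0 powr q * (l0\<^sup>2 * w 0) \<le> l0 powr q * J" by (intro mult_left_mono) auto
          moreover have "l0 powr p = l0 powr q * l0\<^sup>2" using l0 by (simp add: q_def powr_diff powr_numeral)
          ultimately show ?thesis by (simp add: a_def l_def)
        qed
        have "C2 * \<Phi> = 2 * (C1 * ((r / (r - 1)) * \<epsilon> powr (- q) * \<Phi>))" by (simp only: C2_def mult.assoc)
        then show ?thesis using S1 S3 mult_left_mono[OF S2 C(1)] by linarith
      qed
      have ae1: "AE z in lborel. F z \<noteq> \<infinity>"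
      proof -
        have "AE z in lborel. (F z)\<^sup>2 \<noteq> \<infinity>" using F2 by (intro nn_integral_PInf_AE) auto
        then show ?thesis by eventually_elim (auto simp: power2_eq_square ennreal_mult_top)
      qed
      \<comment> \<open>By differentiation, almost every point with \<open>F\<close> between
        \<open>l j\<close> and \<open>L * l j\<close> lies in the level set of height
        \<open>(l j)\<^sup>2\<close>. There \<open>F powr p\<close> is at most
        \<open>L powr p * l j powr p\<close>, which leads to the series of the
        \<open>a j\<close>.\<close>
      have ae2: "AE z in lborel. \<forall>j. G z > ennreal ((l j)\<^sup>2) \<longrightarrow> z \<in> \<Omega> G ((l j)\<^sup>2)"
        by (subst AE_all_countable) (intro allI \<Omega>_differentiation[OF _ Gfin zero_less_power[OF l]], measurable)
      have "(\<integral>\<^sup>+z\<in>{z. F z > ennreal l0}. epowr (F z) p \<partial>lborel)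
        \<le> (\<integral>\<^sup>+z. (\<Sum>j. ennreal (L powr p * (l j) powr p) * indicator (\<Omega> G ((l j)\<^sup>2)) z) \<partial>lborel)"
      proof (rule nn_integral_mono_AE, rule AE_mp[OF AE_conjI[OF ae1 ae2]], rule AE_I2, rule impI)
        fix z assume "F z \<noteq> \<infinity> \<and> (\<forall>j. G z > ennreal ((l j)\<^sup>2) \<longrightarrow> z \<in> \<Omega> G ((l j)\<^sup>2))"
        then have elim: "F z \<noteq> \<infinity>" "\<forall>j. G z > ennreal ((l j)\<^sup>2) \<longrightarrow> z \<in> \<Omega> G ((l j)\<^sup>2)" by auto
        show "epowr (F z) p * indicator {z. F z > ennreal l0} z
          \<le> (\<Sum>j. ennreal (L powr p * (l j) powr p) * indicator (\<Omega> G ((l j)\<^sup>2)) z)"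
        proof (cases "F z > ennreal l0")
          case True
          obtain f where f: "F z = ennreal f" "f \<ge> 0" using elim(1) by (cases "F z") auto
          have fl0: "f > l 0" using True l0 f by (simp add: l_def ennreal_less_iff)
          obtain n where "f / l0 < L ^ n" using real_arch_pow[of L "f / l0"] L by auto
          then have ex: "f \<le> l n" using l0 by (simp add: l_def field_simps)
          define k where "k = (LEAST k. f \<le> l k)"
          have k: "f \<le> l k" unfolding k_def by (rule LeastI) (rule ex)
          have "k \<noteq> 0" using k fl0 by (metis not_le)
          then obtain j where j: "k = Suc j" by (cases k) auto
          have "\<not> f \<le> l j" using not_less_Least[of j "\<lambda>k. f \<le> l k"] j unfolding k_def by simp
          then have fj: "l j < f" "f \<le> L * l j" using k by (auto simp: j lS)
          have "ennreal ((l j)\<^sup>2) < G z"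
            using fj l[of j] f by (simp add: G_def ennreal_power ennreal_less_iff power_strict_mono)
          then have zO: "z \<in> \<Omega> G ((l j)\<^sup>2)" using elim(2) by blast
          have "epowr (F z) p = ennreal (f powr p)" using f by (simp add: epowr_ennreal)
          also have "f powr p \<le> (L * l j) powr p" using fj f p by (intro powr_mono2) auto
          also have "(L * l j) powr p = L powr p * (l j) powr p" using L l[of j] by (simp add: powr_mult)
          finally have "epowr (F z) p \<le> ennreal (L powr p * (l j) powr p)" by (simp add: ennreal_leI)
          also have "\<dots> = (\<Sum>i\<in>{j}. ennreal (L powr p * (l i) powr p) * indicator (\<Omega> G ((l i)\<^sup>2)) z)" using zO by simp
          also have "\<dots> \<le> (\<Sum>j. ennreal (L powr p * (l j) powr p) * indicator (\<Omega> G ((l j)\<^sup>2)) z)"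
            by (rule sum_le_suminf) auto
          finally show ?thesis using True by simp
        qed simp
      qed
      also have "\<dots> = (\<Sum>j. ennreal (L powr p * (l j) powr p) * emeasure lborel (\<Omega> G ((l j)\<^sup>2)))"
      proof -
        have O[measurable]: "\<Omega> G s \<in> sets borel" for s by (rule \<Omega>_sets[OF _ Gfin]) measurable
        have "(\<integral>\<^sup>+z. (\<Sum>j. ennreal (L powr p * (l j) powr p) * indicator (\<Omega> G ((l j)\<^sup>2)) z) \<partial>lborel)
            = (\<Sum>j. \<integral>\<^sup>+z. ennreal (L powr p * (l j) powr p) * indicator (\<Omega> G ((l j)\<^sup>2)) z \<partial>lborel)"
          by (rule nn_integral_suminf) measurable
        also have "\<dots> = (\<Sum>j. ennreal (L powr p * (l j) powr p) * emeasure lborel (\<Omega> G ((l j)\<^sup>2)))"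
          by (intro suminf_cong nn_integral_cmult_indicator) (simp add: O)
        finally show ?thesis .
      qed
      also have "\<dots> = (\<Sum>j. ennreal (L powr p * a j))"
        using w by (intro suminf_cong) (simp add: a_def ennreal_mult'[symmetric] mult.assoc)
      also have "\<dots> \<le> ennreal (L powr p * (2 * (l0 powr q * J) + C2 * \<Phi>))"
      proof (rule suminf_le_const)
        show "summable (\<lambda>j. ennreal (L powr p * a j))" by simp
        fix m
        have "(\<Sum>j<m. ennreal (L powr p * a j)) = ennreal (\<Sum>j<m. L powr p * a j)"
          using a0 by (intro sum_ennreal) auto
        also have "(\<Sum>j<m. L powr p * a j) \<le> (\<Sum>j\<le>m. L powr p * a j)" using a0 by (intro sum_mono2) auto
        also have "\<dots> = L powr p * (\<Sum>j\<le>m. a j)" by (simp add: sum_distrib_left)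
        also have "\<dots> \<le> L powr p * (2 * (l0 powr q * J) + C2 * \<Phi>)" by (intro mult_left_mono suma) simp
        finally show "(\<Sum>j<m. ennreal (L powr p * a j)) \<le> ennreal (L powr p * (2 * (l0 powr q * J) + C2 * \<Phi>))"
          by (simp add: ennreal_leI)
      qed
      finally show ?thesis .
    qed
    \<comment> \<open>The lowest height tends to 0 under Fatou's lemma; its contribution vanishes
      since \<open>q > 0\<close>.\<close>
    define e where "e n = inverse (real (Suc n))" for n
    have e: "e n > 0" for n by (simp add: e_def)
    have "(\<integral>\<^sup>+z. epowr (F z) p \<partial>lborel) \<le> (\<integral>\<^sup>+z. liminf (\<lambda>n. epowr (F z) p * indicator {z. F z > ennreal (e n)} z) \<partial>lborel)"
    proof (rule nn_integral_mono)
      fix z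
      show "epowr (F z) p \<le> liminf (\<lambda>n. epowr (F z) p * indicator {z. F z > ennreal (e n)} z)"
      proof (cases "F z = 0")
        case True then show ?thesis using p by (simp add: epowr_def)
      next
        case False
        have "e \<longlonglongrightarrow> 0" unfolding e_def by (rule LIMSEQ_inverse_real_of_nat)
        then have "(\<lambda>n. ennreal (e n)) \<longlonglongrightarrow> ennreal 0" by (rule tendsto_ennrealI)
        then have "\<forall>\<^sub>F n in sequentially. ennreal (e n) < F z" using False by (intro order_tendstoD) (auto simp: zero_less_iff_neq_zero)
        then have "\<forall>\<^sub>F n in sequentially. epowr (F z) p \<le> epowr (F z) p * indicator {z. F z > ennreal (e n)} z"
          by eventually_elim simp
        then show ?thesis by (rule Liminf_bounded)
      qed
    qed
    also have "\<dots> \<le> liminf (\<lambda>n. \<integral>\<^sup>+z\<in>{z. F z > ennreal (e n)}. epowr (F z) p \<partial>lborel)"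
      by (rule nn_integral_liminf) measurable
    also have "\<dots> \<le> liminf (\<lambda>n. ennreal (L powr p * (2 * (e n powr q * J) + C2 * \<Phi>)))"
      by (intro Liminf_mono always_eventually allI tail e)
    also have "\<dots> = ennreal (L powr p * (2 * (0 * J) + C2 * \<Phi>))"
    proof (rule lim_imp_Liminf)
      have "(\<lambda>n. e n powr q) \<longlonglongrightarrow> 0" unfolding e_def using q by real_asymp
      then show "(\<lambda>n. ennreal (L powr p * (2 * (e n powr q * J) + C2 * \<Phi>))) \<longlonglongrightarrow> ennreal (L powr p * (2 * (0 * J) + C2 * \<Phi>))"
        by (intro tendsto_ennrealI tendsto_intros)
    qed simp
    also have "\<dots> \<le> ennreal (K * \<Phi>)" using \<Phi> by (intro ennreal_leI) (simp add: K_def algebra_simps)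
    also have "\<dots> = ennreal K * (\<integral>\<^sup>+z. ennreal (\<phi> z powr p) \<partial>lborel)" using K \<Phi> by (simp add: ennreal_mult')
    finally show ?thesis .
  qed
  then show ?thesis using K by (intro exI[of _ K] conjI) (simp, blast)
qed

end

section \<open>Anisotropic dyadic cells\<close>

text \<open>\<open>m - k\<close> is a nonnegative integer, so the coarse floor is the integer
  quotient of the fine one by a power of 2. This is what nests the cells.\<close>

lemma floor_coarsen:
  fixes k m :: int and a b :: real
  assumes "k \<le> m" "\<lfloor>2 powr m * a\<rfloor> = \<lfloor>2 powr m * b\<rfloor>"
  shows "\<lfloor>2 powr k * a\<rfloor> = \<lfloor>2 powr k * b\<rfloor>"
proof -
  define d where "d = nat (m - k)"
  have p: "2 powr k * x = (2 powr m * x) / real_of_int (2 ^ d)" for x :: real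
  proof -
    have "2 powr m = 2 powr k * 2 powr (real d)"
      using assms(1) by (simp add: d_def powr_add[symmetric])
    then show ?thesis by (simp add: powr_realpow)
  qed
  show ?thesis unfolding p by (simp only: floor_divide_real_eq_div[of "2 ^ d", OF zero_le_power[OF zero_le_numeral]] assms(2))
qed

lemma floor_eq_iff_interval:
  fixes c t :: real assumes "c > 0"
  shows "\<lfloor>c * t\<rfloor> = i \<longleftrightarrow> of_int i / c \<le> t \<and> t < (of_int i + 1) / c"
  using assms by (auto simp: floor_eq_iff field_simps)

text \<open>The time length is about the side to the power \<open>1 / \<gamma>\<close>, the scaling
  of the kernel. Rounding the time exponent to an integer keeps the time intervals dyadic, hence
  nested.\<close>

definition aniso_cell :: "real \<Rightarrow> int \<Rightarrow> real \<times> 'a::euclidean_space \<Rightarrow> (real \<times> 'a) set" where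
  "aniso_cell \<gamma> n z = {w. \<lfloor>2 powr \<lfloor>n / \<gamma>\<rfloor> * fst w\<rfloor> = \<lfloor>2 powr \<lfloor>n / \<gamma>\<rfloor> * fst z\<rfloor> \<and>
     (\<forall>b\<in>Basis. \<lfloor>2 powr n * (snd w \<bullet> b)\<rfloor> = \<lfloor>2 powr n * (snd z \<bullet> b)\<rfloor>)}"

definition cell_time :: "real \<Rightarrow> int \<Rightarrow> real" where "cell_time \<gamma> n = 2 powr (- \<lfloor>n / \<gamma>\<rfloor>)"

definition cell_side :: "int \<Rightarrow> real" where "cell_side n = 2 powr (- real_of_int n)"

lemma cell_time_pos: "cell_time \<gamma> n > 0" and cell_side_pos: "cell_side n > 0"
  by (auto simp: cell_time_def cell_side_def)

text \<open>Rounding \<open>n / \<gamma>\<close> down enlarges the time length by a factor at most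
  2, hence its power \<open>\<gamma>\<close> by at most \<open>2 powr \<gamma>\<close>.\<close>

lemma cell_side_le_time:
  assumes "\<gamma> > 0" shows "cell_side n \<le> cell_time \<gamma> n powr \<gamma>" "cell_time \<gamma> n powr \<gamma> \<le> 2 powr \<gamma> * cell_side n"
proof -
  have 1: "cell_time \<gamma> n powr \<gamma> = 2 powr (- (\<gamma> * of_int \<lfloor>n / \<gamma>\<rfloor>))"
    by (simp add: cell_time_def powr_powr mult.commute)
  have f: "of_int \<lfloor>n / \<gamma>\<rfloor> \<le> n / \<gamma>" "n / \<gamma> \<le> of_int \<lfloor>n / \<gamma>\<rfloor> + 1" by linarith+
  then have "\<gamma> * of_int \<lfloor>n / \<gamma>\<rfloor> \<le> n" "n \<le> \<gamma> * of_int \<lfloor>n / \<gamma>\<rfloor> + \<gamma>"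
    using mult_left_mono[OF f(1), of \<gamma>] mult_left_mono[OF f(2), of \<gamma>] assms by (auto simp: distrib_left)
  then show "cell_side n \<le> cell_time \<gamma> n powr \<gamma>" "cell_time \<gamma> n powr \<gamma> \<le> 2 powr \<gamma> * cell_side n"
    unfolding 1 cell_side_def by (auto simp: powr_add[symmetric] intro!: powr_mono)
qed

lemma aniso_cell_diff:
  assumes "w \<in> aniso_cell \<gamma> n z"
  shows "\<bar>fst w - fst z\<bar> \<le> cell_time \<gamma> n" "norm (snd w - snd (z :: real \<times> 'a::euclidean_space)) \<le> DIM('a) * cell_side n"
proof -
  have *: "\<bar>x - y\<bar> \<le> 1 / c" if "\<lfloor>c * x\<rfloor> = \<lfloor>c * y\<rfloor>" "c > 0" for x y c :: real
  proof -
    have "\<bar>c * x - c * y\<bar> \<le> 1" using that(1) by linarith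
    moreover have "\<bar>c * x - c * y\<bar> = c * \<bar>x - y\<bar>" using that(2) by (simp add: abs_mult right_diff_distrib[symmetric])
    ultimately show ?thesis using that(2) by (simp add: field_simps)
  qed
  show "\<bar>fst w - fst z\<bar> \<le> cell_time \<gamma> n"
    using *[of "2 powr \<lfloor>n / \<gamma>\<rfloor>" "fst w" "fst z"] assms by (simp add: aniso_cell_def cell_time_def powr_minus_divide)
  have "norm (snd w - snd z) \<le> (\<Sum>b\<in>Basis. \<bar>(snd w - snd z) \<bullet> b\<bar>)" by (rule norm_le_l1)
  also have "\<dots> \<le> (\<Sum>b\<in>(Basis :: 'a set). cell_side n)"
  proof (rule sum_mono)
    fix b :: 'a assume "b \<in> Basis"
    then show "\<bar>(snd w - snd z) \<bullet> b\<bar> \<le> cell_side n"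
      using *[of "2 powr n" "snd w \<bullet> b" "snd z \<bullet> b"] assms
      by (simp add: aniso_cell_def cell_side_def powr_minus_divide inner_diff_left)
  qed
  finally show "norm (snd w - snd z) \<le> DIM('a) * cell_side n" by simp
qed

lemma aniso_cell_Times:
  "aniso_cell \<gamma> n z = {t. \<lfloor>2 powr \<lfloor>n / \<gamma>\<rfloor> * t\<rfloor> = \<lfloor>2 powr \<lfloor>n / \<gamma>\<rfloor> * fst z\<rfloor>} \<times>
     {x. \<forall>b\<in>Basis. \<lfloor>2 powr n * (x \<bullet> b)\<rfloor> = \<lfloor>2 powr n * (snd z \<bullet> b)\<rfloor>}"
  by (auto simp: aniso_cell_def)

text \<open>The half-open cube lies between the open and the closed box with the same corners, and
  these have equal measure.\<close>

lemma lattice_cube: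
  fixes z :: "'a::euclidean_space" and c :: real
  assumes c: "c > 0"
  defines "Q \<equiv> {x :: 'a. \<forall>b\<in>Basis. \<lfloor>c * (x \<bullet> b)\<rfloor> = \<lfloor>c * (z \<bullet> b)\<rfloor>}"
  shows "Q \<in> sets borel" "emeasure lborel Q = ennreal ((1 / c) ^ DIM('a))"
    "\<exists>l u. box l u \<subseteq> Q \<and> box l u \<noteq> {}"
proof -
  define l where "l = (\<Sum>b\<in>Basis. (of_int \<lfloor>c * (z \<bullet> b)\<rfloor> / c) *\<^sub>R b :: 'a)"
  define u where "u = (\<Sum>b\<in>Basis. ((of_int \<lfloor>c * (z \<bullet> b)\<rfloor> + 1) / c) *\<^sub>R b :: 'a)"
  have lu: "l \<bullet> b = of_int \<lfloor>c * (z \<bullet> b)\<rfloor> / c" "u \<bullet> b = (of_int \<lfloor>c * (z \<bullet> b)\<rfloor> + 1) / c" if "b \<in> Basis" for b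
    using that by (simp_all add: l_def u_def)
  have Q: "Q = {x. \<forall>b\<in>Basis. l \<bullet> b \<le> x \<bullet> b \<and> x \<bullet> b < u \<bullet> b}"
    unfolding Q_def using c by (auto simp: floor_eq_iff_interval lu)
  have "Q = (\<Inter>b\<in>Basis. {x. l \<bullet> b \<le> x \<bullet> b} \<inter> {x. x \<bullet> b < u \<bullet> b})" unfolding Q by auto
  moreover have "{x. l \<bullet> b \<le> x \<bullet> b} \<inter> {x. x \<bullet> b < u \<bullet> b} \<in> sets borel" for b
    by (intro sets.Int borel_closed[OF closed_Collect_le] borel_open[OF open_Collect_less] continuous_intros)
  ultimately show Qm: "Q \<in> sets borel" by (auto intro!: sets.finite_INT)
  have sub: "box l u \<subseteq> Q" "Q \<subseteq> cbox l u" unfolding Q by (auto simp: mem_box less_imp_le)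
  have dif: "(u - l) \<bullet> b = 1 / c" if "b \<in> Basis" for b
    using c lu[OF that] by (simp add: inner_diff_left field_simps)
  have le: "l \<bullet> b \<le> u \<bullet> b" "l \<bullet> b < u \<bullet> b" if "b \<in> Basis" for b
    using dif[OF that] c by (auto simp: inner_diff_left) (smt (verit) divide_pos_pos)+
  have "emeasure lborel (box l u) = ennreal ((1 / c) ^ DIM('a))"
    using le by (subst emeasure_lborel_box) (auto simp: dif)
  moreover have "emeasure lborel (cbox l u) = ennreal ((1 / c) ^ DIM('a))"
    using le by (subst emeasure_lborel_cbox) (auto simp: dif)
  moreover have "emeasure lborel (box l u) \<le> emeasure lborel Q" "emeasure lborel Q \<le> emeasure lborel (cbox l u)"
    using sub Qm by (auto intro!: emeasure_mono)
  ultimately show "emeasure lborel Q = ennreal ((1 / c) ^ DIM('a))" by simp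
  show "\<exists>l u. box l u \<subseteq> Q \<and> box l u \<noteq> {}"
    using sub le by (intro exI[of _ l] exI[of _ u]) (auto simp: box_ne_empty)
qed

text \<open>The doubling constant: one generation raises the rounded time exponent by at most
  \<open>1 / \<gamma> + 1\<close> and halves each of the \<open>DIM('a)\<close> sides.\<close>

lemma dyadic_grid_aniso:
  assumes \<gamma>: "\<gamma> > 0"
  shows "dyadic_grid (aniso_cell \<gamma> :: int \<Rightarrow> real \<times> 'a::euclidean_space \<Rightarrow> _)
     (\<lambda>n. cell_time \<gamma> n * cell_side n ^ DIM('a)) (2 powr (1 / \<gamma> + 1) * 2 ^ DIM('a))"
proof
  fix n :: int and z w :: "real \<times> 'a"
  show "z \<in> aniso_cell \<gamma> n z" by (simp add: aniso_cell_def)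
  show "aniso_cell \<gamma> n w = aniso_cell \<gamma> n z" if "w \<in> aniso_cell \<gamma> n z"
    using that by (simp add: aniso_cell_def)
  have k: "\<lfloor>real_of_int n / \<gamma>\<rfloor> \<le> \<lfloor>real_of_int (n + 1) / \<gamma>\<rfloor>"
    using \<gamma> by (intro floor_mono divide_right_mono) auto
  show "aniso_cell \<gamma> (n + 1) z \<subseteq> aniso_cell \<gamma> n z"
  proof
    fix w assume "w \<in> aniso_cell \<gamma> (n + 1) z"
    then have h: "\<lfloor>2 powr \<lfloor>(n + 1) / \<gamma>\<rfloor> * fst w\<rfloor> = \<lfloor>2 powr \<lfloor>(n + 1) / \<gamma>\<rfloor> * fst z\<rfloor>"
      "b \<in> Basis \<Longrightarrow> \<lfloor>2 powr (n + 1) * (snd w \<bullet> b)\<rfloor> = \<lfloor>2 powr (n + 1) * (snd z \<bullet> b)\<rfloor>" for b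
      unfolding aniso_cell_def by simp_all
    show "w \<in> aniso_cell \<gamma> n z"
      unfolding aniso_cell_def mem_Collect_eq
    proof (intro conjI ballI)
      show "\<lfloor>2 powr \<lfloor>n / \<gamma>\<rfloor> * fst w\<rfloor> = \<lfloor>2 powr \<lfloor>n / \<gamma>\<rfloor> * fst z\<rfloor>" by (rule floor_coarsen[OF k h(1)])
      show "\<lfloor>2 powr n * (snd w \<bullet> b)\<rfloor> = \<lfloor>2 powr n * (snd z \<bullet> b)\<rfloor>" if "b \<in> Basis" for b
        by (rule floor_coarsen[OF _ h(2)[OF that]]) simp
    qed
  qed
  note A = lattice_cube[of "2 powr \<lfloor>n / \<gamma>\<rfloor>" "fst z"] lattice_cube[of "2 powr n" "snd z"]
  show "aniso_cell \<gamma> n z \<in> sets borel"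
    unfolding aniso_cell_Times borel_prod[symmetric] using A(1,4) by (intro pair_measureI) auto
  have "emeasure (lborel \<Otimes>\<^sub>M lborel) (aniso_cell \<gamma> n z) = ennreal (cell_time \<gamma> n) * ennreal (cell_side n ^ DIM('a))"
    unfolding aniso_cell_Times using A(1,2,4,5)
    by (subst lborel.emeasure_pair_measure_Times) (auto simp: cell_time_def cell_side_def powr_minus_divide)
  then show "emeasure lborel (aniso_cell \<gamma> n z) = ennreal (cell_time \<gamma> n * cell_side n ^ DIM('a))"
    by (simp add: lborel_prod ennreal_mult cell_time_pos cell_side_pos less_imp_le)
  show "cell_time \<gamma> n * cell_side n ^ DIM('a) > 0" by (simp add: cell_time_pos cell_side_pos)
  show "cell_time \<gamma> n * cell_side n ^ DIM('a)
     \<le> 2 powr (1 / \<gamma> + 1) * 2 ^ DIM('a) * (cell_time \<gamma> (n + 1) * cell_side (n + 1) ^ DIM('a))"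
  proof -
    have "real_of_int \<lfloor>(n + 1) / \<gamma>\<rfloor> \<le> of_int \<lfloor>n / \<gamma>\<rfloor> + (1 / \<gamma> + 1)"
      by (simp add: add_divide_distrib) linarith
    then have "cell_time \<gamma> n \<le> 2 powr (1 / \<gamma> + 1) * cell_time \<gamma> (n + 1)"
      unfolding cell_time_def powr_add[symmetric] by (intro powr_mono) auto
    moreover have "cell_side n = 2 * cell_side (n + 1)"
    proof -
      have "2 powr (- real_of_int n) = 2 powr 1 * 2 powr (- real_of_int n - 1)"
        by (simp only: powr_add[symmetric]) simp
      then show ?thesis by (simp add: cell_side_def)
    qed
    ultimately show ?thesis using cell_side_pos[of "n + 1"] by (simp add: power_mult_distrib mult_ac mult_left_mono)
  qed
next
  fix M :: real
  obtain k :: nat where k: "M < 2 ^ k" using real_arch_pow[of 2 M] by auto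
  show "\<exists>n0. \<forall>n\<le>n0. cell_time \<gamma> n * cell_side n ^ DIM('a) > M"
  proof (intro exI[of _ "- int k"] allI impI)
    fix n :: int assume n: "n \<le> - int k"
    have "\<lfloor>n / \<gamma>\<rfloor> \<le> 0" using \<gamma> n by (simp add: floor_le_iff divide_nonpos_pos le_less_trans)
    then have T: "cell_time \<gamma> n \<ge> 1" unfolding cell_time_def by (intro ge_one_powr_ge_zero) auto
    have "2 ^ k \<le> cell_side n" unfolding cell_side_def powr_realpow[symmetric, OF zero_less_numeral] using n by (intro powr_mono) auto
    then have R: "M < cell_side n" "1 \<le> cell_side n"
      using k order_trans[OF one_le_power[of "2::real" k]] by auto
    have "cell_side n \<le> cell_side n ^ DIM('a)" using R by (intro self_le_power) auto
    also have "\<dots> \<le> cell_time \<gamma> n * cell_side n ^ DIM('a)" using T R by (simp add: mult_le_cancel_right2)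
    finally show "cell_time \<gamma> n * cell_side n ^ DIM('a) > M" using R by simp
  qed
next
  fix n :: int
  \<comment> \<open>Every cell contains a nonempty open box, so the cells through a countable dense
    set are all the cells of the generation.\<close>
  obtain B :: "(real \<times> 'a) set" where B: "countable B" "\<And>X. open X \<Longrightarrow> X \<noteq> {} \<Longrightarrow> \<exists>d\<in>B. d \<in> X"
    using countable_dense_exists by blast
  have "range (aniso_cell \<gamma> n) \<subseteq> aniso_cell \<gamma> n ` B"
  proof
    fix Q assume "Q \<in> range (aniso_cell \<gamma> n :: real \<times> 'a \<Rightarrow> _)"
    then obtain z :: "real \<times> 'a" where z: "Q = aniso_cell \<gamma> n z" by auto
    obtain l u where lu: "box l u \<subseteq> {x. \<forall>b\<in>Basis. \<lfloor>2 powr \<lfloor>n / \<gamma>\<rfloor> * (x \<bullet> b)\<rfloor> = \<lfloor>2 powr \<lfloor>n / \<gamma>\<rfloor> * (fst z \<bullet> b)\<rfloor>}" "box l u \<noteq> {}"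
      using lattice_cube(3)[of "2 powr \<lfloor>n / \<gamma>\<rfloor>" "fst z"] by auto
    obtain l' u' where lu': "box l' u' \<subseteq> {x. \<forall>b\<in>Basis. \<lfloor>2 powr n * (x \<bullet> b)\<rfloor> = \<lfloor>2 powr n * (snd z \<bullet> b)\<rfloor>}" "box l' u' \<noteq> {}"
      using lattice_cube(3)[of "2 powr n" "snd z"] by auto
    have "\<exists>d\<in>B. d \<in> box l u \<times> box l' u'" using lu(2) lu'(2) by (intro B(2) open_Times open_box) auto
    then obtain d where d: "d \<in> B" "d \<in> box l u \<times> box l' u'" by auto
    have "d \<in> aniso_cell \<gamma> n z" using d(2) lu(1) lu'(1) unfolding aniso_cell_Times by auto
    then have "aniso_cell \<gamma> n d = aniso_cell \<gamma> n z" by (auto simp: aniso_cell_def)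
    then show "Q \<in> aniso_cell \<gamma> n ` B" using d z by auto
  qed
  then show "countable (range (aniso_cell \<gamma> n :: real \<times> 'a \<Rightarrow> _))"
    by (rule countable_subset[OF _ countable_image[OF B(1)]])
next
  fix U and z :: "real \<times> 'a" assume U: "open U" "z \<in> U"
  obtain e where e: "e > 0" "ball z e \<subseteq> U" using U by (auto simp: open_contains_ball)
  have "(\<lambda>k::nat. 2 powr (- real_of_int \<lfloor>real k / \<gamma>\<rfloor>)) \<longlonglongrightarrow> 0"
  proof (rule Lim_null_comparison)
    show "(\<lambda>k::nat. 2 powr (1 - real k / \<gamma>)) \<longlonglongrightarrow> 0" using \<gamma> by real_asymp
    have "2 powr (- real_of_int \<lfloor>real k / \<gamma>\<rfloor>) \<le> 2 powr (1 - real k / \<gamma>)" for k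
      by (intro powr_mono) linarith+
    then show "\<forall>\<^sub>F k in sequentially. norm (2 powr (- real_of_int \<lfloor>real k / \<gamma>\<rfloor>)) \<le> 2 powr (1 - real k / \<gamma>)" by simp
  qed
  moreover have "(\<lambda>k::nat. real DIM('a) * 2 powr (- real k)) \<longlonglongrightarrow> 0" by real_asymp
  ultimately have "(\<lambda>k. cell_time \<gamma> (int k) + DIM('a) * cell_side (int k)) \<longlonglongrightarrow> 0 + 0"
    unfolding cell_time_def cell_side_def by (intro tendsto_add) simp_all
  then have "\<forall>\<^sub>F k in sequentially. cell_time \<gamma> (int k) + DIM('a) * cell_side (int k) < e"
    using e by (intro order_tendstoD) auto
  then obtain k where k: "cell_time \<gamma> (int k) + DIM('a) * cell_side (int k) < e"
    by (auto simp: eventually_sequentially)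
  have "aniso_cell \<gamma> (int k) z \<subseteq> ball z e"
  proof
    fix w assume "w \<in> aniso_cell \<gamma> (int k) z"
    note d = aniso_cell_diff[OF this]
    have "dist z w \<le> \<bar>fst w - fst z\<bar> + norm (snd w - snd z)"
      unfolding dist_prod_def using sqrt_sum_squares_le_sum[of "dist (fst z) (fst w)" "dist (snd z) (snd w)"]
      by (simp add: dist_norm norm_minus_commute dist_real_def abs_minus_commute)
    then show "w \<in> ball z e" using d k by simp
  qed
  then show "\<exists>n. aniso_cell \<gamma> n z \<subseteq> U" using e by blast
qed

section \<open>The square function of a kernel with integral estimates\<close>

lemma nn_integral_powr_near_0:
  assumes a: "a > 0" and M: "M \<ge> 0"
  shows "(\<integral>\<^sup>+x\<in>{0<..M}. ennreal (x powr (a - 1)) \<partial>lborel) = ennreal (M powr a / a)"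
proof -
  have "((\<lambda>x. x powr (a - 1)) has_integral (M powr (a - 1 + 1) / (a - 1 + 1))) {0..M}"
    using a M by (intro has_integral_powr_from_0) auto
  then have "(\<integral>\<^sup>+x. ennreal (x powr (a - 1)) * indicator {0..M} x \<partial>lborel) = ennreal (M powr a / a)"
    by (subst nn_integral_has_integral_lebesgue') auto
  moreover have "AE x in lborel. ennreal (x powr (a - 1)) * indicator {0..M} x = ennreal (x powr (a - 1)) * indicator {0<..M} x"
    by (rule AE_I[of _ _ "{0}"]) (auto simp: indicator_def)
  ultimately show ?thesis using nn_integral_cong_AE by metis
qed

lemma nn_integral_powr_tail:
  assumes a: "a > 0" and T: "T > 0"
  shows "(\<integral>\<^sup>+x\<in>{T..}. ennreal (x powr (- 1 - a)) \<partial>lborel) = ennreal (T powr (- a) / a)"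
proof -
  have "((\<lambda>x. x powr (- 1 - a)) has_integral (- (T powr (- 1 - a + 1)) / (- 1 - a + 1))) {T..}"
    using a T by (intro has_integral_powr_to_inf) auto
  then have "((\<lambda>x. x powr (- 1 - a)) has_integral (T powr (- a) / a)) {T..}" by simp
  then show ?thesis by (subst nn_integral_has_integral_lebesgue') auto
qed

lemma epowr_half_sq: "(epowr x (1 / 2))\<^sup>2 = x"
proof (cases x)
  case (real r) then show ?thesis by (simp add: epowr_ennreal ennreal_power powr_half_sqrt)
qed (simp add: epowr_def power2_eq_square ennreal_mult_top)

lemma epowr_sq: "epowr x 2 = x\<^sup>2"
proof (cases x)
  case (real r) then show ?thesis by (simp add: epowr_ennreal ennreal_power powr_numeral)
qed (simp add: epowr_def power2_eq_square ennreal_mult_top)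

lemma norm_sq_add3:
  fixes a b c :: "'h::real_normed_vector"
  shows "(norm (a + b + c))\<^sup>2 \<le> 3 * ((norm a)\<^sup>2 + (norm b)\<^sup>2 + (norm c)\<^sup>2)"
proof -
  have "norm (a + b + c) \<le> norm a + norm b + norm c"
    by (meson norm_triangle_ineq order_trans add_right_mono)
  then have "(norm (a + b + c))\<^sup>2 \<le> (norm a + norm b + norm c)\<^sup>2" by (rule power_mono) simp
  also have "\<dots> \<le> 3 * ((norm a)\<^sup>2 + (norm b)\<^sup>2 + (norm c)\<^sup>2)"
    using zero_le_power2[of "norm a - norm b"] zero_le_power2[of "norm a - norm c"] zero_le_power2[of "norm b - norm c"]
    by (simp add: power2_eq_square algebra_simps)
  finally show ?thesis .
qed

lemma cc_fun_slice:
  fixes f :: "'b::euclidean_space \<times> 'a::euclidean_space \<Rightarrow> 'h::real_normed_vector"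
  assumes "cc_fun f" shows "cc_fun (\<lambda>y. f (s, y))"
proof -
  note c = conjunct1[OF assms[unfolded cc_fun_def]]
  from conjunct2[OF assms[unfolded cc_fun_def]] obtain a b where ab: "\<forall>z. z \<notin> cbox a b \<longrightarrow> f z = 0" by (elim exE) (rule that)
  have "continuous_on UNIV (\<lambda>y. f (s, y))"
    by (rule continuous_on_compose2[OF c]) (auto intro!: continuous_intros)
  moreover have "f (s, y) = 0" if "y \<notin> cbox (snd a) (snd b)" for y
    using that by (intro ab[rule_format]) (auto simp: cbox_Pair_eq[of "fst a" "snd a" "fst b" "snd b", simplified])
  ultimately show ?thesis unfolding cc_fun_def by blast
qed

lemma cc_fun_scaleR:
  assumes u: "cc_fun u" and g: "continuous_on UNIV g"
  shows "cc_fun (\<lambda>x. g x *\<^sub>R u x)"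
proof -
  obtain a b where ab: "\<And>z. z \<notin> cbox a b \<Longrightarrow> u z = 0" and c: "continuous_on UNIV u"
    using u unfolding cc_fun_def by auto
  have "continuous_on UNIV (\<lambda>x. g x *\<^sub>R u x)" by (intro continuous_intros c g)
  moreover have "\<forall>x. x \<notin> cbox a b \<longrightarrow> g x *\<^sub>R u x = 0" using ab by simp
  ultimately show ?thesis unfolding cc_fun_def by blast
qed

context scalar_hilbert
begin

lemma diff_in_S: "a \<in> S \<Longrightarrow> b \<in> S \<Longrightarrow> a - b \<in> S"
  using S_cases by auto

lemma convol_add_right:
  assumes k: "integrable lborel k" "\<And>x. k x \<in> S" and u: "cc_fun u" and v: "cc_fun v"
  shows "convol m k (\<lambda>y. u y + v y) x = convol m k u x + convol m k v x"
  unfolding convol_def m_add_right[OF k(2)]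
  by (rule integral_add) (rule m_integrable[OF integrable_reflect[OF k(1)] k(2)], fact)+

lemma m_diff: assumes "a \<in> S" "b \<in> S" shows "m (a - b) v = m a v - m b v"
  using m_add_left[OF diff_in_S[OF assms] assms(2), of v] by (simp add: algebra_simps)

lemma convol_diff_left:
  assumes k: "integrable lborel k" "\<And>x. k x \<in> S" and l: "integrable lborel l" "\<And>x. l x \<in> S" and u: "cc_fun u"
  shows "convol m (\<lambda>x. k x - l x) u x = convol m k u x - convol m l u x"
  unfolding convol_def m_diff[OF k(2) l(2)]
  by (rule Henstock_Kurzweil_Integration.integral_diff)
     (rule m_integrable[OF integrable_reflect[OF k(1)] k(2) u] m_integrable[OF integrable_reflect[OF l(1)] l(2) u])+

lemma convol_shift: "convol m k u (x + h) = convol m (\<lambda>z. k (z + h)) u x"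
  unfolding convol_def by (simp add: algebra_simps)

lemma convol_bound_nn:
  assumes k: "integrable lborel k" "\<And>x. k x \<in> S" and u: "cc_fun u" and A: "\<And>x. norm (u x) \<le> A"
    and N: "(\<integral>\<^sup>+z. ennreal (norm (k z)) \<partial>lborel) \<le> ennreal N" "N \<ge> 0"
  shows "norm (convol m k u x) \<le> A * N"
proof -
  have A0: "A \<ge> 0" using A[of 0] norm_ge_zero order_trans by blast
  have "ennreal (LINT z|lborel. norm (k z)) = (\<integral>\<^sup>+z. ennreal (norm (k z)) \<partial>lborel)"
    using k by (intro nn_integral_eq_integral[symmetric]) auto
  then have "ennreal (LINT z|lborel. norm (k z)) \<le> ennreal N" using N(1) by (simp only:)
  then have "(LINT z|lborel. norm (k z)) \<le> N" using N(2) by (simp only: ennreal_le_iff)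
  then show ?thesis using convol_bound[OF k u A, of x] A0 by (meson mult_left_mono order_trans)
qed

text \<open>As \<open>u\<close> vanishes within distance \<open>r\<close> of \<open>x\<close>, the
  kernel can be cut to \<open>norm z \<ge> r\<close> before \<open>convol_bound_nn\<close> is
  applied.\<close>

lemma convol_bound_far:
  assumes k: "integrable lborel k" "\<And>x. k x \<in> S" and u: "cc_fun u" and A: "\<And>x. norm (u x) \<le> A"
    and far: "\<And>y. norm (x - y) < r \<Longrightarrow> u y = 0"
    and N: "(\<integral>\<^sup>+z\<in>{z. norm z \<ge> r}. ennreal (norm (k z)) \<partial>lborel) \<le> ennreal N" "N \<ge> 0"
  shows "norm (convol m k u x) \<le> A * N"
proof -
  have A0: "A \<ge> 0" using A[of 0] norm_ge_zero order_trans by blast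
  have [measurable]: "k \<in> borel_measurable borel" using k by auto
  define l where "l z = (if norm z \<ge> r then k z else 0)" for z
  have l: "integrable lborel l"
    unfolding l_def by (rule Bochner_Integration.integrable_bound[OF k(1)]) auto
  have lS: "l z \<in> S" for z unfolding l_def using k(2) of_real_in_S[of 0] by auto
  have "convol m k u x = convol m l u x"
    unfolding convol_def
  proof (rule Henstock_Kurzweil_Integration.integral_cong)
    fix y
    have z: "m c 0 = 0" if "c \<in> S" for c using norm_m[OF that, of 0] by simp
    show "m (k (x - y)) (u y) = m (l (x - y)) (u y)"
      using far[of y] z[OF k(2)] z[OF lS] z[OF of_real_in_S[of 0]] by (cases "norm (x - y) < r") (auto simp: l_def)
  qed
  moreover have "(\<integral>\<^sup>+z. ennreal (norm (l z)) \<partial>lborel) \<le> ennreal N"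
  proof -
    have "(\<integral>\<^sup>+z. ennreal (norm (l z)) \<partial>lborel) = (\<integral>\<^sup>+z\<in>{z. norm z \<ge> r}. ennreal (norm (k z)) \<partial>lborel)"
      by (intro nn_integral_cong) (simp add: l_def indicator_def)
    then show ?thesis using N by simp
  qed
  ultimately show ?thesis using convol_bound_nn[OF l lS u A _ N(2)] by simp
qed

end

text \<open>\<open>K1\<close> to \<open>K4\<close> are integral estimates, so they are blind to
  changes of \<open>K\<close> on null sets in \<open>x\<close>. Their exponents are scale invariant:
  on a cell of length \<open>T\<close> and side \<open>R\<close>, with
  \<open>T powr \<gamma>\<close> comparable to \<open>R\<close>, the square of the bound in
  \<open>K1\<close> at distance \<open>R\<close>, integrated over time differences up to order
  \<open>T\<close>, gives \<open>T powr (\<gamma> * e) * R powr (- e)\<close>. The squares of the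
  bounds in \<open>K2\<close> and \<open>K3\<close>, integrated over time differences from
  \<open>T\<close> on, give \<open>R\<^sup>2 * T powr (- 2 * \<gamma>)\<close> and
  \<open>T\<^sup>2 * T powr (- 2)\<close>, all up to constants.\<close>

locale sqkernel = scalar_hilbert S m for S and m :: "complex \<Rightarrow> 'h::{real_inner,complete_space} \<Rightarrow> 'h" +
  fixes K :: "real \<Rightarrow> real \<Rightarrow> 'a::euclidean_space \<Rightarrow> complex" and Tg :: "real set" and \<gamma> e N0 C0 :: real
  assumes \<gamma>: "\<gamma> > 0" and e: "e > 0" and N0: "N0 \<ge> 0" and C0: "C0 \<ge> 0"
    and K_int: "integrable lborel (K t s)" and K_S: "K t s x \<in> S"
    and K_meas: "(\<lambda>z. K (fst z) (fst (snd z)) (snd (snd z))) \<in> borel_measurable borel"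
    and K_zero: "s \<ge> t \<Longrightarrow> K t s x = 0"
    and Tg: "AE t in lborel. t \<in> Tg"
    and K1: "t \<in> Tg \<Longrightarrow> AE s in lborel. s < t \<longrightarrow> (\<forall>r>0. (\<integral>\<^sup>+z\<in>{z. norm z \<ge> r}. ennreal (norm (K t s z)) \<partial>lborel)
       \<le> ennreal (N0 * (t - s) powr ((\<gamma> * e - 1) / 2) * r powr (- e / 2)))"
    and K2: "t \<in> Tg \<Longrightarrow> AE s in lborel. s < t \<longrightarrow> (\<forall>h. (\<integral>\<^sup>+z. ennreal (norm (K t s (z + h) - K t s z)) \<partial>lborel)
       \<le> ennreal (N0 * norm h * (t - s) powr (- 1 / 2 - \<gamma>)))"
    and K3: "t \<in> Tg \<Longrightarrow> t' \<in> Tg \<Longrightarrow> t' < t \<Longrightarrow> AE s in lborel. s < t' \<longrightarrow>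
       (\<integral>\<^sup>+z. ennreal (norm (K t s z - K t' s z)) \<partial>lborel) \<le> ennreal (N0 * (t - t') * (t' - s) powr (- 3 / 2))"
    and K4: "AE s in lborel. \<forall>\<xi>. (\<integral>\<^sup>+t. ennreal ((norm (fourier (K t s) \<xi>))\<^sup>2) \<partial>lborel) \<le> ennreal C0"
begin

definition V :: "(real \<times> 'a \<Rightarrow> 'h) \<Rightarrow> real \<Rightarrow> real \<Rightarrow> 'a \<Rightarrow> 'h" where
  "V f t s x = convol m (K t s) (\<lambda>y. f (s, y)) x"

definition SQ :: "(real \<times> 'a \<Rightarrow> 'h) \<Rightarrow> real set \<Rightarrow> real \<times> 'a \<Rightarrow> ennreal" where
  "SQ f I z = (\<integral>\<^sup>+s\<in>I. ennreal ((norm (V f (fst z) s (snd z)))\<^sup>2) \<partial>lborel)"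

lemma K_meas' [measurable (raw)]:
  assumes "f \<in> borel_measurable M" "g \<in> borel_measurable M" "h \<in> borel_measurable M"
  shows "(\<lambda>w. K (f w) (g w) (h w)) \<in> borel_measurable M"
proof -
  have "(\<lambda>w. (f w, (g w, h w))) \<in> borel_measurable M" using assms by simp
  from measurable_compose[OF this K_meas] show ?thesis by simp
qed

lemma V_norm_measurable [measurable (raw)]:
  assumes f: "cc_fun f" and [measurable]: "ft \<in> borel_measurable M" "fs \<in> borel_measurable M" "fx \<in> borel_measurable M"
  shows "(\<lambda>w. norm (V f (ft w) (fs w) (fx w))) \<in> borel_measurable M"
proof -
  have cf: "continuous_on UNIV f" using f by (simp add: cc_fun_def)
  have cm: "(\<lambda>z. cip (f (snd (fst z), fst (snd z))) (f (snd (fst z), snd (snd z)))) \<in> borel_measurable (borel :: ((real \<times> real) \<times> ('a \<times> 'a)) measure)"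
    by (intro borel_measurable_continuous_onI continuous_intros continuous_on_compose2[OF cf]) auto
  have "(\<lambda>z. norm (convol m (K (fst (fst z)) (snd (fst z))) (\<lambda>y. f (snd (fst z), y)) (snd z)))
      \<in> borel_measurable ((borel :: (real \<times> real) measure) \<Otimes>\<^sub>M (borel :: 'a measure))"
    by (rule convol_norm_measurable[where k = "\<lambda>p. K (fst p) (snd p)" and u = "\<lambda>p y. f (snd p, y)"])
       (use K_int K_S cc_fun_slice[OF f] cm in \<open>simp_all add: borel_prod\<close>)
  moreover have "(\<lambda>w. ((ft w, fs w), fx w)) \<in> M \<rightarrow>\<^sub>M ((borel :: (real \<times> real) measure) \<Otimes>\<^sub>M (borel :: 'a measure))"
    by measurable
  ultimately have "(\<lambda>w. (\<lambda>z. norm (convol m (K (fst (fst z)) (snd (fst z))) (\<lambda>y. f (snd (fst z), y)) (snd z))) ((ft w, fs w), fx w)) \<in> borel_measurable M"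
    by (rule measurable_compose[rotated])
  then show ?thesis by (simp add: V_def)
qed

lemma SQ_measurable:
  assumes f: "cc_fun f" and [measurable]: "I \<in> sets borel"
  shows "SQ f I \<in> borel_measurable borel"
  unfolding SQ_def[abs_def] using f by measurable

text \<open>By Tonelli \<open>s\<close> becomes the outermost variable, and the inner integral over
  \<open>t\<close> and \<open>x\<close> is the one bounded by
  \<open>Plancherel_bound\<close>.\<close>

lemma SQ_integral:
  assumes f: "cc_fun f" and I[measurable]: "I \<in> sets borel"
  shows "(\<integral>\<^sup>+z. SQ f I z \<partial>lborel)
    \<le> ennreal C0 * (\<integral>\<^sup>+s\<in>I. \<integral>\<^sup>+x. ennreal ((norm (f (s, x)))\<^sup>2) \<partial>lborel \<partial>lborel)"
proof -
  have "(\<integral>\<^sup>+z. SQ f I z \<partial>lborel) = (\<integral>\<^sup>+t. \<integral>\<^sup>+x. SQ f I (t, x) \<partial>lborel \<partial>lborel)"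
    unfolding lborel_prod[symmetric]
    by (rule lborel.nn_integral_fst[symmetric]) (use SQ_measurable[OF f I] in \<open>simp add: lborel_prod\<close>)
  also have "\<dots> = (\<integral>\<^sup>+t. \<integral>\<^sup>+s. \<integral>\<^sup>+x. ennreal ((norm (V f t s x))\<^sup>2) * indicator I s \<partial>lborel \<partial>lborel \<partial>lborel)"
    unfolding SQ_def fst_conv snd_conv using f
    by (intro nn_integral_cong lborel_pair.Fubini') measurable
  also have "\<dots> = (\<integral>\<^sup>+s. \<integral>\<^sup>+t. \<integral>\<^sup>+x. ennreal ((norm (V f t s x))\<^sup>2) * indicator I s \<partial>lborel \<partial>lborel \<partial>lborel)"
    using f by (intro lborel_pair.Fubini') measurable
  also have "\<dots> = (\<integral>\<^sup>+s\<in>I. \<integral>\<^sup>+t. \<integral>\<^sup>+x. ennreal ((norm (V f t s x))\<^sup>2) \<partial>lborel \<partial>lborel \<partial>lborel)"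
    using f by (simp add: nn_integral_multc)
  also have "\<dots> \<le> (\<integral>\<^sup>+s. ennreal C0 * ((\<integral>\<^sup>+x. ennreal ((norm (f (s, x)))\<^sup>2) \<partial>lborel) * indicator I s) \<partial>lborel)"
  proof (rule nn_integral_mono_AE)
    show "AE s in lborel. (\<integral>\<^sup>+t. \<integral>\<^sup>+x. ennreal ((norm (V f t s x))\<^sup>2) \<partial>lborel \<partial>lborel) * indicator I s
      \<le> ennreal C0 * ((\<integral>\<^sup>+x. ennreal ((norm (f (s, x)))\<^sup>2) \<partial>lborel) * indicator I s)"
      using K4
    proof eventually_elim
      case (elim s)
      have "(\<integral>\<^sup>+t. \<integral>\<^sup>+x. ennreal ((norm (convol m (K t s) (\<lambda>y. f (s, y)) x))\<^sup>2) \<partial>lborel \<partial>lborel)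
        \<le> ennreal C0 * (\<integral>\<^sup>+x. ennreal ((norm (f (s, x)))\<^sup>2) \<partial>lborel)"
        by (rule Plancherel_bound) (use K_int K_S elim cc_fun_slice[OF f] in \<open>auto\<close>)
      then show ?case unfolding V_def[symmetric] by (simp add: mult.assoc[symmetric] mult_right_mono)
    qed
  qed
  also have "\<dots> = ennreal C0 * (\<integral>\<^sup>+s\<in>I. \<integral>\<^sup>+x. ennreal ((norm (f (s, x)))\<^sup>2) \<partial>lborel \<partial>lborel)"
  proof (rule nn_integral_cmult)
    have cf: "continuous_on UNIV f" using f by (simp add: cc_fun_def)
    have [measurable]: "(\<lambda>z. norm (f z)) \<in> borel_measurable borel"
      by (intro borel_measurable_continuous_onI continuous_intros cf)
    show "(\<lambda>s. (\<integral>\<^sup>+x. ennreal ((norm (f (s, x)))\<^sup>2) \<partial>lborel) * indicator I s) \<in> borel_measurable lborel"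
      by measurable
  qed
  finally show ?thesis .
qed

lemma SQ_L2:
  assumes f: "cc_fun f"
  shows "(\<integral>\<^sup>+z. SQ f UNIV z \<partial>lborel) \<le> ennreal C0 * (\<integral>\<^sup>+z. ennreal ((norm (f z))\<^sup>2) \<partial>lborel)"
proof -
  have cf: "continuous_on UNIV f" using f by (simp add: cc_fun_def)
  have [measurable]: "(\<lambda>z. norm (f z)) \<in> borel_measurable borel"
    by (intro borel_measurable_continuous_onI continuous_intros cf)
  have "(\<integral>\<^sup>+s\<in>UNIV. \<integral>\<^sup>+x. ennreal ((norm (f (s, x)))\<^sup>2) \<partial>lborel \<partial>lborel) = (\<integral>\<^sup>+z. ennreal ((norm (f z))\<^sup>2) \<partial>lborel)"
    using lborel.nn_integral_fst[of "\<lambda>z. ennreal ((norm (f z))\<^sup>2)" "lborel :: real measure"] by (simp add: lborel_prod)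
  then show ?thesis using SQ_integral[OF f, of UNIV] by simp
qed

end

lemma nn_set_integral_add3_le:
  assumes [measurable]: "a \<in> borel_measurable M" "b \<in> borel_measurable M" "c \<in> borel_measurable M" "I \<in> sets M"
    and le: "AE s in M. s \<in> I \<longrightarrow> v s \<le> 3 * (a s + b s + c s)"
  shows "(\<integral>\<^sup>+s\<in>I. v s \<partial>M) \<le> (3::ennreal) * ((\<integral>\<^sup>+s\<in>I. a s \<partial>M) + (\<integral>\<^sup>+s\<in>I. b s \<partial>M) + (\<integral>\<^sup>+s\<in>I. c s \<partial>M))"
proof -
  have "(\<integral>\<^sup>+s\<in>I. v s \<partial>M) \<le> (\<integral>\<^sup>+s. 3 * (a s * indicator I s + b s * indicator I s + c s * indicator I s) \<partial>M)"
    by (rule nn_integral_mono_AE, rule AE_mp[OF le]) (auto simp: indicator_def)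
  also have "\<dots> = 3 * ((\<integral>\<^sup>+s\<in>I. a s \<partial>M) + (\<integral>\<^sup>+s\<in>I. b s \<partial>M) + (\<integral>\<^sup>+s\<in>I. c s \<partial>M))"
    by (simp add: nn_integral_cmult nn_integral_add)
  finally show ?thesis .
qed

lemma ennreal_norm_sq_add3:
  fixes a b c :: "'h::real_normed_vector"
  assumes "A \<ge> (norm a)\<^sup>2" "B \<ge> (norm b)\<^sup>2" "C \<ge> (norm c)\<^sup>2"
  shows "ennreal ((norm (a + b + c))\<^sup>2) \<le> 3 * (ennreal A + ennreal B + ennreal C)"
proof -
  have 0: "A \<ge> 0" "B \<ge> 0" "C \<ge> 0" using assms zero_le_power2 order_trans by blast+
  have "(norm (a + b + c))\<^sup>2 \<le> 3 * (A + B + C)"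
    using norm_sq_add3[of a b c] assms by simp
  then have "ennreal ((norm (a + b + c))\<^sup>2) \<le> ennreal (3 * (A + B + C))" by (rule ennreal_leI)
  then show ?thesis using ennreal_add3[OF 0] by simp
qed

lemma ex_in_set_of_AE:
  assumes "AE z in M. P z" "emeasure M Q > 0" "Q \<in> sets M"
  shows "\<exists>z\<in>Q. P z"
proof (rule ccontr)
  assume "\<not> ?thesis"
  then have "AE z in M. z \<notin> Q" using assms(1) by (auto elim: AE_mp)
  then have "Q \<in> null_sets M" using assms(3) AE_iff_null_sets by blast
  then show False using assms(2) by (simp add: null_sets_def)
qed

lemma (in scalar_hilbert) convol_zero_left: "convol m (\<lambda>x. 0) u x = 0"
proof -
  have "m 0 v = 0" for v using m_real[of 0 v] by simp
  then show ?thesis by (simp add: convol_def)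
qed

text \<open>The radial retraction onto the ball of radius \<open>l\<close>; written with
  \<open>max\<close> it is a single formula, continuous for \<open>l > 0\<close>.\<close>

definition truncate_norm :: "real \<Rightarrow> ('b \<Rightarrow> 'h::real_normed_vector) \<Rightarrow> 'b \<Rightarrow> 'h" where
  "truncate_norm l f z = (l / max l (norm (f z))) *\<^sub>R f z"

lemma truncate_norm:
  assumes l: "l > 0"
  shows "norm (truncate_norm l f z) \<le> l" "norm (f z - truncate_norm l f z) \<le> norm (f z)"
    "norm (f z) \<le> l \<Longrightarrow> f z - truncate_norm l f z = 0"
proof -
  have mx: "max l (norm (f z)) > 0" using l by simp
  have "l * norm (f z) \<le> l * max l (norm (f z))" using l by simp
  then show "norm (truncate_norm l f z) \<le> l" using l mx by (simp add: truncate_norm_def field_simps)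
  have "f z - truncate_norm l f z = (1 - l / max l (norm (f z))) *\<^sub>R f z"
    by (simp add: truncate_norm_def scaleR_diff_left)
  moreover have "0 \<le> 1 - l / max l (norm (f z))" "1 - l / max l (norm (f z)) \<le> 1" using l mx by (auto simp: field_simps)
  ultimately show "norm (f z - truncate_norm l f z) \<le> norm (f z)" by (simp add: mult_left_le_one_le)
  show "norm (f z) \<le> l \<Longrightarrow> f z - truncate_norm l f z = 0" using l by (simp add: truncate_norm_def max_def)
qed

lemma cc_fun_truncate:
  assumes l: "l > 0" and f: "cc_fun f"
  shows "cc_fun (truncate_norm l f)" "cc_fun (\<lambda>z. f z - truncate_norm l f z)"
proof -
  have c: "continuous_on UNIV f" using f by (simp add: cc_fun_def)
  have m: "max l (norm (f z)) \<noteq> 0" for z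
    using less_le_trans[OF l max.cobounded1[of l "norm (f z)"]] by simp
  have g: "continuous_on UNIV (\<lambda>z. l / max l (norm (f z)))" by (intro continuous_intros c ballI m)
  have "cc_fun (\<lambda>z. (l / max l (norm (f z))) *\<^sub>R f z)" by (rule cc_fun_scaleR[OF f g])
  then show "cc_fun (truncate_norm l f)" by (simp add: truncate_norm_def[abs_def])
  have "cc_fun (\<lambda>z. (1 - l / max l (norm (f z))) *\<^sub>R f z)" by (rule cc_fun_scaleR[OF f]) (intro continuous_intros g)
  then show "cc_fun (\<lambda>z. f z - truncate_norm l f z)" by (simp add: truncate_norm_def scaleR_diff_left)
qed

context sqkernel
begin

lemma V_zero: "s \<ge> t \<Longrightarrow> V f t s x = 0"
proof -
  assume "s \<ge> t"
  then have "K t s = (\<lambda>x. 0)" using K_zero by auto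
  then show ?thesis by (simp add: V_def convol_zero_left)
qed

lemma V_add:
  assumes "cc_fun f" "cc_fun g" shows "V (\<lambda>z. f z + g z) t s x = V f t s x + V g t s x"
  unfolding V_def by (rule convol_add_right[OF K_int K_S cc_fun_slice[OF assms(1)] cc_fun_slice[OF assms(2)]])

text \<open>First the time is moved at the point \<open>x\<close>, then the point at the time
  \<open>t1\<close>, so that translations are needed at the reference time only.\<close>

lemma V_space_time_diff:
  assumes f: "cc_fun f" and A: "\<And>z. norm (f z) \<le> A"
    and t: "(\<integral>\<^sup>+z. ennreal (norm (K t s z - K t1 s z)) \<partial>lborel) \<le> ennreal M1" "M1 \<ge> 0"
    and x: "(\<integral>\<^sup>+z. ennreal (norm (K t1 s (z + (x - x1)) - K t1 s z)) \<partial>lborel) \<le> ennreal M2" "M2 \<ge> 0"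
  shows "norm (V f t s x - V f t1 s x1) \<le> A * (M1 + M2)"
proof -
  let ?u = "\<lambda>y. f (s, y)"
  note u = cc_fun_slice[OF f, of s]
  have sh: "integrable lborel (\<lambda>z. K t1 s (z + (x - x1)))"
    using K_int[of t1 s] integrable_distr_eq[of "\<lambda>z. (x - x1) + z" lborel borel "K t1 s"] lborel_shift[of "x - x1"]
    by (simp add: add.commute)
  have "V f t s x - V f t1 s x = convol m (\<lambda>z. K t s z - K t1 s z) ?u x"
    unfolding V_def by (rule convol_diff_left[OF K_int K_S K_int K_S u, symmetric])
  moreover have "V f t1 s x - V f t1 s x1 = convol m (\<lambda>z. K t1 s (z + (x - x1)) - K t1 s z) ?u x1"
    unfolding V_def convol_diff_left[OF sh K_S K_int K_S u] convol_shift[symmetric] by simp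
  moreover have "norm (convol m (\<lambda>z. K t s z - K t1 s z) ?u x) \<le> A * M1"
    by (rule convol_bound_nn[OF _ _ u A t]) (auto intro: K_int K_S diff_in_S)
  moreover have "norm (convol m (\<lambda>z. K t1 s (z + (x - x1)) - K t1 s z) ?u x1) \<le> A * M2"
    by (rule convol_bound_nn[OF _ _ u A x]) (auto intro: sh K_int K_S diff_in_S)
  ultimately have "norm (V f t s x - V f t1 s x) + norm (V f t1 s x - V f t1 s x1) \<le> A * M1 + A * M2"
    by (simp only: add_mono)
  moreover have "V f t s x - V f t1 s x1 = (V f t s x - V f t1 s x) + (V f t1 s x - V f t1 s x1)" by simp
  ultimately show ?thesis
    using norm_triangle_ineq[of "V f t s x - V f t1 s x" "V f t1 s x - V f t1 s x1"] unfolding distrib_left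
    by (simp only: order_trans)
qed

end

section \<open>Mean oscillation on one cell\<close>

locale sqkernel_cell = sqkernel S m K Tg \<gamma> e N0 C0
  for S and m :: "complex \<Rightarrow> 'h::{real_inner,complete_space} \<Rightarrow> 'h"
    and K :: "real \<Rightarrow> real \<Rightarrow> 'a::euclidean_space \<Rightarrow> complex" and Tg :: "real set" and \<gamma> e N0 C0 :: real +
  fixes f :: "real \<times> 'a \<Rightarrow> 'h" and A :: real and n :: int and z :: "real \<times> 'a"
  assumes f: "cc_fun f" and A: "\<And>z. norm (f z) \<le> A"
begin

abbreviation "T \<equiv> cell_time \<gamma> n"
abbreviation "R \<equiv> cell_side n"
abbreviation "Q \<equiv> aniso_cell \<gamma> n z"

text \<open>
  The time \<open>b\<close> separates the recent from the distant past of the cell; \<open>cutoff\<close> is supported in a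
  fixed multiple of the spatial part of the cell and equals 1 on a neighbourhood of it.
\<close>

definition "b = fst z - 2 * T"

definition cutoff :: "'a \<Rightarrow> real" where
  "cutoff y = max 0 (min 1 ((real DIM('a)) + 2 - norm (y - snd z) / R))"

definition floc :: "real \<times> 'a \<Rightarrow> 'h" where "floc w = cutoff (snd w) *\<^sub>R f w"
definition ffar :: "real \<times> 'a \<Rightarrow> 'h" where "ffar w = (1 - cutoff (snd w)) *\<^sub>R f w"

lemma TR: "T > 0" "R > 0" "R \<le> T powr \<gamma>" "T powr \<gamma> \<le> 2 powr \<gamma> * R"
  by (auto simp: cell_time_pos cell_side_pos cell_side_le_time[OF \<gamma>])

lemma A_nonneg: "A \<ge> 0" using A[of z] norm_ge_zero order_trans by blast

lemma cutoff: "0 \<le> cutoff y" "cutoff y \<le> 1"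
  and cutoff_one: "norm (y - snd z) \<le> ((real DIM('a)) + 1) * R \<Longrightarrow> cutoff y = 1"
  and cutoff_zero: "norm (y - snd z) > ((real DIM('a)) + 2) * R \<Longrightarrow> cutoff y = 0"
  using TR(2) by (auto simp: cutoff_def max_def min_def field_simps)

lemma cutoff_continuous: "continuous_on UNIV cutoff"
  unfolding cutoff_def[abs_def] using TR(2) by (intro continuous_intros) auto

lemma cc_parts: "cc_fun floc" "cc_fun ffar"
  unfolding floc_def[abs_def] ffar_def[abs_def]
  by (intro cc_fun_scaleR[OF f] continuous_intros continuous_on_compose2[OF cutoff_continuous]; simp)+

lemma norm_parts: "norm (floc w) \<le> A" "norm (ffar w) \<le> A"
  using mult_mono[OF cutoff(2) A] mult_mono[of "1 - cutoff (snd w)" 1 "norm (f w)" A] cutoff[of "snd w"] A[of w] A_nonneg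
  by (auto simp: floc_def ffar_def abs_of_nonneg)

lemma cell_diff:
  assumes "w \<in> Q" shows "\<bar>fst w - fst z\<bar> \<le> T" "norm (snd w - snd z) \<le> (real DIM('a)) * R"
  using aniso_cell_diff[OF assms] by auto

text \<open>All times of the cell are at most \<open>b + 3 * T\<close>, and \<open>floc\<close>
  lives over a ball of radius comparable to \<open>R\<close>. So the global \<open>L\<^sub>2\<close>
  bound over this window already has the order of the volume of the cell.\<close>

lemma local_part:
  "(\<integral>\<^sup>+w\<in>Q. SQ floc {b..} w \<partial>lborel) \<le> ennreal (3 * C0 * A\<^sup>2 * (unit_ball_vol (real DIM('a)) * ((real DIM('a)) + 2) ^ DIM('a)) * (T * R ^ DIM('a)))"
proof -
  let ?\<rho> = "((real DIM('a)) + 2) * R"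
  let ?I = "{b..b + 3 * T}"
  have \<rho>: "?\<rho> \<ge> 0" using TR by simp
  have "(\<integral>\<^sup>+w\<in>Q. SQ floc {b..} w \<partial>lborel) \<le> (\<integral>\<^sup>+w. SQ floc ?I w \<partial>lborel)"
  proof (rule nn_integral_mono)
    fix w
    show "SQ floc {b..} w * indicator Q w \<le> SQ floc ?I w"
    proof (cases "w \<in> Q")
      case True
      then have "fst w \<le> b + 3 * T" using cell_diff(1)[OF True] by (simp add: b_def)
      then have "SQ floc {b..} w \<le> SQ floc ?I w"
        unfolding SQ_def by (intro nn_integral_mono) (auto simp: indicator_def V_zero)
      then show ?thesis using True by simp
    qed simp
  qed
  also have "\<dots> \<le> ennreal C0 * (\<integral>\<^sup>+s\<in>?I. \<integral>\<^sup>+x. ennreal ((norm (floc (s, x)))\<^sup>2) \<partial>lborel \<partial>lborel)"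
    by (rule SQ_integral[OF cc_parts(1)]) simp
  also have "(\<integral>\<^sup>+s\<in>?I. \<integral>\<^sup>+x. ennreal ((norm (floc (s, x)))\<^sup>2) \<partial>lborel \<partial>lborel)
      \<le> (\<integral>\<^sup>+s. ennreal (A\<^sup>2 * (unit_ball_vol (real DIM('a)) * ?\<rho> ^ DIM('a))) * indicator ?I s \<partial>lborel)"
  proof (intro nn_integral_mono mult_right_mono)
    fix s
    have "(\<integral>\<^sup>+x. ennreal ((norm (floc (s, x)))\<^sup>2) \<partial>lborel) \<le> (\<integral>\<^sup>+x. ennreal (A\<^sup>2) * indicator (cball (snd z) ?\<rho>) x \<partial>lborel)"
    proof (rule nn_integral_mono)
      fix x
      have "(norm (floc (s, x)))\<^sup>2 \<le> A\<^sup>2" by (intro power_mono norm_parts) simp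
      moreover have "x \<notin> cball (snd z) ?\<rho> \<Longrightarrow> floc (s, x) = 0"
        using cutoff_zero[of x] by (simp add: floc_def dist_norm norm_minus_commute)
      ultimately show "ennreal ((norm (floc (s, x)))\<^sup>2) \<le> ennreal (A\<^sup>2) * indicator (cball (snd z) ?\<rho>) x"
        by (auto simp: indicator_def intro: ennreal_leI)
    qed
    also have "\<dots> = ennreal (A\<^sup>2) * ennreal (unit_ball_vol (real DIM('a)) * ?\<rho> ^ DIM('a))"
      using \<rho> by (simp add: nn_integral_cmult_indicator emeasure_cball)
    also have "\<dots> = ennreal (A\<^sup>2 * (unit_ball_vol (real DIM('a)) * ?\<rho> ^ DIM('a)))"
      using \<rho> by (intro ennreal_mult[symmetric]) auto
    finally show "(\<integral>\<^sup>+x. ennreal ((norm (floc (s, x)))\<^sup>2) \<partial>lborel) \<le> ennreal (A\<^sup>2 * (unit_ball_vol (real DIM('a)) * ?\<rho> ^ DIM('a)))" .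
  qed simp
  also have "(\<integral>\<^sup>+s. ennreal (A\<^sup>2 * (unit_ball_vol (real DIM('a)) * ?\<rho> ^ DIM('a))) * indicator ?I s \<partial>lborel)
      = ennreal (A\<^sup>2 * (unit_ball_vol (real DIM('a)) * ?\<rho> ^ DIM('a))) * ennreal (3 * T)"
    using TR by (simp add: nn_integral_cmult_indicator)
  also have "ennreal C0 * \<dots> = ennreal (C0 * (A\<^sup>2 * (unit_ball_vol (real DIM('a)) * ?\<rho> ^ DIM('a)) * (3 * T)))"
    using C0 TR \<rho> by (subst ennreal_mult[symmetric], simp, simp, subst ennreal_mult[symmetric]) auto
  also have "C0 * (A\<^sup>2 * (unit_ball_vol (real DIM('a)) * ?\<rho> ^ DIM('a)) * (3 * T))
      = 3 * C0 * A\<^sup>2 * (unit_ball_vol (real DIM('a)) * ((real DIM('a)) + 2) ^ DIM('a)) * (T * R ^ DIM('a))"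
    by (simp add: power_mult_distrib mult_ac)
  finally show ?thesis by (simp add: mult_left_mono)
qed

text \<open>The square of \<open>A\<close> times the bound of \<open>K1\<close> at
  \<open>r = R\<close>, cut to the time differences that occur between the cell and times after
  \<open>b\<close>.\<close>

definition far_bound :: "real \<Rightarrow> real \<Rightarrow> ennreal" where
  "far_bound t s = ennreal ((A * N0)\<^sup>2 * R powr (- e)) * (ennreal ((t - s) powr (\<gamma> * e - 1)) * indicator {0<..3 * T} (t - s))"

text \<open>In space the cell stays within \<open>DIM('a) * R\<close> of its base point while
  \<open>ffar\<close> vanishes up to \<open>(DIM('a) + 1) * R\<close>; this leaves the distance
  \<open>R\<close> for the tail bound.\<close>

lemma far_part_pointwise:
  assumes w: "w \<in> Q" "fst w \<in> Tg"
  shows "AE s in lborel. s \<in> {b..} \<longrightarrow> ennreal ((norm (V ffar (fst w) s (snd w)))\<^sup>2) \<le> far_bound (fst w) s"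
  using K1[OF w(2)]
proof eventually_elim
  case (elim s)
  show ?case
  proof
    assume s: "s \<in> {b..}"
    show "ennreal ((norm (V ffar (fst w) s (snd w)))\<^sup>2) \<le> far_bound (fst w) s"
    proof (cases "s < fst w")
      case False then show ?thesis by (simp add: V_zero)
    next
      case True
      let ?\<tau> = "fst w - s"
      let ?N = "N0 * ?\<tau> powr ((\<gamma> * e - 1) / 2) * R powr (- e / 2)"
      have \<tau>: "?\<tau> > 0" "?\<tau> \<le> 3 * T" using True s cell_diff(1)[OF w(1)] by (auto simp: b_def)
      have "norm (V ffar (fst w) s (snd w)) \<le> A * ?N"
        unfolding V_def
      proof (rule convol_bound_far[OF K_int K_S cc_fun_slice[OF cc_parts(2)] norm_parts(2), where r = R])
        fix y assume "norm (snd w - y) < R"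
        then have "norm (y - snd z) \<le> ((real DIM('a)) + 1) * R"
          using cell_diff(2)[OF w(1)] norm_triangle_ineq[of "y - snd w" "snd w - snd z"]
          by (simp add: norm_minus_commute distrib_right)
        then show "ffar (s, y) = 0" by (simp add: ffar_def cutoff_one)
      qed (use elim True TR N0 in auto)
      then have "(norm (V ffar (fst w) s (snd w)))\<^sup>2 \<le> (A * ?N)\<^sup>2" by (rule power_mono) simp
      also have "(A * ?N)\<^sup>2 = (A * N0)\<^sup>2 * R powr (- e) * ?\<tau> powr (\<gamma> * e - 1)"
      proof -
        have "(r powr (a / 2))\<^sup>2 = r powr a" if "r > 0" for r a :: real
          using that by (simp add: powr_power)
        from this[of R "- e"] this[of ?\<tau> "\<gamma> * e - 1"] show ?thesis using TR \<tau>
          by (simp add: power_mult_distrib mult_ac)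
      qed
      finally have "ennreal ((norm (V ffar (fst w) s (snd w)))\<^sup>2) \<le> ennreal ((A * N0)\<^sup>2 * R powr (- e) * ?\<tau> powr (\<gamma> * e - 1))"
        by (rule ennreal_leI)
      then show ?thesis using \<tau> by (simp add: far_bound_def ennreal_mult)
    qed
  qed
qed

text \<open>The exponent \<open>\<gamma> * e - 1\<close> exceeds -1, so the recent past is
  integrable, and the resulting \<open>T powr (\<gamma> * e)\<close> cancels
  \<open>R powr (- e)\<close> up to the factor \<open>2 powr (\<gamma> * e)\<close> from
  rounding.\<close>

lemma far_part:
  "(\<integral>\<^sup>+s\<in>I. far_bound t s \<partial>lborel) \<le> ennreal (A\<^sup>2 * (N0\<^sup>2 * (3 powr (\<gamma> * e) * 2 powr (\<gamma> * e) / (\<gamma> * e))))"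
proof -
  have ge: "\<gamma> * e > 0" using \<gamma> e by simp
  let ?c = "(A * N0)\<^sup>2 * R powr (- e)"
  have "(\<integral>\<^sup>+s\<in>I. far_bound t s \<partial>lborel) \<le> (\<integral>\<^sup>+s. far_bound t s \<partial>lborel)"
    by (intro nn_integral_mono) (simp add: indicator_def)
  also have "\<dots> = ennreal ?c * (\<integral>\<^sup>+s. ennreal ((t - s) powr (\<gamma> * e - 1)) * indicator {0<..3 * T} (t - s) \<partial>lborel)"
    unfolding far_bound_def by (rule nn_integral_cmult) measurable
  also have "(\<integral>\<^sup>+s. ennreal ((t - s) powr (\<gamma> * e - 1)) * indicator {0<..3 * T} (t - s) \<partial>lborel)
      = (\<integral>\<^sup>+\<tau>\<in>{0<..3 * T}. ennreal (\<tau> powr (\<gamma> * e - 1)) \<partial>lborel)"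
    by (rule nn_integral_reflect[where f = "\<lambda>\<tau>. ennreal (\<tau> powr (\<gamma> * e - 1)) * indicator {0<..3 * T} \<tau>"]) measurable
  also have "\<dots> = ennreal ((3 * T) powr (\<gamma> * e) / (\<gamma> * e))"
    using TR by (intro nn_integral_powr_near_0[OF ge]) simp
  also have "ennreal ?c * \<dots> = ennreal (?c * ((3 * T) powr (\<gamma> * e) / (\<gamma> * e)))"
    using ge by (intro ennreal_mult[symmetric]) auto
  also have "\<dots> \<le> ennreal (A\<^sup>2 * (N0\<^sup>2 * (3 powr (\<gamma> * e) * 2 powr (\<gamma> * e) / (\<gamma> * e))))"
  proof (rule ennreal_leI)
    have "(3 * T) powr (\<gamma> * e) = 3 powr (\<gamma> * e) * (T powr \<gamma>) powr e" using TR by (simp add: powr_mult powr_powr)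
    also have "(T powr \<gamma>) powr e \<le> (2 powr \<gamma> * R) powr e" using TR e by (intro powr_mono2) auto
    also have "(2 powr \<gamma> * R) powr e = 2 powr (\<gamma> * e) * R powr e" using TR by (simp add: powr_mult powr_powr)
    finally have "(3 * T) powr (\<gamma> * e) \<le> 3 powr (\<gamma> * e) * (2 powr (\<gamma> * e) * R powr e)" by simp
    then have "?c * ((3 * T) powr (\<gamma> * e) / (\<gamma> * e)) \<le> ?c * (3 powr (\<gamma> * e) * (2 powr (\<gamma> * e) * R powr e) / (\<gamma> * e))"
      using ge by (intro mult_left_mono divide_right_mono) auto
    also have "\<dots> = A\<^sup>2 * (N0\<^sup>2 * (3 powr (\<gamma> * e) * 2 powr (\<gamma> * e) / (\<gamma> * e))) * (R powr (- e) * R powr e)"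
      by (simp add: power_mult_distrib)
    also have "R powr (- e) * R powr e = 1" using TR by (simp add: powr_add[symmetric])
    finally show "?c * ((3 * T) powr (\<gamma> * e) / (\<gamma> * e)) \<le> A\<^sup>2 * (N0\<^sup>2 * (3 powr (\<gamma> * e) * 2 powr (\<gamma> * e) / (\<gamma> * e)))" by simp
  qed
  finally show ?thesis .
qed

text \<open>\<open>b + T = fst z - T\<close> bounds the times of the cell from below, so
  \<open>b + T - s\<close> bounds all time differences to \<open>s\<close> from below. The two terms
  are twice the squares of the time bound, for times at most \<open>2 * T\<close> apart, and of the
  translation bound, for shifts of at most \<open>2 * DIM('a) * R\<close>.\<close>

definition past_bound :: "real \<Rightarrow> real" where
  "past_bound s = A\<^sup>2 * N0\<^sup>2 * (8 * T\<^sup>2 * (b + T - s) powr (- 1 - 2) + 8 * (real DIM('a))\<^sup>2 * R\<^sup>2 * (b + T - s) powr (- 1 - 2 * \<gamma>))"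

text \<open>\<open>K3\<close> presupposes ordered times; the common lower bound
  \<open>\<sigma>0\<close> makes the estimate symmetric.\<close>

lemma K3_sym:
  assumes t: "t \<in> Tg" "t1 \<in> Tg" "\<sigma>0 \<le> t" "\<sigma>0 \<le> t1" "\<bar>t - t1\<bar> \<le> D"
  shows "AE s in lborel. s < \<sigma>0 \<longrightarrow> (\<integral>\<^sup>+z. ennreal (norm (K t s z - K t1 s z)) \<partial>lborel) \<le> ennreal (N0 * D * (\<sigma>0 - s) powr (- 3 / 2))"
proof -
  have *: "AE s in lborel. s < \<sigma>0 \<longrightarrow> (\<integral>\<^sup>+z. ennreal (norm (K p s z - K q s z)) \<partial>lborel) \<le> ennreal (N0 * D * (\<sigma>0 - s) powr (- 3 / 2))"
    if p: "p \<in> Tg" "q \<in> Tg" "\<sigma>0 \<le> q" "q < p" "p - q \<le> D" for p q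
    using K3[OF p(1,2,4)]
  proof eventually_elim
    case (elim s)
    show ?case
    proof
      assume s: "s < \<sigma>0"
      have "N0 * (p - q) * (q - s) powr (- 3 / 2) \<le> N0 * D * (\<sigma>0 - s) powr (- 3 / 2)"
        using N0 p s by (intro mult_mono powr_mono2') auto
      then show "(\<integral>\<^sup>+z. ennreal (norm (K p s z - K q s z)) \<partial>lborel) \<le> ennreal (N0 * D * (\<sigma>0 - s) powr (- 3 / 2))"
        using elim s p by (auto intro: order_trans ennreal_leI)
    qed
  qed
  consider "t1 < t" | "t < t1" | "t = t1" by linarith
  then show ?thesis
  proof cases
    case 1 then show ?thesis using *[of t t1] t by auto
  next
    case 2 then show ?thesis using *[of t1 t] t by (auto simp: norm_minus_commute)
  qed simp
qed

lemma past_part_pointwise: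
  assumes w: "w \<in> Q" "fst w \<in> Tg" and w1: "w1 \<in> Q" "fst w1 \<in> Tg"
  shows "AE s in lborel. s \<in> {..<b} \<longrightarrow> (norm (V f (fst w) s (snd w) - V f (fst w1) s (snd w1)))\<^sup>2 \<le> past_bound s"
proof -
  let ?\<sigma> = "\<lambda>s. b + T - s"
  note cd = cell_diff[OF w(1)] cell_diff[OF w1(1)]
  have "AE s in lborel. s < b + T \<longrightarrow> (\<integral>\<^sup>+z. ennreal (norm (K (fst w) s z - K (fst w1) s z)) \<partial>lborel)
      \<le> ennreal (N0 * (2 * T) * ?\<sigma> s powr (- 3 / 2))"
    by (rule K3_sym) (use w w1 cd in \<open>auto simp: b_def\<close>)
  then show ?thesis using K2[OF w1(2)]
  proof eventually_elim
    case (elim s)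
    show ?case
    proof
      assume "s \<in> {..<b}"
      then have s: "s < b" "s < b + T" "s < fst w1" "?\<sigma> s \<le> fst w1 - s" "?\<sigma> s > 0" using cd TR by (auto simp: b_def)
      have h: "norm (snd w - snd w1) \<le> 2 * (real DIM('a)) * R"
        using cd norm_triangle_ineq4[of "snd w - snd z" "snd w1 - snd z"] by simp
      let ?M1 = "N0 * (2 * T) * ?\<sigma> s powr (- 3 / 2)" and ?M2 = "N0 * (2 * (real DIM('a)) * R) * ?\<sigma> s powr (- 1 / 2 - \<gamma>)"
      have "norm (V f (fst w) s (snd w) - V f (fst w1) s (snd w1)) \<le> A * (?M1 + ?M2)"
      proof (rule V_space_time_diff[OF f A])
        show "(\<integral>\<^sup>+z. ennreal (norm (K (fst w) s z - K (fst w1) s z)) \<partial>lborel) \<le> ennreal ?M1" using elim s by blast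
        have "N0 * norm (snd w - snd w1) * (fst w1 - s) powr (- 1 / 2 - \<gamma>) \<le> ?M2"
          using N0 h s TR \<gamma> by (intro mult_mono powr_mono2') auto
        then show "(\<integral>\<^sup>+z. ennreal (norm (K (fst w1) s (z + (snd w - snd w1)) - K (fst w1) s z)) \<partial>lborel) \<le> ennreal ?M2"
          using elim(2) s by (meson ennreal_leI order_trans)
      qed (use N0 TR in auto)
      then have "(norm (V f (fst w) s (snd w) - V f (fst w1) s (snd w1)))\<^sup>2 \<le> (A * (?M1 + ?M2))\<^sup>2" by (rule power_mono) simp
      also have "\<dots> \<le> A\<^sup>2 * (2 * (?M1\<^sup>2 + ?M2\<^sup>2))"
        using zero_le_power2[of "?M1 - ?M2"] unfolding power_mult_distrib[of A]
        by (intro mult_left_mono) (auto simp: power2_eq_square algebra_simps)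
      also have "\<dots> = past_bound s"
      proof -
        have sq: "(r powr a)\<^sup>2 = r powr (2 * a)" if "r > 0" for r a :: real
          using that by (simp add: powr_power mult.commute)
        have p: "(?\<sigma> s powr (- 3 / 2))\<^sup>2 = ?\<sigma> s powr (- 1 - 2)" "(?\<sigma> s powr (- 1 / 2 - \<gamma>))\<^sup>2 = ?\<sigma> s powr (- 1 - 2 * \<gamma>)"
          using sq[OF s(5)] by simp_all
        show ?thesis unfolding past_bound_def power_mult_distrib p by (simp add: algebra_simps)
      qed
      finally show "(norm (V f (fst w) s (snd w) - V f (fst w1) s (snd w1)))\<^sup>2 \<le> past_bound s" .
    qed
  qed
qed

text \<open>Only differences \<open>\<tau> = b + T - s\<close> beyond \<open>T\<close> occur; then
  \<open>T\<^sup>2 * T powr (- 2) = 1\<close> and \<open>R \<le> T powr \<gamma>\<close> remove the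
  size of the cell from the bound.\<close>

lemma past_part:
  "(\<integral>\<^sup>+s\<in>{..<b}. ennreal (past_bound s) \<partial>lborel) \<le> ennreal (A\<^sup>2 * (N0\<^sup>2 * (4 + 4 * (real DIM('a))\<^sup>2 / \<gamma>)))"
proof -
  let ?c = "A\<^sup>2 * N0\<^sup>2"
  define g where "g \<tau> = ennreal (8 * T\<^sup>2 * ?c) * (ennreal (\<tau> powr (- 1 - 2)) * indicator {T..} \<tau>)
      + ennreal (8 * (real DIM('a))\<^sup>2 * R\<^sup>2 * ?c) * (ennreal (\<tau> powr (- 1 - 2 * \<gamma>)) * indicator {T..} \<tau>)" for \<tau> :: real
  have [measurable]: "g \<in> borel_measurable borel" unfolding g_def by measurable
  have "(\<integral>\<^sup>+s\<in>{..<b}. ennreal (past_bound s) \<partial>lborel) \<le> (\<integral>\<^sup>+s. g (b + T - s) \<partial>lborel)"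
  proof (intro nn_integral_mono)
    fix s
    show "ennreal (past_bound s) * indicator {..<b} s \<le> g (b + T - s)"
    proof (cases "s < b")
      case True
      have "past_bound s = 8 * T\<^sup>2 * ?c * (b + T - s) powr (- 1 - 2) + 8 * (real DIM('a))\<^sup>2 * R\<^sup>2 * ?c * (b + T - s) powr (- 1 - 2 * \<gamma>)"
        by (simp add: past_bound_def algebra_simps)
      then have "ennreal (past_bound s) = ennreal (8 * T\<^sup>2 * ?c) * ennreal ((b + T - s) powr (- 1 - 2)) + ennreal (8 * (real DIM('a))\<^sup>2 * R\<^sup>2 * ?c) * ennreal ((b + T - s) powr (- 1 - 2 * \<gamma>))"
        by (simp only:) (subst ennreal_plus, (auto intro!: mult_nonneg_nonneg arg_cong2[where f = "(+)"] ennreal_mult))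
      then show ?thesis using True by (simp add: g_def)
    qed simp
  qed
  also have "\<dots> = (\<integral>\<^sup>+\<tau>. g \<tau> \<partial>lborel)" by (rule nn_integral_reflect) measurable
  also have "\<dots> = ennreal (8 * T\<^sup>2 * ?c) * (\<integral>\<^sup>+\<tau>\<in>{T..}. ennreal (\<tau> powr (- 1 - 2)) \<partial>lborel)
      + ennreal (8 * (real DIM('a))\<^sup>2 * R\<^sup>2 * ?c) * (\<integral>\<^sup>+\<tau>\<in>{T..}. ennreal (\<tau> powr (- 1 - 2 * \<gamma>)) \<partial>lborel)"
    unfolding g_def by (subst nn_integral_add, measurable, subst (1 2) nn_integral_cmult, measurable)
  also have "\<dots> = ennreal (8 * T\<^sup>2 * ?c) * ennreal (T powr (- 2) / 2) + ennreal (8 * (real DIM('a))\<^sup>2 * R\<^sup>2 * ?c) * ennreal (T powr (- (2 * \<gamma>)) / (2 * \<gamma>))"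
    using TR \<gamma> by (subst (1 2) nn_integral_powr_tail) auto
  also have "\<dots> = ennreal (8 * T\<^sup>2 * ?c * (T powr (- 2) / 2) + 8 * (real DIM('a))\<^sup>2 * R\<^sup>2 * ?c * (T powr (- (2 * \<gamma>)) / (2 * \<gamma>)))"
  proof (subst ennreal_plus)
    have 1: "0 \<le> 8 * T\<^sup>2 * ?c" "0 \<le> 8 * (real DIM('a))\<^sup>2 * R\<^sup>2 * ?c" "0 \<le> T powr (- 2) / 2" "0 \<le> T powr (- (2 * \<gamma>)) / (2 * \<gamma>)"
      using \<gamma> by auto
    then show "0 \<le> 8 * T\<^sup>2 * ?c * (T powr (- 2) / 2)" "0 \<le> 8 * (real DIM('a))\<^sup>2 * R\<^sup>2 * ?c * (T powr (- (2 * \<gamma>)) / (2 * \<gamma>))"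
      by (blast intro: mult_nonneg_nonneg)+
    show "ennreal (8 * T\<^sup>2 * ?c) * ennreal (T powr (- 2) / 2) + ennreal (8 * (real DIM('a))\<^sup>2 * R\<^sup>2 * ?c) * ennreal (T powr (- (2 * \<gamma>)) / (2 * \<gamma>))
      = ennreal (8 * T\<^sup>2 * ?c * (T powr (- 2) / 2)) + ennreal (8 * (real DIM('a))\<^sup>2 * R\<^sup>2 * ?c * (T powr (- (2 * \<gamma>)) / (2 * \<gamma>)))"
      by (simp only: ennreal_mult[OF 1(1) 1(3)] ennreal_mult[OF 1(2) 1(4)])
  qed
  also have "\<dots> \<le> ennreal (A\<^sup>2 * (N0\<^sup>2 * (4 + 4 * (real DIM('a))\<^sup>2 / \<gamma>)))"
  proof (rule ennreal_leI)
    have 1: "T\<^sup>2 * T powr (- 2) = 1" using TR by (simp add: powr_minus powr_numeral)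
    have "R\<^sup>2 \<le> (T powr \<gamma>)\<^sup>2" using TR by (intro power_mono) auto
    also have "(T powr \<gamma>)\<^sup>2 = T powr (2 * \<gamma>)" using TR by (simp add: powr_power mult.commute)
    finally have "R\<^sup>2 * T powr (- (2 * \<gamma>)) \<le> T powr (2 * \<gamma>) * T powr (- (2 * \<gamma>))" by (rule mult_right_mono) simp
    also have "\<dots> = 1" using TR by (simp add: powr_add[symmetric])
    finally have 2: "R\<^sup>2 * T powr (- (2 * \<gamma>)) \<le> 1" .
    have "8 * T\<^sup>2 * ?c * (T powr (- 2) / 2) + 8 * (real DIM('a))\<^sup>2 * R\<^sup>2 * ?c * (T powr (- (2 * \<gamma>)) / (2 * \<gamma>))
      = ?c * (4 * (T\<^sup>2 * T powr (- 2)) + 4 * (real DIM('a))\<^sup>2 / \<gamma> * (R\<^sup>2 * T powr (- (2 * \<gamma>))))"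
      using \<gamma> by (simp add: field_simps)
    also have "\<dots> \<le> ?c * (4 * 1 + 4 * (real DIM('a))\<^sup>2 / \<gamma> * 1)"
      unfolding 1 using 2 \<gamma> by (intro mult_left_mono add_left_mono) auto
    finally show "8 * T\<^sup>2 * ?c * (T powr (- 2) / 2) + 8 * (real DIM('a))\<^sup>2 * R\<^sup>2 * ?c * (T powr (- (2 * \<gamma>)) / (2 * \<gamma>))
      \<le> A\<^sup>2 * (N0\<^sup>2 * (4 + 4 * (real DIM('a))\<^sup>2 / \<gamma>))" by (simp add: mult.assoc)
  qed
  finally show ?thesis .
qed

end

lemma cc_fun_add:
  assumes f: "cc_fun f" and h: "cc_fun h"
  shows "cc_fun (\<lambda>z. f z + h z)"
proof -
  obtain a b where ab: "\<forall>x. x \<notin> cbox a b \<longrightarrow> f x = 0" using conjunct2[OF f[unfolded cc_fun_def]] by (elim exE) (rule that)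
  obtain a' b' where ab': "\<forall>x. x \<notin> cbox a' b' \<longrightarrow> h x = 0" using conjunct2[OF h[unfolded cc_fun_def]] by (elim exE) (rule that)
  obtain p q where pq: "cbox a b \<union> cbox a' b' \<subseteq> cbox p q"
    using bounded_subset_cbox_symmetric[OF bounded_Un[THEN iffD2, OF conjI[OF bounded_cbox bounded_cbox]]] by metis
  have "f x + h x = 0" if "x \<notin> cbox p q" for x
  proof -
    have "x \<notin> cbox a b" "x \<notin> cbox a' b'" using pq that by blast+
    then show ?thesis using ab ab' by simp
  qed
  moreover have "continuous_on UNIV (\<lambda>z. f z + h z)"
    by (intro continuous_intros conjunct1[OF f[unfolded cc_fun_def]] conjunct1[OF h[unfolded cc_fun_def]])
  ultimately show ?thesis unfolding cc_fun_def by (intro conjI exI[of _ p] exI[of _ q] allI impI)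
qed

context sqkernel
begin

definition osc_const :: real where
  "osc_const = 3 * C0 * (unit_ball_vol (real DIM('a)) * (real DIM('a) + 2) ^ DIM('a))
     + N0\<^sup>2 * (3 powr (\<gamma> * e) * 2 powr (\<gamma> * e) / (\<gamma> * e)) + N0\<^sup>2 * (4 + 4 * (real DIM('a))\<^sup>2 / \<gamma>)"

lemma osc_const_nonneg: "osc_const \<ge> 0"
  unfolding osc_const_def using C0 \<gamma> e by (intro add_nonneg_nonneg mult_nonneg_nonneg divide_nonneg_nonneg) auto

lemma SQ_split:
  assumes [simp]: "cc_fun f"
  shows "SQ f UNIV w = SQ f {..<b} w + SQ f {b..} w"
proof -
  have [measurable]: "(\<lambda>s. norm (V f (fst w) s (snd w))) \<in> borel_measurable borel" by measurable
  have "SQ f UNIV w = (\<integral>\<^sup>+s. ennreal ((norm (V f (fst w) s (snd w)))\<^sup>2) * indicator {..<b} s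
     + ennreal ((norm (V f (fst w) s (snd w)))\<^sup>2) * indicator {b..} s \<partial>lborel)"
    unfolding SQ_def by (intro nn_integral_cong) (auto simp: indicator_def)
  also have "\<dots> = SQ f {..<b} w + SQ f {b..} w"
    unfolding SQ_def by (rule nn_integral_add) measurable
  finally show ?thesis .
qed

end

text \<open>\<open>f\<close> is the bounded part and \<open>h\<close> the remainder. The centre
  \<open>c\<close> is the distant-past square function of \<open>f\<close> at a reference point
  \<open>w1\<close>. The error \<open>g\<close> consists of the recent past of \<open>floc\<close>
  and of the constants from \<open>far_part\<close> and \<open>past_part\<close>. Before
  \<open>b\<close> and after \<open>b\<close> the vector \<open>V\<close> is written as a sum of
  three terms, which gives the factors 3.\<close>

lemma (in sqkernel_cell) cell_oscillation:
  assumes h: "cc_fun h"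
  shows "\<exists>c g. g \<in> borel_measurable borel \<and>
     (\<forall>w\<in>Q. SQ (\<lambda>z. f z + h z) UNIV w \<le> 3 * (c + g w + SQ h UNIV w) \<and>
            c \<le> 3 * (SQ (\<lambda>z. f z + h z) UNIV w + g w + SQ h UNIV w)) \<and>
     (\<integral>\<^sup>+w\<in>Q. g w \<partial>lborel) \<le> ennreal (osc_const * A\<^sup>2 * (T * R ^ DIM('a)))"
proof -
  interpret dyadic_grid "aniso_cell \<gamma> :: int \<Rightarrow> real \<times> 'a \<Rightarrow> _" "\<lambda>n. cell_time \<gamma> n * cell_side n ^ DIM('a)"
    "2 powr (1 / \<gamma> + 1) * 2 ^ DIM('a)"
    by (rule dyadic_grid_aniso[OF \<gamma>])
  let ?F = "\<lambda>z. f z + h z"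
  have F: "cc_fun ?F" by (rule cc_fun_add[OF f h])
  obtain N where N: "{t \<in> space lborel. \<not> t \<in> Tg} \<subseteq> N" "emeasure lborel N = 0" "N \<in> sets lborel"
    using AE_E[OF Tg] by metis
  have [measurable]: "N \<in> sets borel" using N(3) by simp
  have notN: "fst w \<in> Tg" if "fst w \<notin> N" for w :: "real \<times> 'a" using N(1) that by auto
  have N0': "emeasure lborel (N \<times> (UNIV :: 'a set)) = 0"
  proof -
    have "emeasure (lborel \<Otimes>\<^sub>M lborel) (N \<times> (UNIV :: 'a set)) = emeasure lborel N * emeasure lborel (UNIV :: 'a set)"
      by (rule lborel.emeasure_pair_measure_Times) auto
    then show ?thesis using N(2) by (simp add: lborel_prod)
  qed
  have Nm[measurable]: "N \<times> (UNIV :: 'a set) \<in> sets borel"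
    unfolding borel_prod[symmetric] by (intro pair_measureI) auto
  have Qm[measurable]: "Q \<in> sets borel" by (rule cell_sets)
  have Qv: "emeasure lborel Q = ennreal (T * R ^ DIM('a))" by (rule emeasure_cell)
  \<comment> \<open>The cell has positive measure, so it contains a reference point whose time lies
    in \<open>Tg\<close>.\<close>
  have "AE w in lborel. w \<notin> N \<times> (UNIV :: 'a set)"
    by (rule AE_not_in) (simp add: null_sets_def N0')
  then have "\<exists>w1\<in>Q. w1 \<notin> N \<times> (UNIV :: 'a set)"
    by (rule ex_in_set_of_AE) (use TR in \<open>simp_all add: Qv\<close>)
  then obtain w1 where w1: "w1 \<in> Q" "fst w1 \<in> Tg" using notN by (auto simp: mem_Times_iff)
  define c where "c = SQ f {..<b} w1"
  define c2 where "c2 = A\<^sup>2 * (N0\<^sup>2 * (3 powr (\<gamma> * e) * 2 powr (\<gamma> * e) / (\<gamma> * e)))"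
  define c3 where "c3 = A\<^sup>2 * (N0\<^sup>2 * (4 + 4 * (real DIM('a))\<^sup>2 / \<gamma>))"
  define c1 where "c1 = 3 * C0 * A\<^sup>2 * (unit_ball_vol (real DIM('a)) * (real DIM('a) + 2) ^ DIM('a))"
  have c0: "c1 \<ge> 0" "c2 \<ge> 0" "c3 \<ge> 0" unfolding c1_def c2_def c3_def using C0 \<gamma> e by auto
  \<comment> \<open>The value \<open>\<infinity>\<close> over the null set of bad times makes the
    two inequalities hold at every point of the cell, at no cost in the integral of
    \<open>g\<close>.\<close>
  define g where "g w = SQ floc {b..} w + ennreal (c2 + c3) + \<infinity> * indicator (N \<times> UNIV) w" for w
  have locm[measurable]: "SQ floc {b..} \<in> borel_measurable borel" by (rule SQ_measurable[OF cc_parts(1)]) simp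
  have gm: "g \<in> borel_measurable borel" unfolding g_def by measurable
  have Vm: "(\<lambda>s. ennreal ((norm (V u t s x))\<^sup>2)) \<in> borel_measurable lborel" if u: "cc_fun u" for u t x
    using u by measurable
  have fdec: "f w = floc w + ffar w" for w by (simp add: floc_def ffar_def scaleR_diff_left)
  have Vf: "V f t s x = V floc t s x + V ffar t s x" for t s x
  proof -
    have "f = (\<lambda>w. floc w + ffar w)" by (rule ext) (rule fdec)
    then show ?thesis using V_add[OF cc_parts, of t s x] by (simp only:)
  qed
  have VF: "V ?F t s x = V f t s x + V h t s x" for t s x by (rule V_add[OF f h])
  have pm[measurable]: "(\<lambda>s. ennreal (past_bound s)) \<in> borel_measurable lborel" unfolding past_bound_def by measurable
  have fm[measurable]: "far_bound t \<in> borel_measurable lborel" for t unfolding far_bound_def[abs_def] by measurable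
  have near: "SQ ?F {b..} w \<le> 3 * (SQ floc {b..} w + ennreal c2 + SQ h {b..} w)" if w: "w \<in> Q" "fst w \<in> Tg" for w
  proof -
    have "SQ ?F {b..} w \<le> 3 * (SQ floc {b..} w + (\<integral>\<^sup>+s\<in>{b..}. far_bound (fst w) s \<partial>lborel) + SQ h {b..} w)"
      unfolding SQ_def
    proof (rule nn_set_integral_add3_le[OF Vm[OF cc_parts(1)] fm Vm[OF h]])
      show "AE s in lborel. s \<in> {b..} \<longrightarrow> ennreal ((norm (V ?F (fst w) s (snd w)))\<^sup>2)
        \<le> 3 * (ennreal ((norm (V floc (fst w) s (snd w)))\<^sup>2) + far_bound (fst w) s + ennreal ((norm (V h (fst w) s (snd w)))\<^sup>2))"
        using far_part_pointwise[OF w]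
      proof eventually_elim
        case (elim s)
        show ?case
        proof
          assume "s \<in> {b..}"
          then have fb: "ennreal ((norm (V ffar (fst w) s (snd w)))\<^sup>2) \<le> far_bound (fst w) s" using elim by simp
          have "ennreal ((norm (V ?F (fst w) s (snd w)))\<^sup>2) \<le> 3 * (ennreal ((norm (V floc (fst w) s (snd w)))\<^sup>2)
             + ennreal ((norm (V ffar (fst w) s (snd w)))\<^sup>2) + ennreal ((norm (V h (fst w) s (snd w)))\<^sup>2))"
            unfolding VF Vf by (rule ennreal_norm_sq_add3) simp_all
          also have "\<dots> \<le> 3 * (ennreal ((norm (V floc (fst w) s (snd w)))\<^sup>2) + far_bound (fst w) s + ennreal ((norm (V h (fst w) s (snd w)))\<^sup>2))"
            by (intro mult_left_mono add_mono fb order_refl) simp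
          finally show "ennreal ((norm (V ?F (fst w) s (snd w)))\<^sup>2)
            \<le> 3 * (ennreal ((norm (V floc (fst w) s (snd w)))\<^sup>2) + far_bound (fst w) s + ennreal ((norm (V h (fst w) s (snd w)))\<^sup>2))" .
        qed
      qed
    qed simp
    also have "\<dots> \<le> 3 * (SQ floc {b..} w + ennreal c2 + SQ h {b..} w)"
      unfolding c2_def by (intro mult_left_mono add_mono far_part order_refl) simp
    finally show ?thesis .
  qed
  have past: "SQ ?F {..<b} w \<le> 3 * (c + ennreal c3 + SQ h {..<b} w)" "c \<le> 3 * (SQ ?F {..<b} w + ennreal c3 + SQ h {..<b} w)"
    if w: "w \<in> Q" "fst w \<in> Tg" for w
  proof -
    have "SQ ?F {..<b} w \<le> 3 * (c + (\<integral>\<^sup>+s\<in>{..<b}. ennreal (past_bound s) \<partial>lborel) + SQ h {..<b} w)"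
      unfolding SQ_def c_def
    proof (rule nn_set_integral_add3_le[OF Vm[OF f] pm Vm[OF h]])
      show "AE s in lborel. s \<in> {..<b} \<longrightarrow> ennreal ((norm (V ?F (fst w) s (snd w)))\<^sup>2)
        \<le> 3 * (ennreal ((norm (V f (fst w1) s (snd w1)))\<^sup>2) + ennreal (past_bound s) + ennreal ((norm (V h (fst w) s (snd w)))\<^sup>2))"
        using past_part_pointwise[OF w w1]
      proof eventually_elim
        case (elim s)
        have eq: "V ?F (fst w) s (snd w) = V f (fst w1) s (snd w1) + (V f (fst w) s (snd w) - V f (fst w1) s (snd w1)) + V h (fst w) s (snd w)"
          by (simp add: VF)
        show ?case
        proof
          assume "s \<in> {..<b}"
          then have pb: "(norm (V f (fst w) s (snd w) - V f (fst w1) s (snd w1)))\<^sup>2 \<le> past_bound s" using elim by simp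
          show "ennreal ((norm (V ?F (fst w) s (snd w)))\<^sup>2)
            \<le> 3 * (ennreal ((norm (V f (fst w1) s (snd w1)))\<^sup>2) + ennreal (past_bound s) + ennreal ((norm (V h (fst w) s (snd w)))\<^sup>2))"
            by (subst eq) (rule ennreal_norm_sq_add3[OF order_refl pb order_refl])
        qed
      qed
    qed simp
    also have "\<dots> \<le> 3 * (c + ennreal c3 + SQ h {..<b} w)"
      unfolding c3_def by (intro mult_left_mono add_mono past_part order_refl) simp
    finally show "SQ ?F {..<b} w \<le> 3 * (c + ennreal c3 + SQ h {..<b} w)" .
    have "c \<le> 3 * (SQ ?F {..<b} w + (\<integral>\<^sup>+s\<in>{..<b}. ennreal (past_bound s) \<partial>lborel) + SQ h {..<b} w)"
      unfolding SQ_def c_def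
    proof (rule nn_set_integral_add3_le[OF Vm[OF F] pm Vm[OF h]])
      show "AE s in lborel. s \<in> {..<b} \<longrightarrow> ennreal ((norm (V f (fst w1) s (snd w1)))\<^sup>2)
        \<le> 3 * (ennreal ((norm (V ?F (fst w) s (snd w)))\<^sup>2) + ennreal (past_bound s) + ennreal ((norm (V h (fst w) s (snd w)))\<^sup>2))"
        using past_part_pointwise[OF w w1]
      proof eventually_elim
        case (elim s)
        have eq: "V f (fst w1) s (snd w1) = V ?F (fst w) s (snd w) + - (V f (fst w) s (snd w) - V f (fst w1) s (snd w1)) + - V h (fst w) s (snd w)"
          by (simp add: VF)
        show ?case
        proof
          assume "s \<in> {..<b}"
          then have pb: "(norm (- (V f (fst w) s (snd w) - V f (fst w1) s (snd w1))))\<^sup>2 \<le> past_bound s"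
            using elim unfolding norm_minus_cancel by simp
          have h: "(norm (- V h (fst w) s (snd w)))\<^sup>2 \<le> (norm (V h (fst w) s (snd w)))\<^sup>2" by simp
          show "ennreal ((norm (V f (fst w1) s (snd w1)))\<^sup>2)
            \<le> 3 * (ennreal ((norm (V ?F (fst w) s (snd w)))\<^sup>2) + ennreal (past_bound s) + ennreal ((norm (V h (fst w) s (snd w)))\<^sup>2))"
            by (subst eq) (rule ennreal_norm_sq_add3[OF order_refl pb h])
        qed
      qed
    qed simp
    also have "\<dots> \<le> 3 * (SQ ?F {..<b} w + ennreal c3 + SQ h {..<b} w)"
      unfolding c3_def by (intro mult_left_mono add_mono past_part order_refl) simp
    finally show "c \<le> 3 * (SQ ?F {..<b} w + ennreal c3 + SQ h {..<b} w)" .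
  qed
  have pw: "SQ ?F UNIV w \<le> 3 * (c + g w + SQ h UNIV w) \<and> c \<le> 3 * (SQ ?F UNIV w + g w + SQ h UNIV w)" if w: "w \<in> Q" for w
  proof (cases "fst w \<in> N")
    case True
    then have "g w = \<infinity>" by (simp add: g_def indicator_def mem_Times_iff)
    then show ?thesis by (simp add: ennreal_mult_top)
  next
    case False
    then have t: "fst w \<in> Tg" by (rule notN)
    have g: "g w = SQ floc {b..} w + (ennreal c2 + ennreal c3)"
      using False c0 by (simp add: g_def indicator_def mem_Times_iff ennreal_plus)
    note S = SQ_split[OF F, of w b] SQ_split[OF h, of w b]
    have "SQ ?F UNIV w \<le> 3 * (c + ennreal c3 + SQ h {..<b} w) + 3 * (SQ floc {b..} w + ennreal c2 + SQ h {b..} w)"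
      unfolding S(1) by (intro add_mono past near w t)
    also have "\<dots> = 3 * (c + g w + SQ h UNIV w)" unfolding S(2) g by (simp add: distrib_left add_ac)
    finally have 1: "SQ ?F UNIV w \<le> 3 * (c + g w + SQ h UNIV w)" .
    \<comment> \<open>\<open>c\<close> involves times before \<open>b\<close> only, so the distant
      past bounds it and the recent terms are merely added.\<close>
    have "c \<le> 3 * (SQ ?F {..<b} w + ennreal c3 + SQ h {..<b} w)" by (rule past(2)[OF w t])
    also have "\<dots> \<le> 3 * (SQ ?F UNIV w + g w + SQ h UNIV w)"
      unfolding S g by (intro mult_left_mono add_mono) (auto simp: add_increasing add_increasing2)
    finally show ?thesis using 1 by simp
  qed
  have int: "(\<integral>\<^sup>+w\<in>Q. g w \<partial>lborel) \<le> ennreal (osc_const * A\<^sup>2 * (T * R ^ DIM('a)))"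
  proof -
    have "(\<integral>\<^sup>+w\<in>Q. g w \<partial>lborel) \<le> (\<integral>\<^sup>+w. SQ floc {b..} w * indicator Q w + ennreal (c2 + c3) * indicator Q w + \<infinity> * indicator (N \<times> UNIV) w \<partial>lborel)"
      by (intro nn_integral_mono) (auto simp: g_def indicator_def)
    also have "\<dots> = (\<integral>\<^sup>+w\<in>Q. SQ floc {b..} w \<partial>lborel) + ennreal (c2 + c3) * emeasure lborel Q + \<infinity> * emeasure lborel (N \<times> (UNIV :: 'a set))"
      by (simp add: nn_integral_add nn_integral_cmult_indicator)
    also have "\<dots> \<le> ennreal (c1 * (T * R ^ DIM('a))) + ennreal (c2 + c3) * ennreal (T * R ^ DIM('a)) + 0"
      using local_part by (intro add_mono) (auto simp: c1_def Qv N0')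
    also have "\<dots> = ennreal ((c1 + c2 + c3) * (T * R ^ DIM('a)))"
      using c0 TR by (simp add: ennreal_mult[symmetric] ennreal_plus[symmetric] algebra_simps del: ennreal_plus)
    also have "c1 + c2 + c3 = osc_const * A\<^sup>2"
      unfolding c1_def c2_def c3_def osc_const_def by (simp add: algebra_simps)
    finally show ?thesis .
  qed
  show ?thesis using gm pw int by (intro exI[of _ c] exI[of _ g]) blast
qed

section \<open>The square function in \<open>L\<^sub>p\<close>\<close>

context sqkernel
begin

text \<open>At height \<open>l\<close> the bounded part is \<open>truncate_norm l f\<close>, so
  \<open>A = l\<close> in the cell estimate. The remainder is supported where
  \<open>norm (f z) > l\<close> and is at most \<open>norm (f z)\<close> there; its square function
  plays the role of the error common to all cells.\<close>

lemma SQ_oscillation_bound: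
  assumes f: "cc_fun f"
  shows "dyadic_grid.oscillation_bound (aniso_cell \<gamma>) (\<lambda>n. cell_time \<gamma> n * cell_side n ^ DIM('a)) C0 osc_const
     (\<lambda>z. epowr (SQ f UNIV z) (1 / 2)) (\<lambda>z. norm (f z))"
proof -
  interpret dyadic_grid "aniso_cell \<gamma> :: int \<Rightarrow> real \<times> 'a \<Rightarrow> _" "\<lambda>n. cell_time \<gamma> n * cell_side n ^ DIM('a)"
    "2 powr (1 / \<gamma> + 1) * 2 ^ DIM('a)"
    by (rule dyadic_grid_aniso[OF \<gamma>])
  show ?thesis
    unfolding oscillation_bound_def epowr_half_sq
  proof (intro allI impI)
    fix l :: real assume l: "l > 0"
    note cc = cc_fun_truncate[OF l f]
    define h where "h z = f z - truncate_norm l f z" for z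
    have h: "cc_fun h" using cc(2) by (simp add: h_def[abs_def])
    have dec: "(\<lambda>z. truncate_norm l f z + h z) = f" by (simp add: h_def)
    have "(\<integral>\<^sup>+z. SQ h UNIV z \<partial>lborel) \<le> ennreal C0 * (\<integral>\<^sup>+z. ennreal ((norm (h z))\<^sup>2) \<partial>lborel)"
      by (rule SQ_L2[OF h])
    also have "\<dots> \<le> ennreal C0 * (\<integral>\<^sup>+z\<in>{z. norm (f z) > l}. ennreal ((norm (f z))\<^sup>2) \<partial>lborel)"
    proof (intro mult_left_mono nn_integral_mono)
      fix z
      show "ennreal ((norm (h z))\<^sup>2) \<le> ennreal ((norm (f z))\<^sup>2) * indicator {z. norm (f z) > l} z"
      proof (cases "norm (f z) > l")
        case True
        have "(norm (h z))\<^sup>2 \<le> (norm (f z))\<^sup>2" unfolding h_def by (intro power_mono truncate_norm(2)[OF l]) simp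
        then show ?thesis using True by (simp add: ennreal_leI)
      next
        case False then show ?thesis using truncate_norm(3)[OF l, of f z] by (simp add: h_def)
      qed
    qed simp
    finally have hb: "(\<integral>\<^sup>+z. SQ h UNIV z \<partial>lborel) \<le> ennreal C0 * (\<integral>\<^sup>+z\<in>{z. norm (f z) > l}. ennreal ((norm (f z))\<^sup>2) \<partial>lborel)" .
    have "\<exists>c g. g \<in> borel_measurable borel \<and>
        (\<forall>w\<in>aniso_cell \<gamma> n z. SQ f UNIV w \<le> 3 * (c + g w + SQ h UNIV w) \<and> c \<le> 3 * (SQ f UNIV w + g w + SQ h UNIV w)) \<and>
        (\<integral>\<^sup>+w\<in>aniso_cell \<gamma> n z. g w \<partial>lborel) \<le> ennreal (osc_const * l\<^sup>2 * (cell_time \<gamma> n * cell_side n ^ DIM('a)))" for n z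
    proof -
      interpret sqkernel_cell S m K Tg \<gamma> e N0 C0 "truncate_norm l f" l n z
        by unfold_locales (use cc truncate_norm(1)[OF l] in auto)
      show ?thesis using cell_oscillation[OF h] by (simp only: dec)
    qed
    then show "\<exists>h. h \<in> borel_measurable borel \<and>
      (\<integral>\<^sup>+z. h z \<partial>lborel) \<le> ennreal C0 * (\<integral>\<^sup>+z\<in>{z. norm (f z) > l}. ennreal ((norm (f z))\<^sup>2) \<partial>lborel) \<and>
      (\<forall>n z. \<exists>c g. g \<in> borel_measurable borel \<and>
         (\<forall>w\<in>aniso_cell \<gamma> n z. SQ f UNIV w \<le> 3 * (c + g w + h w) \<and> c \<le> 3 * (SQ f UNIV w + g w + h w)) \<and>
         (\<integral>\<^sup>+w\<in>aniso_cell \<gamma> n z. g w \<partial>lborel) \<le> ennreal (osc_const * l\<^sup>2 * (cell_time \<gamma> n * cell_side n ^ DIM('a))))"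
      using hb SQ_measurable[OF h, of UNIV] by (intro exI[of _ "SQ h UNIV"] conjI allI) simp_all
  qed
qed

text \<open>The geometric summation in \<open>dyadic_Lp_bound\<close> needs
  \<open>p - 2 > 0\<close>; the remaining exponent \<open>p = 2\<close> is
  \<open>SQ_L2\<close>.\<close>

theorem SQ_Lp:
  assumes p: "p \<ge> 2"
  shows "\<exists>N\<ge>0. \<forall>f. cc_fun f \<longrightarrow>
    (\<integral>\<^sup>+z. epowr (epowr (SQ f UNIV z) (1 / 2)) p \<partial>lborel) \<le> ennreal N * (\<integral>\<^sup>+z. ennreal (norm (f z) powr p) \<partial>lborel)"
proof (cases "p = 2")
  case True
  have "(\<integral>\<^sup>+z. epowr (epowr (SQ f UNIV z) (1 / 2)) p \<partial>lborel) \<le> ennreal C0 * (\<integral>\<^sup>+z. ennreal (norm (f z) powr p) \<partial>lborel)"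
    if f: "cc_fun f" for f
  proof -
    have "norm (f z) powr 2 = (norm (f z))\<^sup>2" for z
      by (cases "f z = 0") (simp_all add: powr_numeral)
    then show ?thesis using SQ_L2[OF f] by (simp add: True epowr_sq epowr_half_sq)
  qed
  then show ?thesis using C0 by blast
next
  case False
  interpret dyadic_grid "aniso_cell \<gamma> :: int \<Rightarrow> real \<times> 'a \<Rightarrow> _" "\<lambda>n. cell_time \<gamma> n * cell_side n ^ DIM('a)"
    "2 powr (1 / \<gamma> + 1) * 2 ^ DIM('a)"
    by (rule dyadic_grid_aniso[OF \<gamma>])
  have p2: "p > 2" using p False by simp
  obtain N where N: "N \<ge> 0" "\<And>F \<phi>. F \<in> borel_measurable borel \<Longrightarrow> \<phi> \<in> borel_measurable borel \<Longrightarrow> (\<forall>z. \<phi> z \<ge> 0) \<Longrightarrow>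
     (\<integral>\<^sup>+z. (F z)\<^sup>2 \<partial>lborel) < \<infinity> \<Longrightarrow> oscillation_bound C0 osc_const F \<phi> \<Longrightarrow>
     (\<integral>\<^sup>+z. epowr (F z) p \<partial>lborel) \<le> ennreal N * (\<integral>\<^sup>+z. ennreal (\<phi> z powr p) \<partial>lborel)"
    using dyadic_Lp_bound[OF p2 C0 osc_const_nonneg] by auto
  have "(\<integral>\<^sup>+z. epowr (epowr (SQ f UNIV z) (1 / 2)) p \<partial>lborel) \<le> ennreal N * (\<integral>\<^sup>+z. ennreal (norm (f z) powr p) \<partial>lborel)"
    if f: "cc_fun f" for f
  proof (rule N(2)[OF _ _ _ _ SQ_oscillation_bound[OF f]])
    have [measurable]: "SQ f UNIV \<in> borel_measurable borel" by (rule SQ_measurable[OF f]) simp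
    show "(\<lambda>z. epowr (SQ f UNIV z) (1 / 2)) \<in> borel_measurable borel" by measurable
    have cf: "continuous_on UNIV f" using f by (simp add: cc_fun_def)
    show "(\<lambda>z. norm (f z)) \<in> borel_measurable borel"
      by (intro borel_measurable_continuous_onI continuous_intros cf)
    have "(\<integral>\<^sup>+z. ennreal ((norm (f z))\<^sup>2) \<partial>lborel) = ennreal (LINT z|lborel. (norm (f z))\<^sup>2)"
      by (intro nn_integral_eq_integral norm_sq_integrable cc_fun_nice f) simp
    then show "(\<integral>\<^sup>+z. (epowr (SQ f UNIV z) (1 / 2))\<^sup>2 \<partial>lborel) < \<infinity>"
      using SQ_L2[OF f] by (simp add: epowr_half_sq) (metis ennreal_less_top ennreal_mult_less_top order.strict_trans1)
  qed simp
  then show ?thesis using N(1) by blast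
qed

end

section \<open>Hardy type estimates along coordinate directions\<close>

lemma lebesgue_borel_version:
  fixes a :: "'a::euclidean_space \<Rightarrow> ennreal"
  assumes "a \<in> borel_measurable lebesgue"
  shows "\<exists>a' N. a' \<in> borel_measurable borel \<and> N \<in> sets borel \<and> emeasure lborel N = 0 \<and> (\<forall>x. x \<notin> N \<longrightarrow> a x = a' x)"
proof -
  obtain a' where a': "a' \<in> borel_measurable lborel" "AE x in lborel. a x = a' x"
    using completion_ex_borel_measurable[OF assms] by blast
  obtain N where "{x \<in> space lborel. \<not> a x = a' x} \<subseteq> N" "emeasure lborel N = 0" "N \<in> sets lborel"
    using AE_E[OF a'(2)] by metis
  then show ?thesis using a'(1) by (intro exI[of _ a'] exI[of _ N]) auto
qed

lemma AE_shift:
  fixes N :: "'a::euclidean_space set"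
  assumes [measurable]: "N \<in> sets borel" and N: "emeasure lborel N = 0"
  shows "AE z in lborel. z + c \<notin> N"
proof -
  have "(\<integral>\<^sup>+z. indicator N (c + z) \<partial>lborel) = (\<integral>\<^sup>+z. indicator N z \<partial>(lborel :: 'a measure))"
    by (rule nn_integral_shift) measurable
  then have "(\<integral>\<^sup>+z. indicator N (c + z) \<partial>lborel) = 0" using N by simp
  then have "AE z in lborel. indicator N (c + z) = (0::ennreal)" by (subst (asm) nn_integral_0_iff_AE) auto
  then show ?thesis by eventually_elim (auto simp: indicator_def add.commute split: if_splits)
qed

lemma nn_integral_shift_lebesgue:
  fixes a :: "'a::euclidean_space \<Rightarrow> ennreal"
  assumes "a \<in> borel_measurable lebesgue"
  shows "(\<integral>\<^sup>+x. a (x + c) \<partial>lborel) = (\<integral>\<^sup>+x. a x \<partial>lborel)"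
proof -
  obtain a' N where a': "a' \<in> borel_measurable borel" "N \<in> sets borel" "emeasure lborel N = 0" "\<And>x. x \<notin> N \<Longrightarrow> a x = a' x"
    using lebesgue_borel_version[OF assms] by auto
  have [measurable]: "a' \<in> borel_measurable borel" "N \<in> sets borel" by fact+
  have "AE x in lborel. x \<notin> N" by (rule AE_not_in) (use a' in \<open>simp add: null_sets_def\<close>)
  have "AE x in lborel. a (x + c) = a' (c + x)"
    using AE_shift[OF a'(2,3), of c] by eventually_elim (use a'(4) in \<open>auto simp: add.commute\<close>)
  then have "(\<integral>\<^sup>+x. a (x + c) \<partial>lborel) = (\<integral>\<^sup>+x. a' (c + x) \<partial>lborel)" by (rule nn_integral_cong_AE)
  also have "\<dots> = (\<integral>\<^sup>+x. a' x \<partial>lborel)" by (rule nn_integral_shift) measurable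
  also have "\<dots> = (\<integral>\<^sup>+x. a x \<partial>lborel)"
    using \<open>AE x in lborel. x \<notin> N\<close> by (intro nn_integral_cong_AE) (auto elim!: eventually_mono simp: a'(4))
  finally show ?thesis .
qed

lemma nn_integral_scale_lebesgue:
  fixes a :: "'a::euclidean_space \<Rightarrow> ennreal"
  assumes "a \<in> borel_measurable lebesgue" and c: "c > 0"
  shows "(\<integral>\<^sup>+x. a x \<partial>lborel) = ennreal (c ^ DIM('a)) * (\<integral>\<^sup>+x. a (c *\<^sub>R x) \<partial>lborel)"
proof -
  obtain a' N where a': "a' \<in> borel_measurable borel" "N \<in> sets borel" "emeasure lborel N = 0" "\<And>x. x \<notin> N \<Longrightarrow> a x = a' x"
    using lebesgue_borel_version[OF assms(1)] by auto
  have [measurable]: "a' \<in> borel_measurable borel" "N \<in> sets borel" by fact+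
  have sc: "(\<integral>\<^sup>+x. f x \<partial>lborel) = ennreal (c ^ DIM('a)) * (\<integral>\<^sup>+x. f (c *\<^sub>R x) \<partial>lborel)"
    if [measurable]: "f \<in> borel_measurable borel" for f :: "'a \<Rightarrow> ennreal"
  proof -
    have "(\<integral>\<^sup>+x. f x \<partial>lborel) = (\<integral>\<^sup>+x. f x \<partial>density (distr lborel borel (\<lambda>x. 0 + c *\<^sub>R x)) (\<lambda>_. ennreal (\<bar>c\<bar> ^ DIM('a))))"
      using lborel_affine[of c "0 :: 'a"] c by simp
    also have "\<dots> = ennreal (c ^ DIM('a)) * (\<integral>\<^sup>+x. f (c *\<^sub>R x) \<partial>lborel)"
      using c by (subst nn_integral_density) (auto simp: nn_integral_distr nn_integral_cmult)
    finally show ?thesis .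
  qed
  have "AE x in lborel. x \<notin> N" by (rule AE_not_in) (use a' in \<open>simp add: null_sets_def\<close>)
  have "ennreal (c ^ DIM('a)) * (\<integral>\<^sup>+x. indicator N (c *\<^sub>R x) \<partial>lborel) = (\<integral>\<^sup>+x. indicator N x \<partial>(lborel :: 'a measure))"
    by (rule sc[symmetric]) measurable
  then have "(\<integral>\<^sup>+x. indicator N (c *\<^sub>R x) \<partial>lborel) = 0" using a' c by simp
  then have "AE x in lborel. indicator N (c *\<^sub>R x) = (0::ennreal)" by (subst (asm) nn_integral_0_iff_AE) auto
  then have "AE x in lborel. a (c *\<^sub>R x) = a' (c *\<^sub>R x)"
    by eventually_elim (use a'(4) in \<open>auto simp: indicator_def split: if_splits\<close>)
  then have "(\<integral>\<^sup>+x. a (c *\<^sub>R x) \<partial>lborel) = (\<integral>\<^sup>+x. a' (c *\<^sub>R x) \<partial>lborel)" by (rule nn_integral_cong_AE)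
  moreover have "(\<integral>\<^sup>+x. a' x \<partial>lborel) = (\<integral>\<^sup>+x. a x \<partial>lborel)"
    using \<open>AE x in lborel. x \<notin> N\<close> by (intro nn_integral_cong_AE) (auto elim!: eventually_mono simp: a'(4))
  ultimately show ?thesis using sc[of a'] by simp
qed

text \<open>Tonelli over the shifts \<open>u *\<^sub>R v\<close>: every translate of
  \<open>N\<close> is null.\<close>

lemma AE_line:
  fixes N :: "'a::euclidean_space set" and v :: 'a
  assumes [measurable]: "N \<in> sets borel" and N: "emeasure lborel N = 0"
  shows "AE z in lborel. AE u in lborel. z + u *\<^sub>R v \<notin> N"
proof -
  have sh: "(\<integral>\<^sup>+z. indicator N (z + c) \<partial>lborel) = emeasure lborel N" for c
    using nn_integral_shift[of "indicator N" c] by (simp add: add.commute)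
  have "(\<integral>\<^sup>+z. \<integral>\<^sup>+u. indicator N (z + u *\<^sub>R v) \<partial>lborel \<partial>lborel) = (\<integral>\<^sup>+u. \<integral>\<^sup>+z. indicator N (z + u *\<^sub>R v) \<partial>lborel \<partial>(lborel :: real measure))"
    by (rule lborel_pair.Fubini') measurable
  also have "\<dots> = 0" using N by (simp add: sh)
  finally have "AE z in lborel. (\<integral>\<^sup>+u. indicator N (z + u *\<^sub>R v) \<partial>(lborel :: real measure)) = 0"
    by (subst (asm) nn_integral_0_iff_AE) auto
  then show ?thesis
  proof eventually_elim
    case (elim z)
    then have "AE u in lborel. indicator N (z + u *\<^sub>R v) = (0::ennreal)" by (subst (asm) nn_integral_0_iff_AE) auto
    then show ?case by eventually_elim (auto simp: indicator_def split: if_splits)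
  qed
qed

lemma line_integral_AE_cong:
  fixes a a' :: "'a::euclidean_space \<Rightarrow> ennreal" and v :: 'a
  assumes "N \<in> sets borel" "emeasure lborel N = 0" and a: "\<And>x. x \<notin> N \<Longrightarrow> a x = a' x"
  shows "AE z in lborel. (\<integral>\<^sup>+u\<in>I. a (z + u *\<^sub>R v) \<partial>lborel) = (\<integral>\<^sup>+u\<in>I. a' (z + u *\<^sub>R v) \<partial>lborel)"
  using AE_line[OF assms(1,2), of v]
proof eventually_elim
  case (elim z)
  then have "AE u in lborel. a (z + u *\<^sub>R v) * indicator I u = a' (z + u *\<^sub>R v) * indicator I u"
    by eventually_elim (simp add: a)
  then show ?case by (rule nn_integral_cong_AE)
qed

text \<open>Substituting \<open>w = z + u v\<close> for fixed \<open>u\<close> and exchanging the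
  order leaves, for each \<open>w\<close>, the measure of those \<open>u\<close> that lead back from
  \<open>w\<close> into \<open>S\<close>. The estimates on half spaces and slabs below amount to
  bounding this measure.\<close>

lemma line_tonelli:
  fixes a :: "'a::euclidean_space \<Rightarrow> ennreal" and v :: 'a
  assumes "a \<in> borel_measurable lebesgue" and [measurable]: "S \<in> sets borel" "I \<in> sets borel"
  shows "(\<integral>\<^sup>+z\<in>S. \<integral>\<^sup>+u\<in>I. a (z + u *\<^sub>R v) \<partial>lborel \<partial>lborel)
    = (\<integral>\<^sup>+w. a w * emeasure lborel {u \<in> I. w - u *\<^sub>R v \<in> S} \<partial>lborel)"
proof -
  obtain a' N where a': "a' \<in> borel_measurable borel" "N \<in> sets borel" "emeasure lborel N = 0" "\<And>x. x \<notin> N \<Longrightarrow> a x = a' x"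
    using lebesgue_borel_version[OF assms(1)] by auto
  have [measurable]: "a' \<in> borel_measurable borel" "N \<in> sets borel" by fact+
  have N: "AE x in lborel. x \<notin> N" by (rule AE_not_in) (use a' in \<open>simp add: null_sets_def\<close>)
  have sh: "(\<integral>\<^sup>+z. f (z + c) \<partial>lborel) = (\<integral>\<^sup>+z. f z \<partial>lborel)" if [measurable]: "f \<in> borel_measurable borel" for f :: "'a \<Rightarrow> ennreal" and c
    using nn_integral_shift[of f c] by (simp add: add.commute)
  have eq: "AE z in lborel. (\<integral>\<^sup>+u\<in>I. a (z + u *\<^sub>R v) \<partial>lborel) * indicator S z = (\<integral>\<^sup>+u\<in>I. a' (z + u *\<^sub>R v) \<partial>lborel) * indicator S z"
  proof -
    have "AE z in lborel. (\<integral>\<^sup>+u\<in>I. a (z + u *\<^sub>R v) \<partial>lborel) = (\<integral>\<^sup>+u\<in>I. a' (z + u *\<^sub>R v) \<partial>lborel)"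
      by (rule line_integral_AE_cong[OF a'(2,3)]) (rule a'(4))
    then show ?thesis by eventually_elim simp
  qed
  have "(\<integral>\<^sup>+z\<in>S. \<integral>\<^sup>+u\<in>I. a (z + u *\<^sub>R v) \<partial>lborel \<partial>lborel) = (\<integral>\<^sup>+z\<in>S. \<integral>\<^sup>+u\<in>I. a' (z + u *\<^sub>R v) \<partial>lborel \<partial>lborel)"
    by (rule nn_integral_cong_AE[OF eq])
  also have "\<dots> = (\<integral>\<^sup>+z. \<integral>\<^sup>+u. a' (z + u *\<^sub>R v) * indicator I u * indicator S z \<partial>lborel \<partial>lborel)"
    by (simp add: nn_integral_multc)
  also have "\<dots> = (\<integral>\<^sup>+u. \<integral>\<^sup>+z. a' (z + u *\<^sub>R v) * indicator I u * indicator S z \<partial>lborel \<partial>lborel)"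
    by (rule lborel_pair.Fubini') measurable
  also have "\<dots> = (\<integral>\<^sup>+u. \<integral>\<^sup>+w. a' w * indicator I u * indicator S (w - u *\<^sub>R v) \<partial>lborel \<partial>lborel)"
  proof (rule nn_integral_cong)
    fix u
    show "(\<integral>\<^sup>+z. a' (z + u *\<^sub>R v) * indicator I u * indicator S z \<partial>lborel) = (\<integral>\<^sup>+w. a' w * indicator I u * indicator S (w - u *\<^sub>R v) \<partial>lborel)"
      using sh[of "\<lambda>w. a' w * indicator I u * indicator S (w - u *\<^sub>R v)" "u *\<^sub>R v"] by simp
  qed
  also have "\<dots> = (\<integral>\<^sup>+w. \<integral>\<^sup>+u. a' w * indicator I u * indicator S (w - u *\<^sub>R v) \<partial>lborel \<partial>lborel)"
    by (rule lborel_pair.Fubini') measurable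
  also have "\<dots> = (\<integral>\<^sup>+w. a' w * emeasure lborel {u \<in> I. w - u *\<^sub>R v \<in> S} \<partial>lborel)"
  proof (rule nn_integral_cong)
    fix w
    have [measurable]: "{u \<in> I. w - u *\<^sub>R v \<in> S} \<in> sets borel" by measurable
    have "(\<integral>\<^sup>+u. a' w * indicator I u * indicator S (w - u *\<^sub>R v) \<partial>lborel) = (\<integral>\<^sup>+u. a' w * indicator {u \<in> I. w - u *\<^sub>R v \<in> S} u \<partial>lborel)"
      by (intro nn_integral_cong) (auto simp: indicator_def)
    also have "\<dots> = a' w * emeasure lborel {u \<in> I. w - u *\<^sub>R v \<in> S}" by (rule nn_integral_cmult_indicator) measurable
    finally show "(\<integral>\<^sup>+u. a' w * indicator I u * indicator S (w - u *\<^sub>R v) \<partial>lborel) = a' w * emeasure lborel {u \<in> I. w - u *\<^sub>R v \<in> S}" .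
  qed
  also have "\<dots> = (\<integral>\<^sup>+w. a w * emeasure lborel {u \<in> I. w - u *\<^sub>R v \<in> S} \<partial>lborel)"
    using N by (intro nn_integral_cong_AE) (auto elim!: eventually_mono simp: a'(4))
  finally show ?thesis .
qed

text \<open>Regularity along one direction and off the origin, the form in which coordinate
  derivatives of the kernel are available. Taking the derivative at parameter 0 of each base point
  covers all points of the line.\<close>

definition line_deriv :: "('a::euclidean_space \<Rightarrow> complex) \<Rightarrow> ('a \<Rightarrow> complex) \<Rightarrow> 'a \<Rightarrow> bool" where
  "line_deriv g D v \<longleftrightarrow> (\<forall>x. x \<noteq> 0 \<longrightarrow> ((\<lambda>h. g (x + h *\<^sub>R v)) has_vector_derivative D x) (at 0))"

definition line_cont :: "('a::euclidean_space \<Rightarrow> complex) \<Rightarrow> 'a \<Rightarrow> bool" where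
  "line_cont D v \<longleftrightarrow> (\<forall>x. x \<noteq> 0 \<longrightarrow> isCont (\<lambda>h. D (x + h *\<^sub>R v)) 0)"

lemma line_derivD:
  assumes "line_deriv g D v" "x + u *\<^sub>R v \<noteq> 0"
  shows "((\<lambda>h. g (x + h *\<^sub>R v)) has_vector_derivative D (x + u *\<^sub>R v)) (at u)"
proof -
  have "((\<lambda>h. g ((x + u *\<^sub>R v) + h *\<^sub>R v)) has_vector_derivative D (x + u *\<^sub>R v)) (at 0)"
    using assms unfolding line_deriv_def by blast
  then have "((\<lambda>h. g ((x + u *\<^sub>R v) + h *\<^sub>R v)) has_vector_derivative D (x + u *\<^sub>R v)) (at (u - u))" by simp
  moreover have "((\<lambda>h. h - u) has_vector_derivative 1) (at u)"
    by (auto intro!: derivative_eq_intros)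
  ultimately have "(((\<lambda>h. g ((x + u *\<^sub>R v) + h *\<^sub>R v)) \<circ> (\<lambda>h. h - u)) has_vector_derivative 1 *\<^sub>R D (x + u *\<^sub>R v)) (at u)"
    by (intro vector_diff_chain_at) auto
  then show ?thesis by (simp add: o_def algebra_simps)
qed

lemma line_contD:
  assumes "line_cont D v" "x + u *\<^sub>R v \<noteq> 0"
  shows "isCont (\<lambda>h. D (x + h *\<^sub>R v)) u"
proof -
  have "isCont (\<lambda>h. D ((x + u *\<^sub>R v) + h *\<^sub>R v)) 0" using assms unfolding line_cont_def by blast
  then have "isCont (\<lambda>h. D ((x + u *\<^sub>R v) + h *\<^sub>R v)) (u - u)" by simp
  then have "isCont (\<lambda>h. D ((x + u *\<^sub>R v) + (h - u) *\<^sub>R v)) u"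
    by (rule isCont_o2[rotated]) (intro continuous_intros)
  then show ?thesis by (simp add: algebra_simps)
qed

section \<open>Recovering a function from a directional derivative\<close>

lemma line_segment_bound:
  assumes g: "line_deriv g D v" "line_cont D v" and h: "h \<ge> 0" and nz: "\<And>u. u \<in> {0..h} \<Longrightarrow> x + u *\<^sub>R v \<noteq> 0"
  shows "ennreal (norm (g (x + h *\<^sub>R v) - g x)) \<le> (\<integral>\<^sup>+u\<in>{0..h}. ennreal (norm (D (x + u *\<^sub>R v))) \<partial>lborel)"
proof -
  have c: "continuous_on {0..h} (\<lambda>u. D (x + u *\<^sub>R v))"
    by (rule continuous_at_imp_continuous_on, rule ballI) (rule line_contD[OF g(2) nz])
  have "((\<lambda>u. D (x + u *\<^sub>R v)) has_integral (g (x + h *\<^sub>R v) - g (x + 0 *\<^sub>R v))) {0..h}"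
    by (rule fundamental_theorem_of_calculus[OF h]) (rule has_vector_derivative_at_within[OF line_derivD[OF g(1) nz]])
  then have eq: "integral {0..h} (\<lambda>u. D (x + u *\<^sub>R v)) = g (x + h *\<^sub>R v) - g x" by (simp add: integral_unique)
  have ci: "(\<lambda>u. norm (D (x + u *\<^sub>R v))) integrable_on {0..h}"
    by (intro integrable_continuous_interval continuous_intros c)
  have "norm (g (x + h *\<^sub>R v) - g x) \<le> integral {0..h} (\<lambda>u. norm (D (x + u *\<^sub>R v)))"
    unfolding eq[symmetric] by (rule integral_norm_bound_integral[OF integrable_continuous_interval[OF c] ci]) simp
  then have "ennreal (norm (g (x + h *\<^sub>R v) - g x)) \<le> ennreal (integral {0..h} (\<lambda>u. norm (D (x + u *\<^sub>R v))))" by (rule ennreal_leI)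
  also have "\<dots> = (\<integral>\<^sup>+u\<in>{0..h}. ennreal (norm (D (x + u *\<^sub>R v))) \<partial>lborel)"
    by (rule nn_integral_has_integral_lebesgue'[symmetric]) (use ci in auto)
  finally show ?thesis .
qed

text \<open>
  Hardy's inequality on a half space: since \<open>g\<close> is integrable, it can be recovered from its
  derivative on the rays in direction \<open>v\<close>, none of which meets the singularity \<open>0\<close>.
\<close>

lemma hardy_half_space:
  fixes g D :: "'a::euclidean_space \<Rightarrow> complex"
  assumes g: "line_deriv g D v" "line_cont D v" and v: "v \<bullet> v = 1"
    and gi: "integrable lebesgue g" and Dm: "D \<in> borel_measurable lebesgue"
    and S[measurable]: "S \<in> sets borel" and Sv: "\<And>x. x \<in> S \<Longrightarrow> x \<bullet> v > 0"
  shows "(\<integral>\<^sup>+z\<in>S. ennreal (norm (g z)) \<partial>lborel)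
    \<le> (\<integral>\<^sup>+w. ennreal (norm (D w)) * emeasure lborel {u \<in> {0..}. w - u *\<^sub>R v \<in> S} \<partial>lborel)"
proof -
  have gm: "g \<in> borel_measurable lebesgue" using gi by auto
  have Dm': "(\<lambda>w. ennreal (norm (D w))) \<in> borel_measurable lebesgue" using Dm by measurable
  define X where "X = (\<integral>\<^sup>+w. ennreal (norm (D w)) * emeasure lborel {u \<in> {0..}. w - u *\<^sub>R v \<in> S} \<partial>lborel)"
  define E where "E h = (\<integral>\<^sup>+w\<in>{w. w \<bullet> v \<ge> h}. ennreal (norm (g w)) \<partial>lborel)" for h
  obtain gn N where gn: "gn \<in> borel_measurable borel" "N \<in> sets borel" "emeasure lborel N = 0" "\<And>x. x \<notin> N \<Longrightarrow> ennreal (norm (g x)) = gn x"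
    using lebesgue_borel_version[of "\<lambda>x. ennreal (norm (g x))"] gm by auto
  have [measurable]: "gn \<in> borel_measurable borel" by fact
  have N: "AE x in lborel. x \<notin> N" by (rule AE_not_in) (use gn in \<open>simp add: null_sets_def\<close>)
  have hv[measurable]: "{w. w \<bullet> v \<ge> h} \<in> sets borel" for h by measurable
  have Eb: "E h = (\<integral>\<^sup>+w\<in>{w. w \<bullet> v \<ge> h}. gn w \<partial>lborel)" for h
    unfolding E_def using N by (intro nn_integral_cong_AE) (auto elim!: eventually_mono simp: gn(4))
  obtain Dn M where Dn: "Dn \<in> borel_measurable borel" "M \<in> sets borel" "emeasure lborel M = 0" "\<And>x. x \<notin> M \<Longrightarrow> ennreal (norm (D x)) = Dn x"
    using lebesgue_borel_version[OF Dm'] by auto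
  have [measurable]: "Dn \<in> borel_measurable borel" by fact
  have De: "AE z in lborel. (\<integral>\<^sup>+u\<in>{0..}. ennreal (norm (D (z + u *\<^sub>R v))) \<partial>lborel) = (\<integral>\<^sup>+u\<in>{0..}. Dn (z + u *\<^sub>R v) \<partial>lborel)"
    by (rule line_integral_AE_cong[OF Dn(2,3)]) (rule Dn(4))
  have XD: "X = (\<integral>\<^sup>+z\<in>S. \<integral>\<^sup>+u\<in>{0..}. Dn (z + u *\<^sub>R v) \<partial>lborel \<partial>lborel)"
  proof -
    have "X = (\<integral>\<^sup>+z\<in>S. \<integral>\<^sup>+u\<in>{0..}. ennreal (norm (D (z + u *\<^sub>R v))) \<partial>lborel \<partial>lborel)"
      unfolding X_def by (rule line_tonelli[OF Dm' S, symmetric]) simp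
    also have "\<dots> = (\<integral>\<^sup>+z\<in>S. \<integral>\<^sup>+u\<in>{0..}. Dn (z + u *\<^sub>R v) \<partial>lborel \<partial>lborel)"
    using De
    by (intro nn_integral_cong_AE) (auto elim!: eventually_mono)
    finally show ?thesis .
  qed
  \<comment> \<open>Following the ray for length \<open>n\<close> leaves the value of
    \<open>g\<close> at the end point. These values contribute at most \<open>E (real n)\<close>,
    the mass of \<open>g\<close> beyond the hyperplane at height \<open>n\<close>, which tends to
    0.\<close>
  have step: "(\<integral>\<^sup>+z\<in>S. ennreal (norm (g z)) \<partial>lborel) \<le> E (real n) + X" for n
  proof -
    let ?h = "real n"
    have "(\<integral>\<^sup>+z\<in>S. ennreal (norm (g z)) \<partial>lborel)
        \<le> (\<integral>\<^sup>+z. gn (z + ?h *\<^sub>R v) * indicator {w. w \<bullet> v \<ge> ?h} (z + ?h *\<^sub>R v)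
             + (\<integral>\<^sup>+u\<in>{0..}. Dn (z + u *\<^sub>R v) \<partial>lborel) * indicator S z \<partial>lborel)"
    proof (rule nn_integral_mono_AE)
      show "AE z in lborel. ennreal (norm (g z)) * indicator S z \<le> gn (z + ?h *\<^sub>R v) * indicator {w. w \<bullet> v \<ge> ?h} (z + ?h *\<^sub>R v)
             + (\<integral>\<^sup>+u\<in>{0..}. Dn (z + u *\<^sub>R v) \<partial>lborel) * indicator S z"
        using AE_shift[OF gn(2,3), of "?h *\<^sub>R v"] De
      proof eventually_elim
        case (elim z)
        show ?case
        proof (cases "z \<in> S")
          case True
          have nz: "z + u *\<^sub>R v \<noteq> 0" if "u \<in> {0..?h}" for u
          proof
            assume "z + u *\<^sub>R v = 0"
            then have "(z + u *\<^sub>R v) \<bullet> v = 0" by simp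
            then show False using Sv[OF True] that v by (simp add: inner_add_left)
          qed
          have "ennreal (norm (g z)) \<le> ennreal (norm (g (z + ?h *\<^sub>R v)) + norm (g (z + ?h *\<^sub>R v) - g z))"
            by (intro ennreal_leI) (metis add.commute norm_minus_commute norm_triangle_sub)
          also have "\<dots> = gn (z + ?h *\<^sub>R v) + ennreal (norm (g (z + ?h *\<^sub>R v) - g z))"
            using gn(4)[OF elim(1)] by simp
          also have "ennreal (norm (g (z + ?h *\<^sub>R v) - g z)) \<le> (\<integral>\<^sup>+u\<in>{0..?h}. ennreal (norm (D (z + u *\<^sub>R v))) \<partial>lborel)"
            by (rule line_segment_bound[OF g _ nz]) simp_all
          also have "\<dots> \<le> (\<integral>\<^sup>+u\<in>{0..}. ennreal (norm (D (z + u *\<^sub>R v))) \<partial>lborel)"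
            by (intro nn_integral_mono) (auto simp: indicator_def)
          also note elim(2)
          finally show ?thesis using True Sv[OF True] v by (simp add: inner_add_left add_left_mono)
        qed simp
      qed
    qed
    also have "\<dots> = (\<integral>\<^sup>+z. gn (z + ?h *\<^sub>R v) * indicator {w. w \<bullet> v \<ge> ?h} (z + ?h *\<^sub>R v) \<partial>lborel) + X"
      unfolding XD by (rule nn_integral_add) measurable
    also have "(\<integral>\<^sup>+z. gn (z + ?h *\<^sub>R v) * indicator {w. w \<bullet> v \<ge> ?h} (z + ?h *\<^sub>R v) \<partial>lborel) = E ?h"
      unfolding Eb using nn_integral_shift[of "\<lambda>w. gn w * indicator {w. w \<bullet> v \<ge> ?h} w" "?h *\<^sub>R v"]
      by (simp add: add.commute)
    finally show ?thesis .
  qed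
  have "(\<lambda>n. E (real n)) \<longlonglongrightarrow> 0"
  proof -
    have "(\<lambda>n. \<integral>\<^sup>+w. gn w * indicator {w. w \<bullet> v \<ge> real n} w \<partial>lborel) \<longlonglongrightarrow> (\<integral>\<^sup>+w. 0 \<partial>(lborel :: 'a measure))"
    proof (rule nn_integral_dominated_convergence[where w = gn])
      have "(\<integral>\<^sup>+w. gn w \<partial>lborel) = (\<integral>\<^sup>+w. ennreal (norm (g w)) \<partial>lborel)"
        using N by (intro nn_integral_cong_AE) (auto elim!: eventually_mono simp: gn(4))
      then show "(\<integral>\<^sup>+w. gn w \<partial>lborel) < \<infinity>"
        using gi by (simp add: integrable_iff_bounded nn_integral_completion)
      show "AE x in lborel. (\<lambda>n. gn x * indicator {w. w \<bullet> v \<ge> real n} x) \<longlonglongrightarrow> 0"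
      proof (rule AE_I2)
        fix x :: 'a
        obtain m :: nat where m: "x \<bullet> v < real m" using reals_Archimedean2 by blast
        have "\<forall>\<^sub>F n in sequentially. gn x * indicator {w. w \<bullet> v \<ge> real n} x = 0"
          using eventually_ge_at_top[of m] by eventually_elim (use m in auto)
        then show "(\<lambda>n. gn x * indicator {w. w \<bullet> v \<ge> real n} x) \<longlonglongrightarrow> 0" by (rule tendsto_eventually)
      qed
    qed (auto simp: indicator_def)
    then show ?thesis unfolding Eb by simp
  qed
  then have "(\<lambda>n. E (real n) + X) \<longlonglongrightarrow> 0 + X" by (intro tendsto_add tendsto_const)
  then have "(\<integral>\<^sup>+z\<in>S. ennreal (norm (g z)) \<partial>lborel) \<le> 0 + X"
    by (rule LIMSEQ_le_const) (use step in blast)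
  then show ?thesis by (simp add: X_def)
qed

lemma ennreal_triple: "x + (x + x) = 3 * x" for x :: ennreal
proof -
  have "3 * x = (1 + 2) * x" by simp
  also have "\<dots> = x + 2 * x" by (simp only: distrib_right mult_1_left)
  finally show ?thesis by (simp only: mult_2)
qed

text \<open>Off a null hyperplane space consists of two half spaces, each treated with rays leading
  away from the hyperplane. Going back from \<open>w\<close> along such a ray inside its half space,
  the norm does not increase and the length is at most \<open>norm w\<close>. The length gives the
  weight, and the monotone norm keeps \<open>w\<close> in the region
  \<open>norm w \<ge> r\<close>.\<close>

lemma hardy_far:
  fixes g D :: "'a::euclidean_space \<Rightarrow> complex"
  assumes g: "line_deriv g D v" "line_cont D v" and g': "line_deriv g (\<lambda>x. - D x) (- v)" "line_cont (\<lambda>x. - D x) (- v)"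
    and v: "norm v = 1" and gi: "integrable lebesgue g" and Dm: "D \<in> borel_measurable lebesgue"
  shows "(\<integral>\<^sup>+z\<in>{z. norm z \<ge> r}. ennreal (norm (g z)) \<partial>lborel)
    \<le> 2 * (\<integral>\<^sup>+w\<in>{w. norm w \<ge> r}. ennreal (norm w * norm (D w)) \<partial>lborel)"
proof -
  let ?X = "\<integral>\<^sup>+w\<in>{w. norm w \<ge> r}. ennreal (norm w * norm (D w)) \<partial>lborel"
  have half: "(\<integral>\<^sup>+z\<in>{z. norm z \<ge> r \<and> z \<bullet> v > 0}. ennreal (norm (g z)) \<partial>lborel) \<le> ?X"
    if g: "line_deriv g D v" "line_cont D v" and v: "norm v = 1" and Dm: "D \<in> borel_measurable lebesgue"
      and X: "?X = (\<integral>\<^sup>+w\<in>{w. norm w \<ge> r}. ennreal (norm w * norm (D w)) \<partial>lborel)" for v D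
  proof -
    have vv: "v \<bullet> v = 1" using v by (simp add: dot_square_norm)
    define S where "S = {z. norm z \<ge> r \<and> z \<bullet> v > 0}"
    have [measurable]: "S \<in> sets borel" unfolding S_def by measurable
    have "(\<integral>\<^sup>+z\<in>S. ennreal (norm (g z)) \<partial>lborel)
        \<le> (\<integral>\<^sup>+w. ennreal (norm (D w)) * emeasure lborel {u \<in> {0..}. w - u *\<^sub>R v \<in> S} \<partial>lborel)"
      by (rule hardy_half_space[OF g vv gi Dm]) (auto simp: S_def)
    also have "\<dots> \<le> (\<integral>\<^sup>+w\<in>{w. norm w \<ge> r}. ennreal (norm w * norm (D w)) \<partial>lborel)"
    proof (rule nn_integral_mono)
      fix w
      let ?U = "{u \<in> {0..}. w - u *\<^sub>R v \<in> S}"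
      \<comment> \<open>With \<open>p = w - u v\<close>, both the cross term
        \<open>2 * (u * (p \<bullet> v))\<close> and \<open>u\<^sup>2\<close> in the expansion are
        nonnegative.\<close>
      have nle: "norm (w - u *\<^sub>R v) \<le> norm w" if "u \<in> ?U" for u
      proof -
        have p: "u \<ge> 0" "(w - u *\<^sub>R v) \<bullet> v > 0" using that by (auto simp: S_def)
        have "(norm w)\<^sup>2 = (norm ((w - u *\<^sub>R v) + u *\<^sub>R v))\<^sup>2" by simp
        also have "(norm (p + u *\<^sub>R v))\<^sup>2 = (norm p)\<^sup>2 + 2 * (u * (p \<bullet> v)) + u\<^sup>2" for p
          unfolding power2_norm_eq_inner inner_add_left inner_add_right inner_scaleR_left inner_scaleR_right inner_commute[of v p] vv
          by (simp add: power2_eq_square algebra_simps)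
        finally have "(norm (w - u *\<^sub>R v))\<^sup>2 \<le> (norm w)\<^sup>2" using p mult_nonneg_nonneg[OF p(1) less_imp_le[OF p(2)]] by simp
        then show ?thesis by (rule power2_le_imp_le) simp
      qed
      have sub: "?U \<subseteq> {0..norm w}"
      proof
        fix u assume u: "u \<in> ?U"
        then have "u < w \<bullet> v" using vv by (auto simp: S_def inner_diff_left)
        also have "w \<bullet> v \<le> norm w" using norm_cauchy_schwarz[of w v] v by simp
        finally show "u \<in> {0..norm w}" using u by simp
      qed
      have "emeasure lborel ?U \<le> ennreal (norm w) * indicator {w. norm w \<ge> r} w"
      proof (cases "norm w \<ge> r")
        case True
        have "emeasure lborel ?U \<le> emeasure lborel {0..norm w}" by (rule emeasure_mono[OF sub]) simp
        then show ?thesis using True by simp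
      next
        case False
        have U: "?U = {}" using nle False by (force simp: S_def)
        show ?thesis unfolding U by simp
      qed
      then have "ennreal (norm (D w)) * emeasure lborel ?U \<le> ennreal (norm (D w)) * (ennreal (norm w) * indicator {w. norm w \<ge> r} w)"
        by (rule mult_left_mono) simp
      then show "ennreal (norm (D w)) * emeasure lborel ?U \<le> ennreal (norm w * norm (D w)) * indicator {w. norm w \<ge> r} w"
        by (simp add: ennreal_mult mult_ac)
    qed
    finally show ?thesis unfolding S_def X .
  qed
  have v0: "v \<noteq> 0" using v by auto
  have "negligible {z. v \<bullet> z = 0}" by (rule negligible_hyperplane) (simp add: v0)
  then have null: "AE z in lborel. v \<bullet> z \<noteq> 0"
    by (intro AE_not_in[of "{z. v \<bullet> z = 0}", simplified]) (simp add: negligible_iff_null_sets null_sets_completion_iff)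
  define A B where "A = {z. norm z \<ge> r \<and> z \<bullet> v > 0}" and "B = {z. norm z \<ge> r \<and> z \<bullet> (- v) > 0}"
  have [measurable]: "A \<in> sets borel" "B \<in> sets borel" unfolding A_def B_def by measurable
  obtain gn N where gn: "gn \<in> borel_measurable borel" "N \<in> sets borel" "emeasure lborel N = 0" "\<And>x. x \<notin> N \<Longrightarrow> ennreal (norm (g x)) = gn x"
    using lebesgue_borel_version[of "\<lambda>x. ennreal (norm (g x))"] gi by auto
  have [measurable]: "gn \<in> borel_measurable borel" by fact
  have N: "AE x in lborel. ennreal (norm (g x)) = gn x"
    by (rule AE_mp[OF AE_not_in[of N]]) (use gn in \<open>auto simp: null_sets_def\<close>)
  have vers: "(\<integral>\<^sup>+z\<in>X. ennreal (norm (g z)) \<partial>lborel) = (\<integral>\<^sup>+z\<in>X. gn z \<partial>lborel)" for X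
    using N by (intro nn_integral_cong_AE) (auto elim!: eventually_mono)
  have "(\<integral>\<^sup>+z\<in>{z. norm z \<ge> r}. gn z \<partial>lborel) \<le> (\<integral>\<^sup>+z. gn z * indicator A z + gn z * indicator B z \<partial>lborel)"
    by (intro nn_integral_mono_AE, rule AE_mp[OF null]) (auto simp: A_def B_def indicator_def inner_commute)
  also have "\<dots> = (\<integral>\<^sup>+z\<in>A. gn z \<partial>lborel) + (\<integral>\<^sup>+z\<in>B. gn z \<partial>lborel)" by (rule nn_integral_add) measurable
  also have "\<dots> \<le> ?X + ?X"
    unfolding vers[symmetric] A_def B_def
    by (intro add_mono half[OF g v Dm refl] half[OF g' _ _ ]) (use v Dm in auto)
  finally show ?thesis unfolding vers by (simp add: mult_2)
qed

text \<open>Going back from a given \<open>w\<close> in the direction \<open>v\<close>, the lengths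
  that end in the slab fill at most an interval of length \<open>h\<close>.\<close>

lemma hardy_slab:
  fixes g D :: "'a::euclidean_space \<Rightarrow> complex"
  assumes g: "line_deriv g D v" "line_cont D v"
    and v: "norm v = 1" and gi: "integrable lebesgue g" and Dm: "D \<in> borel_measurable lebesgue" and h: "h \<ge> 0"
  shows "(\<integral>\<^sup>+z\<in>{z. 0 < z \<bullet> v \<and> z \<bullet> v \<le> h}. ennreal (norm (g z)) \<partial>lborel)
    \<le> ennreal h * (\<integral>\<^sup>+w. ennreal (norm (D w)) \<partial>lborel)"
proof -
  have vv: "v \<bullet> v = 1" using v by (simp add: dot_square_norm)
  define S where "S = {z. 0 < z \<bullet> v \<and> z \<bullet> v \<le> h}"
  have [measurable]: "S \<in> sets borel" unfolding S_def by measurable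
  have "(\<integral>\<^sup>+z\<in>S. ennreal (norm (g z)) \<partial>lborel)
      \<le> (\<integral>\<^sup>+w. ennreal (norm (D w)) * emeasure lborel {u \<in> {0..}. w - u *\<^sub>R v \<in> S} \<partial>lborel)"
    by (rule hardy_half_space[OF g vv gi Dm]) (auto simp: S_def)
  also have "\<dots> \<le> (\<integral>\<^sup>+w. ennreal (norm (D w)) * ennreal h \<partial>lborel)"
  proof (intro nn_integral_mono mult_left_mono)
    fix w
    have "{u \<in> {0..}. w - u *\<^sub>R v \<in> S} \<subseteq> {w \<bullet> v - h..w \<bullet> v}"
      using vv by (auto simp: S_def inner_diff_left)
    then have "emeasure lborel {u \<in> {0..}. w - u *\<^sub>R v \<in> S} \<le> emeasure lborel {w \<bullet> v - h..w \<bullet> v}"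
      by (rule emeasure_mono) simp
    then show "emeasure lborel {u \<in> {0..}. w - u *\<^sub>R v \<in> S} \<le> ennreal h" using h by simp
  qed simp
  also have "\<dots> = ennreal h * (\<integral>\<^sup>+w. ennreal (norm (D w)) \<partial>lborel)"
    using Dm by (subst nn_integral_completion[symmetric], subst nn_integral_multc) (auto simp: nn_integral_completion mult.commute)
  finally show ?thesis unfolding S_def .
qed

text \<open>If the segment from \<open>z\<close> to \<open>z + h v\<close> misses the hyperplane
  through 0, the increment is the integral of the derivative along it. Otherwise the triangle
  inequality is used: the two end points lie in slabs of width \<open>h\<close> on opposite sides of
  the hyperplane, where \<open>hardy_slab\<close> applies. These three contributions make the factor
  3.\<close>

lemma translation_bound:
  fixes g D :: "'a::euclidean_space \<Rightarrow> complex"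
  assumes g: "line_deriv g D v" "line_cont D v" and g': "line_deriv g (\<lambda>x. - D x) (- v)" "line_cont (\<lambda>x. - D x) (- v)"
    and v: "norm v = 1" and gi: "integrable lebesgue g" and Dm: "D \<in> borel_measurable lebesgue" and h: "h \<ge> 0"
  shows "(\<integral>\<^sup>+z. ennreal (norm (g (z + h *\<^sub>R v) - g z)) \<partial>lborel)
    \<le> ennreal (3 * h) * (\<integral>\<^sup>+w. ennreal (norm (D w)) \<partial>lborel)"
proof -
  have vv: "v \<bullet> v = 1" using v by (simp add: dot_square_norm)
  let ?I = "\<integral>\<^sup>+w. ennreal (norm (D w)) \<partial>lborel"
  have Dm': "(\<lambda>w. ennreal (norm (D w))) \<in> borel_measurable lebesgue" using Dm by measurable
  obtain gn N where gn: "gn \<in> borel_measurable borel" "N \<in> sets borel" "emeasure lborel N = 0" "\<And>x. x \<notin> N \<Longrightarrow> ennreal (norm (g x)) = gn x"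
    using lebesgue_borel_version[of "\<lambda>x. ennreal (norm (g x))"] gi by auto
  obtain Dn M where Dn: "Dn \<in> borel_measurable borel" "M \<in> sets borel" "emeasure lborel M = 0" "\<And>x. x \<notin> M \<Longrightarrow> ennreal (norm (D x)) = Dn x"
    using lebesgue_borel_version[OF Dm'] by auto
  have [measurable]: "gn \<in> borel_measurable borel" "Dn \<in> borel_measurable borel" by fact+
  have N: "AE x in lborel. x \<notin> N" by (rule AE_not_in) (use gn in \<open>simp add: null_sets_def\<close>)
  have M: "AE x in lborel. x \<notin> M" by (rule AE_not_in) (use Dn in \<open>simp add: null_sets_def\<close>)
  have De: "AE z in lborel. (\<integral>\<^sup>+u\<in>{0..h}. ennreal (norm (D (z + u *\<^sub>R v))) \<partial>lborel) = (\<integral>\<^sup>+u\<in>{0..h}. Dn (z + u *\<^sub>R v) \<partial>lborel)"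
    by (rule line_integral_AE_cong[OF Dn(2,3)]) (rule Dn(4))
  have v0: "v \<noteq> 0" using v by auto
  have "negligible {z. v \<bullet> z = 0}" by (rule negligible_hyperplane) (simp add: v0)
  then have null: "AE z in lborel. z \<bullet> v \<noteq> 0"
    by (intro AE_not_in[of "{z. z \<bullet> v = 0}", simplified]) (simp add: negligible_iff_null_sets null_sets_completion_iff inner_commute)
  have "negligible {z. v \<bullet> z = - h}" by (rule negligible_hyperplane) (simp add: v0)
  then have null2: "AE z in lborel. z \<bullet> v \<noteq> - h"
    by (intro AE_not_in[of "{z. z \<bullet> v = - h}", simplified]) (simp add: negligible_iff_null_sets null_sets_completion_iff inner_commute)
  define A B where "A = {z. 0 < z \<bullet> v \<and> z \<bullet> v \<le> h}" and "B = {z. 0 < z \<bullet> (- v) \<and> z \<bullet> (- v) \<le> h}"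
  have [measurable]: "A \<in> sets borel" "B \<in> sets borel" unfolding A_def B_def by measurable
  have "(\<integral>\<^sup>+z. ennreal (norm (g (z + h *\<^sub>R v) - g z)) \<partial>lborel)
      \<le> (\<integral>\<^sup>+z. (\<integral>\<^sup>+u\<in>{0..h}. Dn (z + u *\<^sub>R v) \<partial>lborel) + (gn (z + h *\<^sub>R v) * indicator A (z + h *\<^sub>R v) + gn z * indicator B z) \<partial>lborel)"
  proof (rule nn_integral_mono_AE)
    show "AE z in lborel. ennreal (norm (g (z + h *\<^sub>R v) - g z))
      \<le> (\<integral>\<^sup>+u\<in>{0..h}. Dn (z + u *\<^sub>R v) \<partial>lborel) + (gn (z + h *\<^sub>R v) * indicator A (z + h *\<^sub>R v) + gn z * indicator B z)"
      using N AE_shift[OF gn(2,3), of "h *\<^sub>R v"] De null null2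
    proof eventually_elim
      case (elim z)
      show ?case
      proof (cases "z \<bullet> v > 0 \<or> z \<bullet> v < - h")
        case True
        have nz: "z + u *\<^sub>R v \<noteq> 0" if "u \<in> {0..h}" for u
        proof
          assume "z + u *\<^sub>R v = 0"
          then have "(z + u *\<^sub>R v) \<bullet> v = 0" by simp
          then show False using True that vv by (simp add: inner_add_left)
        qed
        have "ennreal (norm (g (z + h *\<^sub>R v) - g z)) \<le> (\<integral>\<^sup>+u\<in>{0..h}. ennreal (norm (D (z + u *\<^sub>R v))) \<partial>lborel)"
          by (rule line_segment_bound[OF g h nz])
        also note elim(3)
        finally show ?thesis by (simp add: add_increasing2)
      next
        case False
        then have s: "- h < z \<bullet> v" "z \<bullet> v < 0" using elim(4,5) by auto
        then have "z + h *\<^sub>R v \<in> A" "z \<in> B" using vv by (auto simp: A_def B_def inner_add_left)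
        then have "gn (z + h *\<^sub>R v) * indicator A (z + h *\<^sub>R v) + gn z * indicator B z = ennreal (norm (g (z + h *\<^sub>R v)) + norm (g z))"
          using gn(4)[OF elim(1)] gn(4)[OF elim(2)] by simp
        moreover have "ennreal (norm (g (z + h *\<^sub>R v) - g z)) \<le> ennreal (norm (g (z + h *\<^sub>R v)) + norm (g z))"
          by (intro ennreal_leI norm_triangle_ineq4)
        ultimately show ?thesis by (simp add: add_increasing)
      qed
    qed
  qed
  also have "\<dots> = (\<integral>\<^sup>+z. (\<integral>\<^sup>+u\<in>{0..h}. Dn (z + u *\<^sub>R v) \<partial>lborel) \<partial>lborel)
      + ((\<integral>\<^sup>+z. gn (z + h *\<^sub>R v) * indicator A (z + h *\<^sub>R v) \<partial>lborel) + (\<integral>\<^sup>+z\<in>B. gn z \<partial>lborel))"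
    by (simp add: nn_integral_add)
  also have "(\<integral>\<^sup>+z. gn (z + h *\<^sub>R v) * indicator A (z + h *\<^sub>R v) \<partial>lborel) = (\<integral>\<^sup>+z\<in>A. gn z \<partial>lborel)"
    using nn_integral_shift[of "\<lambda>w. gn w * indicator A w" "h *\<^sub>R v"] by (simp add: add.commute)
  also have "(\<integral>\<^sup>+z\<in>A. gn z \<partial>lborel) = (\<integral>\<^sup>+z\<in>A. ennreal (norm (g z)) \<partial>lborel)"
    using N by (intro nn_integral_cong_AE) (auto elim!: eventually_mono simp: gn(4))
  also have "(\<integral>\<^sup>+z\<in>B. gn z \<partial>lborel) = (\<integral>\<^sup>+z\<in>B. ennreal (norm (g z)) \<partial>lborel)"
    using N by (intro nn_integral_cong_AE) (auto elim!: eventually_mono simp: gn(4))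
  also have "(\<integral>\<^sup>+z. (\<integral>\<^sup>+u\<in>{0..h}. Dn (z + u *\<^sub>R v) \<partial>lborel) \<partial>lborel) = ennreal h * ?I"
  proof -
    have "Dn \<in> borel_measurable lebesgue" by (simp add: measurable_completion)
    moreover have "{u. 0 \<le> u \<and> u \<le> h} = {0..h}" by auto
    moreover note line_tonelli[OF calculation(1), of UNIV "{0..h}" v]
    ultimately
    have "(\<integral>\<^sup>+z. (\<integral>\<^sup>+u\<in>{0..h}. Dn (z + u *\<^sub>R v) \<partial>lborel) \<partial>lborel) = (\<integral>\<^sup>+w. Dn w * ennreal h \<partial>lborel)"
      using h by simp
    also have "\<dots> = ennreal h * (\<integral>\<^sup>+w. Dn w \<partial>lborel)" by (subst nn_integral_multc) (simp_all add: mult.commute)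
    also have "(\<integral>\<^sup>+w. Dn w \<partial>lborel) = ?I"
      using M by (intro nn_integral_cong_AE) (auto elim!: eventually_mono simp: Dn(4))
    finally show ?thesis .
  qed
  also have "ennreal h * ?I + ((\<integral>\<^sup>+z\<in>A. ennreal (norm (g z)) \<partial>lborel) + (\<integral>\<^sup>+z\<in>B. ennreal (norm (g z)) \<partial>lborel))
      \<le> ennreal h * ?I + (ennreal h * ?I + ennreal h * ?I)"
  proof (intro add_mono order_refl)
    show "(\<integral>\<^sup>+z\<in>A. ennreal (norm (g z)) \<partial>lborel) \<le> ennreal h * ?I"
      unfolding A_def by (rule hardy_slab[OF g v gi Dm h])
    show "(\<integral>\<^sup>+z\<in>B. ennreal (norm (g z)) \<partial>lborel) \<le> ennreal h * ?I"
      unfolding B_def using hardy_slab[OF g' _ gi _ h] v Dm by simp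
  qed
  also have "\<dots> = ennreal (3 * h) * ?I"
    using h by (simp only: ennreal_triple) (simp add: ennreal_mult' mult.assoc)
  finally show ?thesis .
qed

text \<open>
  Moving a point of the ball of radius \<open>R\<close> by \<open>2 R\<close> away from the hyperplane through the singularity
  lands outside the ball, along a segment on which the second derivative is bounded.
\<close>

lemma L1_bound_from_tail:
  fixes D :: "'a::euclidean_space \<Rightarrow> complex"
  assumes v: "norm v = 1" and Dm: "D \<in> borel_measurable lebesgue" and R: "R > 0" and M: "M \<ge> 0"
    and up: "\<And>y. y \<noteq> 0 \<Longrightarrow> y \<bullet> v \<ge> 0 \<Longrightarrow> norm (D (y + (2 * R) *\<^sub>R v) - D y) \<le> 2 * R * M"
    and down: "\<And>y. y \<noteq> 0 \<Longrightarrow> y \<bullet> v \<le> 0 \<Longrightarrow> norm (D (y - (2 * R) *\<^sub>R v) - D y) \<le> 2 * R * M"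
  shows "(\<integral>\<^sup>+w. ennreal (norm (D w)) \<partial>lborel)
    \<le> 3 * (\<integral>\<^sup>+w\<in>{w. norm w \<ge> R}. ennreal (norm (D w)) \<partial>lborel) + ennreal (2 * R * M * (unit_ball_vol (real DIM('a)) * R ^ DIM('a)))"
proof -
  have Dm': "(\<lambda>w. ennreal (norm (D w))) \<in> borel_measurable lebesgue" using Dm by measurable
  obtain Dn N where Dn: "Dn \<in> borel_measurable borel" "N \<in> sets borel" "emeasure lborel N = 0" "\<And>x. x \<notin> N \<Longrightarrow> ennreal (norm (D x)) = Dn x"
    using lebesgue_borel_version[OF Dm'] by auto
  have [measurable]: "Dn \<in> borel_measurable borel" by fact
  have N: "AE x in lborel. x \<notin> N" by (rule AE_not_in) (use Dn in \<open>simp add: null_sets_def\<close>)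
  have N0: "AE x in lborel. x \<noteq> (0::'a)" by (rule AE_I[of _ _ "{0}"]) auto
  define T where "T w = Dn w * indicator {w. norm w \<ge> R} w" for w
  have Tm[measurable]: "T \<in> borel_measurable borel" unfolding T_def by measurable
  let ?X = "\<integral>\<^sup>+w. T w \<partial>lborel"
  let ?c = "ennreal (2 * R * M)"
  have far: "norm (y + z) \<ge> R" if "norm y < R" "norm z = 2 * R" for y z :: 'a
    using norm_triangle_ineq4[of "y + z" y] that by simp
  have nv: "norm ((2 * R) *\<^sub>R v) = 2 * R" "norm (- ((2 * R) *\<^sub>R v)) = 2 * R" using v R by auto
  have "(\<integral>\<^sup>+w. ennreal (norm (D w)) \<partial>lborel)
     \<le> (\<integral>\<^sup>+w. T w + (T (w + (2 * R) *\<^sub>R v) + (T (w + - ((2 * R) *\<^sub>R v)) + ?c * indicator (ball 0 R) w)) \<partial>lborel)"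
  proof (rule nn_integral_mono_AE)
    show "AE w in lborel. ennreal (norm (D w))
      \<le> T w + (T (w + (2 * R) *\<^sub>R v) + (T (w + - ((2 * R) *\<^sub>R v)) + ?c * indicator (ball 0 R) w))"
      using N N0 AE_shift[OF Dn(2,3), of "(2 * R) *\<^sub>R v"] AE_shift[OF Dn(2,3), of "- ((2 * R) *\<^sub>R v)"]
    proof eventually_elim
      case (elim w)
      show ?case
      proof (cases "norm w \<ge> R")
        case True
        then have "ennreal (norm (D w)) = T w" using Dn(4)[OF elim(1)] by (simp add: T_def)
        then show ?thesis by (simp add: add_increasing2)
      next
        case False
        then have b: "?c * indicator (ball 0 R) w = ?c" "norm w < R" by (auto simp: dist_norm)
        have t: "ennreal (norm (D w)) \<le> ennreal (norm (D w')) + ?c" if "norm (D w' - D w) \<le> 2 * R * M" for w'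
        proof -
          have "norm (D w) \<le> norm (D w') + 2 * R * M" using that norm_triangle_sub[of "D w" "D w'"] by (simp add: norm_minus_commute)
          then have "ennreal (norm (D w)) \<le> ennreal (norm (D w') + 2 * R * M)" by (rule ennreal_leI)
          then show ?thesis using R M by (simp add: ennreal_plus)
        qed
        show ?thesis
        proof (cases "w \<bullet> v \<ge> 0")
          case True
          have "ennreal (norm (D w)) \<le> ennreal (norm (D (w + (2 * R) *\<^sub>R v))) + ?c" by (rule t[OF up[OF elim(2) True]])
          also have "ennreal (norm (D (w + (2 * R) *\<^sub>R v))) = T (w + (2 * R) *\<^sub>R v)"
            using Dn(4)[OF elim(3)] far[OF b(2) nv(1)] by (simp add: T_def)
          finally show ?thesis unfolding b(1) by (meson add_mono order_refl order_trans add_increasing zero_le)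
        next
          case F: False
          have "ennreal (norm (D w)) \<le> ennreal (norm (D (w + - ((2 * R) *\<^sub>R v)))) + ?c" using t[OF down[OF elim(2)]] F by simp
          also have "ennreal (norm (D (w + - ((2 * R) *\<^sub>R v)))) = T (w + - ((2 * R) *\<^sub>R v))"
            using Dn(4)[OF elim(4)] far[OF b(2) nv(2)] by (simp add: T_def)
          finally show ?thesis unfolding b(1) by (meson add_mono order_refl order_trans add_increasing zero_le)
        qed
      qed
    qed
  qed
  also have "\<dots> = ?X + ((\<integral>\<^sup>+w. T (w + (2 * R) *\<^sub>R v) \<partial>lborel) + ((\<integral>\<^sup>+w. T (w + - ((2 * R) *\<^sub>R v)) \<partial>lborel) + ?c * emeasure lborel (ball (0::'a) R)))"
  proof -
    have [measurable]: "Measurable.pred borel (\<lambda>x. x \<in> ball (0::'a) R)" by (simp add: pred_def)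
    have m1: "(\<lambda>w. T (w + (2 * R) *\<^sub>R v)) \<in> borel_measurable lborel" by measurable
    have m2: "(\<lambda>w. T (w + - ((2 * R) *\<^sub>R v))) \<in> borel_measurable lborel" by measurable
    have m3: "(\<lambda>w. ?c * indicator (ball (0::'a) R) w) \<in> borel_measurable lborel"
      by measurable
    have m4: "T \<in> borel_measurable lborel" using Tm by simp
    have "(\<integral>\<^sup>+w. ?c * indicator (ball (0::'a) R) w \<partial>lborel) = ?c * emeasure lborel (ball (0::'a) R)"
      by (rule nn_integral_cmult_indicator) simp
    then show ?thesis
      unfolding nn_integral_add[OF m4 borel_measurable_add[OF m1 borel_measurable_add[OF m2 m3]]]
        nn_integral_add[OF m1 borel_measurable_add[OF m2 m3]] nn_integral_add[OF m2 m3] by (simp only:)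
  qed
  also have "(\<integral>\<^sup>+w. T (w + (2 * R) *\<^sub>R v) \<partial>lborel) = ?X" using nn_integral_shift[of T "(2 * R) *\<^sub>R v"] by (simp add: add.commute)
  also have "(\<integral>\<^sup>+w. T (w + - ((2 * R) *\<^sub>R v)) \<partial>lborel) = ?X" using nn_integral_shift[of T "- ((2 * R) *\<^sub>R v)"] by (simp add: add.commute)
  also have "?X = (\<integral>\<^sup>+w\<in>{w. norm w \<ge> R}. ennreal (norm (D w)) \<partial>lborel)"
    unfolding T_def using N by (intro nn_integral_cong_AE) (auto elim!: eventually_mono simp: Dn(4))
  also have "?c * emeasure lborel (ball (0::'a) R) = ennreal (2 * R * M * (unit_ball_vol (real DIM('a)) * R ^ DIM('a)))"
    using R M by (simp add: emeasure_ball ennreal_mult)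
  finally show ?thesis unfolding ennreal_triple[symmetric] by (simp add: add.assoc)
qed

text \<open>Over the dyadic annuli starting at \<open>r * 2 ^ k\<close> the integrals are bounded by
  a geometric series of ratio \<open>2 powr (DIM('a) - q)\<close>, which is less than 1.\<close>

lemma tail_power_integral:
  assumes q: "q > real DIM('a::euclidean_space)"
  shows "\<exists>c\<ge>0. \<forall>r>0. (\<integral>\<^sup>+x\<in>{x :: 'a. norm x \<ge> r}. ennreal (norm x powr (- q)) \<partial>lborel) \<le> ennreal (c * r powr (real DIM('a) - q))"
proof -
  let ?d = "DIM('a)"
  define b where "b = unit_ball_vol (real ?d) * 2 ^ ?d"
  define \<rho> where "\<rho> = 2 powr (real ?d - q)"
  have \<rho>: "0 < \<rho>" "\<rho> < 1" using q by (auto simp: \<rho>_def intro: powr_less_one)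
  define c where "c = b * (1 / (1 - \<rho>))"
  have b0: "b \<ge> 0" by (simp add: b_def)
  have c0: "c \<ge> 0" using \<rho> b0 by (simp add: c_def)
  have "(\<integral>\<^sup>+x\<in>{x :: 'a. norm x \<ge> r}. ennreal (norm x powr (- q)) \<partial>lborel) \<le> ennreal (c * r powr (real ?d - q))" if r: "r > 0" for r
  proof -
    let ?t = "\<lambda>k. r * 2 ^ k"
    have "(\<integral>\<^sup>+x\<in>{x :: 'a. norm x \<ge> r}. ennreal (norm x powr (- q)) \<partial>lborel)
      \<le> (\<integral>\<^sup>+x. (\<Sum>k. ennreal (?t k powr (- q)) * indicator (ball (0::'a) (?t (Suc k))) x) \<partial>lborel)"
    proof (rule nn_integral_mono)
      fix x :: 'a
      show "ennreal (norm x powr (- q)) * indicator {x. norm x \<ge> r} x \<le> (\<Sum>k. ennreal (?t k powr (- q)) * indicator (ball (0::'a) (?t (Suc k))) x)"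
      proof (cases "norm x \<ge> r")
        case True
        obtain n where "norm x / r < 2 ^ n" using real_arch_pow[of 2 "norm x / r"] by auto
        then have ex: "norm x < ?t n" using r by (simp add: field_simps)
        define k where "k = (LEAST k. norm x < ?t k)"
        have k: "norm x < ?t k" unfolding k_def by (rule LeastI) (rule ex)
        have "k \<noteq> 0"
        proof
          assume "k = 0" then show False using k True by simp
        qed
        then obtain j where j: "k = Suc j" by (cases k) auto
        have "\<not> norm x < ?t j" using not_less_Least[of j "\<lambda>k. norm x < ?t k"] j unfolding k_def by simp
        then have nj: "?t j \<le> norm x" by simp
        have tj: "?t j > 0" using r by simp
        have "ennreal (norm x powr (- q)) \<le> ennreal (?t j powr (- q))"
          using nj tj q by (intro ennreal_leI powr_mono2') auto
        also have "\<dots> = (\<Sum>k\<in>{j}. ennreal (?t k powr (- q)) * indicator (ball (0::'a) (?t (Suc k))) x)"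
          using k by (simp add: j)
        also have "\<dots> \<le> (\<Sum>k. ennreal (?t k powr (- q)) * indicator (ball (0::'a) (?t (Suc k))) x)" by (rule sum_le_suminf) auto
        finally show ?thesis using True by simp
      qed simp
    qed
    also have "\<dots> = (\<Sum>k. \<integral>\<^sup>+x. ennreal (?t k powr (- q)) * indicator (ball (0::'a) (?t (Suc k))) x \<partial>lborel)"
    proof (rule nn_integral_suminf[where f = "\<lambda>k x. ennreal (?t k powr (- q)) * indicator (ball (0::'a) (?t (Suc k))) x"])
      fix k
      have [measurable]: "Measurable.pred borel (\<lambda>x. x \<in> ball (0::'a) (?t (Suc k)))" by (simp add: pred_def)
      show "(\<lambda>x. ennreal (?t k powr (- q)) * indicator (ball (0::'a) (?t (Suc k))) x) \<in> borel_measurable lborel"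
        by measurable
    qed
    also have "\<dots> = (\<Sum>k. ennreal (b * r powr (real ?d - q) * \<rho> ^ k))"
    proof (rule suminf_cong)
      fix k
      have t: "?t k > 0" using r by simp
      have "(\<integral>\<^sup>+x. ennreal (?t k powr (- q)) * indicator (ball (0::'a) (?t (Suc k))) x \<partial>lborel)
          = ennreal (?t k powr (- q)) * ennreal (unit_ball_vol (real ?d) * (?t (Suc k)) ^ ?d)"
        using r by (simp add: nn_integral_cmult_indicator emeasure_ball)
      also have "\<dots> = ennreal (?t k powr (- q) * (unit_ball_vol (real ?d) * (?t (Suc k)) ^ ?d))"
        using r by (intro ennreal_mult[symmetric]) auto
      also have "?t k powr (- q) * (unit_ball_vol (real ?d) * (?t (Suc k)) ^ ?d) = b * (?t k powr (- q) * ?t k powr (real ?d))"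
        using t by (simp add: b_def powr_realpow power_mult_distrib mult_ac)
      also have "?t k powr (- q) * ?t k powr (real ?d) = ?t k powr (real ?d - q)" using t by (simp add: powr_add[symmetric])
      also have "?t k powr (real ?d - q) = r powr (real ?d - q) * \<rho> ^ k"
        using r by (simp add: powr_mult \<rho>_def powr_realpow[symmetric] powr_powr mult.commute)
      finally show "(\<integral>\<^sup>+x. ennreal (?t k powr (- q)) * indicator (ball (0::'a) (?t (Suc k))) x \<partial>lborel) = ennreal (b * r powr (real ?d - q) * \<rho> ^ k)"
        by (simp add: mult.assoc)
    qed
    also have "\<dots> = ennreal (\<Sum>k. b * r powr (real ?d - q) * \<rho> ^ k)"
      using \<rho> b0 by (intro suminf_ennreal2) (auto intro!: summable_mult summable_geometric)
    also have "(\<Sum>k. b * r powr (real ?d - q) * \<rho> ^ k) = b * r powr (real ?d - q) * (1 / (1 - \<rho>))"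
      using \<rho> by (subst suminf_mult) (auto simp: suminf_geometric summable_geometric)
    finally show ?thesis by (simp add: c_def mult_ac)
  qed
  then show ?thesis using c0 by blast
qed

text \<open>Cauchy-Schwarz against the weight \<open>norm x powr (2 * j - \<mu>)\<close>, which is
  integrable at infinity by the hypothesis on \<open>\<mu>\<close>. It is used in its additive form
  with a parameter, so that no roots of extended integrals are taken; hence \<open>c + N\<close> in
  place of a geometric mean.\<close>

lemma weighted_tail_bound:
  assumes q: "\<mu> - 2 * j > real DIM('a::euclidean_space)"
  shows "\<exists>c\<ge>0. \<forall>D :: 'a \<Rightarrow> complex. \<forall>r>0. \<forall>N\<ge>0. \<forall>\<omega>>0. D \<in> borel_measurable lebesgue \<longrightarrow>
    (\<integral>\<^sup>+x\<in>{x. norm x \<ge> r}. ennreal (norm x powr \<mu> * (norm (D x))\<^sup>2) \<partial>lborel) \<le> ennreal (N * \<omega>\<^sup>2) \<longrightarrow>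
    (\<integral>\<^sup>+x\<in>{x. norm x \<ge> r}. ennreal (norm x powr j * norm (D x)) \<partial>lborel)
      \<le> ennreal ((c + N) * \<omega> * r powr ((real DIM('a) + 2 * j - \<mu>) / 2))"
proof -
  obtain c where c: "c \<ge> 0" "\<And>r. r > 0 \<Longrightarrow> (\<integral>\<^sup>+x\<in>{x :: 'a. norm x \<ge> r}. ennreal (norm x powr (- (\<mu> - 2 * j))) \<partial>lborel) \<le> ennreal (c * r powr (real DIM('a) - (\<mu> - 2 * j)))"
    using tail_power_integral[OF q] by blast
  have "(\<integral>\<^sup>+x\<in>{x. norm x \<ge> r}. ennreal (norm x powr j * norm (D x)) \<partial>lborel)
      \<le> ennreal ((c + N) * \<omega> * r powr ((real DIM('a) + 2 * j - \<mu>) / 2))"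
    if r: "r > 0" and N: "N \<ge> 0" and \<omega>: "\<omega> > 0" and Dm: "D \<in> borel_measurable lebesgue"
      and W: "(\<integral>\<^sup>+x\<in>{x. norm x \<ge> r}. ennreal (norm x powr \<mu> * (norm (D x))\<^sup>2) \<partial>lborel) \<le> ennreal (N * \<omega>\<^sup>2)"
    for D :: "'a \<Rightarrow> complex" and r N \<omega>
  proof -
    have sq: "(y powr (a / 2))\<^sup>2 = y powr a" if "y > 0" for y a :: real using that by (simp add: powr_power)
    define P where "P = r powr ((real DIM('a) + 2 * j - \<mu>) / 2)"
    have P: "P > 0" "P\<^sup>2 = r powr (real DIM('a) - (\<mu> - 2 * j))"
      using r sq[OF r, of "real DIM('a) + 2 * j - \<mu>"] by (auto simp: P_def algebra_simps)
    \<comment> \<open>Balances the two terms: up to constants the integrals are bounded by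
      \<open>P\<^sup>2\<close> and \<open>\<omega>\<^sup>2\<close>, and both products become
      multiples of \<open>\<omega> * P\<close>.\<close>
    define \<theta> where "\<theta> = \<omega> / P"
    have \<theta>: "\<theta> > 0" using \<omega> P by (simp add: \<theta>_def)
    have lin: "ennreal (\<theta> * A + 1 / \<theta> * B) = ennreal \<theta> * ennreal A + ennreal (1 / \<theta>) * ennreal B"
      if "A \<ge> 0" "B \<ge> 0" for A B
    proof -
      have t: "\<theta> \<ge> 0" "1 / \<theta> \<ge> 0" using \<theta> by auto
      show ?thesis
        unfolding ennreal_mult[OF t(1) that(1), symmetric] ennreal_mult[OF t(2) that(2), symmetric]
        by (rule ennreal_plus) (intro mult_nonneg_nonneg t that)+
    qed
    let ?S = "{x :: 'a. norm x \<ge> r}"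
    have "?S \<in> sets borel" by measurable
    then have Sm: "?S \<in> sets lebesgue" by simp
    have "(\<integral>\<^sup>+x\<in>?S. ennreal (norm x powr j * norm (D x)) \<partial>lebesgue)
      \<le> (\<integral>\<^sup>+x. ennreal \<theta> * (ennreal (norm x powr (- (\<mu> - 2 * j))) * indicator ?S x)
           + ennreal (1 / \<theta>) * (ennreal (norm x powr \<mu> * (norm (D x))\<^sup>2) * indicator ?S x) \<partial>lebesgue)"
    proof (rule nn_integral_mono)
      fix x :: 'a
      show "ennreal (norm x powr j * norm (D x)) * indicator ?S x \<le> ennreal \<theta> * (ennreal (norm x powr (- (\<mu> - 2 * j))) * indicator ?S x)
           + ennreal (1 / \<theta>) * (ennreal (norm x powr \<mu> * (norm (D x))\<^sup>2) * indicator ?S x)"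
      proof (cases "norm x \<ge> r")
        case True
        define y where "y = norm x"
        have y: "y > 0" using True r unfolding y_def by linarith
        define p where "p = y powr (- (\<mu> - 2 * j) / 2)"
        define s where "s = y powr (\<mu> / 2) * norm (D x)"
        have ps: "p * s = y powr j * norm (D x)"
          using y by (simp add: p_def s_def powr_add[symmetric] mult.assoc[symmetric] field_simps)
        have p2: "p\<^sup>2 = y powr (- (\<mu> - 2 * j))" unfolding p_def by (rule sq[OF y])
        have s2: "s\<^sup>2 = y powr \<mu> * (norm (D x))\<^sup>2" unfolding s_def power_mult_distrib sq[OF y] ..
        have "0 \<le> (\<theta> * p - s)\<^sup>2" by simp
        then have "2 * (\<theta> * (p * s)) \<le> \<theta>\<^sup>2 * p\<^sup>2 + s\<^sup>2" by (simp add: power2_eq_square algebra_simps)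
        moreover have "\<theta> * (p * s) \<ge> 0" using \<theta> by (simp add: p_def s_def)
        ultimately have "\<theta> * (p * s) \<le> \<theta>\<^sup>2 * p\<^sup>2 + s\<^sup>2" by linarith
        then have "p * s \<le> \<theta> * p\<^sup>2 + 1 / \<theta> * s\<^sup>2" using \<theta> by (simp add: field_simps power2_eq_square)
        then have "ennreal (p * s) \<le> ennreal (\<theta> * p\<^sup>2 + 1 / \<theta> * s\<^sup>2)" by (rule ennreal_leI)
        also have "\<dots> = ennreal \<theta> * ennreal (p\<^sup>2) + ennreal (1 / \<theta>) * ennreal (s\<^sup>2)"
          by (rule lin) auto
        finally show ?thesis using True unfolding ps p2 s2 by (simp add: y_def)
      qed simp
    qed
    also have "\<dots> = ennreal \<theta> * (\<integral>\<^sup>+x\<in>?S. ennreal (norm x powr (- (\<mu> - 2 * j))) \<partial>lebesgue)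
        + ennreal (1 / \<theta>) * (\<integral>\<^sup>+x\<in>?S. ennreal (norm x powr \<mu> * (norm (D x))\<^sup>2) \<partial>lebesgue)"
    proof -
      have [measurable]: "D \<in> borel_measurable lebesgue" "norm \<in> borel_measurable (lebesgue :: 'a measure)" "?S \<in> sets lebesgue"
        using Dm Sm by (auto intro: measurable_completion)
      show ?thesis
        by (subst nn_integral_add, measurable, subst nn_integral_cmult, measurable, subst nn_integral_cmult, measurable)
    qed
    also have "\<dots> \<le> ennreal \<theta> * ennreal (c * P\<^sup>2) + ennreal (1 / \<theta>) * ennreal (N * \<omega>\<^sup>2)"
      unfolding P(2) using c(2)[OF r] W by (intro add_mono mult_left_mono) (simp_all add: nn_integral_completion)
    also have "\<dots> = ennreal (\<theta> * (c * P\<^sup>2) + 1 / \<theta> * (N * \<omega>\<^sup>2))"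
      by (rule lin[symmetric]) (use c N in auto)
    also have "\<theta> * (c * P\<^sup>2) + 1 / \<theta> * (N * \<omega>\<^sup>2) = (c + N) * \<omega> * P"
      using P \<omega> by (simp add: \<theta>_def field_simps power2_eq_square)
    finally show ?thesis by (simp add: P_def nn_integral_completion)
  qed
  then show ?thesis using c(1) by blast
qed

section \<open>Integral estimates for the kernel\<close>

lemma line_deriv_minus:
  assumes "line_deriv g D v" shows "line_deriv g (\<lambda>x. - D x) (- v)"
  unfolding line_deriv_def
proof (intro allI impI)
  fix x :: 'a assume "x \<noteq> 0"
  then have "((\<lambda>h. g (x + h *\<^sub>R v)) has_vector_derivative D x) (at (- 0))"
    using assms by (simp add: line_deriv_def)
  moreover have "(uminus has_vector_derivative - 1) (at (0::real))" by (auto intro!: derivative_eq_intros)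
  ultimately have "(((\<lambda>h. g (x + h *\<^sub>R v)) \<circ> uminus) has_vector_derivative (- 1) *\<^sub>R D x) (at 0)"
    by (intro vector_diff_chain_at) auto
  then show "((\<lambda>h. g (x + h *\<^sub>R - v)) has_vector_derivative - D x) (at 0)"
    by (simp add: o_def)
qed

lemma line_cont_minus:
  assumes "line_cont D v" shows "line_cont (\<lambda>x. - D x) (- v)"
  unfolding line_cont_def
proof (intro allI impI)
  fix x :: 'a assume "x \<noteq> 0"
  then have "isCont (\<lambda>h. D (x + h *\<^sub>R v)) (- 0)" using assms by (simp add: line_cont_def)
  then have "isCont (\<lambda>h. D (x + (- h) *\<^sub>R v)) 0"
    by (rule isCont_o2[rotated]) (intro continuous_intros)
  then show "isCont (\<lambda>h. - D (x + h *\<^sub>R - v)) 0" by (simp add: continuous_minus)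
qed

lemma line_increment_bound:
  assumes D: "line_deriv D E v" and h: "h \<ge> 0" and nz: "\<And>u. u \<in> {0..h} \<Longrightarrow> x + u *\<^sub>R v \<noteq> 0"
    and M: "\<And>y. y \<noteq> 0 \<Longrightarrow> norm (E y) \<le> M"
  shows "norm (D (x + h *\<^sub>R v) - D x) \<le> h * M"
proof (cases "h = 0")
  case False
  then have h0: "0 < h" using h by simp
  have d: "((\<lambda>h. D (x + h *\<^sub>R v)) has_derivative (\<lambda>k. k *\<^sub>R E (x + u *\<^sub>R v))) (at u)" if "u \<in> {0..h}" for u
    using line_derivD[OF D nz[OF that]] by (simp add: has_vector_derivative_def)
  have "continuous_on {0..h} (\<lambda>h. D (x + h *\<^sub>R v))"
    by (rule continuous_at_imp_continuous_on) (use d has_derivative_continuous in blast)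
  then obtain u where u: "u \<in> {0<..<h}" "norm (D (x + h *\<^sub>R v) - D (x + 0 *\<^sub>R v)) \<le> norm ((h - 0) *\<^sub>R E (x + u *\<^sub>R v))"
    using mvt_general[OF h0, of "\<lambda>h. D (x + h *\<^sub>R v)" "\<lambda>u k. k *\<^sub>R E (x + u *\<^sub>R v)"] d by auto
  have "norm (D (x + h *\<^sub>R v) - D (x + 0 *\<^sub>R v)) \<le> norm ((h - 0) *\<^sub>R E (x + u *\<^sub>R v))" by (rule u(2))
  also have "norm ((h - 0) *\<^sub>R E (x + u *\<^sub>R v)) \<le> h * M"
    using M[OF nz[of u]] u(1) h0 by (simp add: mult_left_mono)
  finally show ?thesis by simp
qed simp

lemma locally_integrable_measurable:
  assumes "locally_integrable g" shows "g \<in> borel_measurable lebesgue"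
proof (rule borel_measurable_LIMSEQ_metric)
  fix n :: nat
  have "g absolutely_integrable_on cball 0 (real n)" using assms by (simp add: locally_integrable_def)
  then show "(\<lambda>x. indicat_real (cball 0 (real n)) x *\<^sub>R g x) \<in> borel_measurable lebesgue"
    unfolding set_integrable_def by (rule borel_measurable_integrable)
next
  fix x :: 'a
  obtain m :: nat where m: "norm x < real m" using reals_Archimedean2 by blast
  have "\<forall>\<^sub>F n in sequentially. indicat_real (cball 0 (real n)) x *\<^sub>R g x = g x"
    using eventually_ge_at_top[of m] by eventually_elim (use m in \<open>auto simp: dist_norm\<close>)
  then show "(\<lambda>n. indicat_real (cball 0 (real n)) x *\<^sub>R g x) \<longlonglongrightarrow> g x" by (rule tendsto_eventually)
qed

lemma half_powr_square: "(y powr (a / 2))\<^sup>2 = y powr a" if "y > 0" for y a :: real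
  using that by (simp add: powr_power)

text \<open>The substitution \<open>y = \<tau> powr (- \<kappa>) x\<close> contributes
  \<open>\<kappa> * \<mu>\<close> to the exponent through the weight and
  \<open>\<kappa> * DIM('a)\<close> through the Jacobian; squaring the bound on \<open>D\<close>
  contributes \<open>- 2 * \<sigma>\<close>.\<close>

lemma scaled_weight_bound:
  fixes D :: "'a::euclidean_space \<Rightarrow> complex" and F :: "'a \<Rightarrow> real"
  assumes F: "F \<in> borel_measurable lebesgue" and \<tau>: "\<tau> > 0" and \<rho>: "\<rho> \<ge> 0" and C: "C \<ge> 0" and S: "S \<ge> 0"
    and D: "\<And>x. x \<noteq> 0 \<Longrightarrow> norm x \<ge> \<rho> \<Longrightarrow> norm (D x) \<le> C * (\<tau> powr (- \<sigma>) * \<bar>F (\<tau> powr (- \<kappa>) *\<^sub>R x)\<bar>)"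
    and W: "(\<integral>\<^sup>+y\<in>{y. norm y \<ge> \<tau> powr (- \<kappa>) * \<rho>}. ennreal (norm y powr \<mu> * \<bar>F y\<bar>\<^sup>2) \<partial>lebesgue) \<le> ennreal S"
  shows "(\<integral>\<^sup>+x\<in>{x. norm x \<ge> \<rho>}. ennreal (norm x powr \<mu> * (norm (D x))\<^sup>2) \<partial>lborel)
    \<le> ennreal (C\<^sup>2 * S * \<tau> powr (\<kappa> * \<mu> + \<kappa> * real DIM('a) - 2 * \<sigma>))"
proof -
  define c where "c = \<tau> powr (- \<kappa>)"
  have c: "c > 0" using \<tau> by (simp add: c_def)
  define q where "q = C\<^sup>2 * \<tau> powr (\<kappa> * \<mu> - 2 * \<sigma>)"
  have q: "q \<ge> 0" by (simp add: q_def)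
  define a where "a y = ennreal q * (ennreal (norm y powr \<mu> * \<bar>F y\<bar>\<^sup>2) * indicator {y. norm y \<ge> c * \<rho>} y)" for y
  have nm: "norm \<in> borel_measurable (lebesgue :: 'a measure)" by (auto intro: measurable_completion)
  have "{y :: 'a. norm y \<ge> c * \<rho>} \<in> sets borel" by measurable
  then have sm: "{y :: 'a. norm y \<ge> c * \<rho>} \<in> sets lebesgue" by simp
  note [measurable] = F nm sm
  have am: "a \<in> borel_measurable lebesgue" unfolding a_def by measurable
  have "(\<integral>\<^sup>+x\<in>{x. norm x \<ge> \<rho>}. ennreal (norm x powr \<mu> * (norm (D x))\<^sup>2) \<partial>lborel) \<le> (\<integral>\<^sup>+x. a (c *\<^sub>R x) \<partial>lborel)"
  proof (rule nn_integral_mono)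
    fix x :: 'a
    show "ennreal (norm x powr \<mu> * (norm (D x))\<^sup>2) * indicator {x. norm x \<ge> \<rho>} x \<le> a (c *\<^sub>R x)"
    proof (cases "norm x \<ge> \<rho> \<and> x \<noteq> 0")
      case True
      then have x: "norm x \<ge> \<rho>" "x \<noteq> 0" "norm x > 0" by auto
      have "(norm (D x))\<^sup>2 \<le> (C * (\<tau> powr (- \<sigma>) * \<bar>F (c *\<^sub>R x)\<bar>))\<^sup>2"
        unfolding c_def by (intro power_mono D x) simp
      then have "norm x powr \<mu> * (norm (D x))\<^sup>2 \<le> norm x powr \<mu> * (C * (\<tau> powr (- \<sigma>) * \<bar>F (c *\<^sub>R x)\<bar>))\<^sup>2"
        by (rule mult_left_mono) simp
      also have "\<dots> = q * (norm (c *\<^sub>R x) powr \<mu> * \<bar>F (c *\<^sub>R x)\<bar>\<^sup>2)"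
      proof -
        have "norm (c *\<^sub>R x) powr \<mu> = \<tau> powr (- \<kappa> * \<mu>) * norm x powr \<mu>"
          using c x \<tau> by (simp add: powr_mult c_def powr_powr)
        moreover have "(\<tau> powr (- \<sigma>))\<^sup>2 = \<tau> powr (\<kappa> * \<mu> - 2 * \<sigma>) * \<tau> powr (- \<kappa> * \<mu>)"
          using \<tau> by (simp add: powr_power powr_add[symmetric] mult.commute)
        ultimately show ?thesis by (simp add: q_def power_mult_distrib)
      qed
      finally have "ennreal (norm x powr \<mu> * (norm (D x))\<^sup>2) \<le> ennreal (q * (norm (c *\<^sub>R x) powr \<mu> * \<bar>F (c *\<^sub>R x)\<bar>\<^sup>2))"
        by (rule ennreal_leI)
      also have "\<dots> = ennreal q * ennreal (norm (c *\<^sub>R x) powr \<mu> * \<bar>F (c *\<^sub>R x)\<bar>\<^sup>2)" by (rule ennreal_mult) (use q in auto)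
      also have "\<dots> = a (c *\<^sub>R x)" using x c by (simp add: a_def)
      finally show ?thesis using x by simp
    qed (auto simp: indicator_def)
  qed
  also have "\<dots> = ennreal ((1 / c) ^ DIM('a)) * (\<integral>\<^sup>+y. a y \<partial>lborel)"
  proof -
    have "ennreal ((1 / c) ^ DIM('a)) * (\<integral>\<^sup>+y. a y \<partial>lborel) = ennreal ((1 / c) ^ DIM('a)) * (ennreal (c ^ DIM('a)) * (\<integral>\<^sup>+x. a (c *\<^sub>R x) \<partial>lborel))"
      using nn_integral_scale_lebesgue[OF am c] by simp
    also have "\<dots> = (ennreal ((1 / c) ^ DIM('a)) * ennreal (c ^ DIM('a))) * (\<integral>\<^sup>+x. a (c *\<^sub>R x) \<partial>lborel)" by (rule mult.assoc[symmetric])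
    also have "ennreal ((1 / c) ^ DIM('a)) * ennreal (c ^ DIM('a)) = 1"
      using c by (subst ennreal_mult[symmetric]) (auto simp: power_mult_distrib[symmetric])
    finally show ?thesis by simp
  qed
  also have "(\<integral>\<^sup>+y. a y \<partial>lborel) = ennreal q * (\<integral>\<^sup>+y\<in>{y. norm y \<ge> c * \<rho>}. ennreal (norm y powr \<mu> * \<bar>F y\<bar>\<^sup>2) \<partial>lebesgue)"
  proof -
    have "(\<integral>\<^sup>+y. a y \<partial>lborel) = (\<integral>\<^sup>+y. a y \<partial>lebesgue)" by (rule nn_integral_completion[symmetric])
    also have "\<dots> = ennreal q * (\<integral>\<^sup>+y\<in>{y. norm y \<ge> c * \<rho>}. ennreal (norm y powr \<mu> * \<bar>F y\<bar>\<^sup>2) \<partial>lebesgue)"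
      unfolding a_def by (rule nn_integral_cmult) measurable
    finally show ?thesis .
  qed
  also have "ennreal ((1 / c) ^ DIM('a)) * (ennreal q * (\<integral>\<^sup>+y\<in>{y. norm y \<ge> c * \<rho>}. ennreal (norm y powr \<mu> * \<bar>F y\<bar>\<^sup>2) \<partial>lebesgue))
      \<le> ennreal ((1 / c) ^ DIM('a)) * (ennreal q * ennreal S)"
    using W by (intro mult_left_mono) (simp_all add: c_def)
  also have "\<dots> = ennreal ((1 / c) ^ DIM('a) * (q * S))"
    using c q S by (simp add: ennreal_mult)
  also have "(1 / c) ^ DIM('a) * (q * S) = C\<^sup>2 * S * \<tau> powr (\<kappa> * \<mu> + \<kappa> * real DIM('a) - 2 * \<sigma>)"
  proof -
    have "1 / c = \<tau> powr \<kappa>" using \<tau> by (simp add: c_def powr_minus_divide)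
    then have "(1 / c) ^ DIM('a) = \<tau> powr (\<kappa> * real DIM('a))" using \<tau> by (simp add: powr_power mult.commute)
    then show ?thesis using \<tau> by (simp add: q_def powr_add[symmetric] algebra_simps)
  qed
  finally show ?thesis .
qed

text \<open>The conditions that hold for almost all \<open>t\<close> are gathered in one set
  \<open>Gd\<close> of good times, and the suprema of (B) become the numbers \<open>S1\<close> and
  \<open>S3\<close>. Second derivatives enter along a repeated coordinate direction.\<close>

locale singular_kernel =
  fixes K :: "real \<Rightarrow> real \<Rightarrow> 'a::euclidean_space \<Rightarrow> complex" and F1 F3 :: "real \<Rightarrow> real \<Rightarrow> 'a \<Rightarrow> real"
    and C c2 c3 \<sigma>1 \<sigma>3 \<kappa>1 \<kappa>3 \<mu>1 \<mu>3 S1 S3 :: real and Gd :: "real set"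
  assumes c2: "c2 > 1 / 2"
    and c3: "c3 = (2 * (real DIM('a) + 1) * (c2 + 1) + 3) / (2 * (real DIM('a) + 2))"
    and C: "C > 0" and S: "S1 \<ge> 0" "S3 \<ge> 0"
    and Gd: "AE t in lborel. t \<in> Gd"
    and loc_int: "t \<in> Gd \<Longrightarrow> s < t \<Longrightarrow> locally_integrable (K t s)"
        "t \<in> Gd \<Longrightarrow> s < t \<Longrightarrow> b \<in> Basis \<Longrightarrow> locally_integrable (space_deriv b K t s)"
    and derivs: "t \<in> Gd \<Longrightarrow> s < t \<Longrightarrow> x \<noteq> 0 \<Longrightarrow> b \<in> Basis \<Longrightarrow> has_space_deriv b K t s x"
        "t \<in> Gd \<Longrightarrow> s < t \<Longrightarrow> x \<noteq> 0 \<Longrightarrow> b \<in> Basis \<Longrightarrow> has_time_deriv (space_deriv b K) t s x"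
        "t \<in> Gd \<Longrightarrow> s < t \<Longrightarrow> x \<noteq> 0 \<Longrightarrow> b \<in> Basis \<Longrightarrow> has_space_deriv b (space_deriv b K) t s x"
    and bound1: "t \<in> Gd \<Longrightarrow> s < t \<Longrightarrow> x \<noteq> 0 \<Longrightarrow> b \<in> Basis \<Longrightarrow>
        norm (space_deriv b K t s x) \<le> C * \<bar>(t - s) powr (- \<sigma>1) * F1 t s ((t - s) powr (- \<kappa>1) *\<^sub>R x)\<bar>"
    and bound2: "t \<in> Gd \<Longrightarrow> s < t \<Longrightarrow> x \<noteq> 0 \<Longrightarrow> b \<in> Basis \<Longrightarrow>
        norm (space_deriv b (space_deriv b K) t s x) \<le> C * (t - s) powr (- c2)"
    and bound3: "t \<in> Gd \<Longrightarrow> s < t \<Longrightarrow> x \<noteq> 0 \<Longrightarrow> b \<in> Basis \<Longrightarrow>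
        norm (time_deriv (space_deriv b K) t s x) \<le> C * min ((t - s) powr (- \<sigma>3) * \<bar>F3 t s ((t - s) powr (- \<kappa>3) *\<^sub>R x)\<bar>) ((t - s) powr (- c3))"
    and time_ac: "x \<noteq> 0 \<Longrightarrow> b \<in> Basis \<Longrightarrow> time_abs_continuous (space_deriv b K) s x"
    and F_meas: "s < t \<Longrightarrow> F1 t s \<in> borel_measurable lebesgue" "s < t \<Longrightarrow> F3 t s \<in> borel_measurable lebesgue"
    and weight1: "s < t \<Longrightarrow> (\<integral>\<^sup>+ x. ennreal (norm x powr \<mu>1 * \<bar>F1 t s x\<bar>\<^sup>2) \<partial>lebesgue) \<le> ennreal S1"
    and weight3: "s < t \<Longrightarrow> (\<integral>\<^sup>+ x\<in>{x. norm x \<ge> (t - s) powr (c2 - c3 + 1 - \<kappa>3)}.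
          ennreal (norm x powr \<mu>3 * \<bar>F3 t s x\<bar>\<^sup>2) \<partial>lebesgue) \<le> ennreal S3"
    and mu: "\<mu>1 > real DIM('a) + 2" "\<mu>3 > real DIM('a) + 2"
    and mu1: "(c2 - c3 + 1 - \<kappa>1) * \<mu>1 = real DIM('a) * (\<kappa>1 + c2 - c3 + 1) + 2 * (c2 - c3 - \<sigma>1) + 3"
    and mu3: "(c2 - c3 + 1 - \<kappa>3) * \<mu>3 = real DIM('a) * (\<kappa>3 - c2 + c3 - 1) + 2 * (c3 - \<sigma>3)"
begin

definition "\<gamma> = c2 - c3 + 1"
text \<open>The surplus in the condition on \<open>\<mu>1\<close>; half of it becomes the decay rate
  of the kernel's tail in space.\<close>

definition "e = \<mu>1 - real DIM('a) - 2"

lemma e_pos: "e > 0" using mu by (simp add: e_def)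

lemma gamma_eq: "2 * (real DIM('a) + 2) * \<gamma> = 2 * c2 - 1"
proof -
  have "2 * (real DIM('a) + 2) * c3 = 2 * (real DIM('a) + 1) * (c2 + 1) + 3" unfolding c3 by simp
  then show ?thesis by (simp add: \<gamma>_def algebra_simps)
qed

lemma gamma_pos: "\<gamma> > 0"
proof (rule ccontr)
  assume "\<not> ?thesis"
  then have "2 * (real DIM('a) + 2) * \<gamma> \<le> 0" by (intro mult_nonneg_nonpos) auto
  then show False using gamma_eq c2 by simp
qed

text \<open>Here the value of \<open>c3\<close> pays off. With
  \<open>R = \<tau> powr \<gamma>\<close>, the contributions
  \<open>R * \<tau> powr (- c2) * R ^ DIM('a)\<close> and
  \<open>R * \<tau> powr (- c3) * R ^ DIM('a)\<close> of the ball of radius \<open>R\<close> equal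
  \<open>\<tau> powr (- 1 / 2 - \<gamma>)\<close> and \<open>\<tau> powr (- 3 / 2)\<close>, the
  powers that the weighted bounds produce outside the ball.\<close>

lemma c2_eq: "c2 = 1 / 2 + (real DIM('a) + 2) * \<gamma>" and c3_eq: "c3 = 3 / 2 + (real DIM('a) + 1) * \<gamma>"
proof -
  show 1: "c2 = 1 / 2 + (real DIM('a) + 2) * \<gamma>" using gamma_eq by (simp add: algebra_simps)
  show "c3 = 3 / 2 + (real DIM('a) + 1) * \<gamma>" using 1 by (simp add: \<gamma>_def algebra_simps)
qed

text \<open>The equation for \<open>\<mu>1\<close> is tailored so that \<open>\<kappa>1\<close> and
  \<open>\<sigma>1\<close> disappear from the exponent in \<open>scaled_weight_bound\<close>;
  \<open>exponent3\<close> does the same for the mixed derivative.\<close>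

lemma exponent1: "\<kappa>1 * \<mu>1 + \<kappa>1 * real DIM('a) - 2 * \<sigma>1 = \<gamma> * e - 1"
  using mu1 by (simp add: \<gamma>_def e_def algebra_simps)

lemma exponent3: "\<kappa>3 * \<mu>3 + \<kappa>3 * real DIM('a) - 2 * \<sigma>3 = \<gamma> * (\<mu>3 - real DIM('a) - 2) - 3"
proof -
  have 1: "(\<gamma> - \<kappa>3) * \<mu>3 = real DIM('a) * (\<kappa>3 - \<gamma>) + 2 * (c3 - \<sigma>3)"
    using mu3 by (simp add: \<gamma>_def algebra_simps)
  have 2: "2 * c3 = 3 + 2 * (real DIM('a) * \<gamma>) + 2 * \<gamma>" by (subst c3_eq) (simp add: algebra_simps)
  show ?thesis using 1 2 by (simp add: algebra_simps)
qed

context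
  fixes t s :: real and b :: 'a
  assumes t: "t \<in> Gd" and s: "s < t" and b: "b \<in> Basis"
begin

lemma line: "line_deriv (K t s) (space_deriv b K t s) b" "line_cont (space_deriv b K t s) b"
    "line_deriv (space_deriv b K t s) (space_deriv b (space_deriv b K) t s) b"
proof -
  show "line_deriv (K t s) (space_deriv b K t s) b"
    using derivs(1)[OF t s _ b] unfolding line_deriv_def has_space_deriv_def space_deriv_def
    by (simp add: vector_derivative_works)
  show 3: "line_deriv (space_deriv b K t s) (space_deriv b (space_deriv b K) t s) b"
    using derivs(3)[OF t s _ b] unfolding line_deriv_def has_space_deriv_def space_deriv_def
    by (simp add: vector_derivative_works)
  show "line_cont (space_deriv b K t s) b"
    unfolding line_cont_def
  proof (intro allI impI)
    fix x :: 'a assume "x \<noteq> 0"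
    then have "(\<lambda>h. space_deriv b K t s (x + h *\<^sub>R b)) differentiable (at 0)"
      using derivs(3)[OF t s _ b] by (simp add: has_space_deriv_def)
    then show "isCont (\<lambda>h. space_deriv b K t s (x + h *\<^sub>R b)) 0" by (rule differentiable_imp_continuous_within)
  qed
qed

lemma D_meas: "space_deriv b K t s \<in> borel_measurable lebesgue"
  by (rule locally_integrable_measurable[OF loc_int(2)[OF t s b]])

lemma weight_D: "(\<integral>\<^sup>+x\<in>{x. norm x \<ge> r}. ennreal (norm x powr \<mu>1 * (norm (space_deriv b K t s x))\<^sup>2) \<partial>lborel)
    \<le> ennreal (C\<^sup>2 * S1 * ((t - s) powr ((\<gamma> * e - 1) / 2))\<^sup>2)"
proof -
  have \<tau>: "t - s > 0" using s by simp
  have "(\<integral>\<^sup>+x\<in>{x. norm x \<ge> r}. ennreal (norm x powr \<mu>1 * (norm (space_deriv b K t s x))\<^sup>2) \<partial>lborel)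
     \<le> (\<integral>\<^sup>+x\<in>{x. norm x \<ge> 0}. ennreal (norm x powr \<mu>1 * (norm (space_deriv b K t s x))\<^sup>2) \<partial>lborel)"
    by (intro nn_integral_mono) (auto simp: indicator_def)
  also have "\<dots> \<le> ennreal (C\<^sup>2 * S1 * (t - s) powr (\<kappa>1 * \<mu>1 + \<kappa>1 * real DIM('a) - 2 * \<sigma>1))"
  proof (rule scaled_weight_bound[OF F_meas(1)[OF s] \<tau> _ _ S(1)])
    show "norm (space_deriv b K t s x) \<le> C * ((t - s) powr (- \<sigma>1) * \<bar>F1 t s ((t - s) powr (- \<kappa>1) *\<^sub>R x)\<bar>)" if "x \<noteq> 0" for x
      using bound1[OF t s that b] by (simp add: abs_mult)
    show "(\<integral>\<^sup>+ y\<in>{y. norm y \<ge> (t - s) powr (- \<kappa>1) * 0}. ennreal (norm y powr \<mu>1 * \<bar>F1 t s y\<bar>\<^sup>2) \<partial>lebesgue) \<le> ennreal S1"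
      using weight1[OF s] by (simp add: indicator_def)
  qed (use C in auto)
  also have "(t - s) powr (\<kappa>1 * \<mu>1 + \<kappa>1 * real DIM('a) - 2 * \<sigma>1) = ((t - s) powr ((\<gamma> * e - 1) / 2))\<^sup>2"
    unfolding exponent1 using half_powr_square[OF \<tau>] by simp
  finally show ?thesis .
qed

text \<open>The threshold fits the scaling: \<open>(t - s) powr (- \<kappa>3)\<close> times
  \<open>(t - s) powr \<gamma>\<close> is the radius from which \<open>weight3\<close>
  integrates.\<close>

lemma weight_Dt: "(\<integral>\<^sup>+x\<in>{x. norm x \<ge> (t - s) powr \<gamma>}. ennreal (norm x powr \<mu>3 * (norm (time_deriv (space_deriv b K) t s x))\<^sup>2) \<partial>lborel)
    \<le> ennreal (C\<^sup>2 * S3 * ((t - s) powr ((\<gamma> * (\<mu>3 - real DIM('a) - 2) - 3) / 2))\<^sup>2)"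
proof -
  have \<tau>: "t - s > 0" using s by simp
  have "(\<integral>\<^sup>+x\<in>{x. norm x \<ge> (t - s) powr \<gamma>}. ennreal (norm x powr \<mu>3 * (norm (time_deriv (space_deriv b K) t s x))\<^sup>2) \<partial>lborel)
      \<le> ennreal (C\<^sup>2 * S3 * (t - s) powr (\<kappa>3 * \<mu>3 + \<kappa>3 * real DIM('a) - 2 * \<sigma>3))"
  proof (rule scaled_weight_bound[OF F_meas(2)[OF s] \<tau> _ _ S(2)])
    show "norm (time_deriv (space_deriv b K) t s x) \<le> C * ((t - s) powr (- \<sigma>3) * \<bar>F3 t s ((t - s) powr (- \<kappa>3) *\<^sub>R x)\<bar>)" if "x \<noteq> 0" for x
      using order_trans[OF bound3[OF t s that b] mult_left_mono[OF min.cobounded1]] C by simp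
    have "(t - s) powr (- \<kappa>3) * (t - s) powr \<gamma> = (t - s) powr (c2 - c3 + 1 - \<kappa>3)"
      using \<tau> by (simp add: powr_add[symmetric] \<gamma>_def)
    then show "(\<integral>\<^sup>+ y\<in>{y. norm y \<ge> (t - s) powr (- \<kappa>3) * (t - s) powr \<gamma>}. ennreal (norm y powr \<mu>3 * \<bar>F3 t s y\<bar>\<^sup>2) \<partial>lebesgue) \<le> ennreal S3"
      using weight3[OF s] by simp
  qed (use C in auto)
  also have "(t - s) powr (\<kappa>3 * \<mu>3 + \<kappa>3 * real DIM('a) - 2 * \<sigma>3) = ((t - s) powr ((\<gamma> * (\<mu>3 - real DIM('a) - 2) - 3) / 2))\<^sup>2"
    unfolding exponent3 using half_powr_square[OF \<tau>] by simp
  finally show ?thesis .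
qed

end

text \<open>Outside radius \<open>R = \<tau> powr \<gamma>\<close> the weighted bound with
  \<open>j = 0\<close> applies; inside, the pointwise bound on the second derivative enters through
  \<open>L1_bound_from_tail\<close>. Both give the same power of \<open>\<tau>\<close>.\<close>

lemma D_L1: "\<exists>N\<ge>0. \<forall>t\<in>Gd. \<forall>s<t. \<forall>b\<in>Basis.
    (\<integral>\<^sup>+w. ennreal (norm (space_deriv b K t s w)) \<partial>lborel) \<le> ennreal (N * (t - s) powr (- 1 / 2 - \<gamma>))"
proof -
  have "\<mu>1 - 2 * 0 > real DIM('a)" using mu by simp
  from weighted_tail_bound[OF this] obtain c where c: "c \<ge> 0"
    "\<And>D :: 'a \<Rightarrow> complex. \<And>r N \<omega>. r > 0 \<Longrightarrow> N \<ge> 0 \<Longrightarrow> \<omega> > 0 \<Longrightarrow> D \<in> borel_measurable lebesgue \<Longrightarrow>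
      (\<integral>\<^sup>+x\<in>{x. norm x \<ge> r}. ennreal (norm x powr \<mu>1 * (norm (D x))\<^sup>2) \<partial>lborel) \<le> ennreal (N * \<omega>\<^sup>2) \<Longrightarrow>
      (\<integral>\<^sup>+x\<in>{x. norm x \<ge> r}. ennreal (norm x powr 0 * norm (D x)) \<partial>lborel) \<le> ennreal ((c + N) * \<omega> * r powr ((real DIM('a) + 2 * 0 - \<mu>1) / 2))"
    by auto
  define N1 where "N1 = c + C\<^sup>2 * S1"
  define N2 where "N2 = 2 * C * unit_ball_vol (real DIM('a))"
  have N: "N1 \<ge> 0" "N2 \<ge> 0" using c(1) S C by (auto simp: N1_def N2_def)
  have "(\<integral>\<^sup>+w. ennreal (norm (space_deriv b K t s w)) \<partial>lborel) \<le> ennreal ((3 * N1 + N2) * (t - s) powr (- 1 / 2 - \<gamma>))"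
    if t: "t \<in> Gd" and s: "s < t" and b: "b \<in> Basis" for t s b
  proof -
    define \<tau> where "\<tau> = t - s"
    define R where "R = \<tau> powr \<gamma>"
    have \<tau>: "\<tau> > 0" using s by (simp add: \<tau>_def)
    have R: "R > 0" using \<tau> by (simp add: R_def)
    let ?D = "space_deriv b K t s"
    note L = line[OF t s b]
    have nb: "norm b = 1" using b by simp
    have bb: "b \<bullet> b = 1" using b by simp
    have tail: "(\<integral>\<^sup>+x\<in>{x. norm x \<ge> R}. ennreal (norm (?D x)) \<partial>lborel) \<le> ennreal (N1 * \<tau> powr (- 1 / 2 - \<gamma>))"
    proof -
      have "(\<integral>\<^sup>+x\<in>{x. norm x \<ge> R}. ennreal (norm (?D x)) \<partial>lborel) = (\<integral>\<^sup>+x\<in>{x. norm x \<ge> R}. ennreal (norm x powr 0 * norm (?D x)) \<partial>lborel)"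
        using R by (intro nn_integral_cong) (auto simp: indicator_def)
      also have "\<dots> \<le> ennreal (N1 * \<tau> powr ((\<gamma> * e - 1) / 2) * R powr ((real DIM('a) + 2 * 0 - \<mu>1) / 2))"
        unfolding N1_def by (rule c(2)[OF R _ _ D_meas[OF t s b] weight_D[OF t s b, folded \<tau>_def]]) (use S \<tau> in auto)
      also have "N1 * \<tau> powr ((\<gamma> * e - 1) / 2) * R powr ((real DIM('a) + 2 * 0 - \<mu>1) / 2) = N1 * \<tau> powr (- 1 / 2 - \<gamma>)"
      proof -
        have "(\<gamma> * e - 1) / 2 + \<gamma> * ((real DIM('a) + 2 * 0 - \<mu>1) / 2) = - 1 / 2 - \<gamma>"
          by (simp add: e_def field_simps)
        then have "\<tau> powr ((\<gamma> * e - 1) / 2) * R powr ((real DIM('a) + 2 * 0 - \<mu>1) / 2) = \<tau> powr (- 1 / 2 - \<gamma>)"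
          unfolding R_def powr_powr powr_add[symmetric] by simp
        then show ?thesis by simp
      qed
      finally show ?thesis .
    qed
    have M: "norm (space_deriv b (space_deriv b K) t s y) \<le> C * \<tau> powr (- c2)" if "y \<noteq> 0" for y
      using bound2[OF t s that b] by (simp add: \<tau>_def)
    have "(\<integral>\<^sup>+w. ennreal (norm (?D w)) \<partial>lborel) \<le> 3 * (\<integral>\<^sup>+w\<in>{w. norm w \<ge> R}. ennreal (norm (?D w)) \<partial>lborel)
        + ennreal (2 * R * (C * \<tau> powr (- c2)) * (unit_ball_vol (real DIM('a)) * R ^ DIM('a)))"
    proof (rule L1_bound_from_tail[OF nb D_meas[OF t s b] R])
      show "0 \<le> C * \<tau> powr (- c2)" using C by simp
      show "norm (?D (y + (2 * R) *\<^sub>R b) - ?D y) \<le> 2 * R * (C * \<tau> powr (- c2))" if y: "y \<noteq> 0" "y \<bullet> b \<ge> 0" for y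
      \<comment> \<open>On the side \<open>y \<bullet> b \<ge> 0\<close> the segment moves away from
        the hyperplane through 0, so it could meet 0 only at its first point, which is
        \<open>y\<close> itself.\<close>
      proof (rule line_increment_bound[OF L(3) _ _ M])
        show "y + u *\<^sub>R b \<noteq> 0" if "u \<in> {0..2 * R}" for u
        proof
          assume z: "y + u *\<^sub>R b = 0"
          then have "(y + u *\<^sub>R b) \<bullet> b = 0" by simp
          then have "u = 0" using y(2) that bb by (simp add: inner_add_left)
          then show False using z y(1) by simp
        qed
      qed (use R in auto)
      show "norm (?D (y - (2 * R) *\<^sub>R b) - ?D y) \<le> 2 * R * (C * \<tau> powr (- c2))" if y: "y \<noteq> 0" "y \<bullet> b \<le> 0" for y
      proof -
        have "norm (?D (y + (2 * R) *\<^sub>R (- b)) - ?D y) \<le> 2 * R * (C * \<tau> powr (- c2))"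
        proof (rule line_increment_bound[OF line_deriv_minus[OF L(3)]])
          show "y + u *\<^sub>R (- b) \<noteq> 0" if "u \<in> {0..2 * R}" for u
          proof
            assume z: "y + u *\<^sub>R (- b) = 0"
            then have "(y + u *\<^sub>R (- b)) \<bullet> b = 0" by simp
            then have "u = 0" using y(2) that bb by (simp add: inner_diff_left)
            then show False using z y(1) by simp
          qed
          show "norm (- space_deriv b (space_deriv b K) t s x) \<le> C * \<tau> powr (- c2)" if "x \<noteq> 0" for x using M[OF that] by simp
        qed (use R in auto)
        then show ?thesis by simp
      qed
    qed
    also have "\<dots> \<le> 3 * ennreal (N1 * \<tau> powr (- 1 / 2 - \<gamma>)) + ennreal (N2 * \<tau> powr (- 1 / 2 - \<gamma>))"
    proof (intro add_mono mult_left_mono tail)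
      have "R * \<tau> powr (- c2) * R ^ DIM('a) = \<tau> powr (- 1 / 2 - \<gamma>)"
      proof -
        have "R ^ DIM('a) = \<tau> powr (\<gamma> * real DIM('a))" using \<tau> by (simp add: R_def powr_power mult.commute)
        then have "R * \<tau> powr (- c2) * R ^ DIM('a) = \<tau> powr (\<gamma> + - c2 + \<gamma> * real DIM('a))"
          unfolding R_def powr_add by simp
        also have "\<gamma> + - c2 + \<gamma> * real DIM('a) = - 1 / 2 - \<gamma>" by (subst c2_eq) (simp add: algebra_simps)
        finally show ?thesis .
      qed
      then have "2 * R * (C * \<tau> powr (- c2)) * (unit_ball_vol (real DIM('a)) * R ^ DIM('a)) = N2 * \<tau> powr (- 1 / 2 - \<gamma>)"
        unfolding N2_def by (metis (no_types, lifting) mult.assoc mult.left_commute)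
      then show "ennreal (2 * R * (C * \<tau> powr (- c2)) * (unit_ball_vol (real DIM('a)) * R ^ DIM('a))) \<le> ennreal (N2 * \<tau> powr (- 1 / 2 - \<gamma>))" by simp
    qed simp
    also have "\<dots> = ennreal ((3 * N1 + N2) * \<tau> powr (- 1 / 2 - \<gamma>))"
    proof -
      have "3 * ennreal (N1 * \<tau> powr (- 1 / 2 - \<gamma>)) = ennreal (3 * (N1 * \<tau> powr (- 1 / 2 - \<gamma>)))"
        using N by (simp add: ennreal_mult')
      then show ?thesis using N by (simp add: ennreal_plus[symmetric] distrib_right mult.assoc del: ennreal_plus)
    qed
    finally show ?thesis unfolding \<tau>_def .
  qed
  then show ?thesis using N by (intro exI[of _ "3 * N1 + N2"]) auto
qed

text \<open>The weighted bound with \<open>j = 1\<close>: the factor \<open>norm w\<close> is the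
  weight of Hardy's inequality, and it is affordable because
  \<open>\<mu>1 - 2 > DIM('a)\<close>.\<close>

lemma D_tail: "\<exists>N\<ge>0. \<forall>t\<in>Gd. \<forall>s<t. \<forall>b\<in>Basis. \<forall>r>0.
    (\<integral>\<^sup>+w\<in>{w. norm w \<ge> r}. ennreal (norm w * norm (space_deriv b K t s w)) \<partial>lborel) \<le> ennreal (N * (t - s) powr ((\<gamma> * e - 1) / 2) * r powr (- e / 2))"
proof -
  have "\<mu>1 - 2 * 1 > real DIM('a)" using mu by simp
  from weighted_tail_bound[OF this] obtain c where c: "c \<ge> 0"
    "\<And>D :: 'a \<Rightarrow> complex. \<And>r N \<omega>. r > 0 \<Longrightarrow> N \<ge> 0 \<Longrightarrow> \<omega> > 0 \<Longrightarrow> D \<in> borel_measurable lebesgue \<Longrightarrow>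
      (\<integral>\<^sup>+x\<in>{x. norm x \<ge> r}. ennreal (norm x powr \<mu>1 * (norm (D x))\<^sup>2) \<partial>lborel) \<le> ennreal (N * \<omega>\<^sup>2) \<Longrightarrow>
      (\<integral>\<^sup>+x\<in>{x. norm x \<ge> r}. ennreal (norm x powr 1 * norm (D x)) \<partial>lborel) \<le> ennreal ((c + N) * \<omega> * r powr ((real DIM('a) + 2 * 1 - \<mu>1) / 2))"
    by auto
  have ee: "(real DIM('a) + 2 * 1 - \<mu>1) / 2 = - e / 2" by (simp add: e_def)
  have "(\<integral>\<^sup>+w\<in>{w. norm w \<ge> r}. ennreal (norm w * norm (space_deriv b K t s w)) \<partial>lborel) \<le> ennreal ((c + C\<^sup>2 * S1) * (t - s) powr ((\<gamma> * e - 1) / 2) * r powr (- e / 2))"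
    if t: "t \<in> Gd" and s: "s < t" and b: "b \<in> Basis" and r: "r > 0" for t s b r
    using c(2)[OF r _ _ D_meas[OF t s b] weight_D[OF t s b], unfolded ee] S s by simp
  then show ?thesis using c(1) S by (intro exI[of _ "c + C\<^sup>2 * S1"]) auto
qed

text \<open>The weighted bound with \<open>j = 1\<close> is used outside radius
  \<open>\<tau> powr \<gamma>\<close> and the bound by \<open>\<tau> powr (- c3)\<close> inside.
  Measurability of the mixed derivative is a premise here; at good times it is supplied by
  \<open>time_deriv_borel_version\<close>.\<close>

lemma Dt_bound: "\<exists>N\<ge>0. \<forall>t\<in>Gd. \<forall>s<t. \<forall>b\<in>Basis. time_deriv (space_deriv b K) t s \<in> borel_measurable lebesgue \<longrightarrow>
    (\<integral>\<^sup>+w. ennreal (norm w * norm (time_deriv (space_deriv b K) t s w)) \<partial>lborel) \<le> ennreal (N * (t - s) powr (- 3 / 2))"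
proof -
  have "\<mu>3 - 2 * 1 > real DIM('a)" using mu by simp
  from weighted_tail_bound[OF this] obtain c where c: "c \<ge> 0"
    "\<And>D :: 'a \<Rightarrow> complex. \<And>r N \<omega>. r > 0 \<Longrightarrow> N \<ge> 0 \<Longrightarrow> \<omega> > 0 \<Longrightarrow> D \<in> borel_measurable lebesgue \<Longrightarrow>
      (\<integral>\<^sup>+x\<in>{x. norm x \<ge> r}. ennreal (norm x powr \<mu>3 * (norm (D x))\<^sup>2) \<partial>lborel) \<le> ennreal (N * \<omega>\<^sup>2) \<Longrightarrow>
      (\<integral>\<^sup>+x\<in>{x. norm x \<ge> r}. ennreal (norm x powr 1 * norm (D x)) \<partial>lborel) \<le> ennreal ((c + N) * \<omega> * r powr ((real DIM('a) + 2 * 1 - \<mu>3) / 2))"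
    by auto
  define N1 where "N1 = c + C\<^sup>2 * S3"
  define N2 where "N2 = C * unit_ball_vol (real DIM('a))"
  have N: "N1 \<ge> 0" "N2 \<ge> 0" using c(1) S C by (auto simp: N1_def N2_def)
  have "(\<integral>\<^sup>+w. ennreal (norm w * norm (time_deriv (space_deriv b K) t s w)) \<partial>lborel) \<le> ennreal ((N1 + N2) * (t - s) powr (- 3 / 2))"
    if t: "t \<in> Gd" and s: "s < t" and b: "b \<in> Basis" and Em: "time_deriv (space_deriv b K) t s \<in> borel_measurable lebesgue" for t s b
  proof -
    define \<tau> where "\<tau> = t - s"
    define R where "R = \<tau> powr \<gamma>"
    have \<tau>: "\<tau> > 0" using s by (simp add: \<tau>_def)
    have R: "R > 0" using \<tau> by (simp add: R_def)
    let ?E = "time_deriv (space_deriv b K) t s"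
    have [measurable]: "?E \<in> borel_measurable lebesgue" "norm \<in> borel_measurable (lebesgue :: 'a measure)"
      using Em by (auto intro: measurable_completion)
    have "{w :: 'a. norm w \<ge> R} \<in> sets borel" "{w :: 'a. norm w < R} \<in> sets borel" by measurable
    then have [measurable]: "{w :: 'a. norm w \<ge> R} \<in> sets lebesgue" "{w :: 'a. norm w < R} \<in> sets lebesgue" by simp_all
    have far: "(\<integral>\<^sup>+x\<in>{x. norm x \<ge> R}. ennreal (norm x * norm (?E x)) \<partial>lborel) \<le> ennreal (N1 * \<tau> powr (- 3 / 2))"
    proof -
      have "(\<integral>\<^sup>+x\<in>{x. norm x \<ge> R}. ennreal (norm x * norm (?E x)) \<partial>lborel) = (\<integral>\<^sup>+x\<in>{x. norm x \<ge> R}. ennreal (norm x powr 1 * norm (?E x)) \<partial>lborel)"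
        by simp
      also have "\<dots> \<le> ennreal (N1 * \<tau> powr ((\<gamma> * (\<mu>3 - real DIM('a) - 2) - 3) / 2) * R powr ((real DIM('a) + 2 * 1 - \<mu>3) / 2))"
        unfolding N1_def by (rule c(2)[OF R _ _ Em weight_Dt[OF t s b, folded \<tau>_def, folded R_def]]) (use S \<tau> in auto)
      also have "N1 * \<tau> powr ((\<gamma> * (\<mu>3 - real DIM('a) - 2) - 3) / 2) * R powr ((real DIM('a) + 2 * 1 - \<mu>3) / 2) = N1 * \<tau> powr (- 3 / 2)"
      proof -
        have "(\<gamma> * (\<mu>3 - real DIM('a) - 2) - 3) / 2 + \<gamma> * ((real DIM('a) + 2 * 1 - \<mu>3) / 2) = - 3 / 2"
          by (simp add: field_simps)
        then have "\<tau> powr ((\<gamma> * (\<mu>3 - real DIM('a) - 2) - 3) / 2) * R powr ((real DIM('a) + 2 * 1 - \<mu>3) / 2) = \<tau> powr (- 3 / 2)"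
          unfolding R_def powr_powr powr_add[symmetric] by simp
        then show ?thesis by simp
      qed
      finally show ?thesis .
    qed
    have near: "(\<integral>\<^sup>+x\<in>{x. norm x < R}. ennreal (norm x * norm (?E x)) \<partial>lborel) \<le> ennreal (N2 * \<tau> powr (- 3 / 2))"
    proof -
      have "(\<integral>\<^sup>+x\<in>{x. norm x < R}. ennreal (norm x * norm (?E x)) \<partial>lborel) \<le> (\<integral>\<^sup>+x. ennreal (R * (C * \<tau> powr (- c3))) * indicator (ball (0::'a) R) x \<partial>lborel)"
      proof (rule nn_integral_mono)
        fix x :: 'a
        show "ennreal (norm x * norm (?E x)) * indicator {x. norm x < R} x \<le> ennreal (R * (C * \<tau> powr (- c3))) * indicator (ball (0::'a) R) x"
        proof (cases "norm x < R \<and> x \<noteq> 0")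
          case True
          have "norm (?E x) \<le> C * \<tau> powr (- c3)"
            using order_trans[OF bound3[OF t s _ b] mult_left_mono[OF min.cobounded2]] C True by (simp add: \<tau>_def)
          then have "norm x * norm (?E x) \<le> R * (C * \<tau> powr (- c3))" using True R by (intro mult_mono) auto
          then show ?thesis using True by (simp add: ennreal_leI)
        qed (auto simp: indicator_def)
      qed
      also have "\<dots> = ennreal (R * (C * \<tau> powr (- c3))) * ennreal (unit_ball_vol (real DIM('a)) * R ^ DIM('a))"
        using R by (simp add: nn_integral_cmult_indicator emeasure_ball)
      also have "\<dots> = ennreal (R * (C * \<tau> powr (- c3)) * (unit_ball_vol (real DIM('a)) * R ^ DIM('a)))"
        using R C by (intro ennreal_mult[symmetric]) auto
      also have "R * (C * \<tau> powr (- c3)) * (unit_ball_vol (real DIM('a)) * R ^ DIM('a)) = N2 * (R * \<tau> powr (- c3) * R ^ DIM('a))"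
        by (simp add: N2_def)
      also have "R * \<tau> powr (- c3) * R ^ DIM('a) = \<tau> powr (- 3 / 2)"
      proof -
        have "R ^ DIM('a) = \<tau> powr (\<gamma> * real DIM('a))" using \<tau> by (simp add: R_def powr_power mult.commute)
        then have "R * \<tau> powr (- c3) * R ^ DIM('a) = \<tau> powr (\<gamma> + - c3 + \<gamma> * real DIM('a))"
          unfolding R_def powr_add by simp
        also have "\<gamma> + - c3 + \<gamma> * real DIM('a) = - 3 / 2" by (subst c3_eq) (simp add: algebra_simps)
        finally show ?thesis .
      qed
      finally show ?thesis .
    qed
    have "(\<integral>\<^sup>+w. ennreal (norm w * norm (?E w)) \<partial>lebesgue)
        = (\<integral>\<^sup>+w. ennreal (norm w * norm (?E w)) * indicator {w. norm w \<ge> R} w + ennreal (norm w * norm (?E w)) * indicator {w. norm w < R} w \<partial>lebesgue)"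
      by (intro nn_integral_cong) (auto simp: indicator_def)
    also have "\<dots> = (\<integral>\<^sup>+w\<in>{w. norm w \<ge> R}. ennreal (norm w * norm (?E w)) \<partial>lebesgue) + (\<integral>\<^sup>+w\<in>{w. norm w < R}. ennreal (norm w * norm (?E w)) \<partial>lebesgue)"
      by (rule nn_integral_add) measurable
    also have "\<dots> \<le> ennreal (N1 * \<tau> powr (- 3 / 2)) + ennreal (N2 * \<tau> powr (- 3 / 2))"
      using far near by (intro add_mono) (simp_all add: nn_integral_completion)
    also have "\<dots> = ennreal ((N1 + N2) * \<tau> powr (- 3 / 2))"
      using N by (simp add: ennreal_plus[symmetric] distrib_right del: ennreal_plus)
    finally show ?thesis unfolding \<tau>_def by (simp add: nn_integral_completion)
  qed
  then show ?thesis using N by (intro exI[of _ "N1 + N2"]) auto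
qed

end

lemma lebesgue_measurable_shift:
  fixes g :: "'a::euclidean_space \<Rightarrow> 'b::topological_space"
  assumes "g \<in> borel_measurable lebesgue"
  shows "(\<lambda>x. g (x + c)) \<in> borel_measurable lebesgue"
proof -
  have "(\<lambda>x::'a. c + (\<Sum>j\<in>Basis. (1 * (x \<bullet> j)) *\<^sub>R j)) \<in> lebesgue \<rightarrow>\<^sub>M lebesgue"
    by (rule lebesgue_affine_measurable) simp
  then have "(\<lambda>x::'a. c + x) \<in> lebesgue \<rightarrow>\<^sub>M lebesgue" by (simp add: euclidean_representation)
  from measurable_compose[OF this assms] show ?thesis by (simp add: add.commute)
qed

text \<open>The shift is made one vector at a time, and translation invariance removes the shifts
  already made from each increment.\<close>

lemma translation_chain:
  fixes g :: "'a::euclidean_space \<Rightarrow> complex"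
  assumes g: "g \<in> borel_measurable lebesgue" and B: "finite B"
    and step: "\<And>b. b \<in> B \<Longrightarrow> (\<integral>\<^sup>+z. ennreal (norm (g (z + c b) - g z)) \<partial>lborel) \<le> M b"
  shows "(\<integral>\<^sup>+z. ennreal (norm (g (z + (\<Sum>b\<in>B. c b)) - g z)) \<partial>lborel) \<le> (\<Sum>b\<in>B. M b)"
  using B step
proof (induction B)
  case (insert b B)
  define w where "w = (\<Sum>b\<in>B. c b)"
  define a where "a x = ennreal (norm (g (x + c b) - g x))" for x
  have [measurable]: "(\<lambda>x. g (x + v)) \<in> borel_measurable lebesgue" for v by (rule lebesgue_measurable_shift[OF g])
  have am: "a \<in> borel_measurable lebesgue" using g unfolding a_def by measurable
  have am': "(\<lambda>x. a (x + w)) \<in> borel_measurable lebesgue" by (rule lebesgue_measurable_shift[OF am])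
  have bm: "(\<lambda>x. ennreal (norm (g (x + w) - g x))) \<in> borel_measurable lebesgue" using g by measurable
  have "(\<integral>\<^sup>+z. ennreal (norm (g (z + (\<Sum>b\<in>insert b B. c b)) - g z)) \<partial>lborel)
    \<le> (\<integral>\<^sup>+z. a (z + w) + ennreal (norm (g (z + w) - g z)) \<partial>lborel)"
  proof (rule nn_integral_mono)
    fix z
    have "norm (g (z + (\<Sum>b\<in>insert b B. c b)) - g z) \<le> norm (g (z + w + c b) - g (z + w)) + norm (g (z + w) - g z)"
      using norm_triangle_ineq[of "g (z + w + c b) - g (z + w)" "g (z + w) - g z"] insert.hyps by (simp add: w_def add_ac)
    then show "ennreal (norm (g (z + (\<Sum>b\<in>insert b B. c b)) - g z)) \<le> a (z + w) + ennreal (norm (g (z + w) - g z))"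
      unfolding a_def by (simp add: ennreal_plus[symmetric] ennreal_leI del: ennreal_plus)
  qed
  also have "\<dots> = (\<integral>\<^sup>+z. a (z + w) + ennreal (norm (g (z + w) - g z)) \<partial>lebesgue)" by (rule nn_integral_completion[symmetric])
  also have "\<dots> = (\<integral>\<^sup>+z. a (z + w) \<partial>lebesgue) + (\<integral>\<^sup>+z. ennreal (norm (g (z + w) - g z)) \<partial>lebesgue)"
    by (rule nn_integral_add[OF am' bm])
  also have "\<dots> = (\<integral>\<^sup>+z. a z \<partial>lborel) + (\<integral>\<^sup>+z. ennreal (norm (g (z + w) - g z)) \<partial>lborel)"
    by (simp only: nn_integral_completion nn_integral_shift_lebesgue[OF am])
  also have "\<dots> \<le> M b + (\<Sum>b\<in>B. M b)"
    unfolding w_def a_def using insert by (intro add_mono) auto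
  finally show ?case using insert.hyps by simp
qed simp

section \<open>Tails and translations of the kernel\<close>

context singular_kernel
begin

text \<open>Hardy's inequality works along a single direction, so any one coordinate serves.\<close>

lemma kernel_tail: "\<exists>N\<ge>0. \<forall>t\<in>Gd. \<forall>s<t. integrable lebesgue (K t s) \<longrightarrow> (\<forall>r>0.
    (\<integral>\<^sup>+z\<in>{z. norm z \<ge> r}. ennreal (norm (K t s z)) \<partial>lborel) \<le> ennreal (N * (t - s) powr ((\<gamma> * e - 1) / 2) * r powr (- e / 2)))"
proof -
  obtain N where N: "N \<ge> 0" "\<And>t s b r. t \<in> Gd \<Longrightarrow> s < t \<Longrightarrow> b \<in> Basis \<Longrightarrow> r > 0 \<Longrightarrow>
    (\<integral>\<^sup>+w\<in>{w. norm w \<ge> r}. ennreal (norm w * norm (space_deriv b K t s w)) \<partial>lborel) \<le> ennreal (N * (t - s) powr ((\<gamma> * e - 1) / 2) * r powr (- e / 2))"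
    using D_tail by blast
  obtain b :: 'a where b: "b \<in> Basis" using nonempty_Basis by blast
  have "(\<integral>\<^sup>+z\<in>{z. norm z \<ge> r}. ennreal (norm (K t s z)) \<partial>lborel) \<le> ennreal ((2 * N) * (t - s) powr ((\<gamma> * e - 1) / 2) * r powr (- e / 2))"
    if t: "t \<in> Gd" and s: "s < t" and i: "integrable lebesgue (K t s)" and r: "r > 0" for t s r
  proof -
    note L = line[OF t s b]
    have "(\<integral>\<^sup>+z\<in>{z. norm z \<ge> r}. ennreal (norm (K t s z)) \<partial>lborel)
      \<le> 2 * (\<integral>\<^sup>+w\<in>{w. norm w \<ge> r}. ennreal (norm w * norm (space_deriv b K t s w)) \<partial>lborel)"
      by (rule hardy_far[OF L(1,2) line_deriv_minus[OF L(1)] line_cont_minus[OF L(2)] norm_Basis[OF b] i D_meas[OF t s b]])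
    also have "\<dots> \<le> 2 * ennreal (N * (t - s) powr ((\<gamma> * e - 1) / 2) * r powr (- e / 2))"
      by (intro mult_left_mono N(2)[OF t s b r]) simp
    also have "\<dots> = ennreal (2 * (N * (t - s) powr ((\<gamma> * e - 1) / 2) * r powr (- e / 2)))"
      using N(1) by (simp add: ennreal_mult')
    finally show ?thesis by (simp add: mult.assoc)
  qed
  then show ?thesis using N(1) by (intro exI[of _ "2 * N"]) auto
qed

text \<open>\<open>translation_bound\<close> is applied along each coordinate, with the direction
  \<open>- b\<close> when the coordinate of \<open>h\<close> is negative. Bounding every coordinate
  by \<open>norm h\<close> costs the factor \<open>DIM('a)\<close>.\<close>

lemma kernel_translation: "\<exists>N\<ge>0. \<forall>t\<in>Gd. \<forall>s<t. integrable lebesgue (K t s) \<longrightarrow> (\<forall>h.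
    (\<integral>\<^sup>+z. ennreal (norm (K t s (z + h) - K t s z)) \<partial>lborel) \<le> ennreal (N * norm h * (t - s) powr (- 1 / 2 - \<gamma>)))"
proof -
  obtain N where N: "N \<ge> 0" "\<And>t s b. t \<in> Gd \<Longrightarrow> s < t \<Longrightarrow> b \<in> Basis \<Longrightarrow>
    (\<integral>\<^sup>+w. ennreal (norm (space_deriv b K t s w)) \<partial>lborel) \<le> ennreal (N * (t - s) powr (- 1 / 2 - \<gamma>))"
    using D_L1 by blast
  define N' where "N' = real DIM('a) * (3 * N)"
  have "(\<integral>\<^sup>+z. ennreal (norm (K t s (z + h) - K t s z)) \<partial>lborel) \<le> ennreal (N' * norm h * (t - s) powr (- 1 / 2 - \<gamma>))"
    if t: "t \<in> Gd" and s: "s < t" and i: "integrable lebesgue (K t s)" for t s h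
  proof -
    define I where "I = N * (t - s) powr (- 1 / 2 - \<gamma>)"
    have I: "I \<ge> 0" using N(1) by (simp add: I_def)
    have step: "(\<integral>\<^sup>+z. ennreal (norm (K t s (z + (h \<bullet> b) *\<^sub>R b) - K t s z)) \<partial>lborel) \<le> ennreal (3 * norm h * I)"
      if b: "b \<in> Basis" for b
    proof -
      note L = line[OF t s b]
      note L' = line_deriv_minus[OF L(1)] line_cont_minus[OF L(2)]
      have bd: "ennreal (3 * \<bar>h \<bullet> b\<bar>) * (\<integral>\<^sup>+w. ennreal (norm (space_deriv b K t s w)) \<partial>lborel) \<le> ennreal (3 * norm h * I)"
      proof -
        have "ennreal (3 * \<bar>h \<bullet> b\<bar>) * (\<integral>\<^sup>+w. ennreal (norm (space_deriv b K t s w)) \<partial>lborel) \<le> ennreal (3 * norm h) * ennreal I"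
          unfolding I_def using Basis_le_norm[OF b, of h] by (intro mult_mono ennreal_leI N(2)[OF t s b]) auto
        then show ?thesis using I by (simp add: ennreal_mult'')
      qed
      show ?thesis
      proof (cases "h \<bullet> b \<ge> 0")
        case True
        have "(\<integral>\<^sup>+z. ennreal (norm (K t s (z + (h \<bullet> b) *\<^sub>R b) - K t s z)) \<partial>lborel)
            \<le> ennreal (3 * (h \<bullet> b)) * (\<integral>\<^sup>+w. ennreal (norm (space_deriv b K t s w)) \<partial>lborel)"
          by (rule translation_bound[OF L(1,2) L' norm_Basis[OF b] i D_meas[OF t s b] True])
        then show ?thesis using bd unfolding abs_of_nonneg[OF True] by (rule order_trans)
      next
        case False
        have "(\<integral>\<^sup>+z. ennreal (norm (K t s (z + (- (h \<bullet> b)) *\<^sub>R (- b)) - K t s z)) \<partial>lborel)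
            \<le> ennreal (3 * (- (h \<bullet> b))) * (\<integral>\<^sup>+w. ennreal (norm (- space_deriv b K t s w)) \<partial>lborel)"
        proof (rule translation_bound[OF L'])
          show "line_deriv (K t s) (\<lambda>x. - (- space_deriv b K t s x)) (- (- b))" "line_cont (\<lambda>x. - (- space_deriv b K t s x)) (- (- b))"
            using L(1,2) by simp_all
          show "(\<lambda>x. - space_deriv b K t s x) \<in> borel_measurable lebesgue" using D_meas[OF t s b] by measurable
        qed (use b i False in auto)
        then have "(\<integral>\<^sup>+z. ennreal (norm (K t s (z + (- (h \<bullet> b)) *\<^sub>R (- b)) - K t s z)) \<partial>lborel)
            \<le> ennreal (3 * \<bar>h \<bullet> b\<bar>) * (\<integral>\<^sup>+w. ennreal (norm (space_deriv b K t s w)) \<partial>lborel)"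
          using False by (simp only: norm_minus_cancel abs_of_neg not_le)
        then have "(\<integral>\<^sup>+z. ennreal (norm (K t s (z + (h \<bullet> b) *\<^sub>R b) - K t s z)) \<partial>lborel)
            \<le> ennreal (3 * \<bar>h \<bullet> b\<bar>) * (\<integral>\<^sup>+w. ennreal (norm (space_deriv b K t s w)) \<partial>lborel)"
          by (simp only: scaleR_minus_left scaleR_minus_right minus_minus)
        from order_trans[OF this bd] show ?thesis .
      qed
    qed
    have gm: "K t s \<in> borel_measurable lebesgue" using i by auto
    have "(\<integral>\<^sup>+z. ennreal (norm (K t s (z + (\<Sum>b\<in>Basis. (h \<bullet> b) *\<^sub>R b)) - K t s z)) \<partial>lborel) \<le> (\<Sum>b\<in>(Basis :: 'a set). ennreal (3 * norm h * I))"
      by (rule translation_chain[OF gm finite_Basis step])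
    also have "\<dots> = ennreal (real DIM('a) * (3 * norm h * I))"
      using I by (simp add: ennreal_mult ennreal_of_nat_eq_real_of_nat)
    finally show ?thesis by (simp add: euclidean_representation N'_def I_def mult_ac)
  qed
  then show ?thesis using N(1) by (intro exI[of _ N']) (auto simp: N'_def)
qed

end

section \<open>Joint measurability in time and space\<close>

lemma lebesgue_measurable_AE:
  fixes f g :: "'a::euclidean_space \<Rightarrow> complex"
  assumes g: "g \<in> borel_measurable borel" and N: "N \<in> sets borel" "emeasure lborel N = 0"
    and eq: "\<And>x. x \<notin> N \<Longrightarrow> f x = g x"
  shows "f \<in> borel_measurable lebesgue"
proof (rule borel_measurableI)
  fix U :: "complex set" assume "open U"
  then have 1: "g -` U \<in> sets borel" using measurable_sets_borel[OF g] by simp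
  have "N \<in> null_sets lborel" using N by (simp add: null_sets_def)
  then have Nn: "N \<in> null_sets lebesgue" by (rule null_sets_completionI)
  have "f -` U \<inter> N \<in> null_sets lebesgue" by (rule null_sets_completion_subset[OF _ Nn]) simp
  then have "f -` U \<inter> N \<in> sets lebesgue" by (rule null_setsD2)
  moreover have "g -` U - N \<in> sets borel" using 1 N(1) by blast
  then have "g -` U - N \<in> sets lebesgue" by simp
  ultimately have "(g -` U - N) \<union> (f -` U \<inter> N) \<in> sets lebesgue" by simp
  also have "(g -` U - N) \<union> (f -` U \<inter> N) = f -` U \<inter> space lebesgue" using eq by auto
  finally show "f -` U \<inter> space lebesgue \<in> sets lebesgue" .
qed

lemma lebesgue_borel_version_complex:
  fixes g :: "'a::euclidean_space \<Rightarrow> complex"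
  assumes "g \<in> borel_measurable lebesgue"
  shows "\<exists>g' N. g' \<in> borel_measurable borel \<and> N \<in> sets borel \<and> emeasure lborel N = 0 \<and> (\<forall>x. x \<notin> N \<longrightarrow> g x = g' x)"
proof -
  have "(\<lambda>x. Re (g x)) \<in> borel_measurable lebesgue" "(\<lambda>x. Im (g x)) \<in> borel_measurable lebesgue"
    using assms by measurable
  then obtain u v where u: "u \<in> borel_measurable lborel" "AE x in lborel. Re (g x) = u x"
      and v: "v \<in> borel_measurable lborel" "AE x in lborel. Im (g x) = v x"
    using completion_ex_borel_measurable_real by metis
  have "AE x in lborel. g x = Complex (u x) (v x)"
    using u(2) v(2) by eventually_elim (simp add: complex_eq_iff)
  then obtain N where N: "{x \<in> space lborel. \<not> g x = Complex (u x) (v x)} \<subseteq> N" "emeasure lborel N = 0" "N \<in> sets lborel"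
    by (rule AE_E)
  have "u \<in> borel_measurable borel" "v \<in> borel_measurable borel" using u(1) v(1) by simp_all
  then have "(\<lambda>x. Complex (u x) (v x)) \<in> borel_measurable borel" by (simp add: borel_measurable_complex_iff)
  then show ?thesis using N by (intro exI[of _ "\<lambda>x. Complex (u x) (v x)"] exI[of _ N]) auto
qed

lemma has_vector_derivative_quotient:
  fixes f :: "real \<Rightarrow> 'b::real_normed_vector"
  assumes "(f has_vector_derivative D) (at r)"
  shows "((\<lambda>h. (f (r + h) - f r) /\<^sub>R h) \<longlongrightarrow> D) (at 0)"
proof -
  have *: "((\<lambda>h. norm (f (r + h) - f r - h *\<^sub>R D) / norm h) \<longlongrightarrow> 0) (at 0)"
    using assms by (simp add: has_vector_derivative_def has_derivative_at)
  have "norm (f (r + h) - f r - h *\<^sub>R D) / norm h = norm ((f (r + h) - f r) /\<^sub>R h - D)" if "h \<noteq> 0" for h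
  proof -
    have "(f (r + h) - f r) /\<^sub>R h - D = (f (r + h) - f r - h *\<^sub>R D) /\<^sub>R h" using that by (simp add: scaleR_diff_right)
    then show ?thesis by (simp add: divide_inverse_commute)
  qed
  then have "\<forall>\<^sub>F h in at 0. norm (f (r + h) - f r - h *\<^sub>R D) / norm h = norm ((f (r + h) - f r) /\<^sub>R h - D)"
    by (auto simp: eventually_at_filter)
  with * have "((\<lambda>h. norm ((f (r + h) - f r) /\<^sub>R h - D)) \<longlongrightarrow> 0) (at 0)"
    by (simp cong: filterlim_cong add: tendsto_cong)
  then show ?thesis by (simp add: tendsto_norm_zero_iff LIM_zero_iff)
qed

text \<open>
  Only the slices \<open>D\<^sub>x K(t,s)\<close> for good times \<open>t\<close> are known to be measurable. Since \<open>D\<^sub>x K(t,s,x)\<close> is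
  continuous in \<open>t\<close>, it is the limit of its values on a countable dense set of good times, and so is
  jointly measurable up to a null set of points \<open>x\<close>.
\<close>

lemma joint_borel_version:
  fixes H :: "real \<Rightarrow> 'a::euclidean_space \<Rightarrow> complex"
  assumes Q: "countable Q" and dense: "\<And>r \<epsilon>. r > s \<Longrightarrow> \<epsilon> > 0 \<Longrightarrow> \<exists>q\<in>Q. \<bar>q - r\<bar> < \<epsilon>"
    and Hm: "\<And>q. q \<in> Q \<Longrightarrow> H q \<in> borel_measurable lebesgue"
    and cont: "\<And>r w. r > s \<Longrightarrow> w \<noteq> 0 \<Longrightarrow> isCont (\<lambda>r. H r w) r"
  shows "\<exists>Hb N. (\<lambda>z. Hb (fst z) (snd z)) \<in> borel_measurable borel \<and> N \<in> sets borel \<and> emeasure lborel N = 0 \<and> 0 \<in> N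
    \<and> (\<forall>r>s. \<forall>w. w \<notin> N \<longrightarrow> H r w = Hb r w)"
proof -
  have "Q \<noteq> {}" using dense[of "s + 1" 1] by auto
  define q where "q = from_nat_into Q"
  have q: "q i \<in> Q" for i unfolding q_def by (rule from_nat_into[OF \<open>Q \<noteq> {}\<close>])
  have rq: "\<exists>i. q i = x" if "x \<in> Q" for x
    using from_nat_into_surj[OF Q that] by (simp add: q_def)
  have "\<forall>i. \<exists>g' N. g' \<in> borel_measurable borel \<and> N \<in> sets borel \<and> emeasure lborel N = 0 \<and> (\<forall>x. x \<notin> N \<longrightarrow> H (q i) x = g' x)"
    using lebesgue_borel_version_complex[OF Hm[OF q]] by blast
  then obtain G M where G: "\<And>i. G i \<in> borel_measurable borel" and M: "\<And>i. M i \<in> sets borel" "\<And>i. emeasure lborel (M i) = 0"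
      and GM: "\<And>i x. x \<notin> M i \<Longrightarrow> H (q i) x = G i x"
    by metis
  define N where "N = insert 0 (\<Union>i. M i)"
  have Ns: "N \<in> sets borel" unfolding N_def using M(1) by auto
  have "(\<Union>i. M i) \<in> null_sets lborel" using M by (intro null_sets_UN) (auto simp: null_sets_def)
  moreover have "{0} \<in> null_sets (lborel :: 'a measure)" by (simp add: null_sets_def)
  ultimately have "insert 0 (\<Union>i. M i) \<in> null_sets lborel" using null_sets.Un[of "{0}" lborel "\<Union>i. M i"] by simp
  then have N0: "emeasure lborel N = 0" by (simp add: N_def null_sets_def)
  \<comment> \<open>A least index depends on \<open>r\<close> in a Borel way, so evaluating at the
    selected time keeps joint measurability.\<close>
  define idx where "idx n r = (LEAST i. \<bar>q i - r\<bar> < 1 / real (Suc n))" for n r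
  have idx: "\<bar>q (idx n r) - r\<bar> < 1 / real (Suc n)" if r: "r > s" for n r
  proof -
    obtain x where "x \<in> Q" "\<bar>x - r\<bar> < 1 / real (Suc n)" using dense[OF r, of "1 / real (Suc n)"] by auto
    then obtain i where "\<bar>q i - r\<bar> < 1 / real (Suc n)" using rq by metis
    then show ?thesis unfolding idx_def by (rule LeastI)
  qed
  define Hb where "Hb r w = lim (\<lambda>n. G (idx n r) w)" for r w
  have im: "(\<lambda>z. idx n (fst z)) \<in> measurable (borel :: (real \<times> 'a) measure) (count_space UNIV)" for n
    unfolding idx_def by measurable
  have Gm: "(\<lambda>z. G i (snd z)) \<in> borel_measurable (borel :: (real \<times> 'a) measure)" for i
    by (rule measurable_compose[OF borel_measurable_continuous_onI G]) (intro continuous_intros)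
  have "(\<lambda>z. G (idx n (fst z)) (snd z)) \<in> borel_measurable (borel :: (real \<times> 'a) measure)" for n
    by (rule measurable_compose_countable[OF Gm im])
  then have Hbm: "(\<lambda>z. Hb (fst z) (snd z)) \<in> borel_measurable (borel :: (real \<times> 'a) measure)"
    unfolding Hb_def by (rule borel_measurable_lim_metric)
  have "H r w = Hb r w" if r: "r > s" and w: "w \<notin> N" for r w
  proof -
    have w0: "w \<noteq> 0" "\<And>i. w \<notin> M i" using w by (auto simp: N_def)
    have "(\<lambda>n. q (idx n r)) \<longlonglongrightarrow> r"
    proof (rule LIMSEQ_I)
      fix \<epsilon> :: real assume "\<epsilon> > 0"
      then obtain n0 where n0: "1 / real (Suc n0) < \<epsilon>" using nat_approx_posE by blast
      have "norm (q (idx n r) - r) < \<epsilon>" if "n \<ge> n0" for n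
      proof -
        have "1 / real (Suc n) \<le> 1 / real (Suc n0)" using that by (intro divide_left_mono) auto
        then show ?thesis using idx[OF r, of n] n0 by simp
      qed
      then show "\<exists>n0. \<forall>n\<ge>n0. norm (q (idx n r) - r) < \<epsilon>" by blast
    qed
    then have "(\<lambda>n. H (q (idx n r)) w) \<longlonglongrightarrow> H r w" by (rule isCont_tendsto_compose[OF cont[OF r w0(1)]])
    then have "(\<lambda>n. G (idx n r) w) \<longlonglongrightarrow> H r w" by (simp add: GM[OF w0(2)])
    then show ?thesis unfolding Hb_def by (rule limI[symmetric])
  qed
  then show ?thesis using Hbm Ns N0 by (intro exI[of _ Hb] exI[of _ N]) (auto simp: N_def)
qed

context singular_kernel
begin

text \<open>A set of full measure meets every interval, and a set of reals has a countable dense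
  subset.\<close>

lemma Gd_dense: "\<exists>Q. countable Q \<and> Q \<subseteq> Gd \<inter> {s<..} \<and> (\<forall>r>s. \<forall>\<epsilon>>0. \<exists>q\<in>Q. \<bar>q - r\<bar> < \<epsilon>)"
proof -
  obtain Q where Q: "countable Q" "Q \<subseteq> Gd \<inter> {s<..}" "Gd \<inter> {s<..} \<subseteq> closure Q"
    using separable[of "Gd \<inter> {s<..}"] by metis
  have "\<exists>q\<in>Q. \<bar>q - r\<bar> < \<epsilon>" if r: "r > s" and \<epsilon>: "\<epsilon> > 0" for r \<epsilon>
  proof -
    have "\<exists>g. g \<in> Gd \<and> r < g \<and> g < r + \<epsilon> / 2"
    proof (rule ccontr)
      assume neg: "\<not> ?thesis"
      have "AE t in lborel. t \<notin> {r<..<r + \<epsilon> / 2}"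
        using Gd by (rule eventually_mono) (use neg in auto)
      then have "emeasure lborel {r<..<r + \<epsilon> / 2} = 0"
        by (subst (asm) AE_iff_measurable[where N = "{r<..<r + \<epsilon> / 2}"]) auto
      then show False using \<epsilon> by simp
    qed
    then obtain g where g: "g \<in> Gd" "r < g" "g < r + \<epsilon> / 2" by blast
    then have "g \<in> closure Q" using Q(3) r by auto
    then obtain q where q: "q \<in> Q" "dist q g < \<epsilon> / 2"
      using \<epsilon> closure_approachable[of g Q] by (metis half_gt_zero)
    have "\<bar>q - g\<bar> < \<epsilon> / 2" using q(2) by (simp add: dist_real_def)
    then have "\<bar>q - r\<bar> < \<epsilon>" using g by linarith
    then show ?thesis using q(1) by blast
  qed
  then show ?thesis using Q(1,2) by blast
qed

text \<open>\<open>time_abs_continuous\<close> presents the derivative as an indefinite integral in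
  time, so continuity holds at every \<open>r > s\<close> and not only at good times.\<close>

lemma space_deriv_time_cont:
  assumes w: "w \<noteq> 0" and b: "b \<in> Basis" and r: "r > s"
  shows "isCont (\<lambda>r. space_deriv b K r s w) r"
proof -
  let ?P = "\<lambda>t. time_deriv (space_deriv b K) t s w"
  define u where "u = (s + r) / 2"
  have u: "s < u" "u < r" using r by (auto simp: u_def)
  have ac: "\<And>v. u \<le> v \<Longrightarrow> ?P absolutely_integrable_on {u..v}" "\<And>v. u \<le> v \<Longrightarrow> space_deriv b K v s w - space_deriv b K u s w = integral {u..v} ?P"
    using time_ac[OF w b, of s] u(1) unfolding time_abs_continuous_def by blast+
  have "?P integrable_on {u..r + 1}" using u by (intro set_lebesgue_integral_eq_integral(1)[OF ac(1)]) simp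
  then have "continuous_on {u..r + 1} (\<lambda>v. space_deriv b K u s w + integral {u..v} ?P)"
    by (intro continuous_intros indefinite_integral_continuous_1)
  then have "continuous_on {u..r + 1} (\<lambda>v. space_deriv b K v s w)"
  proof (rule continuous_on_eq)
    fix v assume "v \<in> {u..r + 1}"
    then have "space_deriv b K v s w - space_deriv b K u s w = integral {u..v} ?P" by (intro ac(2)) simp
    then show "space_deriv b K u s w + integral {u..v} ?P = space_deriv b K v s w" by (simp only: eq_diff_eq' diff_eq_eq add.commute)
  qed
  moreover have "r \<in> interior {u..r + 1}" using u by (simp add: interior_atLeastAtMost_real)
  ultimately show ?thesis by (rule continuous_on_interior)
qed

text \<open>At a good time the mixed derivative is the limit of difference quotients with steps
  \<open>1 / Suc n\<close>. The shifted times may be bad, but the version from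
  \<open>joint_borel_version\<close> is valid at all \<open>r > s\<close> with one exceptional
  set.\<close>

lemma time_deriv_borel_version:
  assumes b: "b \<in> Basis"
  shows "\<exists>Pb N. (\<lambda>z. Pb (fst z) (snd z)) \<in> borel_measurable borel \<and> N \<in> sets borel \<and> emeasure lborel N = 0 \<and> 0 \<in> N
    \<and> (\<forall>r\<in>Gd. r > s \<longrightarrow> (\<forall>w. w \<notin> N \<longrightarrow> time_deriv (space_deriv b K) r s w = Pb r w))"
proof -
  obtain Q where Q: "countable Q" "Q \<subseteq> Gd \<inter> {s<..}" and dense: "\<forall>r>s. \<forall>\<epsilon>>0. \<exists>q\<in>Q. \<bar>q - r\<bar> < \<epsilon>"
    using Gd_dense[of s] by (elim exE conjE) (rule that)
  have Q3: "\<exists>q\<in>Q. \<bar>q - r\<bar> < \<epsilon>" if "r > s" "\<epsilon> > 0" for r \<epsilon> using dense that by simp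
  have Hm: "space_deriv b K q s \<in> borel_measurable lebesgue" if "q \<in> Q" for q
    using Q(2) that by (intro D_meas[OF _ _ b]) auto
  obtain Hb N where Hb: "(\<lambda>z. Hb (fst z) (snd z)) \<in> borel_measurable borel" and N: "N \<in> sets borel" "emeasure lborel N = 0" "0 \<in> N"
      and eq': "\<forall>r>s. \<forall>w. w \<notin> N \<longrightarrow> space_deriv b K r s w = Hb r w"
  proof -
    have "\<exists>Hb N. (\<lambda>z. Hb (fst z) (snd z)) \<in> borel_measurable borel \<and> N \<in> sets borel \<and> emeasure lborel N = 0 \<and> 0 \<in> N
        \<and> (\<forall>r>s. \<forall>w. w \<notin> N \<longrightarrow> space_deriv b K r s w = Hb r w)"
      by (rule joint_borel_version[where Q = Q]) (use Q(1) Q3 Hm space_deriv_time_cont[OF _ b] in blast)+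
    then show thesis by (elim exE conjE) (rule that)
  qed
  have eq: "space_deriv b K r s w = Hb r w" if "r > s" "w \<notin> N" for r w using eq' that by simp
  define Pb where "Pb r w = lim (\<lambda>n. real (Suc n) *\<^sub>R (Hb (r + 1 / real (Suc n)) w - Hb r w))" for r w
  have Hsh: "(\<lambda>z. Hb (fst z + c) (snd z)) \<in> borel_measurable (borel :: (real \<times> 'a) measure)" for c
  proof -
    have "(\<lambda>z :: real \<times> 'a. (fst z + c, snd z)) \<in> borel_measurable borel"
      by (intro borel_measurable_continuous_onI continuous_intros)
    from measurable_compose[OF this Hb] show ?thesis by simp
  qed
  have "(\<lambda>z. real (Suc n) *\<^sub>R (Hb (fst z + 1 / real (Suc n)) (snd z) - Hb (fst z) (snd z))) \<in> borel_measurable (borel :: (real \<times> 'a) measure)" for n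
    by (rule borel_measurable_scaleR[OF borel_measurable_const borel_measurable_diff[OF Hsh Hb]])
  then have Pbm: "(\<lambda>z. Pb (fst z) (snd z)) \<in> borel_measurable (borel :: (real \<times> 'a) measure)"
    unfolding Pb_def by (rule borel_measurable_lim_metric)
  have "time_deriv (space_deriv b K) r s w = Pb r w" if r: "r \<in> Gd" "r > s" and w: "w \<notin> N" for r w
  proof -
    have w0: "w \<noteq> 0" using w N(3) by auto
    let ?D = "time_deriv (space_deriv b K) r s w"
    have "((\<lambda>r. space_deriv b K r s w) has_vector_derivative ?D) (at r)"
      using derivs(2)[OF r w0 b] unfolding has_time_deriv_def time_deriv_def by (simp add: vector_derivative_works)
    then have "((\<lambda>h. (space_deriv b K (r + h) s w - space_deriv b K r s w) /\<^sub>R h) \<longlongrightarrow> ?D) (at 0)"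
      by (rule has_vector_derivative_quotient)
    moreover have "filterlim (\<lambda>n. 1 / real (Suc n)) (at 0) sequentially"
      unfolding filterlim_at using LIMSEQ_inverse_real_of_nat by (simp add: inverse_eq_divide)
    ultimately have "(\<lambda>n. (space_deriv b K (r + 1 / real (Suc n)) s w - space_deriv b K r s w) /\<^sub>R (1 / real (Suc n))) \<longlonglongrightarrow> ?D"
      by (rule filterlim_compose)
    moreover have "space_deriv b K (r + 1 / real (Suc n)) s w = Hb (r + 1 / real (Suc n)) w" for n
    proof (rule eq[OF _ w])
      have "0 < 1 / real (Suc n)" by simp
      then show "s < r + 1 / real (Suc n)" using r(2) by linarith
    qed
    ultimately have "(\<lambda>n. real (Suc n) *\<^sub>R (Hb (r + 1 / real (Suc n)) w - Hb r w)) \<longlonglongrightarrow> ?D"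
      using eq[OF r(2) w] by (simp add: inverse_eq_divide)
    then show ?thesis unfolding Pb_def by (rule limI[symmetric])
  qed
  then show ?thesis using Pbm N by blast
qed

text \<open>\<open>hardy_far\<close> with \<open>r = 0\<close> is applied to the difference of two
  slices, whose derivative is the time integral of the mixed derivative. Exchanging that integral
  with the one over \<open>w\<close> is what requires joint measurability.\<close>

lemma kernel_time_increment: "\<exists>N\<ge>0. \<forall>t\<in>Gd. \<forall>t'\<in>Gd. \<forall>s. s < t' \<longrightarrow> t' < t \<longrightarrow> integrable lebesgue (K t s) \<longrightarrow> integrable lebesgue (K t' s) \<longrightarrow>
    (\<integral>\<^sup>+z. ennreal (norm (K t s z - K t' s z)) \<partial>lborel) \<le> ennreal (N * (t - t') * (t' - s) powr (- 3 / 2))"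
proof -
  obtain N0 where N0: "N0 \<ge> 0" "\<And>t s b. t \<in> Gd \<Longrightarrow> s < t \<Longrightarrow> b \<in> Basis \<Longrightarrow> time_deriv (space_deriv b K) t s \<in> borel_measurable lebesgue \<Longrightarrow>
    (\<integral>\<^sup>+w. ennreal (norm w * norm (time_deriv (space_deriv b K) t s w)) \<partial>lborel) \<le> ennreal (N0 * (t - s) powr (- 3 / 2))"
    using Dt_bound by blast
  obtain b :: 'a where b: "b \<in> Basis" using nonempty_Basis by blast
  have "(\<integral>\<^sup>+z. ennreal (norm (K t s z - K t' s z)) \<partial>lborel) \<le> ennreal ((2 * N0) * (t - t') * (t' - s) powr (- 3 / 2))"
    if t: "t \<in> Gd" and t': "t' \<in> Gd" and s: "s < t'" and tt: "t' < t" and i: "integrable lebesgue (K t s)" "integrable lebesgue (K t' s)" for t t' s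
  proof -
    have s': "s < t" using s tt by simp
    let ?D = "\<lambda>w. space_deriv b K t s w - space_deriv b K t' s w"
    let ?P = "\<lambda>r w. time_deriv (space_deriv b K) r s w"
    obtain Pb N where Pb: "(\<lambda>z. Pb (fst z) (snd z)) \<in> borel_measurable borel" and N: "N \<in> sets borel" "emeasure lborel N = 0" "0 \<in> N"
        and eq': "\<forall>r\<in>Gd. r > s \<longrightarrow> (\<forall>w. w \<notin> N \<longrightarrow> ?P r w = Pb r w)"
      using time_deriv_borel_version[OF b, of s] by (elim exE conjE) (rule that)
    have eq: "?P r w = Pb r w" if "r \<in> Gd" "r > s" "w \<notin> N" for r w using eq' that by simp
    have Pb1: "Pb r \<in> borel_measurable borel" for r using measurable_compose[OF _ Pb, of "\<lambda>w. (r, w)"] by simp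
    have Pb2: "(\<lambda>r. Pb r w) \<in> borel_measurable borel" for w using measurable_compose[OF _ Pb, of "\<lambda>r. (r, w)"] by simp
    have Pbp: "(\<lambda>z. Pb (fst z) (snd z)) \<in> borel_measurable (lborel \<Otimes>\<^sub>M lborel)" using Pb by (simp add: lborel_prod)
    define B where "B = N0 * (t' - s) powr (- 3 / 2)"
    have B: "B \<ge> 0" using N0(1) by (simp add: B_def)
    have AEN: "AE w in lborel. w \<notin> N" by (rule AE_not_in) (use N in \<open>simp add: null_sets_def\<close>)
    have Pint: "(\<integral>\<^sup>+w. ennreal (norm w * norm (Pb r w)) \<partial>lborel) \<le> ennreal B" if r: "r \<in> Gd" "t' \<le> r" for r
    proof -
      have rs: "s < r" using s r by simp
      have m: "?P r \<in> borel_measurable lebesgue"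
        by (rule lebesgue_measurable_AE[OF Pb1 N(1,2) eq[OF r(1) rs]])
      have "(\<integral>\<^sup>+w. ennreal (norm w * norm (Pb r w)) \<partial>lborel) = (\<integral>\<^sup>+w. ennreal (norm w * norm (?P r w)) \<partial>lborel)"
        using AEN by (intro nn_integral_cong_AE) (auto elim!: eventually_mono simp: eq[OF r(1) rs])
      also have "\<dots> \<le> ennreal (N0 * (r - s) powr (- 3 / 2))" by (rule N0(2)[OF r(1) rs b m])
      also have "\<dots> \<le> ennreal B"
        unfolding B_def using s r N0(1) by (intro ennreal_leI mult_left_mono powr_mono2') auto
      finally show ?thesis .
    qed
    \<comment> \<open>The bound is stated with the Borel version \<open>Pb\<close>, to which
      Tonelli's theorem applies; the two integrands agree because good times have full
      measure.\<close>
    have Dw: "ennreal (norm (?D w)) \<le> (\<integral>\<^sup>+r\<in>{t'..t}. ennreal (norm (Pb r w)) \<partial>lborel)" if w: "w \<notin> N" for w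
    proof -
      have w0: "w \<noteq> 0" using w N(3) by auto
      have ac: "(\<lambda>r. ?P r w) absolutely_integrable_on {t'..t}" "?D w = integral {t'..t} (\<lambda>r. ?P r w)"
        using time_ac[OF w0 b, of s] s tt unfolding time_abs_continuous_def by auto
      have "?D w = (LINT r|lebesgue. indicat_real {t'..t} r *\<^sub>R ?P r w)"
        using set_lebesgue_integral_eq_integral(2)[OF ac(1)] ac(2) by (simp add: set_lebesgue_integral_def)
      then have "ennreal (norm (?D w)) = ennreal (norm (LINT r|lebesgue. indicat_real {t'..t} r *\<^sub>R ?P r w))" by simp
      also have "\<dots> \<le> (\<integral>\<^sup>+r. ennreal (norm (indicat_real {t'..t} r *\<^sub>R ?P r w)) \<partial>lebesgue)"
        using ac(1) unfolding set_integrable_def by (rule integral_norm_bound_ennreal)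
      also have "\<dots> = (\<integral>\<^sup>+r. ennreal (norm (indicat_real {t'..t} r *\<^sub>R ?P r w)) \<partial>lborel)" by (rule nn_integral_completion)
      also have "\<dots> = (\<integral>\<^sup>+r\<in>{t'..t}. ennreal (norm (Pb r w)) \<partial>lborel)"
        using Gd by (intro nn_integral_cong_AE) (auto elim!: eventually_mono simp: indicator_def eq[OF _ _ w] less_le_trans[OF s])
      finally show ?thesis .
    qed
    note L = line[OF t s' b] line[OF t' s b]
    have LD: "line_deriv (\<lambda>z. K t s z - K t' s z) ?D b" "line_cont ?D b"
      using L(1,2,4,5) unfolding line_deriv_def line_cont_def by (auto intro!: has_vector_derivative_diff continuous_diff)
    have Dm: "?D \<in> borel_measurable lebesgue" using D_meas[OF t s' b] D_meas[OF t' s b] by measurable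
    have "(\<integral>\<^sup>+z. ennreal (norm (K t s z - K t' s z)) \<partial>lborel) = (\<integral>\<^sup>+z\<in>{z. norm z \<ge> 0}. ennreal (norm (K t s z - K t' s z)) \<partial>lborel)"
      by (simp add: indicator_def)
    also have "\<dots> \<le> 2 * (\<integral>\<^sup>+w\<in>{w. norm w \<ge> 0}. ennreal (norm w * norm (?D w)) \<partial>lborel)"
      by (rule hardy_far[OF LD line_deriv_minus[OF LD(1)] line_cont_minus[OF LD(2)] norm_Basis[OF b] Bochner_Integration.integrable_diff[OF i] Dm])
    also have "(\<integral>\<^sup>+w\<in>{w. norm w \<ge> 0}. ennreal (norm w * norm (?D w)) \<partial>lborel) = (\<integral>\<^sup>+w. ennreal (norm w * norm (?D w)) \<partial>lborel)"
      by (simp add: indicator_def)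
    also have "\<dots> \<le> (\<integral>\<^sup>+w. \<integral>\<^sup>+r. ennreal (norm w * norm (Pb r w)) * indicator {t'..t} r \<partial>lborel \<partial>lborel)"
    proof (rule nn_integral_mono_AE, use AEN in eventually_elim)
      fix w assume w: "w \<notin> N"
      have [measurable]: "(\<lambda>r. Pb r w) \<in> borel_measurable borel" by (rule Pb2)
      have "ennreal (norm w * norm (?D w)) = ennreal (norm w) * ennreal (norm (?D w))" by (simp add: ennreal_mult)
      also have "\<dots> \<le> ennreal (norm w) * (\<integral>\<^sup>+r\<in>{t'..t}. ennreal (norm (Pb r w)) \<partial>lborel)" by (rule mult_left_mono[OF Dw[OF w]]) simp
      also have "\<dots> = (\<integral>\<^sup>+r. ennreal (norm w) * (ennreal (norm (Pb r w)) * indicator {t'..t} r) \<partial>lborel)"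
        by (rule nn_integral_cmult[symmetric]) measurable
      also have "\<dots> = (\<integral>\<^sup>+r. ennreal (norm w * norm (Pb r w)) * indicator {t'..t} r \<partial>lborel)"
        by (simp add: ennreal_mult mult.assoc)
      finally show "ennreal (norm w * norm (?D w)) \<le> (\<integral>\<^sup>+r. ennreal (norm w * norm (Pb r w)) * indicator {t'..t} r \<partial>lborel)" .
    qed
    also have "\<dots> = (\<integral>\<^sup>+r. \<integral>\<^sup>+w. ennreal (norm w * norm (Pb r w)) * indicator {t'..t} r \<partial>lborel \<partial>lborel)"
    proof (rule lborel_pair.Fubini')
      have [measurable]: "(\<lambda>z. Pb (fst z) (snd z)) \<in> borel_measurable (lborel \<Otimes>\<^sub>M lborel)" by (rule Pbp)
      show "(\<lambda>(r, w). ennreal (norm w * norm (Pb r w)) * indicator {t'..t} r) \<in> borel_measurable (lborel \<Otimes>\<^sub>M lborel)"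
        unfolding split_beta by measurable
    qed
    also have "\<dots> \<le> (\<integral>\<^sup>+r. ennreal B * indicator {t'..t} r \<partial>lborel)"
    proof (rule nn_integral_mono_AE, use Gd in eventually_elim)
      fix r assume r: "r \<in> Gd"
      show "(\<integral>\<^sup>+w. ennreal (norm w * norm (Pb r w)) * indicator {t'..t} r \<partial>lborel) \<le> ennreal B * indicator {t'..t} r"
        using Pint[OF r] by (cases "r \<in> {t'..t}") auto
    qed
    also have "\<dots> = ennreal (B * (t - t'))" using tt B by (simp add: nn_integral_cmult_indicator ennreal_mult)
    finally have "(\<integral>\<^sup>+z. ennreal (norm (K t s z - K t' s z)) \<partial>lborel) \<le> 2 * ennreal (B * (t - t'))"
      by (simp add: mult_left_mono)
    also have "\<dots> = ennreal (2 * (B * (t - t')))" using B tt by (simp add: ennreal_mult')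
    also have "2 * (B * (t - t')) = (2 * N0) * (t - t') * (t' - s) powr (- 3 / 2)" by (simp only: B_def mult_ac)
    finally show ?thesis .
  qed
  then show ?thesis using N0(1) by (intro exI[of _ "2 * N0"]) auto
qed

end

section \<open>Borel versions of the kernel\<close>

lemma AE_lborel_translate:
  fixes c :: "'a::euclidean_space"
  assumes "AE x in lborel. P x" shows "AE x in lborel. P (x + c)"
proof -
  obtain N where N: "{x \<in> space lborel. \<not> P x} \<subseteq> N" "emeasure lborel N = 0" "N \<in> sets lborel"
    using assms by (rule AE_E)
  have "N \<in> sets borel" using N(3) by simp
  from AE_shift[OF this N(2), of c] show ?thesis by (rule eventually_mono) (use N(1) in auto)
qed

lemma AE_lborel_reflect:
  fixes c :: "'a::euclidean_space"
  assumes "AE x in lborel. P x" shows "\<exists>N. negligible N \<and> (\<forall>y. y \<notin> N \<longrightarrow> P (c - y))"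
proof -
  obtain N where N: "{x \<in> space lborel. \<not> P x} \<subseteq> N" "emeasure lborel N = 0" "N \<in> sets lborel"
    using assms by (rule AE_E)
  have [measurable]: "N \<in> sets borel" using N(3) by simp
  have m: "(\<lambda>y. c - y) \<in> borel_measurable borel" by measurable
  have M: "(\<lambda>y. c - y) -` N \<in> sets borel" by (rule measurable_sets_borel[OF m]) fact
  have "emeasure lborel ((\<lambda>y. c - y) -` N) = (\<integral>\<^sup>+y. indicator ((\<lambda>y. c - y) -` N) y \<partial>lborel)" using M by simp
  also have "\<dots> = (\<integral>\<^sup>+y. indicator N (c - y) \<partial>lborel)" by (simp add: indicator_def)
  also have "\<dots> = (\<integral>\<^sup>+y. indicator N y \<partial>lborel)" by (rule nn_integral_reflect) measurable
  also have "\<dots> = 0" using N(2) by simp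
  finally have "(\<lambda>y. c - y) -` N \<in> null_sets lborel" using M by (simp add: null_sets_def)
  then have "negligible ((\<lambda>y. c - y) -` N)" by (simp add: negligible_iff_null_sets null_sets_completionI)
  then show ?thesis using N(1) by (intro exI[of _ "(\<lambda>y. c - y) -` N"]) auto
qed

lemma convol_cong_AE:
  assumes "AE x in lborel. g x = g' x" shows "convol m g u x = convol m g' u x"
proof -
  obtain N where N: "negligible N" "\<And>y. y \<notin> N \<Longrightarrow> g (x - y) = g' (x - y)"
    using AE_lborel_reflect[OF assms, of x] by blast
  show ?thesis unfolding convol_def by (rule integral_spike[OF N(1)]) (simp add: N(2))
qed

lemma AE_fst_lborel:
  assumes "AE t in lborel. P t" shows "AE z in (lborel :: (real \<times> 'a::euclidean_space) measure). P (fst z)"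
proof -
  obtain N where N: "{x \<in> space lborel. \<not> P x} \<subseteq> N" "emeasure lborel N = 0" "N \<in> sets lborel"
    using assms by (rule AE_E)
  have [measurable]: "N \<in> sets borel" using N(3) by simp
  have "emeasure (lborel \<Otimes>\<^sub>M (lborel :: 'a measure)) (N \<times> UNIV) = emeasure lborel N * emeasure (lborel :: 'a measure) UNIV"
    using N(3) by (intro lborel.emeasure_pair_measure_Times) auto
  also have "\<dots> = 0" using N(2) by simp
  finally have "emeasure (lborel :: (real \<times> 'a) measure) (N \<times> UNIV) = 0" by (simp add: lborel_prod)
  moreover have "N \<times> UNIV \<in> sets (lborel \<Otimes>\<^sub>M (lborel :: 'a measure))" using N(3) by (intro pair_measureI) auto
  then have "N \<times> UNIV \<in> sets (lborel :: (real \<times> 'a) measure)" by (simp only: lborel_prod)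
  ultimately show ?thesis using N(1) by (intro AE_I[of _ _ "N \<times> UNIV"]) auto
qed

lemma epowr_mono:
  assumes "x \<le> y" "a \<ge> 0" shows "epowr x a \<le> epowr y a"
proof (cases "y = \<infinity>")
  case False
  then have "x \<noteq> \<infinity>" using assms(1) by (auto simp: top_unique)
  moreover have "enn2real x \<le> enn2real y" using assms(1) False by (intro enn2real_mono) (auto simp: less_top)
  ultimately show ?thesis using False assms(2) by (simp add: epowr_def ennreal_leI powr_mono2)
qed (simp add: epowr_def)

lemma epowr_cmult:
  assumes "c > 0" shows "epowr (ennreal c * x) a = ennreal (c powr a) * epowr x a"
proof (cases x)
  case (real r)
  then show ?thesis using assms by (simp add: ennreal_mult[symmetric] epowr_ennreal powr_mult)
next
  case top
  then show ?thesis using assms by (simp add: epowr_def ennreal_mult_top)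
qed

lemma smooth_compact_support_cc_fun: "smooth_compact_support f \<Longrightarrow> cc_fun f"
proof -
  assume f: "smooth_compact_support f"
  then have "times_cont_diff 0 f" unfolding smooth_compact_support_def by blast
  then have c: "continuous_on UNIV f" by simp
  have "bounded (closure {x. f x \<noteq> 0})" using f unfolding smooth_compact_support_def by (intro compact_imp_bounded) simp
  then obtain a b where "closure {x. f x \<noteq> 0} \<subseteq> cbox a b" using bounded_subset_cbox_symmetric by metis
  then have "\<forall>x. x \<notin> cbox a b \<longrightarrow> f x = 0" using closure_subset[of "{x. f x \<noteq> 0}"] by blast
  then show "cc_fun f" using c unfolding cc_fun_def by blast
qed

text \<open>A Borel function agreeing with \<open>K\<close> off a null set \<open>N\<close> of
  triples is repaired so as to stay in \<open>S\<close>, vanish for \<open>s \<ge> t\<close> and be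
  integrable on every slice. Tonelli makes almost every slice of \<open>N\<close> null. Both orders
  of the two time quantifiers are proved because the square function fixes \<open>t\<close> while
  (A) fixes \<open>s\<close>.\<close>

lemma kernel_borel_version:
  fixes K :: "real \<Rightarrow> real \<Rightarrow> 'a::euclidean_space \<Rightarrow> complex"
  assumes S: "S = \<real> \<or> S = UNIV" and K_S: "\<And>t s x. K t s x \<in> S"
    and Km: "(\<lambda>(t, s, x). K t s x) \<in> borel_measurable lebesgue"
    and Ki: "\<And>s. AE t in lborel. s < t \<longrightarrow> integrable lebesgue (K t s)"
  shows "\<exists>K'. (\<lambda>z. K' (fst z) (fst (snd z)) (snd (snd z))) \<in> borel_measurable borel \<and>
    (\<forall>t s. integrable lborel (K' t s)) \<and> (\<forall>t s x. K' t s x \<in> S) \<and> (\<forall>t s x. s \<ge> t \<longrightarrow> K' t s x = 0) \<and>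
    (AE t in lborel. AE s in lborel. s < t \<longrightarrow> integrable lebesgue (K t s) \<and> (AE x in lborel. K t s x = K' t s x)) \<and>
    (AE s in lborel. AE t in lborel. s < t \<longrightarrow> integrable lebesgue (K t s) \<and> (AE x in lborel. K t s x = K' t s x))"
proof -
  obtain k N where k: "k \<in> borel_measurable borel" and N: "N \<in> sets borel" "emeasure lborel N = 0"
      and kN: "\<And>z. z \<notin> N \<Longrightarrow> (\<lambda>(t, s, x). K t s x) z = k z"
    using lebesgue_borel_version_complex[OF Km] by metis
  \<comment> \<open>For real scalars the Borel version may be nonreal on the exceptional set; taking
    its real part changes nothing elsewhere.\<close>
  define k1 where "k1 z = (if S = UNIV then k z else complex_of_real (Re (k z)))" for z
  have k1m: "k1 \<in> borel_measurable borel"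
  proof (cases "S = UNIV")
    case False
    have "(\<lambda>z. complex_of_real (Re (k z))) \<in> borel_measurable borel" using k by measurable
    then show ?thesis using False unfolding k1_def by simp
  next
    case True
    then show ?thesis using k unfolding k1_def by simp
  qed
  have k1S: "k1 z \<in> S" for z using S by (auto simp: k1_def)
  have k1N: "K t s x = k1 (t, s, x)" if "(t, s, x) \<notin> N" for t s x
    using kN[OF that] K_S[of t s x] S by (auto simp: k1_def complex_is_Real_iff complex_eq_iff)
  have pm: "(\<lambda>w :: (real \<times> real) \<times> 'a. (fst (fst w), snd (fst w), snd w)) \<in> borel_measurable borel"
    by (intro borel_measurable_continuous_onI continuous_intros)
  have pm1: "(\<lambda>w. k1 (fst (fst w), snd (fst w), snd w)) \<in> borel_measurable ((borel :: (real \<times> real) measure) \<Otimes>\<^sub>M lborel)"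
    using measurable_compose[OF pm k1m] by (simp add: borel_prod[symmetric] cong: measurable_cong_sets)
  have pm2: "(\<lambda>w. indicator N (fst (fst w), snd (fst w), snd w) :: ennreal) \<in> borel_measurable ((borel :: (real \<times> real) measure) \<Otimes>\<^sub>M lborel)"
    using measurable_compose[OF pm borel_measurable_indicator[OF N(1)]] by (simp add: borel_prod[symmetric] cong: measurable_cong_sets)
  \<comment> \<open>\<open>I\<close> and \<open>Z\<close> are the \<open>L\<^sub>1\<close> norm of a
    slice and the measure of its exceptional points. Both are Borel functions of the two times,
    which makes \<open>P\<close> a measurable condition.\<close>
  define I where "I w = (\<integral>\<^sup>+x. ennreal (norm (k1 (fst w, snd w, x))) \<partial>lborel)" for w
  define Z where "Z w = (\<integral>\<^sup>+x. indicator N (fst w, snd w, x) \<partial>lborel)" for w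
  have Im[measurable]: "I \<in> borel_measurable borel"
    unfolding I_def by (rule lborel.borel_measurable_nn_integral) (use pm1 in \<open>simp add: split_beta\<close>)
  have Zm[measurable]: "Z \<in> borel_measurable borel"
    unfolding Z_def by (rule lborel.borel_measurable_nn_integral) (use pm2 in \<open>simp add: split_beta\<close>)
  have slice: "(\<lambda>x. k1 (t, s, x)) \<in> borel_measurable borel" "{x. (t, s, x) \<in> N} \<in> sets borel" for t s
  proof -
    have p: "(\<lambda>x :: 'a. (t, s, x)) \<in> borel_measurable borel" by (intro borel_measurable_continuous_onI continuous_intros)
    show "(\<lambda>x. k1 (t, s, x)) \<in> borel_measurable borel" by (rule measurable_compose[OF p k1m])
    have "(\<lambda>x :: 'a. (t, s, x)) -` N \<in> sets borel" by (rule measurable_sets_borel[OF p N(1)])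
    then show "{x. (t, s, x) \<in> N} \<in> sets borel" by (simp add: vimage_def)
  qed
  have Zn: "emeasure lborel {x. (t, s, x) \<in> N} = Z (t, s)" for t s
  proof -
    have "emeasure lborel {x. (t, s, x) \<in> N} = (\<integral>\<^sup>+x. indicator {x. (t, s, x) \<in> N} x \<partial>lborel)"
      using slice(2)[of t s] by simp
    then show ?thesis by (simp add: Z_def indicator_def)
  qed
  define K' where "K' t s x = (if s < t \<and> I (t, s) < \<infinity> then k1 (t, s, x) else 0)" for t s x
  define P where "P t s \<longleftrightarrow> (s < t \<longrightarrow> Z (t, s) = 0 \<and> I (t, s) < \<infinity>)" for t s
  have good: "integrable lebesgue (K t s)" "AE x in lborel. K t s x = K' t s x" if P: "P t s" and st: "s < t" for t s
  proof -
    have z: "emeasure lborel {x. (t, s, x) \<in> N} = 0" and i: "I (t, s) < \<infinity>" using P st by (auto simp: P_def Zn)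
    have eq: "K t s x = k1 (t, s, x)" if "x \<notin> {x. (t, s, x) \<in> N}" for x using k1N that by simp
    have AEk: "AE x in lborel. K t s x = k1 (t, s, x)"
      by (rule AE_I[of _ _ "{x. (t, s, x) \<in> N}"]) (use eq z slice(2) in auto)
    have m: "K t s \<in> borel_measurable lebesgue" by (rule lebesgue_measurable_AE[OF slice(1) slice(2) z eq])
    have "(\<integral>\<^sup>+x. ennreal (norm (K t s x)) \<partial>lebesgue) = I (t, s)"
      unfolding I_def nn_integral_completion by (rule nn_integral_cong_AE) (use AEk in \<open>auto elim!: eventually_mono\<close>)
    then show "integrable lebesgue (K t s)" using m i by (intro integrableI_bounded) simp_all
    show "AE x in lborel. K t s x = K' t s x" using AEk st i by (simp add: K'_def)
  qed
  have Z_AE: "AE s in lborel. AE t in lborel. Z (t, s) = 0"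
  proof -
    have "AE z in lborel. z \<notin> N" by (rule AE_not_in) (use N in \<open>simp add: null_sets_def\<close>)
    then have "AE z in (lborel :: real measure) \<Otimes>\<^sub>M (lborel :: (real \<times> 'a) measure). z \<notin> N" unfolding lborel_prod .
    then have 1: "AE t in lborel. AE y in (lborel :: (real \<times> 'a) measure). (t, y) \<notin> N" by (rule lborel_pair.AE_pair)
    have 2: "AE t in lborel. AE s in lborel. Z (t, s) = 0"
      using 1
    proof eventually_elim
      case (elim t)
      then have "AE y in (lborel :: real measure) \<Otimes>\<^sub>M (lborel :: 'a measure). (t, y) \<notin> N" unfolding lborel_prod .
      then have "AE s in lborel. AE x in (lborel :: 'a measure). (t, s, x) \<notin> N" by (rule lborel_pair.AE_pair)
      then show ?case
      proof eventually_elim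
        case (elim s)
        then have "emeasure lborel {x. (t, s, x) \<in> N} = 0"
          using slice(2) by (subst (asm) AE_iff_measurable[where N = "{x. (t, s, x) \<in> N}"]) auto
        then show ?case by (simp add: Zn)
      qed
    qed
    have "{w \<in> space (lborel \<Otimes>\<^sub>M lborel). Z (fst w, snd w) = 0} \<in> sets (lborel \<Otimes>\<^sub>M lborel)"
    proof -
      have "{w. Z w = 0} \<in> sets borel" by measurable
      then show ?thesis by (simp only: lborel_prod sets_lborel space_lborel space_borel UNIV_I simp_thms prod.collapse)
    qed
    from iffD1[OF lborel_pair.AE_commute[OF this] 2] show ?thesis .
  qed
  have P1: "AE s in lborel. AE t in lborel. P t s"
    using Z_AE
  proof eventually_elim
    case (elim s)
    then show ?case using Ki[of s]
    proof eventually_elim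
      case (elim t)
      show ?case unfolding P_def
      proof
        assume st: "s < t"
        have z: "emeasure lborel {x. (t, s, x) \<in> N} = 0" using elim(1) by (simp add: Zn)
        have AEk: "AE x in lborel. K t s x = k1 (t, s, x)"
          by (rule AE_I[of _ _ "{x. (t, s, x) \<in> N}"]) (use k1N z slice(2) in auto)
        have "I (t, s) = (\<integral>\<^sup>+x. ennreal (norm (K t s x)) \<partial>lebesgue)"
          unfolding I_def nn_integral_completion by (rule nn_integral_cong_AE) (use AEk in \<open>auto elim!: eventually_mono\<close>)
        also have "\<dots> < \<infinity>" using elim(2) st by (simp add: integrable_iff_bounded)
        finally show "Z (t, s) = 0 \<and> I (t, s) < \<infinity>" using elim(1) by simp
      qed
    qed
  qed
  \<comment> \<open>Integrability is given for each \<open>s\<close> and almost all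
    \<open>t\<close>; exchanging the two quantifiers rests on the measurability of
    \<open>P\<close>.\<close>
  have P2: "AE t in lborel. AE s in lborel. P t s"
  proof -
    have "{w \<in> space (lborel \<Otimes>\<^sub>M lborel). P (snd w) (fst w)} \<in> sets (lborel \<Otimes>\<^sub>M lborel)"
    proof -
      have sw: "(\<lambda>w :: real \<times> real. (snd w, fst w)) \<in> borel_measurable borel"
        by (intro borel_measurable_continuous_onI continuous_intros)
      have [measurable]: "(\<lambda>w. I (snd w, fst w)) \<in> borel_measurable borel" "(\<lambda>w. Z (snd w, fst w)) \<in> borel_measurable borel"
        by (rule measurable_compose[OF sw Im], rule measurable_compose[OF sw Zm])
      have "{w. P (snd w) (fst w)} \<in> sets borel" unfolding P_def by measurable
      then show ?thesis by (simp only: lborel_prod sets_lborel space_lborel space_borel UNIV_I simp_thms prod.collapse)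
    qed
    from iffD1[OF lborel_pair.AE_commute[OF this]] show ?thesis using P1 by simp
  qed
  have K'm: "(\<lambda>z. K' (fst z) (fst (snd z)) (snd (snd z))) \<in> borel_measurable borel"
  proof -
    have tr: "(\<lambda>z :: real \<times> real \<times> 'a. (fst z, fst (snd z))) \<in> borel_measurable borel"
      by (intro borel_measurable_continuous_onI continuous_intros)
    have [measurable]: "(\<lambda>z :: real \<times> real \<times> 'a. I (fst z, fst (snd z))) \<in> borel_measurable borel"
      by (rule measurable_compose[OF tr Im])
    have [measurable]: "(\<lambda>z :: real \<times> real \<times> 'a. fst (snd z)) \<in> borel_measurable borel" "(\<lambda>z :: real \<times> real \<times> 'a. fst z) \<in> borel_measurable borel"
      by (intro borel_measurable_continuous_onI continuous_intros)+
    have [measurable]: "k1 \<in> borel_measurable borel" by (rule k1m)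
    show ?thesis unfolding K'_def by simp measurable
  qed
  have K'i: "integrable lborel (K' t s)" for t s
  proof (cases "s < t \<and> I (t, s) < \<infinity>")
    case True
    then have "K' t s = (\<lambda>x. k1 (t, s, x))" by (auto simp: K'_def)
    moreover have "integrable lborel (\<lambda>x. k1 (t, s, x))"
      using True slice(1)[of t s] by (intro integrableI_bounded) (auto simp: I_def)
    ultimately show ?thesis by simp
  next
    case False
    then have "K' t s = (\<lambda>x. 0)" by (auto simp: K'_def)
    then show ?thesis by simp
  qed
  have K'S: "K' t s x \<in> S" for t s x using k1S S by (auto simp: K'_def)
  have G1: "AE t in lborel. AE s in lborel. s < t \<longrightarrow> integrable lebesgue (K t s) \<and> (AE x in lborel. K t s x = K' t s x)"
    using P2 by eventually_elim (erule eventually_mono, use good in blast)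
  have G2: "AE s in lborel. AE t in lborel. s < t \<longrightarrow> integrable lebesgue (K t s) \<and> (AE x in lborel. K t s x = K' t s x)"
    using P1 by eventually_elim (erule eventually_mono, use good in blast)
  have K'0: "K' t s x = 0" if "s \<ge> t" for t s x using that by (simp add: K'_def)
  show ?thesis using K'm K'i K'S K'0 G1 G2 by (intro exI[of _ K'] conjI allI impI)
qed

lemma fourier_cong_AE:
  assumes "AE x in lborel. g x = g' x" "g \<in> borel_measurable lebesgue" "g' \<in> borel_measurable lebesgue"
  shows "fourier g \<xi> = fourier g' \<xi>"
proof -
  have e: "(\<lambda>x. exp (- (\<i> * complex_of_real (x \<bullet> \<xi>)))) \<in> borel_measurable lebesgue"
    by (intro measurable_completion) measurable
  have "AE x in lebesgue. exp (- (\<i> * complex_of_real (x \<bullet> \<xi>))) * g x = exp (- (\<i> * complex_of_real (x \<bullet> \<xi>))) * g' x"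
    using assms(1) by (intro AE_completion) (auto elim!: eventually_mono)
  then show ?thesis unfolding fourier_def
    using borel_measurable_times[OF e assms(2)] borel_measurable_times[OF e assms(3)] by (intro integral_cong_AE)
qed

text \<open>The pointwise bounds have become integrals over \<open>x\<close> by now, and these do
  not see the change from \<open>K\<close> to \<open>K'\<close>. Earlier the replacement would have
  destroyed the derivatives.\<close>

lemma (in singular_kernel) sqkernel_borel_version:
  fixes m :: "complex \<Rightarrow> 'h::{real_inner,complete_space} \<Rightarrow> 'h"
  assumes H: "scalar_mult_on S m" and K_S: "\<And>t s x. K t s x \<in> S"
    and Km: "(\<lambda>(t, s, x). K t s x) \<in> borel_measurable lebesgue"
    and Ki: "\<And>s. AE t in lborel. s < t \<longrightarrow> integrable lebesgue (K t s)"
    and A: "\<And>s \<xi>. (\<integral>\<^sup>+ t\<in>{s<..}. ennreal ((norm (fourier (K t s) \<xi>))\<^sup>2) \<partial>lebesgue) \<le> ennreal C0"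
  shows "\<exists>K' Tg N0. sqkernel S m K' Tg \<gamma> e N0 (max C0 0) \<and>
    (AE t in lborel. AE s in lborel. s < t \<longrightarrow> (AE x in lborel. K t s x = K' t s x))"
proof -
  have S01: "S = \<real> \<or> S = UNIV" using H by (simp add: scalar_mult_on_def)
  define E where "E K' t s \<longleftrightarrow> integrable lebesgue (K t s) \<and> (AE x in lborel. K t s x = K' t s x)" for K' t s
  from kernel_borel_version[OF S01 K_S Km Ki]
  obtain K' where K'm: "(\<lambda>z. K' (fst z) (fst (snd z)) (snd (snd z))) \<in> borel_measurable borel"
    and K'i: "\<forall>t s. integrable lborel (K' t s)" and K'S: "\<forall>t s x. K' t s x \<in> S" and K'0: "\<forall>t s x. s \<ge> t \<longrightarrow> K' t s x = 0"
    and G1: "AE t in lborel. AE s in lborel. s < t \<longrightarrow> E K' t s" and G2: "AE s in lborel. AE t in lborel. s < t \<longrightarrow> E K' t s"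
    unfolding E_def[symmetric] by (elim exE conjE) (rule that)
  define Tg where "Tg = {t \<in> Gd. AE s in lborel. s < t \<longrightarrow> E K' t s}"
  obtain Na where Na: "Na \<ge> 0" and K1: "\<forall>t\<in>Gd. \<forall>s<t. integrable lebesgue (K t s) \<longrightarrow> (\<forall>r>0.
    (\<integral>\<^sup>+z\<in>{z. norm z \<ge> r}. ennreal (norm (K t s z)) \<partial>lborel) \<le> ennreal (Na * (t - s) powr ((\<gamma> * e - 1) / 2) * r powr (- e / 2)))"
    using kernel_tail by (elim exE conjE) (rule that)
  obtain Nb where Nb: "Nb \<ge> 0" and K2: "\<forall>t\<in>Gd. \<forall>s<t. integrable lebesgue (K t s) \<longrightarrow> (\<forall>h.
    (\<integral>\<^sup>+z. ennreal (norm (K t s (z + h) - K t s z)) \<partial>lborel) \<le> ennreal (Nb * norm h * (t - s) powr (- 1 / 2 - \<gamma>)))"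
    using kernel_translation by (elim exE conjE) (rule that)
  obtain Nc where Nc: "Nc \<ge> 0" and K3: "\<forall>t\<in>Gd. \<forall>t'\<in>Gd. \<forall>s. s < t' \<longrightarrow> t' < t \<longrightarrow> integrable lebesgue (K t s) \<longrightarrow> integrable lebesgue (K t' s) \<longrightarrow>
    (\<integral>\<^sup>+z. ennreal (norm (K t s z - K t' s z)) \<partial>lborel) \<le> ennreal (Nc * (t - t') * (t' - s) powr (- 3 / 2))"
    using kernel_time_increment by (elim exE conjE) (rule that)
  define N0 where "N0 = Na + Nb + Nc"
  have N0: "Na \<le> N0" "Nb \<le> N0" "Nc \<le> N0" "N0 \<ge> 0" using Na Nb Nc by (auto simp: N0_def)
  have K'leb: "K' t s \<in> borel_measurable lebesgue" for t s
    using K'i by (intro measurable_completion borel_measurable_integrable) simp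
  interpret scalar_hilbert S m by standard (rule H)
  \<comment> \<open>\<open>C0\<close> is an arbitrary real while the locale asks for a nonnegative
    constant; \<open>ennreal\<close> sends negative numbers to 0, so the bound persists for the
    maximum.\<close>
  have "sqkernel S m K' Tg \<gamma> e N0 (max C0 0)"
  proof unfold_locales
    show "0 < \<gamma>" by (rule gamma_pos)
    show "0 < e" by (rule e_pos)
    show "0 \<le> N0" by (rule N0)
    show "0 \<le> max C0 0" by simp
    show "integrable lborel (K' t s)" for t s using K'i by simp
    show "K' t s x \<in> S" for t s x using K'S by simp
    show "(\<lambda>z. K' (fst z) (fst (snd z)) (snd (snd z))) \<in> borel_measurable borel" by (rule K'm)
    show "t \<le> s \<Longrightarrow> K' t s x = 0" for t s x using K'0 by simp
    show "AE t in lborel. t \<in> Tg" unfolding Tg_def using Gd G1 by eventually_elim simp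
    show "AE s in lborel. s < t \<longrightarrow> (\<forall>r>0. (\<integral>\<^sup>+z\<in>{z. norm z \<ge> r}. ennreal (norm (K' t s z)) \<partial>lborel)
       \<le> ennreal (N0 * (t - s) powr ((\<gamma> * e - 1) / 2) * r powr (- e / 2)))" if t: "t \<in> Tg" for t
    proof -
      have tG: "t \<in> Gd" and "AE s in lborel. s < t \<longrightarrow> E K' t s" using t by (auto simp: Tg_def)
      from this(2) show ?thesis
      proof (eventually_elim, intro impI allI)
        fix s r :: real assume Es: "s < t \<longrightarrow> E K' t s" and st: "s < t" and r: "0 < r"
        have i: "integrable lebesgue (K t s)" and ae: "AE x in lborel. K t s x = K' t s x" using Es st by (auto simp: E_def)
        have "(\<integral>\<^sup>+z\<in>{z. norm z \<ge> r}. ennreal (norm (K' t s z)) \<partial>lborel) = (\<integral>\<^sup>+z\<in>{z. norm z \<ge> r}. ennreal (norm (K t s z)) \<partial>lborel)"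
          by (rule nn_integral_cong_AE) (use ae in eventually_elim, simp)
        also have "\<dots> \<le> ennreal (Na * (t - s) powr ((\<gamma> * e - 1) / 2) * r powr (- e / 2))" using K1 tG st i r by simp
        also have "\<dots> \<le> ennreal (N0 * (t - s) powr ((\<gamma> * e - 1) / 2) * r powr (- e / 2))"
          by (intro ennreal_leI mult_right_mono N0) auto
        finally show "(\<integral>\<^sup>+z\<in>{z. norm z \<ge> r}. ennreal (norm (K' t s z)) \<partial>lborel) \<le> ennreal (N0 * (t - s) powr ((\<gamma> * e - 1) / 2) * r powr (- e / 2))" .
      qed
    qed
    show "AE s in lborel. s < t \<longrightarrow> (\<forall>h. (\<integral>\<^sup>+z. ennreal (norm (K' t s (z + h) - K' t s z)) \<partial>lborel)
       \<le> ennreal (N0 * norm h * (t - s) powr (- 1 / 2 - \<gamma>)))" if t: "t \<in> Tg" for t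
    proof -
      have tG: "t \<in> Gd" and "AE s in lborel. s < t \<longrightarrow> E K' t s" using t by (auto simp: Tg_def)
      from this(2) show ?thesis
      proof (eventually_elim, intro impI allI)
        fix s :: real and h :: 'a assume Es: "s < t \<longrightarrow> E K' t s" and st: "s < t"
        have i: "integrable lebesgue (K t s)" and ae: "AE x in lborel. K t s x = K' t s x" using Es st by (auto simp: E_def)
        have "(\<integral>\<^sup>+z. ennreal (norm (K' t s (z + h) - K' t s z)) \<partial>lborel) = (\<integral>\<^sup>+z. ennreal (norm (K t s (z + h) - K t s z)) \<partial>lborel)"
          by (rule nn_integral_cong_AE) (use ae AE_lborel_translate[OF ae, of h] in eventually_elim, simp)
        also have "\<dots> \<le> ennreal (Nb * norm h * (t - s) powr (- 1 / 2 - \<gamma>))" using K2 tG st i by simp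
        also have "\<dots> \<le> ennreal (N0 * norm h * (t - s) powr (- 1 / 2 - \<gamma>))"
          by (intro ennreal_leI mult_right_mono N0) auto
        finally show "(\<integral>\<^sup>+z. ennreal (norm (K' t s (z + h) - K' t s z)) \<partial>lborel) \<le> ennreal (N0 * norm h * (t - s) powr (- 1 / 2 - \<gamma>))" .
      qed
    qed
    show "AE s in lborel. s < t' \<longrightarrow>
       (\<integral>\<^sup>+z. ennreal (norm (K' t s z - K' t' s z)) \<partial>lborel) \<le> ennreal (N0 * (t - t') * (t' - s) powr (- 3 / 2))"
      if t: "t \<in> Tg" "t' \<in> Tg" "t' < t" for t t'
    proof -
      have tG: "t \<in> Gd" "t' \<in> Gd" and E2: "AE s in lborel. s < t \<longrightarrow> E K' t s" "AE s in lborel. s < t' \<longrightarrow> E K' t' s"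
        using t by (auto simp: Tg_def)
      from E2 show ?thesis
      proof (eventually_elim, intro impI)
        fix s :: real assume Es: "s < t \<longrightarrow> E K' t s" "s < t' \<longrightarrow> E K' t' s" and st: "s < t'"
        have i: "integrable lebesgue (K t s)" "integrable lebesgue (K t' s)"
          and ae: "AE x in lborel. K t s x = K' t s x" "AE x in lborel. K t' s x = K' t' s x"
          using Es st t(3) by (auto simp: E_def)
        have "(\<integral>\<^sup>+z. ennreal (norm (K' t s z - K' t' s z)) \<partial>lborel) = (\<integral>\<^sup>+z. ennreal (norm (K t s z - K t' s z)) \<partial>lborel)"
          by (rule nn_integral_cong_AE) (use ae in eventually_elim, simp)
        also have "\<dots> \<le> ennreal (Nc * (t - t') * (t' - s) powr (- 3 / 2))" using K3 tG st t(3) i by simp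
        also have "\<dots> \<le> ennreal (N0 * (t - t') * (t' - s) powr (- 3 / 2))"
          using t(3) by (intro ennreal_leI mult_right_mono N0) auto
        finally show "(\<integral>\<^sup>+z. ennreal (norm (K' t s z - K' t' s z)) \<partial>lborel) \<le> ennreal (N0 * (t - t') * (t' - s) powr (- 3 / 2))" .
      qed
    qed
    show "AE s in lborel. \<forall>\<xi>. (\<integral>\<^sup>+t. ennreal ((norm (fourier (K' t s) \<xi>))\<^sup>2) \<partial>lborel) \<le> ennreal (max C0 0)"
      using G2
    proof (eventually_elim, intro allI)
      \<comment> \<open>(A) covers \<open>t > s\<close> only; \<open>K'\<close> vanishes at all
        other times, so its integral may run over the whole line.\<close>
      fix s :: real and \<xi> :: 'a assume Es: "AE t in lborel. s < t \<longrightarrow> E K' t s"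
      have "(\<integral>\<^sup>+t. ennreal ((norm (fourier (K' t s) \<xi>))\<^sup>2) \<partial>lborel) = (\<integral>\<^sup>+t\<in>{s<..}. ennreal ((norm (fourier (K t s) \<xi>))\<^sup>2) \<partial>lborel)"
      proof (rule nn_integral_cong_AE, use Es in eventually_elim)
        fix t assume t: "s < t \<longrightarrow> E K' t s"
        show "ennreal ((norm (fourier (K' t s) \<xi>))\<^sup>2) = ennreal ((norm (fourier (K t s) \<xi>))\<^sup>2) * indicator {s<..} t"
        proof (cases "s < t")
          case True
          then have "fourier (K t s) \<xi> = fourier (K' t s) \<xi>"
            using t K'leb by (intro fourier_cong_AE) (auto simp: E_def)
          then show ?thesis using True by simp
        next
          case False
          then have "K' t s = (\<lambda>x. 0)" using K'0 by auto
          then show ?thesis using False by (simp add: fourier_def)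
        qed
      qed
      also have "\<dots> \<le> ennreal C0" using A[of s \<xi>] by (simp add: nn_integral_completion)
      also have "\<dots> \<le> ennreal (max C0 0)" by (rule ennreal_leI) simp
      finally show "(\<integral>\<^sup>+t. ennreal ((norm (fourier (K' t s) \<xi>))\<^sup>2) \<partial>lborel) \<le> ennreal (max C0 0)" .
    qed
  qed
  moreover have "AE t in lborel. AE s in lborel. s < t \<longrightarrow> (AE x in lborel. K t s x = K' t s x)"
    using G1 by eventually_elim (erule eventually_mono, simp add: E_def)
  ultimately show ?thesis by blast
qed

theorem theorem2p4:
  fixes S :: "complex set"
    and smul :: "complex \<Rightarrow> 'h::{real_inner,complete_space} \<Rightarrow> 'h"
    and K :: "real \<Rightarrow> real \<Rightarrow> 'a::euclidean_space \<Rightarrow> complex"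
    and F1 F2 F3 :: "real \<Rightarrow> real \<Rightarrow> 'a \<Rightarrow> real"
    and p d C\<^sub>0 C c\<^sub>2 c\<^sub>3 \<sigma>\<^sub>1 \<sigma>\<^sub>2 \<sigma>\<^sub>3 \<kappa>\<^sub>1 \<kappa>\<^sub>2 \<kappa>\<^sub>3 \<mu>\<^sub>1 \<mu>\<^sub>2 \<mu>\<^sub>3 :: real
  assumes d: "d = real DIM('a)"
    and H: "scalar_mult_on S smul"
    and p: "p \<ge> 2"
    and K_scalar: "\<And>t s x. K t s x \<in> S"
    and K_measurable: "(\<lambda>(t, s, x). K t s x) \<in> borel_measurable lebesgue"
    and A_defined: "\<And>s. AE t in lebesgue. s < t \<longrightarrow> integrable lebesgue (K t s)"
    and A: "\<And>s \<xi>. (\<integral>\<^sup>+ t\<in>{s<..}. ennreal ((norm (fourier (K t s) \<xi>))\<^sup>2) \<partial>lebesgue) \<le> ennreal C\<^sub>0"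
    and c2: "c\<^sub>2 > 1 / 2"
    and c3: "c\<^sub>3 = (2 * (d + 1) * (c\<^sub>2 + 1) + 3) / (2 * (d + 2))"
    and B_i: "AE t in lebesgue. \<forall>s<t.
        locally_integrable (K t s) \<and>
        (\<forall>b\<in>Basis. locally_integrable (space_deriv b K t s)) \<and>
        locally_integrable (time_deriv K t s)"
    and derivs_exist: "AE t in lebesgue. \<forall>s<t. \<forall>x. x \<noteq> 0 \<longrightarrow>
        has_time_deriv K t s x \<and>
        (\<forall>b\<in>Basis. has_space_deriv b K t s x \<and> has_time_deriv (space_deriv b K) t s x \<and>
          (\<forall>b'\<in>Basis. has_space_deriv b' (space_deriv b K) t s x))"
    and derivs_time: "\<And>s x. x \<noteq> 0 \<Longrightarrow> time_abs_continuous K s x \<and>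
        (\<forall>b\<in>Basis. time_abs_continuous (space_deriv b K) s x)"
    and pos: "C > 0" "\<sigma>\<^sub>1 > 0" "\<sigma>\<^sub>2 > 0" "\<sigma>\<^sub>3 > 0" "\<kappa>\<^sub>1 > 0" "\<kappa>\<^sub>2 > 0" "\<kappa>\<^sub>3 > 0"
    and B_ii: "AE t in lebesgue. \<forall>s<t. \<forall>x. x \<noteq> 0 \<longrightarrow> (\<forall>b\<in>Basis.
        norm (space_deriv b K t s x)
          \<le> C * \<bar>(t - s) powr (- \<sigma>\<^sub>1) * F1 t s ((t - s) powr (- \<kappa>\<^sub>1) *\<^sub>R x)\<bar> \<and>
        (\<forall>b'\<in>Basis. norm (space_deriv b' (space_deriv b K) t s x)
          \<le> C * min ((t - s) powr (- \<sigma>\<^sub>2) * \<bar>F2 t s ((t - s) powr (- \<kappa>\<^sub>2) *\<^sub>R x)\<bar>)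
                    ((t - s) powr (- c\<^sub>2))) \<and>
        norm (time_deriv (space_deriv b K) t s x)
          \<le> C * min ((t - s) powr (- \<sigma>\<^sub>3) * \<bar>F3 t s ((t - s) powr (- \<kappa>\<^sub>3) *\<^sub>R x)\<bar>)
                    ((t - s) powr (- c\<^sub>3)))"
    and F_measurable: "\<And>t s. s < t \<Longrightarrow> F1 t s \<in> borel_measurable lebesgue"
        "\<And>t s. s < t \<Longrightarrow> F2 t s \<in> borel_measurable lebesgue"
        "\<And>t s. s < t \<Longrightarrow> F3 t s \<in> borel_measurable lebesgue"
    and B_iii_1: "(SUP (t, s)\<in>{(t, s). s < t}.
        \<integral>\<^sup>+ x. ennreal (norm x powr \<mu>\<^sub>1 * \<bar>F1 t s x\<bar>\<^sup>2) \<partial>lebesgue) < \<infinity>"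
    and B_iii_2: "(SUP (t, s)\<in>{(t, s). s < t}.
        \<integral>\<^sup>+ x\<in>{x. norm x \<ge> (t - s) powr (c\<^sub>2 - c\<^sub>3 + 1 - \<kappa>\<^sub>2)}.
          ennreal (norm x powr \<mu>\<^sub>2 * \<bar>F2 t s x\<bar>\<^sup>2) \<partial>lebesgue) < \<infinity>"
    and B_iii_3: "(SUP (t, s)\<in>{(t, s). s < t}.
        \<integral>\<^sup>+ x\<in>{x. norm x \<ge> (t - s) powr (c\<^sub>2 - c\<^sub>3 + 1 - \<kappa>\<^sub>3)}.
          ennreal (norm x powr \<mu>\<^sub>3 * \<bar>F3 t s x\<bar>\<^sup>2) \<partial>lebesgue) < \<infinity>"
    and mu: "\<mu>\<^sub>1 > d + 2" "\<mu>\<^sub>2 > d + 2" "\<mu>\<^sub>3 > d + 2"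
    and mu1: "(c\<^sub>2 - c\<^sub>3 + 1 - \<kappa>\<^sub>1) * \<mu>\<^sub>1
        = d * (\<kappa>\<^sub>1 + c\<^sub>2 - c\<^sub>3 + 1) + 2 * (c\<^sub>2 - c\<^sub>3 - \<sigma>\<^sub>1) + 3"
    and mu2: "(c\<^sub>2 - c\<^sub>3 + 1 - \<kappa>\<^sub>2) * \<mu>\<^sub>2
        = d * (\<kappa>\<^sub>2 - c\<^sub>2 + c\<^sub>3 - 1) + 2 * (c\<^sub>2 - \<sigma>\<^sub>2)"
    and mu3: "(c\<^sub>2 - c\<^sub>3 + 1 - \<kappa>\<^sub>3) * \<mu>\<^sub>3
        = d * (\<kappa>\<^sub>3 - c\<^sub>2 + c\<^sub>3 - 1) + 2 * (c\<^sub>3 - \<sigma>\<^sub>3)"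
  shows "\<exists>N::real. N \<ge> 0 \<and> (\<forall>f :: real \<times> 'a \<Rightarrow> 'h. smooth_compact_support f \<longrightarrow>
      Lp_norm p (\<lambda>(t, x). epowr (\<integral>\<^sup>+ s\<in>{..t}.
          ennreal ((norm (convol smul (K t s) (\<lambda>y. f (s, y)) x))\<^sup>2) \<partial>lebesgue) (1 / 2))
      \<le> ennreal N * Lp_norm p (\<lambda>z. ennreal (norm (f z))))"
  proof -
  define S1 where "S1 = enn2real (SUP (t, s)\<in>{(t, s). s < t}. \<integral>\<^sup>+ x. ennreal (norm x powr \<mu>\<^sub>1 * \<bar>F1 t s x\<bar>\<^sup>2) \<partial>lebesgue)"
  define S3 where "S3 = enn2real (SUP (t, s)\<in>{(t, s). s < t}.
        \<integral>\<^sup>+ x\<in>{x. norm x \<ge> (t - s) powr (c\<^sub>2 - c\<^sub>3 + 1 - \<kappa>\<^sub>3)}. ennreal (norm x powr \<mu>\<^sub>3 * \<bar>F3 t s x\<bar>\<^sup>2) \<partial>lebesgue)"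
  \<comment> \<open>The three statements for almost all \<open>t\<close> are each already uniform in
    \<open>s\<close>, and in \<open>x\<close> where it occurs, so they hold together off one null
    set of times.\<close>
  define Gd where "Gd = {t. (\<forall>s<t. locally_integrable (K t s) \<and>
        (\<forall>b\<in>Basis. locally_integrable (space_deriv b K t s)) \<and> locally_integrable (time_deriv K t s)) \<and>
      (\<forall>s<t. \<forall>x. x \<noteq> 0 \<longrightarrow> has_time_deriv K t s x \<and>
        (\<forall>b\<in>Basis. has_space_deriv b K t s x \<and> has_time_deriv (space_deriv b K) t s x \<and>
          (\<forall>b'\<in>Basis. has_space_deriv b' (space_deriv b K) t s x))) \<and>
      (\<forall>s<t. \<forall>x. x \<noteq> 0 \<longrightarrow> (\<forall>b\<in>Basis.
        norm (space_deriv b K t s x)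
          \<le> C * \<bar>(t - s) powr (- \<sigma>\<^sub>1) * F1 t s ((t - s) powr (- \<kappa>\<^sub>1) *\<^sub>R x)\<bar> \<and>
        (\<forall>b'\<in>Basis. norm (space_deriv b' (space_deriv b K) t s x)
          \<le> C * min ((t - s) powr (- \<sigma>\<^sub>2) * \<bar>F2 t s ((t - s) powr (- \<kappa>\<^sub>2) *\<^sub>R x)\<bar>)
                    ((t - s) powr (- c\<^sub>2))) \<and>
        norm (time_deriv (space_deriv b K) t s x)
          \<le> C * min ((t - s) powr (- \<sigma>\<^sub>3) * \<bar>F3 t s ((t - s) powr (- \<kappa>\<^sub>3) *\<^sub>R x)\<bar>)
                    ((t - s) powr (- c\<^sub>3))))}"
  interpret singular_kernel K F1 F3 C c\<^sub>2 c\<^sub>3 \<sigma>\<^sub>1 \<sigma>\<^sub>3 \<kappa>\<^sub>1 \<kappa>\<^sub>3 \<mu>\<^sub>1 \<mu>\<^sub>3 S1 S3 Gd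
  proof
    show "1 / 2 < c\<^sub>2" "C > 0" by fact+
    show "c\<^sub>3 = (2 * (real DIM('a) + 1) * (c\<^sub>2 + 1) + 3) / (2 * (real DIM('a) + 2))" using c3 unfolding d .
    show "S1 \<ge> 0" "S3 \<ge> 0" by (simp_all add: S1_def S3_def)
    have "AE t in lebesgue. t \<in> Gd" using B_i derivs_exist B_ii unfolding Gd_def by eventually_elim simp
    then show "AE t in lborel. t \<in> Gd" by (simp add: AE_completion_iff)
    show "locally_integrable (K t s)" if "t \<in> Gd" "s < t" for t s using that unfolding Gd_def by blast
    show "locally_integrable (space_deriv b K t s)" if "t \<in> Gd" "s < t" "b \<in> Basis" for t s b using that unfolding Gd_def by blast
    fix t s :: real and x b :: 'a
    show "time_abs_continuous (space_deriv b K) s x" if "x \<noteq> 0" "b \<in> Basis" using derivs_time[OF that(1)] that(2) by blast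
    show "F1 t s \<in> borel_measurable lebesgue" "F3 t s \<in> borel_measurable lebesgue" if "s < t" by (fact F_measurable(1)[OF that], fact F_measurable(3)[OF that])
    show "(\<integral>\<^sup>+ x. ennreal (norm x powr \<mu>\<^sub>1 * \<bar>F1 t s x\<bar>\<^sup>2) \<partial>lebesgue) \<le> ennreal S1" if st: "s < t"
    proof -
      have "(\<integral>\<^sup>+ x. ennreal (norm x powr \<mu>\<^sub>1 * \<bar>F1 t s x\<bar>\<^sup>2) \<partial>lebesgue)
          \<le> (SUP (t, s)\<in>{(t, s). s < t}. \<integral>\<^sup>+ x. ennreal (norm x powr \<mu>\<^sub>1 * \<bar>F1 t s x\<bar>\<^sup>2) \<partial>lebesgue)"
        by (rule SUP_upper2[of "(t, s)"]) (use st in auto)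
      also have "\<dots> = ennreal S1" unfolding S1_def using B_iii_1 by (intro ennreal_enn2real[symmetric]) simp
      finally show ?thesis .
    qed
    show "(\<integral>\<^sup>+ x\<in>{x. norm x \<ge> (t - s) powr (c\<^sub>2 - c\<^sub>3 + 1 - \<kappa>\<^sub>3)}. ennreal (norm x powr \<mu>\<^sub>3 * \<bar>F3 t s x\<bar>\<^sup>2) \<partial>lebesgue) \<le> ennreal S3"
      if st: "s < t"
    proof -
      have "(\<integral>\<^sup>+ x\<in>{x. norm x \<ge> (t - s) powr (c\<^sub>2 - c\<^sub>3 + 1 - \<kappa>\<^sub>3)}. ennreal (norm x powr \<mu>\<^sub>3 * \<bar>F3 t s x\<bar>\<^sup>2) \<partial>lebesgue)
          \<le> (SUP (t, s)\<in>{(t, s). s < t}.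
        \<integral>\<^sup>+ x\<in>{x. norm x \<ge> (t - s) powr (c\<^sub>2 - c\<^sub>3 + 1 - \<kappa>\<^sub>3)}. ennreal (norm x powr \<mu>\<^sub>3 * \<bar>F3 t s x\<bar>\<^sup>2) \<partial>lebesgue)"
        by (rule SUP_upper2[of "(t, s)"]) (use st in auto)
      also have "\<dots> = ennreal S3" unfolding S3_def using B_iii_3 by (intro ennreal_enn2real[symmetric]) simp
      finally show ?thesis .
    qed
    show "real DIM('a) + 2 < \<mu>\<^sub>1" "real DIM('a) + 2 < \<mu>\<^sub>3" using mu by (simp_all add: d)
    show "(c\<^sub>2 - c\<^sub>3 + 1 - \<kappa>\<^sub>1) * \<mu>\<^sub>1 = real DIM('a) * (\<kappa>\<^sub>1 + c\<^sub>2 - c\<^sub>3 + 1) + 2 * (c\<^sub>2 - c\<^sub>3 - \<sigma>\<^sub>1) + 3" using mu1 unfolding d .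
    show "(c\<^sub>2 - c\<^sub>3 + 1 - \<kappa>\<^sub>3) * \<mu>\<^sub>3 = real DIM('a) * (\<kappa>\<^sub>3 - c\<^sub>2 + c\<^sub>3 - 1) + 2 * (c\<^sub>3 - \<sigma>\<^sub>3)" using mu3 unfolding d .
    assume h: "t \<in> Gd" "s < t" "x \<noteq> 0" "b \<in> Basis"
    have h1: "has_space_deriv b K t s x \<and> has_time_deriv (space_deriv b K) t s x \<and>
          (\<forall>b'\<in>Basis. has_space_deriv b' (space_deriv b K) t s x)" using h unfolding Gd_def by blast
    have h2: "norm (space_deriv b K t s x)
          \<le> C * \<bar>(t - s) powr (- \<sigma>\<^sub>1) * F1 t s ((t - s) powr (- \<kappa>\<^sub>1) *\<^sub>R x)\<bar> \<and>
        (\<forall>b'\<in>Basis. norm (space_deriv b' (space_deriv b K) t s x)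
          \<le> C * min ((t - s) powr (- \<sigma>\<^sub>2) * \<bar>F2 t s ((t - s) powr (- \<kappa>\<^sub>2) *\<^sub>R x)\<bar>)
                    ((t - s) powr (- c\<^sub>2))) \<and>
        norm (time_deriv (space_deriv b K) t s x)
          \<le> C * min ((t - s) powr (- \<sigma>\<^sub>3) * \<bar>F3 t s ((t - s) powr (- \<kappa>\<^sub>3) *\<^sub>R x)\<bar>)
                    ((t - s) powr (- c\<^sub>3))" using h unfolding Gd_def by blast
    show "has_space_deriv b K t s x" "has_time_deriv (space_deriv b K) t s x" "has_space_deriv b (space_deriv b K) t s x"
      using h1 h(4) by simp_all
    show "norm (space_deriv b K t s x) \<le> C * \<bar>(t - s) powr (- \<sigma>\<^sub>1) * F1 t s ((t - s) powr (- \<kappa>\<^sub>1) *\<^sub>R x)\<bar>"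
      "norm (time_deriv (space_deriv b K) t s x)
          \<le> C * min ((t - s) powr (- \<sigma>\<^sub>3) * \<bar>F3 t s ((t - s) powr (- \<kappa>\<^sub>3) *\<^sub>R x)\<bar>) ((t - s) powr (- c\<^sub>3))"
      using h2 by simp_all
    have "norm (space_deriv b (space_deriv b K) t s x)
          \<le> C * min ((t - s) powr (- \<sigma>\<^sub>2) * \<bar>F2 t s ((t - s) powr (- \<kappa>\<^sub>2) *\<^sub>R x)\<bar>) ((t - s) powr (- c\<^sub>2))"
      using h2 h(4) by blast
    also have "\<dots> \<le> C * (t - s) powr (- c\<^sub>2)" using pos(1) by (intro mult_left_mono min.cobounded2) simp
    finally show "norm (space_deriv b (space_deriv b K) t s x) \<le> C * (t - s) powr (- c\<^sub>2)" .
  qed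
  have Ki: "AE t in lborel. s < t \<longrightarrow> integrable lebesgue (K t s)" for s
    using A_defined[of s] by (simp add: AE_completion_iff)
  obtain K' Tg N0 where "sqkernel S smul K' Tg \<gamma> e N0 (max C\<^sub>0 0)"
      and eqK: "AE t in lborel. AE s in lborel. s < t \<longrightarrow> (AE x in lborel. K t s x = K' t s x)"
    using sqkernel_borel_version[OF H K_scalar K_measurable Ki A] by (elim exE conjE) (rule that)
  then interpret sq: sqkernel S smul K' Tg \<gamma> e N0 "max C\<^sub>0 0" by simp
  obtain N where N: "N \<ge> 0" and bound: "\<forall>f :: real \<times> 'a \<Rightarrow> 'h. cc_fun f \<longrightarrow>
    (\<integral>\<^sup>+z. epowr (epowr (sq.SQ f UNIV z) (1 / 2)) p \<partial>lborel) \<le> ennreal N * (\<integral>\<^sup>+z. ennreal (norm (f z) powr p) \<partial>lborel)"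
    using sq.SQ_Lp[OF p] by (elim exE conjE) (rule that)
  define G :: "(real \<times> 'a \<Rightarrow> 'h) \<Rightarrow> real \<times> 'a \<Rightarrow> ennreal" where "G f = (\<lambda>(t, x). epowr (\<integral>\<^sup>+ s\<in>{..t}.
          ennreal ((norm (convol smul (K t s) (\<lambda>y. f (s, y)) x))\<^sup>2) \<partial>lebesgue) (1 / 2))" for f
  have eqG: "AE z in lborel. G f z = epowr (sq.SQ f UNIV z) (1 / 2)" for f
  proof -
    from AE_fst_lborel[OF eqK]
    have "AE z in lborel. AE s in lborel. s < fst (z :: real \<times> 'a) \<longrightarrow> (AE x in lborel. K (fst z) s x = K' (fst z) s x)" .
    then show ?thesis
    proof eventually_elim
      fix z :: "real \<times> 'a" assume *: "AE s in lborel. s < fst z \<longrightarrow> (AE x in lborel. K (fst z) s x = K' (fst z) s x)"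
      obtain t x where z: "z = (t, x)" by (cases z)
      \<comment> \<open>At \<open>s = t\<close> the kernel \<open>K\<close> is unconstrained while
        \<open>K'\<close> vanishes, so this single time is discarded.\<close>
      have "AE s in lborel. s \<noteq> t" by (rule AE_lborel_singleton)
      with * have "AE s in lborel. ennreal ((norm (convol smul (K t s) (\<lambda>y. f (s, y)) x))\<^sup>2) * indicator {..t} s
          = ennreal ((norm (sq.V f t s x))\<^sup>2) * indicator UNIV s"
      proof eventually_elim
        fix s assume s: "s < fst z \<longrightarrow> (AE x in lborel. K (fst z) s x = K' (fst z) s x)" and ne: "s \<noteq> t"
        show "ennreal ((norm (convol smul (K t s) (\<lambda>y. f (s, y)) x))\<^sup>2) * indicator {..t} s
          = ennreal ((norm (sq.V f t s x))\<^sup>2) * indicator UNIV s"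
        proof (cases "s < t")
          case True
          then have "convol smul (K t s) (\<lambda>y. f (s, y)) x = convol smul (K' t s) (\<lambda>y. f (s, y)) x"
            using s z by (intro convol_cong_AE) simp
          then show ?thesis using True by (simp add: sq.V_def)
        next
          case False
          then have "s \<ge> t" "s \<notin> {..t}" using ne by auto
          moreover have "smul 0 v = 0" for v using sq.m_real[of 0 v] by simp
          ultimately show ?thesis using sq.K_zero[of t s] by (simp add: sq.V_def convol_def)
        qed
      qed
      then have "(\<integral>\<^sup>+ s\<in>{..t}. ennreal ((norm (convol smul (K t s) (\<lambda>y. f (s, y)) x))\<^sup>2) \<partial>lborel) = sq.SQ f UNIV z"
        unfolding sq.SQ_def z fst_conv snd_conv by (rule nn_integral_cong_AE)
      then show "G f z = epowr (sq.SQ f UNIV z) (1 / 2)" by (simp add: G_def z nn_integral_completion)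
    qed
  qed
  \<comment> \<open>Adding 1 makes the constant positive, as \<open>epowr_cmult\<close> requires;
    the power \<open>1 / p\<close> is the root taken in \<open>Lp_norm\<close>.\<close>
  have "Lp_norm p (G f) \<le> ennreal ((N + 1) powr (1 / p)) * Lp_norm p (\<lambda>z. ennreal (norm (f z)))"
    if f: "smooth_compact_support f" for f
  proof -
    have "(\<integral>\<^sup>+z. epowr (G f z) p \<partial>lebesgue) = (\<integral>\<^sup>+z. epowr (epowr (sq.SQ f UNIV z) (1 / 2)) p \<partial>lborel)"
      unfolding nn_integral_completion by (rule nn_integral_cong_AE) (use eqG[of f] in eventually_elim, simp)
    also have "\<dots> \<le> ennreal N * (\<integral>\<^sup>+z. ennreal (norm (f z) powr p) \<partial>lborel)"
      using bound smooth_compact_support_cc_fun[OF f] by blast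
    also have "\<dots> \<le> ennreal (N + 1) * (\<integral>\<^sup>+z. ennreal (norm (f z) powr p) \<partial>lborel)"
      by (intro mult_right_mono ennreal_leI) auto
    also have "(\<integral>\<^sup>+z. ennreal (norm (f z) powr p) \<partial>lborel) = (\<integral>\<^sup>+z. epowr (ennreal (norm (f z))) p \<partial>lebesgue)"
      by (simp add: epowr_ennreal nn_integral_completion)
    finally have "epowr (\<integral>\<^sup>+z. epowr (G f z) p \<partial>lebesgue) (1 / p)
        \<le> epowr (ennreal (N + 1) * (\<integral>\<^sup>+z. epowr (ennreal (norm (f z))) p \<partial>lebesgue)) (1 / p)"
      using p by (intro epowr_mono) auto
    also have "\<dots> = ennreal ((N + 1) powr (1 / p)) * epowr (\<integral>\<^sup>+z. epowr (ennreal (norm (f z))) p \<partial>lebesgue) (1 / p)"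
      using N by (intro epowr_cmult) simp
    finally show ?thesis unfolding Lp_norm_def .
  qed
  then show ?thesis unfolding G_def by (intro exI[of _ "(N + 1) powr (1 / p)"]) auto
qed

end
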